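(* Let $G$ be a locally compact group. If the Fourier-Stieltjes algebra $\mathrm{B}(G)$ is operator amenable, then the set $\mathrm{ZE}(G^{\varpi})$ of central idempotents of the Eberlein compactification $G^\varpi$ is finite.
   Context: Fourier-Stieltjes algebra: $\mathrm{B}(G)$ is the space of all matrix coefficients $s\mapsto\langle\pi(s)\xi,\eta\rangle$ of continuous unitary representations $\pi$ of $G$, under pointwise operations. Let $\varpi:G\to\mathcal{U}(\mathcal{H}_G)$ be the universal (continuous unitary) representation of $G$ and $\mathrm{W}^*(G)=\varpi(G)''\subseteq\mathcal{B}(\mathcal{H}_G)$ the universal von Neumann algebra. $\mathrm{B}(G)$ is the predual of $\mathrm{W}^*(G)$ via $\langle u,\varpi(s)\rangle=u(s)$, and carries the corresponding norm and predual operator space structure. With this structure it is a completely contractive Banach algebra. Eberlein compactification: $G^\varpi=\overline{\varpi(G)}^{wo}$, the closure of $\varpi(G)$ in the closed unit ball of $\mathcal{B}(\mathcal{H}_G)$ in the weak operator topology. It is a compact semitopological semigroup under operator multiplication. Its set of central idempotents is $$\mathrm{ZE}(G^\varpi)=\{p\in G^\varpi: p^2=p\text{ and }\varpi(s)p=p\varpi(s)\text{ for all }s\in G\}.$$ Operator amenability: a completely contractive Banach algebra $\mathcal{B}$ with multiplication map $m$ is operator amenable if the operator projective tensor product $\mathcal{B}\widehat{\otimes}\mathcal{B}$ contains a norm-bounded net $(d_\alpha)$ such that for every $a\in\mathcal{B}$, $(a\otimes 1)d_\alpha-d_\alpha(1\otimes a)\to 0$ and $m(d_\alpha)a\to a$,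 $a\,m(d_\alpha)\to a$ in norm. Here $(a\otimes 1)(b\otimes c)=ab\otimes c$ and $(b\otimes c)(1\otimes a)=b\otimes ca$. *)

theory Defs
  imports "HOL-Analysis.Analysis" "HOL-Library.Function_Algebras"
begin

section \<open>Complex vector spaces\<close>

class complex_vector = ab_group_add +
  fixes scaleC :: "complex \<Rightarrow> 'a \<Rightarrow> 'a"  (infixr \<open>*\<^sub>C\<close> 75)
  assumes scaleC_add_right: "c *\<^sub>C (x + y) = c *\<^sub>C x + c *\<^sub>C y"
    and scaleC_add_left: "(c + d) *\<^sub>C x = c *\<^sub>C x + d *\<^sub>C x"
    and scaleC_scaleC: "c *\<^sub>C (d *\<^sub>C x) = (c * d) *\<^sub>C x"
    and scaleC_one: "1 *\<^sub>C x = x"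

global_interpretation complex_vector:
  vector_space "scaleC :: complex \<Rightarrow> 'a \<Rightarrow> 'a::complex_vector"
  by standard (rule scaleC_add_right scaleC_add_left scaleC_scaleC scaleC_one)+

instantiation complex :: complex_vector
begin
definition scaleC_complex_def: "c *\<^sub>C (x::complex) = c * x"
instance by standard (simp_all add: scaleC_complex_def algebra_simps)
end

instantiation "fun" :: (type, complex_vector) complex_vector
begin
definition scaleC_fun_def: "c *\<^sub>C f = (\<lambda>x. c *\<^sub>C f x)"
instance
  by standard
    (simp_all add: scaleC_fun_def fun_eq_iff scaleC_add_right scaleC_add_left scaleC_scaleC scaleC_one)
end


section \<open>Hilbert spaces and their operators\<close>

text \<open>A Hilbert space is a linear subspace of an ambient complex vector space (in which it need not
  be closed in any sense) with an inner product of its own, linear in the first variable.\<close>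

record 'a hilbert =
  hcarrier :: "'a set"
  hinner :: "'a \<Rightarrow> 'a \<Rightarrow> complex"

definition hnorm :: "'a::complex_vector hilbert \<Rightarrow> 'a \<Rightarrow> real" where
  "hnorm H x = sqrt (Re (hinner H x x))"

definition hilbert_space :: "'a::complex_vector hilbert \<Rightarrow> bool" where
  "hilbert_space H \<longleftrightarrow>
     complex_vector.subspace (hcarrier H) \<and>
     (\<forall>x\<in>hcarrier H. \<forall>y\<in>hcarrier H. \<forall>z\<in>hcarrier H.
        hinner H (x + y) z = hinner H x z + hinner H y z) \<and>
     (\<forall>c. \<forall>x\<in>hcarrier H. \<forall>y\<in>hcarrier H. hinner H (c *\<^sub>C x) y = c * hinner H x y) \<and>
     (\<forall>x\<in>hcarrier H. \<forall>y\<in>hcarrier H. hinner H y x = cnj (hinner H x y)) \<and>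
     (\<forall>x\<in>hcarrier H. 0 \<le> Re (hinner H x x)) \<and>
     (\<forall>x\<in>hcarrier H. hinner H x x = 0 \<longrightarrow> x = 0) \<and>
     (\<forall>X. range X \<subseteq> hcarrier H \<and>
          (\<forall>e>0. \<exists>N. \<forall>m\<ge>N. \<forall>n\<ge>N. hnorm H (X m - X n) < e) \<longrightarrow>
          (\<exists>l\<in>hcarrier H. (\<lambda>n. hnorm H (X n - l)) \<longlonglongrightarrow> 0))"

definition hilbert_sum :: "'i set \<Rightarrow> ('i \<Rightarrow> 'a::complex_vector hilbert) \<Rightarrow> ('i \<Rightarrow> 'a) hilbert" where
  "hilbert_sum I H = \<lparr>
     hcarrier = {f. (\<forall>i\<in>I. f i \<in> hcarrier (H i)) \<and> (\<forall>i. i \<notin> I \<longrightarrow> f i = 0) \<and>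
                    (\<lambda>i. (hnorm (H i) (f i))\<^sup>2) summable_on I},
     hinner = (\<lambda>f g. \<Sum>\<^sub>\<infinity>i\<in>I. hinner (H i) (f i) (g i)) \<rparr>"

text \<open>Operators take the value 0 outside the carrier, so that equality of operators on the Hilbert
  space is equality of functions.\<close>

definition bounded_ops :: "'a::complex_vector hilbert \<Rightarrow> ('a \<Rightarrow> 'a) set" where
  "bounded_ops H = {A.
     (\<forall>x\<in>hcarrier H. A x \<in> hcarrier H) \<and> (\<forall>x. x \<notin> hcarrier H \<longrightarrow> A x = 0) \<and>
     (\<forall>x\<in>hcarrier H. \<forall>y\<in>hcarrier H. A (x + y) = A x + A y) \<and>
     (\<forall>c. \<forall>x\<in>hcarrier H. A (c *\<^sub>C x) = c *\<^sub>C A x) \<and>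
     (\<exists>C. \<forall>x\<in>hcarrier H. hnorm H (A x) \<le> C * hnorm H x)}"

definition ops_unit_ball :: "'a::complex_vector hilbert \<Rightarrow> ('a \<Rightarrow> 'a) set" where
  "ops_unit_ball H = {A \<in> bounded_ops H. \<forall>x\<in>hcarrier H. hnorm H (A x) \<le> hnorm H x}"

definition unitary_ops :: "'a::complex_vector hilbert \<Rightarrow> ('a \<Rightarrow> 'a) set" where
  "unitary_ops H = {U \<in> bounded_ops H. U ` hcarrier H = hcarrier H \<and>
     (\<forall>x\<in>hcarrier H. \<forall>y\<in>hcarrier H. hinner H (U x) (U y) = hinner H x y)}"

definition commutant :: "'a::complex_vector hilbert \<Rightarrow> ('a \<Rightarrow> 'a) set \<Rightarrow> ('a \<Rightarrow> 'a) set" where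
  "commutant H S = {A \<in> bounded_ops H. \<forall>B\<in>S. A \<circ> B = B \<circ> A}"

definition weak_op_topology :: "'a::complex_vector hilbert \<Rightarrow> ('a \<Rightarrow> 'a) topology" where
  "weak_op_topology H = topology_generated_by
     {{A \<in> bounded_ops H. hinner H (A x) y \<in> U} | x y U.
        x \<in> hcarrier H \<and> y \<in> hcarrier H \<and> open U}"

text \<open>Elements of the predual of a von Neumann algebra \<open>M\<close> on \<open>H\<close>: the ultraweakly continuous linear
  functionals.\<close>

definition normal_functional ::
    "'a::complex_vector hilbert \<Rightarrow> ('a \<Rightarrow> 'a) set \<Rightarrow> (('a \<Rightarrow> 'a) \<Rightarrow> complex) \<Rightarrow> bool" where
  "normal_functional H M \<omega> \<longleftrightarrow> (\<exists>\<xi> \<eta> :: nat \<Rightarrow> 'a.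
     range \<xi> \<subseteq> hcarrier H \<and> range \<eta> \<subseteq> hcarrier H \<and>
     summable (\<lambda>n. (hnorm H (\<xi> n))\<^sup>2) \<and> summable (\<lambda>n. (hnorm H (\<eta> n))\<^sup>2) \<and>
     (\<forall>A\<in>M. \<omega> A = (\<Sum>n. hinner H (A (\<xi> n)) (\<eta> n))))"

text \<open>The norms of a matrix of operators, acting from \<open>H\<^sup>J\<close> to \<open>H\<^sup>I\<close>, and of a matrix of scalars.\<close>

definition opmat_norm ::
    "'a::complex_vector hilbert \<Rightarrow> 'i set \<Rightarrow> 'j set \<Rightarrow> ('i \<Rightarrow> 'j \<Rightarrow> 'a \<Rightarrow> 'a) \<Rightarrow> real" where
  "opmat_norm H I J A = Sup {L2_set (\<lambda>i. hnorm H (\<Sum>j\<in>J. A i j (\<xi> j))) I | \<xi>.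
     (\<forall>j\<in>J. \<xi> j \<in> hcarrier H) \<and> L2_set (\<lambda>j. hnorm H (\<xi> j)) J \<le> 1}"

definition cmat_norm :: "'i set \<Rightarrow> 'j set \<Rightarrow> ('i \<Rightarrow> 'j \<Rightarrow> complex) \<Rightarrow> real" where
  "cmat_norm I J A = Sup {L2_set (\<lambda>i. norm (\<Sum>j\<in>J. A i j * z j)) I | z.
     L2_set (\<lambda>j. norm (z j)) J \<le> 1}"


section \<open>Unitary representations\<close>

text \<open>Topological groups are those of the class \<^class>\<open>topological_group_add\<close>: the group operation is
  written additively but is not assumed to be commutative.\<close>

record ('g, 'a) urep =
  rep_space :: "'a hilbert"
  rep_op :: "'g \<Rightarrow> 'a \<Rightarrow> 'a"

definition unitary_rep :: "('g::topological_group_add, 'a::complex_vector) urep \<Rightarrow> bool" where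
  "unitary_rep \<rho> \<longleftrightarrow>
     hilbert_space (rep_space \<rho>) \<and>
     (\<forall>s. rep_op \<rho> s \<in> unitary_ops (rep_space \<rho>)) \<and>
     (\<forall>s t. rep_op \<rho> (s + t) = rep_op \<rho> s \<circ> rep_op \<rho> t) \<and>
     (\<forall>x\<in>hcarrier (rep_space \<rho>). \<forall>s.
        ((\<lambda>t. hnorm (rep_space \<rho>) (rep_op \<rho> t x - rep_op \<rho> s x)) \<longlongrightarrow> 0) (at s))"

text \<open>Up to unitary equivalence, every cyclic representation \<open>\<pi>\<close>, with cyclic vector \<open>\<xi>\<close>, lives on a
  linear subspace of \<open>'g \<Rightarrow> complex\<close>, through the injection mapping \<open>\<zeta>\<close> to the function
  \<open>s \<mapsto> \<langle>\<zeta>, \<pi>(s)\<xi>\<rangle>\<close>. Every matrix coefficient is one of a cyclic representation, and every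
  representation is a direct sum of cyclic ones. Hence it is enough to let representations range over
  this universe, both for the matrix coefficients and for the summands of the universal
  representation.\<close>

type_synonym 'g small_urep = "('g, 'g \<Rightarrow> complex) urep"

definition fourier_stieltjes :: "('g::topological_group_add \<Rightarrow> complex) set" where
  "fourier_stieltjes = {(\<lambda>s. hinner (rep_space \<rho>) (rep_op \<rho> s \<xi>) \<eta>) | (\<rho> :: 'g small_urep) \<xi> \<eta>.
     unitary_rep \<rho> \<and> \<xi> \<in> hcarrier (rep_space \<rho>) \<and> \<eta> \<in> hcarrier (rep_space \<rho>)}"

type_synonym 'g univ_vector = "'g small_urep \<Rightarrow> 'g \<Rightarrow> complex"

definition univ_space :: "'g::topological_group_add univ_vector hilbert" where
  "univ_space = hilbert_sum {\<rho>. unitary_rep \<rho>} rep_space"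

definition univ_rep :: "'g::topological_group_add \<Rightarrow> 'g univ_vector \<Rightarrow> 'g univ_vector" where
  "univ_rep s f =
     (if f \<in> hcarrier univ_space
      then (\<lambda>\<rho>. if unitary_rep \<rho> then rep_op \<rho> s (f \<rho>) else 0) else 0)"

definition univ_vn_algebra :: "('g::topological_group_add univ_vector \<Rightarrow> 'g univ_vector) set" where
  "univ_vn_algebra = commutant univ_space (commutant univ_space (range univ_rep))"


section \<open>The Eberlein compactification\<close>

definition eberlein_compactification ::
    "('g::topological_group_add univ_vector \<Rightarrow> 'g univ_vector) set" where
  "eberlein_compactification =
     subtopology (weak_op_topology univ_space) (ops_unit_ball univ_space) closure_of range univ_rep"

definition central_idempotents ::
    "('g::topological_group_add univ_vector \<Rightarrow> 'g univ_vector) set" where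
  "central_idempotents =
     {p \<in> eberlein_compactification. p \<circ> p = p \<and> (\<forall>s. univ_rep s \<circ> p = p \<circ> univ_rep s)}"


section \<open>Operator spaces and the operator projective tensor product\<close>

text \<open>In \<open>os_matnorm V n x\<close> only the entries \<open>x i j\<close> with \<open>i, j < n\<close> matter.\<close>

record 'a op_space =
  os_carrier :: "'a set"
  os_matnorm :: "nat \<Rightarrow> (nat \<Rightarrow> nat \<Rightarrow> 'a) \<Rightarrow> real"

record 'a op_algebra = "'a op_space" +
  oa_mult :: "'a \<Rightarrow> 'a \<Rightarrow> 'a"

definition os_norm :: "('a, 'r) op_space_scheme \<Rightarrow> 'a \<Rightarrow> real" where
  "os_norm V a = os_matnorm V 1 (\<lambda>_ _. a)"

definition bilinear_forms :: "'a::complex_vector set \<Rightarrow> 'b::complex_vector set \<Rightarrow> ('a \<Rightarrow> 'b \<Rightarrow> complex) set" where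
  "bilinear_forms V W = {\<phi>.
     (\<forall>a\<in>V. \<forall>a'\<in>V. \<forall>b\<in>W. \<phi> (a + a') b = \<phi> a b + \<phi> a' b) \<and>
     (\<forall>a\<in>V. \<forall>b\<in>W. \<forall>b'\<in>W. \<phi> a (b + b') = \<phi> a b + \<phi> a b') \<and>
     (\<forall>c. \<forall>a\<in>V. \<forall>b\<in>W. \<phi> (c *\<^sub>C a) b = c * \<phi> a b \<and> \<phi> a (c *\<^sub>C b) = c * \<phi> a b)}"

text \<open>The algebraic tensor product of two vector spaces is realised inside the dual of the space of
  bilinear forms, \<open>a \<otimes> b\<close> being evaluation at \<open>(a, b)\<close>.\<close>

type_synonym ('a, 'b) tensor = "('a \<Rightarrow> 'b \<Rightarrow> complex) \<Rightarrow> complex"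

definition elem_tensor ::
    "'a::complex_vector set \<Rightarrow> 'b::complex_vector set \<Rightarrow> 'a \<Rightarrow> 'b \<Rightarrow> ('a, 'b) tensor" where
  "elem_tensor V W a b = (\<lambda>\<phi>. if \<phi> \<in> bilinear_forms V W then \<phi> a b else 0)"

definition alg_tensor :: "'a::complex_vector set \<Rightarrow> 'b::complex_vector set \<Rightarrow> ('a, 'b) tensor set" where
  "alg_tensor V W = {(\<Sum>i<n. elem_tensor V W (a i) (b i)) | (n::nat) a b.
     \<forall>i<n. a i \<in> V \<and> b i \<in> W}"

text \<open>The linear map on the algebraic tensor product induced by a bilinear map \<open>f\<close>.\<close>

definition tensor_lift ::
    "'a::complex_vector set \<Rightarrow> 'b::complex_vector set \<Rightarrow> ('a \<Rightarrow> 'b \<Rightarrow> 'c::complex_vector) \<Rightarrow>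
     ('a, 'b) tensor \<Rightarrow> 'c" where
  "tensor_lift V W f t = (THE c. \<exists>(n::nat) a b. (\<forall>i<n. a i \<in> V \<and> b i \<in> W) \<and>
     t = (\<Sum>i<n. elem_tensor V W (a i) (b i)) \<and> c = (\<Sum>i<n. f (a i) (b i)))"

text \<open>The operator projective norm of \<open>t\<close> is the infimum of
  \<open>\<parallel>\<alpha>\<parallel> \<parallel>x\<parallel> \<parallel>y\<parallel> \<parallel>\<beta>\<parallel>\<close> over the factorisations \<open>t = \<alpha> (x \<otimes> y) \<beta>\<close>, where \<open>x\<close> is a
  \<open>p \<times> p\<close> matrix over \<open>V\<close>, \<open>y\<close> a \<open>q \<times> q\<close> matrix over \<open>W\<close>, and \<open>\<alpha>\<close>, \<open>\<beta>\<close> are a scalar row and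
  a scalar column of length \<open>pq\<close>.\<close>

definition op_proj_norm ::
    "('a::complex_vector, 'r) op_space_scheme \<Rightarrow> ('b::complex_vector, 's) op_space_scheme \<Rightarrow>
     ('a, 'b) tensor \<Rightarrow> real" where
  "op_proj_norm V W t = Inf {
     L2_set (\<lambda>ik. norm (\<alpha> ik)) ({..<p} \<times> {..<q}) * os_matnorm V p x * os_matnorm W q y *
     L2_set (\<lambda>jl. norm (\<beta> jl)) ({..<p} \<times> {..<q})
     | p q (\<alpha> :: nat \<times> nat \<Rightarrow> complex) (\<beta> :: nat \<times> nat \<Rightarrow> complex) x y.
       (\<forall>i<p. \<forall>j<p. x i j \<in> os_carrier V) \<and> (\<forall>k<q. \<forall>l<q. y k l \<in> os_carrier W) \<and>
       t = (\<Sum>i<p. \<Sum>k<q. \<Sum>j<p. \<Sum>l<q. (\<alpha> (i, k) * \<beta> (j, l)) *\<^sub>C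
              elem_tensor (os_carrier V) (os_carrier W) (x i j) (y k l))}"

text \<open>The completion of a space \<open>E\<close> with norm \<open>\<nu>\<close>: classes of Cauchy sequences modulo null
  sequences.\<close>

definition cauchy_seqs :: "'e::complex_vector set \<Rightarrow> ('e \<Rightarrow> real) \<Rightarrow> (nat \<Rightarrow> 'e) set" where
  "cauchy_seqs E \<nu> = {x. range x \<subseteq> E \<and> (\<forall>e>0. \<exists>N. \<forall>m\<ge>N. \<forall>n\<ge>N. \<nu> (x m - x n) < e)}"

definition completion_rel ::
    "'e::complex_vector set \<Rightarrow> ('e \<Rightarrow> real) \<Rightarrow> ((nat \<Rightarrow> 'e) \<times> (nat \<Rightarrow> 'e)) set" where
  "completion_rel E \<nu> = {(x, y). x \<in> cauchy_seqs E \<nu> \<and> y \<in> cauchy_seqs E \<nu> \<and>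
     (\<lambda>n. \<nu> (x n - y n)) \<longlonglongrightarrow> 0}"

definition completion :: "'e::complex_vector set \<Rightarrow> ('e \<Rightarrow> real) \<Rightarrow> (nat \<Rightarrow> 'e) set set" where
  "completion E \<nu> = cauchy_seqs E \<nu> // completion_rel E \<nu>"

definition completion_norm :: "('e::complex_vector \<Rightarrow> real) \<Rightarrow> (nat \<Rightarrow> 'e) set \<Rightarrow> real" where
  "completion_norm \<nu> X = (THE r. \<exists>x\<in>X. (\<lambda>n. \<nu> (x n)) \<longlonglongrightarrow> r)"

definition completion_diff ::
    "'e::complex_vector set \<Rightarrow> ('e \<Rightarrow> real) \<Rightarrow> (nat \<Rightarrow> 'e) set \<Rightarrow> (nat \<Rightarrow> 'e) set \<Rightarrow> (nat \<Rightarrow> 'e) set" where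
  "completion_diff E \<nu> X Y = completion_rel E \<nu> `` {(\<lambda>n. x n - y n) | x y. x \<in> X \<and> y \<in> Y}"

text \<open>The continuous extensions to the completion of a bounded linear map from \<open>E\<close> to \<open>E\<close>, and of one
  from \<open>E\<close> to a complete space \<open>V\<close> with norm \<open>\<mu>\<close>.\<close>

definition completion_map ::
    "'e::complex_vector set \<Rightarrow> ('e \<Rightarrow> real) \<Rightarrow> ('e \<Rightarrow> 'e) \<Rightarrow> (nat \<Rightarrow> 'e) set \<Rightarrow> (nat \<Rightarrow> 'e) set" where
  "completion_map E \<nu> f X = completion_rel E \<nu> `` {(\<lambda>n. f (x n)) | x. x \<in> X}"

definition completion_extend ::
    "'v::complex_vector set \<Rightarrow> ('v \<Rightarrow> real) \<Rightarrow> ('e::complex_vector \<Rightarrow> 'v) \<Rightarrow> (nat \<Rightarrow> 'e) set \<Rightarrow> 'v" where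
  "completion_extend V \<mu> f X = (THE v. v \<in> V \<and> (\<exists>x\<in>X. (\<lambda>n. \<mu> (f (x n) - v)) \<longlonglongrightarrow> 0))"


section \<open>Operator amenability\<close>

text \<open>The notion is meant for completely contractive Banach algebras \<open>A\<close>. A net \<open>(d\<^sub>\<alpha>)\<close> is
  represented by the proper filter generated by its tails, on the completed tensor product;
  conversely every proper filter \<open>F\<close> is the tail filter of a net, indexed by the pairs \<open>(S, d)\<close> with
  \<open>S\<close> in \<open>F\<close> and \<open>d\<close> in \<open>S\<close>.\<close>

definition operator_amenable :: "('a::complex_vector, 'r) op_algebra_scheme \<Rightarrow> bool" where
  "operator_amenable A \<longleftrightarrow>
     (let V = os_carrier A;
          E = alg_tensor V V;
          \<nu> = op_proj_norm A A;
          lact = (\<lambda>a. completion_map E \<nu>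
                   (tensor_lift V V (\<lambda>b c. elem_tensor V V (oa_mult A a b) c)));
          ract = (\<lambda>a. completion_map E \<nu>
                   (tensor_lift V V (\<lambda>b c. elem_tensor V V b (oa_mult A c a))));
          m = completion_extend V (os_norm A) (tensor_lift V V (oa_mult A))
      in \<exists>(F :: (nat \<Rightarrow> ('a, 'a) tensor) set filter) C.
           F \<noteq> bot \<and>
           (\<forall>\<^sub>F d in F. d \<in> completion E \<nu> \<and> completion_norm \<nu> d \<le> C) \<and>
           (\<forall>a\<in>V.
              ((\<lambda>d. completion_norm \<nu> (completion_diff E \<nu> (lact a d) (ract a d))) \<longlongrightarrow> 0) F \<and>
              ((\<lambda>d. os_norm A (oa_mult A (m d) a - a)) \<longlongrightarrow> 0) F \<and>
              ((\<lambda>d. os_norm A (oa_mult A a (m d) - a)) \<longlongrightarrow> 0) F))"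


section \<open>The Fourier--Stieltjes algebra\<close>

text \<open>\<open>fs_pairing u A\<close> is the value at \<open>A\<close> of the normal functional on the universal von Neumann
  algebra which takes the value \<open>u s\<close> at \<open>univ_rep s\<close>. A matrix \<open>u\<close> over the predual is normed as
  the completely bounded map \<open>A \<mapsto> [\<langle>u i j, A\<rangle>]\<close> into the scalar matrices.\<close>

definition fs_pairing ::
    "('g::topological_group_add \<Rightarrow> complex) \<Rightarrow> ('g univ_vector \<Rightarrow> 'g univ_vector) \<Rightarrow> complex" where
  "fs_pairing u A = (THE c. \<exists>\<omega>. normal_functional univ_space univ_vn_algebra \<omega> \<and>
     (\<forall>s. \<omega> (univ_rep s) = u s) \<and> c = \<omega> A)"

definition fs_matnorm ::
    "nat \<Rightarrow> (nat \<Rightarrow> nat \<Rightarrow> 'g::topological_group_add \<Rightarrow> complex) \<Rightarrow> real" where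
  "fs_matnorm n u = Sup {
     cmat_norm ({..<n} \<times> {..<m}) ({..<n} \<times> {..<m})
       (\<lambda>ik jl. fs_pairing (u (fst ik) (fst jl)) (A (snd ik) (snd jl)))
     | (m::nat) A. (\<forall>k<m. \<forall>l<m. A k l \<in> univ_vn_algebra) \<and> opmat_norm univ_space {..<m} {..<m} A \<le> 1}"

definition fourier_stieltjes_algebra :: "('g::topological_group_add \<Rightarrow> complex) op_algebra" where
  "fourier_stieltjes_algebra = \<lparr>
     os_carrier = fourier_stieltjes,
     os_matnorm = fs_matnorm,
     oa_mult = (\<lambda>u v s. u s * v s) \<rparr>"

end

theory Submission
  imports Defs
begin

text \<open>Write \<open>B\<close> for the Fourier--Stieltjes algebra and \<open>M\<close> for the universal von Neumann algebra. The
  idea is that each finite set \<open>S\<close> of nonzero central idempotents of the Eberlein compactification gives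
  a contraction of \<open>B \<otimes> B\<close> into the scalars that takes values tending to \<open>card S\<close> along a bounded
  approximate diagonal; hence \<open>card S\<close> is at most the bound of the approximate diagonal.

  Every \<open>p\<close> in the Eberlein compactification lies in \<open>M\<close>, and \<open>u \<mapsto> \<langle>u, p\<rangle>\<close> is multiplicative on \<open>B\<close>,
  since it is a pointwise limit of point evaluations (\<open>EB_multiplicative\<close>). If \<open>p\<close> and \<open>q\<close> are two
  central idempotents and \<open>d\<close> runs through an approximate diagonal, then the value of \<open>p \<otimes> q\<close> at
  \<open>a \<cdot> d - d \<cdot> a\<close> is \<open>(\<langle>a, p\<rangle> - \<langle>a, q\<rangle>) \<langle>d, p \<otimes> q\<rangle>\<close>, so \<open>\<langle>d, p \<otimes> q\<rangle>\<close> tends to 0 when \<open>p \<noteq> q\<close>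
  (\<open>off_diagonal\<close>), while \<open>\<langle>d, p \<otimes> p\<rangle> = \<langle>m d, p\<rangle>\<close> tends to 1 when \<open>p \<noteq> 0\<close> (\<open>diagonal\<close>).

  An idempotent contraction is an orthogonal projection, so the central idempotents are commuting
  projections in the centre of \<open>M\<close>, and their set is closed under products (\<open>ZE_comp\<close>). For a finite
  set \<open>S\<close> of them let \<open>e s\<close> be the product of \<open>s\<close> with all \<open>1 - t\<close>, where \<open>t\<close> in \<open>S\<close> does not majorise
  \<open>s\<close>. The \<open>e s\<close> are mutually orthogonal, so \<open>\<Sum>s\<in>S. s \<otimes> e s\<close> is again a projection, of norm at most 1
  on the Hilbert space tensor square. Expanding the product, \<open>e s\<close> is \<open>s\<close> plus an integral combination
  of central idempotents different from \<open>s\<close>; hence \<open>\<langle>d, s \<otimes> e s\<rangle>\<close> tends to 1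
  (\<open>separating_projection\<close>), and the value of the sum tends to \<open>card S\<close> (\<open>card_le\<close>).

  The functional analysis behind this consists of two inequalities. A bilinear form on \<open>B\<close> that
  comes from a contraction on the Hilbert space tensor square is a contractive functional for the
  operator projective norm (\<open>contractive_form_matrix_bound\<close>, \<open>contractive_form_fnorm\<close>): this is the
  half of the duality between the operator projective tensor product and the von Neumann tensor
  product that bounds the pairing. And the norm of \<open>B\<close> is the infimum of \<open>\<parallel>\<xi>\<parallel> \<parallel>\<eta>\<parallel>\<close> over the
  representations of a function as a coefficient (\<open>coeff_norm\<close>, \<open>fs_matnorm_1\<close>). The latter makes
  \<open>B\<close> complete and identifies its dual with \<open>M\<close> (\<open>dual_functional\<close>), through which all the estimates
  are reduced to inner products.\<close>

section \<open>Notation\<close>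

abbreviation (input) "Hu \<equiv> hcarrier univ_space"
abbreviation (input) "ipu \<equiv> hinner univ_space"
abbreviation (input) "nmu \<equiv> hnorm univ_space"
abbreviation (input) "Bu \<equiv> bounded_ops univ_space"
abbreviation (input) "VN \<equiv> univ_vn_algebra"
abbreviation "FS \<equiv> fourier_stieltjes"
type_synonym 'g univ_op = "'g univ_vector => 'g univ_vector"

section \<open>Geometry of a Hilbert space\<close>

locale hilb =
  fixes H :: "'a::complex_vector hilbert"
  assumes hilbert: "hilbert_space H"
begin

abbreviation (input) "cr \<equiv> hcarrier H"
abbreviation (input) "ip \<equiv> hinner H"
abbreviation (input) "nm \<equiv> hnorm H"

lemma subspace_carrier: "complex_vector.subspace cr"
  using hilbert by (simp add: hilbert_space_def)

lemma zero_in [simp, intro]: "0 \<in> cr"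
  by (rule complex_vector.subspace_0[OF subspace_carrier])
lemma add_in [simp, intro]: "x \<in> cr ==> y \<in> cr ==> x + y \<in> cr"
  by (rule complex_vector.subspace_add[OF subspace_carrier])
lemma scale_in [simp, intro]: "x \<in> cr ==> c *\<^sub>C x \<in> cr"
  by (rule complex_vector.subspace_scale[OF subspace_carrier])
lemma diff_in [simp, intro]: "x \<in> cr ==> y \<in> cr ==> x - y \<in> cr"
  by (rule complex_vector.subspace_diff[OF subspace_carrier])
lemma minus_in [simp, intro]: "x \<in> cr ==> - x \<in> cr"
  by (rule complex_vector.subspace_neg[OF subspace_carrier])
lemma sum_in [intro]: "(\<And>i. i \<in> I ==> f i \<in> cr) ==> sum f I \<in> cr"
  by (rule complex_vector.subspace_sum[OF subspace_carrier])

lemma ip_add_left: "x \<in> cr ==> y \<in> cr ==> z \<in> cr ==> ip (x + y) z = ip x z + ip y z"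
  using hilbert[unfolded hilbert_space_def, THEN conjunct2, THEN conjunct1] by blast
lemma ip_scale_left: "x \<in> cr ==> y \<in> cr ==> ip (c *\<^sub>C x) y = c * ip x y"
  using hilbert[unfolded hilbert_space_def, THEN conjunct2, THEN conjunct2, THEN conjunct1] by blast
lemma ip_commute: "x \<in> cr ==> y \<in> cr ==> ip y x = cnj (ip x y)"
  using hilbert[unfolded hilbert_space_def, THEN conjunct2, THEN conjunct2, THEN conjunct2, THEN conjunct1] by blast
lemma ip_ge_0: "x \<in> cr ==> 0 \<le> Re (ip x x)"
  using hilbert[unfolded hilbert_space_def, THEN conjunct2, THEN conjunct2, THEN conjunct2, THEN conjunct2, THEN conjunct1] by blast
lemma ip_eq_0D: "x \<in> cr ==> ip x x = 0 ==> x = 0"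
  using hilbert[unfolded hilbert_space_def, THEN conjunct2, THEN conjunct2, THEN conjunct2, THEN conjunct2, THEN conjunct2, THEN conjunct1] by blast

lemma complete:
  assumes "\<And>n. X n \<in> cr" "\<And>e. e > 0 ==> \<exists>N. \<forall>m\<ge>N. \<forall>n\<ge>N. nm (X m - X n) < e"
  shows "\<exists>l\<in>cr. (\<lambda>n. nm (X n - l)) \<longlonglongrightarrow> 0"
proof -
  have "range X \<subseteq> cr \<and> (\<forall>e>0. \<exists>N. \<forall>m\<ge>N. \<forall>n\<ge>N. nm (X m - X n) < e)" using assms by auto
  then show ?thesis using hilbert unfolding hilbert_space_def by blast
qed

lemma ip_add_right: "x \<in> cr ==> y \<in> cr ==> z \<in> cr ==> ip z (x + y) = ip z x + ip z y"
  by (subst (1 2 3) ip_commute) (auto simp: ip_add_left)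
lemma ip_scale_right: "x \<in> cr ==> y \<in> cr ==> ip y (c *\<^sub>C x) = cnj c * ip y x"
  by (subst (1 2) ip_commute) (auto simp: ip_scale_left)
lemma ip_minus_left: "x \<in> cr ==> y \<in> cr ==> ip (- x) y = - ip x y"
  using ip_scale_left[of x y "-1"] by (simp add: complex_vector.scale_minus_left)
lemma ip_minus_right: "x \<in> cr ==> y \<in> cr ==> ip y (- x) = - ip y x"
  using ip_scale_right[of x y "-1"] by (simp add: complex_vector.scale_minus_left)
lemma ip_diff_left: "x \<in> cr ==> y \<in> cr ==> z \<in> cr ==> ip (x - y) z = ip x z - ip y z"
  using ip_add_left[of x "- y" z] by (simp add: ip_minus_left)
lemma ip_diff_right: "x \<in> cr ==> y \<in> cr ==> z \<in> cr ==> ip z (x - y) = ip z x - ip z y"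
  using ip_add_right[of x "- y" z] by (simp add: ip_minus_right)
lemma ip_zero_left [simp]: "y \<in> cr ==> ip 0 y = 0"
  using ip_scale_left[of 0 y 0] by simp
lemma ip_zero_right [simp]: "y \<in> cr ==> ip y 0 = 0"
  using ip_scale_right[of 0 y 0] by simp
lemma ip_sum_left: "(\<And>i. i \<in> I ==> f i \<in> cr) ==> y \<in> cr ==> ip (sum f I) y = (\<Sum>i\<in>I. ip (f i) y)"
  by (induction I rule: infinite_finite_induct) (auto simp: ip_add_left sum_in)
lemma ip_sum_right: "(\<And>i. i \<in> I ==> f i \<in> cr) ==> y \<in> cr ==> ip y (sum f I) = (\<Sum>i\<in>I. ip y (f i))"
  by (induction I rule: infinite_finite_induct) (auto simp: ip_add_right sum_in)

lemmas ip_linear = ip_add_left ip_add_right ip_diff_left ip_diff_right ip_scale_left ip_scale_right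
  ip_minus_left ip_minus_right


lemma nm_ge_0 [simp]: "x \<in> cr ==> 0 \<le> nm x"
  by (simp add: hnorm_def ip_ge_0)
lemma nm_sq: "x \<in> cr ==> (nm x)\<^sup>2 = Re (ip x x)"
  by (simp add: hnorm_def ip_ge_0)
lemma ip_self: "x \<in> cr ==> ip x x = complex_of_real ((nm x)\<^sup>2)"
  using ip_commute[of x x] by (simp add: nm_sq complex_eq_iff)
lemma nm_zero [simp]: "nm 0 = 0"
  by (simp add: hnorm_def)
lemma nm_eq_0: "x \<in> cr ==> nm x = 0 \<longleftrightarrow> x = 0"
  using ip_eq_0D ip_self by auto
lemma nm_pos: "x \<in> cr ==> x \<noteq> 0 ==> 0 < nm x"
  by (metis nm_eq_0 nm_ge_0 order_le_less)
lemma nm_scale: "x \<in> cr ==> nm (c *\<^sub>C x) = cmod c * nm x"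
proof -
  assume x: "x \<in> cr"
  have "ip (c *\<^sub>C x) (c *\<^sub>C x) = (c * cnj c) * ip x x"
    using x by (simp add: ip_linear)
  also have "\<dots> = complex_of_real ((cmod c)\<^sup>2 * (nm x)\<^sup>2)"
    unfolding complex_norm_square[symmetric] ip_self[OF x] by simp
  finally have "(nm (c *\<^sub>C x))\<^sup>2 = (cmod c * nm x)\<^sup>2"
    using x by (simp add: nm_sq power_mult_distrib)
  then show ?thesis using x by simp
qed
lemma nm_minus: "x \<in> cr ==> nm (- x) = nm x"
  using nm_scale[of x "-1"] by (simp add: complex_vector.scale_minus_left)
lemma nm_diff_commute: "x \<in> cr ==> y \<in> cr ==> nm (x - y) = nm (y - x)"
  using nm_minus[of "x - y"] by simp

lemma nm_add_sq: "x \<in> cr ==> y \<in> cr ==> (nm (x + y))\<^sup>2 = (nm x)\<^sup>2 + (nm y)\<^sup>2 + 2 * Re (ip x y)"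
  using ip_commute[of x y] by (simp add: nm_sq ip_linear)
lemma nm_diff_sq: "x \<in> cr ==> y \<in> cr ==> (nm (x - y))\<^sup>2 = (nm x)\<^sup>2 + (nm y)\<^sup>2 - 2 * Re (ip x y)"
  using ip_commute[of x y] by (simp add: nm_sq ip_linear)

lemma nm_diff_proj_sq:
  assumes "x \<in> cr" "y \<in> cr" "y \<noteq> 0"
  shows "(nm (x - (ip x y / (nm y)\<^sup>2) *\<^sub>C y))\<^sup>2 = (nm x)\<^sup>2 - (cmod (ip x y))\<^sup>2 / (nm y)\<^sup>2"
proof -
  have y0: "nm y \<noteq> 0" using assms nm_eq_0 by blast
  have "Re (ip x ((ip x y / (nm y)\<^sup>2) *\<^sub>C y)) = (cmod (ip x y))\<^sup>2 / (nm y)\<^sup>2"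
    using assms by (simp add: ip_linear complex_norm_square[symmetric] mult.commute[of "cnj _"]
      flip: of_real_power of_real_divide)
  moreover have "(nm ((ip x y / (nm y)\<^sup>2) *\<^sub>C y))\<^sup>2 = (cmod (ip x y))\<^sup>2 / (nm y)\<^sup>2"
  proof -
    have "cmod (ip x y / complex_of_real ((nm y)\<^sup>2)) = cmod (ip x y) / (nm y)\<^sup>2"
      by (simp add: norm_divide norm_power)
    then show ?thesis using assms y0 by (simp add: nm_scale power_mult_distrib power2_eq_square)
  qed
  ultimately show ?thesis using assms by (simp add: nm_diff_sq)
qed

lemma cauchy_schwarz:
  assumes "x \<in> cr" "y \<in> cr"
  shows "cmod (ip x y) \<le> nm x * nm y"
proof (cases "y = 0")
  case False
  then have "nm y > 0" using assms nm_pos by blast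
  have "0 \<le> (nm x)\<^sup>2 - (cmod (ip x y))\<^sup>2 / (nm y)\<^sup>2"
    unfolding nm_diff_proj_sq[OF assms False, symmetric] by simp
  then have "(cmod (ip x y))\<^sup>2 \<le> (nm x * nm y)\<^sup>2"
    using \<open>nm y > 0\<close> by (simp add: field_simps power_mult_distrib)
  then show ?thesis using assms by (simp add: power2_le_iff_abs_le)
qed (use assms in auto)

lemma triangle:
  assumes "x \<in> cr" "y \<in> cr"
  shows "nm (x + y) \<le> nm x + nm y"
proof -
  have "Re (ip x y) \<le> nm x * nm y"
    using cauchy_schwarz[OF assms] complex_Re_le_cmod order_trans by blast
  then have "(nm (x + y))\<^sup>2 \<le> (nm x + nm y)\<^sup>2"
    using assms by (simp add: nm_add_sq power2_sum)
  then show ?thesis using assms by (simp add: power2_le_iff_abs_le)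
qed

lemma triangle_diff:
  assumes "x \<in> cr" "y \<in> cr" "z \<in> cr"
  shows "nm (x - z) \<le> nm (x - y) + nm (y - z)"
  using triangle[of "x - y" "y - z"] assms by simp

lemma nm_diff_triangle:
  assumes "x \<in> cr" "y \<in> cr"
  shows "nm (x - y) \<le> nm x + nm y"
  using triangle[of x "- y"] assms by (simp add: nm_minus)

lemma reverse_triangle:
  assumes "x \<in> cr" "y \<in> cr"
  shows "\<bar>nm x - nm y\<bar> \<le> nm (x - y)"
  using triangle_diff[of x y 0] triangle_diff[of y x 0] nm_diff_commute[of x y] assms by auto

lemma nm_sum: "(\<And>i. i \<in> I ==> f i \<in> cr) ==> nm (sum f I) \<le> (\<Sum>i\<in>I. nm (f i))"
proof (induction I rule: infinite_finite_induct)
  case (insert i I)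
  then show ?case using triangle[of "f i" "sum f I"] by (force intro: sum_in)
qed auto

lemma tendsto_ip_left:
  assumes "\<And>n. X n \<in> cr" "l \<in> cr" "y \<in> cr" "((\<lambda>n. nm (X n - l)) \<longlongrightarrow> 0) F"
  shows "((\<lambda>n. ip (X n) y) \<longlongrightarrow> ip l y) F"
proof -
  have "((\<lambda>n. nm (X n - l) * nm y) \<longlongrightarrow> 0) F" using assms(4) tendsto_mult_left_zero by blast
  then have "((\<lambda>n. ip (X n) y - ip l y) \<longlongrightarrow> 0) F"
    by (rule Lim_null_comparison[rotated])
      (use assms cauchy_schwarz[of "X _ - l" y] in \<open>simp add: ip_linear\<close>)
  then show ?thesis by (simp add: LIM_zero_iff)
qed

lemma tendsto_nm:
  assumes "\<And>n. X n \<in> cr" "l \<in> cr" "((\<lambda>n. nm (X n - l)) \<longlongrightarrow> 0) F"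
  shows "((\<lambda>n. nm (X n)) \<longlongrightarrow> nm l) F"
proof -
  have "((\<lambda>n. nm (X n) - nm l) \<longlongrightarrow> 0) F"
    by (rule Lim_null_comparison[rotated, OF assms(3)]) (use assms reverse_triangle in simp)
  then show ?thesis by (simp add: LIM_zero_iff)
qed

lemma eqI:
  assumes "x \<in> cr" "y \<in> cr" "\<And>z. z \<in> cr ==> ip x z = ip y z"
  shows "x = y"
proof -
  have "ip (x - y) (x - y) = 0" using ip_diff_left[of x y "x - y"] assms(3)[of "x - y"] assms(1,2) by simp
  then show ?thesis using ip_eq_0D[of "x - y"] assms(1,2) by simp
qed

subsection \<open>Closed subspaces and orthogonal projections\<close>

definition closed_sub :: "'a set => bool" where
  "closed_sub K \<longleftrightarrow> complex_vector.subspace K \<and> K \<subseteq> cr \<and>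
     (\<forall>x\<in>cr. (\<forall>e>0. \<exists>y\<in>K. nm (x - y) < e) \<longrightarrow> x \<in> K)"

lemma closed_subD:
  assumes "closed_sub K"
  shows "complex_vector.subspace K" "\<And>x. x \<in> K ==> x \<in> cr"
    "\<And>x. x \<in> cr ==> (\<And>e. e > 0 ==> \<exists>y\<in>K. nm (x - y) < e) ==> x \<in> K"
  using assms by (auto simp: closed_sub_def)

lemma closed_sub_limit:
  assumes "closed_sub K" "\<And>n. X n \<in> K" "l \<in> cr" "(\<lambda>n::nat. nm (X n - l)) \<longlonglongrightarrow> 0"
  shows "l \<in> K"
proof (rule closed_subD(3)[OF assms(1,3)])
  fix e :: real assume "e > 0"
  then obtain n where "nm (X n - l) < e"
    using eventually_happens'[OF sequentially_bot order_tendstoD(2)[OF assms(4), of e]] by blast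
  then show "\<exists>y\<in>K. nm (l - y) < e"
    using assms(2)[of n] nm_diff_commute[OF assms(3) closed_subD(2)[OF assms(1,2)], of n]
    by (intro bexI[of _ "X n"]) simp_all
qed

text \<open>By the parallelogram identity every minimising sequence for the distance from \<open>x\<close>
  to \<open>K\<close> is Cauchy.\<close>

lemma projection_exists:
  assumes K: "closed_sub K" and x: "x \<in> cr"
  shows "\<exists>k\<in>K. \<forall>y\<in>K. ip (x - k) y = 0"
proof -
  note sub = closed_subD(1)[OF K] and Kc = closed_subD(2)[OF K]
  define D where "D = (\<lambda>y. (nm (x - y))\<^sup>2) ` K"
  have D: "D \<noteq> {}" "bdd_below D"
    using complex_vector.subspace_0[OF sub] by (auto simp: D_def intro!: bdd_belowI[of _ 0])
  define d where "d = Inf D"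
  have dle: "d \<le> (nm (x - y))\<^sup>2" if "y \<in> K" for y
    unfolding d_def using D that by (intro cInf_lower) (auto simp: D_def)
  have "\<exists>y\<in>K. (nm (x - y))\<^sup>2 < d + 1 / real (Suc n)" for n
    using cInf_lessD[OF D(1), of "d + 1 / real (Suc n)"] by (auto simp: d_def D_def)
  then obtain Y where Y: "\<And>n. Y n \<in> K" "\<And>n. (nm (x - Y n))\<^sup>2 < d + 1 / real (Suc n)"
    by metis
  have Yc: "Y n \<in> cr" for n using Y Kc by blast
  have par: "(nm (Y m - Y n))\<^sup>2 \<le> 2 / real (Suc m) + 2 / real (Suc n)" for m n
  proof -
    let ?h = "(1/2) *\<^sub>C (Y m + Y n)"
    have h: "?h \<in> K"
      by (intro complex_vector.subspace_scale[OF sub] complex_vector.subspace_add[OF sub] Y)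
    have e1: "(x - Y m) + (x - Y n) = 2 *\<^sub>C (x - ?h)"
      by (simp add: complex_vector.scale_right_diff_distrib scaleC_scaleC scaleC_one algebra_simps
          scaleC_add_left[of 1 1, simplified])
    have e2: "(x - Y n) - (x - Y m) = Y m - Y n" by simp
    have "(nm ((x - Y m) + (x - Y n)))\<^sup>2 = 4 * (nm (x - ?h))\<^sup>2"
      unfolding e1 using x Yc by (simp add: nm_scale power_mult_distrib)
    moreover have "(nm ((x - Y m) + (x - Y n)))\<^sup>2 + (nm ((x - Y n) - (x - Y m)))\<^sup>2
        = 2 * (nm (x - Y m))\<^sup>2 + 2 * (nm (x - Y n))\<^sup>2"
    proof -
      have "Re (ip (x - Y n) (x - Y m)) = Re (ip (x - Y m) (x - Y n))"
        using ip_commute[of "x - Y n" "x - Y m"] x Yc by simp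
      then show ?thesis using nm_add_sq[of "x - Y m" "x - Y n"] nm_diff_sq[of "x - Y n" "x - Y m"] x Yc by simp
    qed
    ultimately show ?thesis using dle[OF h] Y(2)[of m] Y(2)[of n] unfolding e2 by simp
  qed
  have "\<exists>N. \<forall>m\<ge>N. \<forall>n\<ge>N. nm (Y m - Y n) < e" if "e > 0" for e
  proof -
    obtain N :: nat where N: "4 / e\<^sup>2 < real N" using reals_Archimedean2 by blast
    have "nm (Y m - Y n) < e" if "m \<ge> N" "n \<ge> N" for m n
    proof -
      have N0: "real N > 0" using N \<open>e > 0\<close> by (smt (verit) divide_pos_pos zero_less_power)
      have "2 / real (Suc m) \<le> 2 / real N" "2 / real (Suc n) \<le> 2 / real N"
        using that N0 by (auto intro!: divide_left_mono)
      then have "(nm (Y m - Y n))\<^sup>2 \<le> 4 / real N" using par[of m n] by linarith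
      also have "\<dots> < e\<^sup>2" using N N0 \<open>e > 0\<close> by (simp add: field_simps)
      finally show ?thesis using \<open>e > 0\<close> by (simp add: power2_less_imp_less)
    qed
    then show ?thesis by blast
  qed
  then obtain l where l: "l \<in> cr" "(\<lambda>n. nm (Y n - l)) \<longlonglongrightarrow> 0" using complete[of Y] Yc by blast
  have lK: "l \<in> K" using closed_sub_limit[OF K Y(1) l] .
  have "(\<lambda>n. nm ((x - Y n) - (x - l))) \<longlonglongrightarrow> 0"
    using l Yc by (simp add: nm_diff_commute)
  then have "(\<lambda>n. nm (x - Y n)) \<longlonglongrightarrow> nm (x - l)"
    using tendsto_nm[of "\<lambda>n. x - Y n" "x - l"] x Yc l(1) by blast
  then have "(\<lambda>n. (nm (x - Y n))\<^sup>2) \<longlonglongrightarrow> (nm (x - l))\<^sup>2" by (intro tendsto_power)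
  moreover have "(\<lambda>n. d + 1 / real (Suc n)) \<longlonglongrightarrow> d"
    using tendsto_add[OF tendsto_const[of d] LIMSEQ_Suc[OF lim_1_over_n]] by simp
  ultimately have dl: "(nm (x - l))\<^sup>2 \<le> d"
    by (rule LIMSEQ_le) (use Y(2) less_imp_le in blast)
  have "ip (x - l) y = 0" if y: "y \<in> K" for y
  proof (cases "y = 0")
    case False
    have yc: "y \<in> cr" using Kc y .
    have xl: "x - l \<in> cr" using x l by simp
    let ?c = "ip (x - l) y / (nm y)\<^sup>2"
    have "l + ?c *\<^sub>C y \<in> K"
      by (intro complex_vector.subspace_scale[OF sub] complex_vector.subspace_add[OF sub] lK y)
    then have "d \<le> (nm ((x - l) - ?c *\<^sub>C y))\<^sup>2" using dle by (metis diff_diff_add)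
    also have "\<dots> = (nm (x - l))\<^sup>2 - (cmod (ip (x - l) y))\<^sup>2 / (nm y)\<^sup>2"
      by (rule nm_diff_proj_sq[OF xl yc False])
    finally have "(cmod (ip (x - l) y))\<^sup>2 / (nm y)\<^sup>2 \<le> 0" using dl by linarith
    moreover have "0 < (nm y)\<^sup>2" using False nm_pos[OF yc] by simp
    ultimately show ?thesis by (simp add: divide_le_0_iff)
  qed (use x l in auto)
  then show ?thesis using lK by blast
qed

definition proj :: "'a set => 'a => 'a" where
  "proj K x = (SOME k. k \<in> K \<and> (\<forall>y\<in>K. ip (x - k) y = 0))"

lemma
  assumes "closed_sub K" "x \<in> cr"
  shows proj_in: "proj K x \<in> K" and proj_orth: "\<And>y. y \<in> K ==> ip (x - proj K x) y = 0"
  using someI_ex[of "\<lambda>k. k \<in> K \<and> (\<forall>y\<in>K. ip (x - k) y = 0)"] projection_exists[OF assms]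
  unfolding proj_def[symmetric] by blast+

lemma proj_carrier [simp, intro]: "closed_sub K ==> x \<in> cr ==> proj K x \<in> cr"
  using proj_in closed_subD(2) by blast

lemma ip_proj: "closed_sub K ==> x \<in> cr ==> y \<in> K ==> ip (proj K x) y = ip x y"
  using proj_orth[of K x y] closed_subD(2)[of K] by (simp add: ip_linear)
lemma ip_proj': "closed_sub K ==> x \<in> cr ==> y \<in> K ==> ip y (proj K x) = ip y x"
  using ip_proj[of K x y] closed_subD(2)[of K y] ip_commute[of _ y] by (metis proj_carrier)

lemma proj_unique:
  assumes K: "closed_sub K" and x: "x \<in> cr" and k: "k \<in> K" "\<And>y. y \<in> K ==> ip k y = ip x y"
  shows "proj K x = k"
proof -
  let ?w = "proj K x - k"
  have w: "?w \<in> K" using proj_in[OF K x] k(1) closed_subD(1)[OF K] complex_vector.subspace_diff by blast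
  have "k \<in> cr" using closed_subD(2)[OF K k(1)] .
  then have "ip ?w ?w = 0"
    using ip_proj[OF K x w] k(2)[OF w] closed_subD(2)[OF K w] x K
    by (subst ip_diff_left) auto
  then show ?thesis using ip_eq_0D closed_subD(2)[OF K w] by fastforce
qed

lemma proj_id: "closed_sub K ==> x \<in> K ==> proj K x = x"
  by (rule proj_unique) (auto dest: closed_subD(2))

lemma proj_eq_0: "closed_sub K ==> x \<in> cr ==> (\<And>y. y \<in> K ==> ip x y = 0) ==> proj K x = 0"
  by (rule proj_unique) (auto dest: closed_subD(1,2) simp: complex_vector.subspace_0)

lemma proj_symm: "closed_sub K ==> x \<in> cr ==> y \<in> cr ==> ip (proj K x) y = ip x (proj K y)"
  using ip_proj[of K x "proj K y"] ip_proj'[of K y "proj K x"] by (simp add: proj_in)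

lemma proj_add:
  assumes K: "closed_sub K" and "x \<in> cr" "y \<in> cr"
  shows "proj K (x + y) = proj K x + proj K y"
  by (rule proj_unique[OF K])
    (use assms in \<open>auto intro: complex_vector.subspace_add[OF closed_subD(1)[OF K]] proj_in
      simp: ip_linear ip_proj closed_subD(2)[OF K]\<close>)

lemma proj_scale:
  assumes K: "closed_sub K" and "x \<in> cr"
  shows "proj K (c *\<^sub>C x) = c *\<^sub>C proj K x"
  by (rule proj_unique[OF K])
    (use assms in \<open>auto intro: complex_vector.subspace_scale[OF closed_subD(1)[OF K]] proj_in
      simp: ip_linear ip_proj closed_subD(2)[OF K]\<close>)

lemma nm_proj_le: "closed_sub K ==> x \<in> cr ==> nm (proj K x) \<le> nm x"
proof -
  assume K: "closed_sub K" and x: "x \<in> cr"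
  have "ip (x - proj K x) (proj K x) = 0" using proj_orth[OF K x proj_in[OF K x]] .
  then have "(nm (x - proj K x + proj K x))\<^sup>2 = (nm (x - proj K x))\<^sup>2 + (nm (proj K x))\<^sup>2"
    using K x by (subst nm_add_sq) auto
  then have "(nm (proj K x))\<^sup>2 \<le> (nm x)\<^sup>2" by simp
  then show ?thesis using K x by (simp add: power2_le_iff_abs_le)
qed

definition clspan :: "'a set => 'a set" where
  "clspan S = {x \<in> cr. \<forall>e>0. \<exists>y\<in>complex_vector.span S. nm (x - y) < e}"

lemma clspan_approx: "x \<in> clspan S ==> e > 0 ==> \<exists>y\<in>complex_vector.span S. nm (x - y) < e"
  by (simp add: clspan_def)

lemma span_carrier: "S \<subseteq> cr ==> complex_vector.span S \<subseteq> cr"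
  by (simp add: complex_vector.span_minimal subspace_carrier)

lemma clspan_superset: "S \<subseteq> cr ==> complex_vector.span S \<subseteq> clspan S"
  using span_carrier unfolding clspan_def by (auto intro!: bexI)

lemma clspan_base: "S \<subseteq> cr ==> s \<in> S ==> s \<in> clspan S"
  using clspan_superset complex_vector.span_base by blast

lemma closed_sub_clspan:
  assumes S: "S \<subseteq> cr"
  shows "closed_sub (clspan S)"
  unfolding closed_sub_def
proof (intro conjI ballI impI)
  note Sc = subsetD[OF span_carrier[OF S]]
  show "complex_vector.subspace (clspan S)"
  proof (rule complex_vector.subspaceI)
    show "0 \<in> clspan S" using clspan_superset[OF S] complex_vector.span_zero by blast
  next
    fix x y assume xy: "x \<in> clspan S" "y \<in> clspan S"
    show "x + y \<in> clspan S" unfolding clspan_def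
    proof (safe, use xy in \<open>auto simp: clspan_def\<close>)
      fix e :: real assume "e > 0"
      then obtain a b where ab: "a \<in> complex_vector.span S" "b \<in> complex_vector.span S"
        "nm (x - a) < e/2" "nm (y - b) < e/2"
        using clspan_approx[OF xy(1), of "e/2"] clspan_approx[OF xy(2), of "e/2"] by auto
      have "nm (x + y - (a + b)) \<le> nm (x - a) + nm (y - b)"
        using triangle[of "x - a" "y - b"] ab xy Sc by (auto simp: clspan_def algebra_simps)
      then show "\<exists>z\<in>complex_vector.span S. nm (x + y - z) < e" using ab
        by (intro bexI[of _ "a + b"]) (auto intro: complex_vector.span_add)
    qed
  next
    fix c x assume x: "x \<in> clspan S"
    show "c *\<^sub>C x \<in> clspan S" unfolding clspan_def
    proof (safe, use x in \<open>auto simp: clspan_def\<close>)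
      fix e :: real assume "e > 0"
      then have "e / (cmod c + 1) > 0" by (simp add: add_nonneg_pos)
      then obtain a where a: "a \<in> complex_vector.span S" "nm (x - a) < e / (cmod c + 1)"
        using x unfolding clspan_def by blast
      have xa: "x - a \<in> cr" using x Sc[OF a(1)] by (auto simp: clspan_def)
      have "nm (c *\<^sub>C x - c *\<^sub>C a) = cmod c * nm (x - a)"
        using nm_scale[OF xa] by (simp add: complex_vector.scale_right_diff_distrib)
      also have "\<dots> \<le> (cmod c + 1) * nm (x - a)" using xa by (simp add: mult_right_mono)
      also have "\<dots> < e" using a(2) by (simp add: pos_less_divide_eq add_nonneg_pos mult.commute)
      finally show "\<exists>z\<in>complex_vector.span S. nm (c *\<^sub>C x - z) < e" using a(1)
        by (intro bexI[of _ "c *\<^sub>C a"]) (auto intro: complex_vector.span_scale)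
    qed
  qed
  show "clspan S \<subseteq> cr" by (auto simp: clspan_def)
  fix x assume x: "x \<in> cr" "\<forall>e>0. \<exists>y\<in>clspan S. nm (x - y) < e"
  show "x \<in> clspan S" unfolding clspan_def
  proof (safe intro!: x(1))
    fix e :: real assume "e > 0"
    then obtain y where y: "y \<in> clspan S" "nm (x - y) < e/2" using x(2) half_gt_zero by blast
    then obtain z where z: "z \<in> complex_vector.span S" "nm (y - z) < e/2"
      using clspan_approx[OF y(1), of "e/2"] \<open>e > 0\<close> by auto
    have "nm (x - z) \<le> nm (x - y) + nm (y - z)"
      using triangle_diff[of x y z] x(1) y(1) Sc[OF z(1)] by (auto simp: clspan_def)
    then show "\<exists>z\<in>complex_vector.span S. nm (x - z) < e" using y z by force
  qed
qed

lemma clspan_minimal: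
  assumes K: "closed_sub K" and "S \<subseteq> K"
  shows "clspan S \<subseteq> K"
proof
  fix x assume x: "x \<in> clspan S"
  have "complex_vector.span S \<subseteq> K"
    by (rule complex_vector.span_minimal[OF assms(2) closed_subD(1)[OF K]])
  then show "x \<in> K" using x clspan_approx[OF x] by (intro closed_subD(3)[OF K]) (auto simp: clspan_def, blast)
qed

lemma closed_sub_orth:
  assumes y: "y \<in> cr"
  shows "closed_sub {x \<in> cr. ip x y = 0}"
  unfolding closed_sub_def
proof (safe)
  show "complex_vector.subspace {x \<in> cr. ip x y = 0}"
    by (rule complex_vector.subspaceI) (use y in \<open>auto simp: ip_linear\<close>)
  fix x assume x: "x \<in> cr" "\<forall>e>0. \<exists>z\<in>{x \<in> cr. ip x y = 0}. nm (x - z) < e"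
  show "ip x y = 0"
  proof (rule ccontr)
    assume n: "ip x y \<noteq> 0"
    then have ny: "nm y > 0" using x(1) y nm_pos by fastforce
    then obtain z where z: "z \<in> cr" "ip z y = 0" "nm (x - z) < cmod (ip x y) / nm y"
      using x(2) n by (metis (mono_tags, lifting) divide_pos_pos mem_Collect_eq zero_less_norm_iff)
    have "cmod (ip x y) \<le> nm (x - z) * nm y"
      using cauchy_schwarz[of "x - z" y] x(1) y z by (simp add: ip_linear)
    then show False using z(3) ny by (simp add: field_simps)
  qed
qed

lemma clspan_orth:
  assumes "S \<subseteq> cr" "y \<in> cr" "\<And>s. s \<in> S ==> ip s y = 0" "x \<in> clspan S"
  shows "ip x y = 0"
  using clspan_minimal[OF closed_sub_orth[OF assms(2)], of S] assms by blast

subsection \<open>The Riesz representation theorem and adjoints\<close>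

lemma riesz:
  assumes add: "\<And>x y. x \<in> cr ==> y \<in> cr ==> f (x + y) = f x + f y"
    and scale: "\<And>c x. x \<in> cr ==> f (c *\<^sub>C x) = c * f x"
    and bound: "\<And>x. x \<in> cr ==> cmod (f x) \<le> c * nm x"
  shows "\<exists>z\<in>cr. \<forall>x\<in>cr. f x = ip x z"
proof (cases "\<forall>x\<in>cr. f x = 0")
  case False
  then obtain x0 where x0: "x0 \<in> cr" "f x0 \<noteq> 0" by blast
  have diff: "f (x - y) = f x - f y" if "x \<in> cr" "y \<in> cr" for x y
    using add[of x "-1 *\<^sub>C y"] scale[of y "-1"] that
    by (simp add: complex_vector.scale_minus_left scaleC_one)
  let ?K = "{x \<in> cr. f x = 0}"
  have f0: "f 0 = 0" using scale[of 0 0] by simp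
  have K: "closed_sub ?K" unfolding closed_sub_def
  proof safe
    show "complex_vector.subspace ?K"
      by (rule complex_vector.subspaceI) (auto simp: f0 add scale)
    fix x assume x: "x \<in> cr" "\<forall>e>0. \<exists>z\<in>?K. nm (x - z) < e"
    show "f x = 0"
    proof (rule ccontr)
      assume n: "f x \<noteq> 0"
      let ?c = "\<bar>c\<bar> + 1"
      have "cmod (f x) / ?c > 0" using n by (simp add: add_nonneg_pos)
      then obtain z where z: "z \<in> cr" "f z = 0" "nm (x - z) < cmod (f x) / ?c"
        using x(2) by blast
      have "cmod (f x) \<le> c * nm (x - z)" using bound[of "x - z"] diff[of x z] x(1) z by simp
      also have "\<dots> \<le> ?c * nm (x - z)" using x z by (intro mult_right_mono) auto
      finally show False using z(3) by (simp add: field_simps add_nonneg_pos)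
    qed
  qed
  define w where "w = x0 - proj ?K x0"
  have w: "w \<in> cr" using x0 K by (simp add: w_def)
  have fw: "f w \<noteq> 0" using x0 proj_in[OF K x0(1)] by (simp add: w_def diff)
  have w0: "w \<noteq> 0" using fw f0 by auto
  have nw: "nm w \<noteq> 0" using w w0 nm_eq_0 by blast
  let ?z = "(cnj (f w) / (nm w)\<^sup>2) *\<^sub>C w"
  have "f x = ip x ?z" if x: "x \<in> cr" for x
  proof -
    have "f w *\<^sub>C x - f x *\<^sub>C w \<in> ?K" using x w by (simp add: diff scale)
    then have "ip w (f w *\<^sub>C x - f x *\<^sub>C w) = 0" unfolding w_def using proj_orth[OF K x0(1)] by auto
    then have "ip (f w *\<^sub>C x - f x *\<^sub>C w) w = 0" using w x by (subst ip_commute) auto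
    then have "f w * ip x w = f x * (nm w)\<^sup>2" using x w by (simp add: ip_linear ip_self)
    then show ?thesis using x w nw by (simp add: ip_linear field_simps)
  qed
  then show ?thesis using w by blast
qed (auto intro!: bexI[of _ 0])

lemma bounded_opsI:
  assumes "\<And>x. x \<in> cr ==> A x \<in> cr" "\<And>x. x \<notin> cr ==> A x = 0"
    "\<And>x y. x \<in> cr ==> y \<in> cr ==> A (x + y) = A x + A y"
    "\<And>c x. x \<in> cr ==> A (c *\<^sub>C x) = c *\<^sub>C A x" "\<And>x. x \<in> cr ==> nm (A x) \<le> C * nm x"
  shows "A \<in> bounded_ops H"
  unfolding bounded_ops_def mem_Collect_eq by (intro conjI exI[of _ C] ballI allI impI assms)

lemma
  assumes "A \<in> bounded_ops H"
  shows op_in [simp, intro]: "x \<in> cr ==> A x \<in> cr" and op_outside: "x \<notin> cr ==> A x = 0"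
    and op_add: "x \<in> cr ==> y \<in> cr ==> A (x + y) = A x + A y"
    and op_scale: "x \<in> cr ==> A (c *\<^sub>C x) = c *\<^sub>C A x"
  using assms unfolding bounded_ops_def by simp_all

lemma op_bound:
  assumes "A \<in> bounded_ops H"
  obtains C where "C \<ge> 0" "\<And>x. x \<in> cr ==> nm (A x) \<le> C * nm x"
proof -
  obtain C where C: "\<And>x. x \<in> cr ==> nm (A x) \<le> C * nm x" using assms unfolding bounded_ops_def by blast
  have "nm (A x) \<le> \<bar>C\<bar> * nm x" if "x \<in> cr" for x
    using C[OF that] that by (smt (verit) abs_ge_self mult_right_mono nm_ge_0)
  then show thesis using that[of "\<bar>C\<bar>"] by simp
qed

lemma op_zero: "A \<in> bounded_ops H ==> A 0 = 0"
  using op_scale[of A 0 0] by simp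
lemma op_diff: "A \<in> bounded_ops H ==> x \<in> cr ==> y \<in> cr ==> A (x - y) = A x - A y"
  using op_add[of A x "-1 *\<^sub>C y"] op_scale[of A y "-1"]
  by (simp add: complex_vector.scale_minus_left scaleC_one)
lemma op_sum: "A \<in> bounded_ops H ==> (\<And>i. i \<in> I ==> f i \<in> cr) ==> A (sum f I) = (\<Sum>i\<in>I. A (f i))"
  by (induction I rule: infinite_finite_induct) (auto simp: op_zero op_add sum_in)

lemma op_eqI:
  assumes "A \<in> bounded_ops H" "B \<in> bounded_ops H"
    "\<And>x y. x \<in> cr ==> y \<in> cr ==> ip (A x) y = ip (B x) y"
  shows "A = B"
proof
  fix x show "A x = B x"
    by (cases "x \<in> cr") (use assms eqI[of "A x" "B x"] in \<open>auto simp: op_outside\<close>)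
qed

lemma nm_le_if_ip_le:
  assumes "x \<in> cr" "0 \<le> c" "\<And>y. y \<in> cr ==> cmod (ip x y) \<le> c * nm y"
  shows "nm x \<le> c"
proof (cases "x = 0")
  case False
  then have "nm x > 0" using assms nm_pos by blast
  have "nm x * nm x \<le> c * nm x"
    using assms(3)[OF assms(1)] ip_self[OF assms(1)] by (simp add: norm_power power2_eq_square norm_mult assms(1))
  then show ?thesis using \<open>nm x > 0\<close> by simp
qed (use assms in auto)

text \<open>The Riesz representation theorem, applied to \<open>y \<mapsto> cnj (B x y)\<close> for each
  \<open>x\<close>.\<close>

lemma sesquilinear_op:
  assumes "\<And>x y z. x \<in> cr ==> y \<in> cr ==> z \<in> cr ==> B (x + y) z = B x z + B y z"
    and "\<And>x y z. x \<in> cr ==> y \<in> cr ==> z \<in> cr ==> B z (x + y) = B z x + B z y"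
    and "\<And>c x y. x \<in> cr ==> y \<in> cr ==> B (c *\<^sub>C x) y = c * B x y"
    and "\<And>c x y. x \<in> cr ==> y \<in> cr ==> B x (c *\<^sub>C y) = cnj c * B x y"
    and bound: "\<And>x y. x \<in> cr ==> y \<in> cr ==> cmod (B x y) \<le> c * nm x * nm y" and c: "0 \<le> c"
  shows "\<exists>A\<in>bounded_ops H. (\<forall>x\<in>cr. nm (A x) \<le> c * nm x) \<and> (\<forall>x\<in>cr. \<forall>y\<in>cr. ip (A x) y = B x y)"
proof -
  have "\<exists>z\<in>cr. \<forall>y\<in>cr. ip z y = B x y" if x: "x \<in> cr" for x
  proof -
    have "\<exists>z\<in>cr. \<forall>y\<in>cr. cnj (B x y) = ip y z"
      by (rule riesz[of _ "c * nm x"]) (use x assms in auto)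
    then obtain z where z: "z \<in> cr" "\<And>y. y \<in> cr ==> cnj (B x y) = ip y z" by blast
    have "ip z y = B x y" if "y \<in> cr" for y
      using z(2)[OF that] ip_commute[OF that z(1)] by (metis complex_cnj_cnj)
    then show ?thesis using z(1) by blast
  qed
  then obtain A0 where A0: "\<And>x. x \<in> cr ==> A0 x \<in> cr" "\<And>x y. x \<in> cr ==> y \<in> cr ==> ip (A0 x) y = B x y"
    by metis
  define A where "A x = (if x \<in> cr then A0 x else 0)" for x
  have A: "A x \<in> cr" "y \<in> cr ==> ip (A x) y = B x y" if "x \<in> cr" for x y using that A0 by (auto simp: A_def)
  have n: "nm (A x) \<le> c * nm x" if x: "x \<in> cr" for x
    by (rule nm_le_if_ip_le) (use x A c bound in auto)
  have "A \<in> bounded_ops H"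
  proof (rule bounded_opsI[where C = c])
    show "A (x + y) = A x + A y" if "x \<in> cr" "y \<in> cr" for x y
      by (rule eqI) (use that A assms in \<open>auto simp: ip_linear\<close>)
    show "A (k *\<^sub>C x) = k *\<^sub>C A x" if "x \<in> cr" for x k
      by (rule eqI) (use that A assms in \<open>auto simp: ip_linear\<close>)
  qed (use A n in \<open>auto simp: A_def\<close>)
  then show ?thesis using A n by blast
qed

definition adj :: "('a => 'a) => 'a => 'a" where
  "adj A = (SOME A'. A' \<in> bounded_ops H \<and> (\<forall>x\<in>cr. \<forall>y\<in>cr. ip (A' x) y = ip x (A y)))"

lemma
  assumes A: "A \<in> bounded_ops H"
  shows adj_bounded: "adj A \<in> bounded_ops H"
    and ip_adj: "x \<in> cr ==> y \<in> cr ==> ip (adj A x) y = ip x (A y)"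
    and ip_adj': "x \<in> cr ==> y \<in> cr ==> ip x (adj A y) = ip (A x) y"
proof -
  obtain C where C: "C \<ge> 0" "\<And>x. x \<in> cr ==> nm (A x) \<le> C * nm x" using op_bound[OF A] by blast
  have "\<exists>A'\<in>bounded_ops H. (\<forall>x\<in>cr. nm (A' x) \<le> C * nm x) \<and> (\<forall>x\<in>cr. \<forall>y\<in>cr. ip (A' x) y = ip x (A y))"
  proof (rule sesquilinear_op)
    fix x y assume xy: "x \<in> cr" "y \<in> cr"
    have "cmod (ip x (A y)) \<le> nm x * nm (A y)" by (rule cauchy_schwarz) (use xy A in auto)
    also have "\<dots> \<le> nm x * (C * nm y)" by (rule mult_left_mono) (use xy C in auto)
    finally show "cmod (ip x (A y)) \<le> C * nm x * nm y" by (simp add: algebra_simps)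
  qed (use A C in \<open>auto simp: op_add op_scale ip_linear\<close>)
  then have "\<exists>A'. A' \<in> bounded_ops H \<and> (\<forall>x\<in>cr. \<forall>y\<in>cr. ip (A' x) y = ip x (A y))"
    by blast
  from someI_ex[OF this, folded adj_def]
  have "adj A \<in> bounded_ops H \<and> (\<forall>x\<in>cr. \<forall>y\<in>cr. ip (adj A x) y = ip x (A y))" .
  then show 1: "adj A \<in> bounded_ops H" and 2: "x \<in> cr ==> y \<in> cr ==> ip (adj A x) y = ip x (A y)" for x y
    by auto
  show "ip x (adj A y) = ip (A x) y" if "x \<in> cr" "y \<in> cr"
    using 2[OF that(2,1)] 1 A that ip_commute by (metis op_in)
qed

lemma comp_bounded:
  assumes "A \<in> bounded_ops H" "B \<in> bounded_ops H"
  shows "A \<circ> B \<in> bounded_ops H"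
proof -
  obtain C where C: "C \<ge> 0" "\<And>x. x \<in> cr ==> nm (A x) \<le> C * nm x" using op_bound[OF assms(1)] by blast
  obtain D where D: "D \<ge> 0" "\<And>x. x \<in> cr ==> nm (B x) \<le> D * nm x" using op_bound[OF assms(2)] by blast
  have "nm (A (B x)) \<le> C * D * nm x" if x: "x \<in> cr" for x
  proof -
    have "nm (A (B x)) \<le> C * nm (B x)" using C assms x by auto
    also have "\<dots> \<le> C * (D * nm x)" using C(1) D(2)[OF x] by (rule mult_left_mono[rotated])
    finally show ?thesis by (simp add: mult.assoc)
  qed
  then show ?thesis
    by (intro bounded_opsI[where C = "C * D"]) (use assms in \<open>auto simp: op_add op_scale op_outside op_zero\<close>)
qed

end

context hilb
begin

subsection \<open>Orthonormal families\<close>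

definition orthonormal :: "'a set => bool" where
  "orthonormal B \<longleftrightarrow> B \<subseteq> cr \<and> (\<forall>e\<in>B. \<forall>e'\<in>B. ip e e' = (if e = e' then 1 else 0))"

lemma normalized:
  assumes "w \<in> cr" "w \<noteq> 0"
  shows "ip ((1 / complex_of_real (nm w)) *\<^sub>C w) ((1 / complex_of_real (nm w)) *\<^sub>C w) = 1"
  using assms nm_pos[OF assms] by (simp add: ip_self nm_scale norm_divide)

text \<open>A maximal orthonormal set has trivial orthogonal complement. Parseval's identity is the only
  form in which bases are used, to realise tensor products as spaces of families of vectors.\<close>

lemma orthonormal_basis_exists:
  "\<exists>B. orthonormal B \<and> (\<forall>x\<in>cr. \<forall>y\<in>cr. ((\<lambda>e. ip x e * cnj (ip y e)) has_sum ip x y) B)"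
proof -
  have "\<exists>M\<in>Collect orthonormal. \<forall>X\<in>Collect orthonormal. M \<subseteq> X \<longrightarrow> X = M"
  proof (rule subset_Zorn_nonempty)
    show "Collect orthonormal \<noteq> {}" by (auto simp: orthonormal_def)
    fix C assume C: "C \<noteq> {}" "subset.chain (Collect orthonormal) C"
    have "ip e e' = (if e = e' then 1 else 0)" if "X \<in> C" "Y \<in> C" "e \<in> X" "e' \<in> Y" for X Y e e'
    proof -
      have "X \<subseteq> Y \<or> Y \<subseteq> X" using C that by (auto simp: subset.chain_def)
      moreover have "orthonormal X" "orthonormal Y" using C that by (auto simp: subset.chain_def)
      ultimately show ?thesis using that unfolding orthonormal_def by blast
    qed
    moreover have "X \<subseteq> cr" if "X \<in> C" for X
    proof -
      have "orthonormal X" using C that by (auto simp: subset.chain_def)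
      then show ?thesis by (simp add: orthonormal_def)
    qed
    then have "\<Union> C \<subseteq> cr" by blast
    ultimately show "\<Union> C \<in> Collect orthonormal" unfolding orthonormal_def by blast
  qed
  then obtain B where B: "orthonormal B" and max: "\<And>X. orthonormal X ==> B \<subseteq> X ==> X = B" by blast
  have Bc: "B \<subseteq> cr" using B by (simp add: orthonormal_def)
  have Bip: "ip e e' = (if e = e' then 1 else 0)" if "e \<in> B" "e' \<in> B" for e e'
    using B that unfolding orthonormal_def by blast
  note K = closed_sub_clspan[OF Bc]
  have total: "x \<in> clspan B" if x: "x \<in> cr" for x
  proof (rule ccontr)
    assume n: "x \<notin> clspan B"
    define w where "w = x - proj (clspan B) x"
    have w: "w \<in> cr" using K x by (simp add: w_def)
    have w0: "w \<noteq> 0" using n proj_in[OF K x] by (auto simp: w_def)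
    have wB: "ip w e = 0" if "e \<in> B" for e
      using proj_orth[OF K x clspan_base[OF Bc that]] by (simp add: w_def)
    then have wB': "ip e w = 0" if "e \<in> B" for e using that w Bc by (subst ip_commute) auto
    define e where "e = (1 / complex_of_real (nm w)) *\<^sub>C w"
    have ee: "ip e e = 1" unfolding e_def by (rule normalized[OF w w0])
    have ein: "e \<in> cr" using w by (simp add: e_def)
    have b: "ip e b = 0" "ip b e = 0" if "b \<in> B" for b
      using wB[OF that] wB'[OF that] w subsetD[OF Bc that] by (simp_all add: e_def ip_linear)
    have eB: "e \<notin> B" using b(1)[of e] ee by auto
    have "orthonormal (insert e B)"
      unfolding orthonormal_def using Bc ein ee b Bip eB by auto
    then have "insert e B = B" by (rule max) auto
    then show False using eB by blast
  qed
  have "((\<lambda>e. ip x e * cnj (ip y e)) has_sum ip x y) B" if x: "x \<in> cr" and y: "y \<in> cr" for x y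
    unfolding has_sum_def tendsto_iff
  proof safe
    fix \<epsilon> :: real assume "\<epsilon> > 0"
    then have "\<epsilon> / (nm y + 1) > 0" using y by (simp add: add_nonneg_pos)
    from clspan_approx[OF total[OF x] this] obtain z where
      z: "z \<in> complex_vector.span B" "nm (x - z) < \<epsilon> / (nm y + 1)" by blast
    obtain t r where t: "finite t" "t \<subseteq> B" "z = (\<Sum>a\<in>t. r a *\<^sub>C a)"
      using z(1) unfolding complex_vector.span_explicit by blast
    have zt: "z \<in> complex_vector.span t"
      unfolding t(3) by (intro complex_vector.span_sum complex_vector.span_scale complex_vector.span_base)
    show "\<forall>\<^sub>F F in finite_subsets_at_top B. dist (\<Sum>e\<in>F. ip x e * cnj (ip y e)) (ip x y) < \<epsilon>"
      unfolding eventually_finite_subsets_at_top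
    proof (intro exI[of _ t] conjI allI impI t)
      fix F assume F: "finite F \<and> t \<subseteq> F \<and> F \<subseteq> B"
      have Fc: "e \<in> cr" if "e \<in> F" for e using F Bc that by blast
      define p where "p = (\<Sum>e\<in>F. ip x e *\<^sub>C e)"
      have p: "p \<in> cr" unfolding p_def using Fc by (auto intro: sum_in)
      have "ip p e = ip x e" if e: "e \<in> F" for e
      proof -
        have "ip p e = (\<Sum>e'\<in>F. ip x e' * ip e' e)"
          unfolding p_def using Fc e by (subst ip_sum_left) (auto simp: ip_linear)
        also have "\<dots> = (\<Sum>e'\<in>F. if e' = e then ip x e' else 0)"
          using Bip[OF subsetD[of F B] subsetD[of F B]] F e by (intro sum.cong) auto
        finally show ?thesis using F e by simp
      qed
      then have "ip e (x - p) = 0" if "e \<in> F" for e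
        using Fc[OF that] that x p by (subst ip_commute) (auto simp: ip_linear)
      then have "F \<subseteq> {v \<in> cr. ip v (x - p) = 0}" using Fc by auto
      then have sp: "complex_vector.span F \<subseteq> {v \<in> cr. ip v (x - p) = 0}"
        using closed_subD(1)[OF closed_sub_orth[of "x - p"]] x p by (intro complex_vector.span_minimal) auto
      have "p - z \<in> complex_vector.span F"
      proof (rule complex_vector.span_diff)
        show "p \<in> complex_vector.span F" unfolding p_def
          by (intro complex_vector.span_sum complex_vector.span_scale complex_vector.span_base)
        show "z \<in> complex_vector.span F" using zt F complex_vector.span_mono by blast
      qed
      then have o: "p - z \<in> cr" "ip (p - z) (x - p) = 0" using sp by auto
      have "(nm ((p - z) + (x - p)))\<^sup>2 = (nm (p - z))\<^sup>2 + (nm (x - p))\<^sup>2"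
        using o x p by (subst nm_add_sq) auto
      then have "(nm (x - p))\<^sup>2 \<le> (nm (x - z))\<^sup>2" by simp
      moreover have "z \<in> cr" using zt F Bc span_carrier[of t] by blast
      ultimately have le: "nm (x - p) \<le> nm (x - z)" using x p by (simp add: power2_le_iff_abs_le)
      have "(\<Sum>e\<in>F. ip x e * cnj (ip y e)) = ip p y"
        unfolding p_def using Fc y by (subst ip_sum_left) (auto simp: ip_linear ip_commute[of y] intro!: sum.cong)
      then have "dist (\<Sum>e\<in>F. ip x e * cnj (ip y e)) (ip x y) = cmod (ip (x - p) y)"
        using x p y by (simp add: dist_norm ip_linear norm_minus_commute)
      also have "\<dots> \<le> nm (x - p) * nm y" using x p y by (intro cauchy_schwarz) auto
      also have "\<dots> \<le> nm (x - z) * nm y" using le y by (intro mult_right_mono) auto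
      also have "\<dots> \<le> nm (x - z) * (nm y + 1)" using \<open>z \<in> cr\<close> x by (intro mult_left_mono) auto
      also have "\<dots> < \<epsilon>" using z(2) y by (simp add: pos_less_divide_eq add_nonneg_pos)
      finally show "dist (\<Sum>e\<in>F. ip x e * cnj (ip y e)) (ip x y) < \<epsilon>" .
    qed
  qed
  then show ?thesis using B by blast
qed

text \<open>Finitely many vectors are written in one orthonormal family, so that sums of elementary tensors
  can be normed by their coefficients.\<close>

lemma finite_gram_schmidt:
  assumes "finite F" "F \<subseteq> cr"
  shows "\<exists>m (f :: nat => 'a). (\<forall>a<m. f a \<in> cr) \<and> (\<forall>a<m. \<forall>b<m. ip (f a) (f b) = (if a = b then 1 else 0)) \<and>
    (\<forall>x\<in>F. x = (\<Sum>a<m. ip x (f a) *\<^sub>C f a))"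
  using assms
proof (induction F)
  case empty
  show ?case by (intro exI[of _ 0]) auto
next
  case (insert x F)
  then obtain m and f :: "nat => 'a" where f: "\<And>a. a < m ==> f a \<in> cr"
    and o: "\<And>a b. a < m ==> b < m ==> ip (f a) (f b) = (if a = b then 1 else 0)"
    and s: "\<And>x. x \<in> F ==> x = (\<Sum>a<m. ip x (f a) *\<^sub>C f a)"
    by (metis insert_subset)
  have x: "x \<in> cr" using insert by simp
  define p where "p = (\<Sum>a<m. ip x (f a) *\<^sub>C f a)"
  have p: "p \<in> cr" unfolding p_def using f by (auto intro: sum_in)
  define w where "w = x - p"
  have w: "w \<in> cr" using x p by (simp add: w_def)
  have "ip p (f b) = ip x (f b)" if b: "b < m" for b
  proof -
    have "ip p (f b) = (\<Sum>a<m. ip x (f a) * ip (f a) (f b))"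
      unfolding p_def using f b by (subst ip_sum_left) (auto simp: ip_linear)
    also have "\<dots> = (\<Sum>a<m. if a = b then ip x (f a) else 0)" using o b by (intro sum.cong) auto
    finally show ?thesis using b by simp
  qed
  then have wf: "ip w (f b) = 0" if "b < m" for b using that f x p by (simp add: w_def ip_linear)
  then have fw: "ip (f b) w = 0" if "b < m" for b using that f w by (subst ip_commute) auto
  show ?case
  proof (cases "w = 0")
    case True
    then have "x = (\<Sum>a<m. ip x (f a) *\<^sub>C f a)" by (simp add: w_def p_def)
    then show ?thesis using f o s by (intro exI[of _ m] exI[of _ f]) auto
  next
    case False
    define e where "e = (1 / complex_of_real (nm w)) *\<^sub>C w"
    have ein: "e \<in> cr" using w by (simp add: e_def)
    have ee: "ip e e = 1" unfolding e_def by (rule normalized[OF w False])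
    define g where "g = f(m := e)"
    have gsum: "(\<Sum>a<Suc m. ip y (g a) *\<^sub>C g a) = (\<Sum>a<m. ip y (f a) *\<^sub>C f a) + ip y e *\<^sub>C e" for y
      by (simp add: g_def)
    have pw: "ip p w = 0" unfolding p_def using f w fw by (subst ip_sum_left) (auto simp: ip_linear)
    have xw: "ip x w = ip w w" using x p w pw by (simp add: w_def ip_linear)
    have "ip x e *\<^sub>C e = w"
      using x w xw nm_pos[OF w False]
      by (simp add: e_def ip_linear ip_self scaleC_scaleC scaleC_one power2_eq_square)
    then have "x = (\<Sum>a<Suc m. ip x (g a) *\<^sub>C g a)" unfolding gsum by (simp add: w_def flip: p_def)
    moreover have "y = (\<Sum>a<Suc m. ip y (g a) *\<^sub>C g a)" if y: "y \<in> F" for y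
    proof -
      have "ip y w = 0"
        by (subst s[OF y], subst ip_sum_left) (use f w fw in \<open>auto simp: ip_linear\<close>)
      then have "ip y e = 0" using y insert w by (auto simp: e_def ip_linear)
      then show ?thesis unfolding gsum using s[OF y] by simp
    qed
    moreover have "ip (f a) e = 0" "ip e (f a) = 0" if "a < m" for a
      using f[OF that] w wf[OF that] fw[OF that] by (auto simp: e_def ip_linear)
    then have "\<forall>a<Suc m. \<forall>b<Suc m. ip (g a) (g b) = (if a = b then 1 else 0)"
      using o ee by (auto simp: g_def less_Suc_eq)
    moreover have "\<forall>a<Suc m. g a \<in> cr" using f ein by (auto simp: g_def less_Suc_eq)
    ultimately show ?thesis by (intro exI[of _ "Suc m"] exI[of _ g]) auto
  qed
qed

lemma orthonormal_combination_sq: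
  fixes m :: nat
  assumes "\<And>a. a < m ==> f a \<in> cr"
    "\<And>a b. a < m ==> b < m ==> ip (f a) (f b) = (if a = b then 1 else 0)"
  shows "(nm (\<Sum>a<m. c a *\<^sub>C f a))\<^sup>2 = (\<Sum>a<m. (cmod (c a))\<^sup>2)"
proof -
  let ?s = "\<Sum>a<m. c a *\<^sub>C f a"
  have s: "?s \<in> cr" using assms by (auto intro: sum_in)
  have "ip (f b) ?s = cnj (c b)" if b: "b < m" for b
  proof -
    have "ip (f b) ?s = (\<Sum>a<m. cnj (c a) * ip (f b) (f a))"
      using assms b by (subst ip_sum_right) (auto simp: ip_linear)
    also have "\<dots> = (\<Sum>a<m. if a = b then cnj (c a) else 0)" using assms b by (intro sum.cong) auto
    also have "\<dots> = cnj (c b)" using b by (subst sum.delta) auto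
    finally show ?thesis .
  qed
  then have "ip ?s ?s = (\<Sum>a<m. c a * cnj (c a))"
    using assms s by (subst ip_sum_left) (auto simp: ip_linear)
  also have "\<dots> = complex_of_real (\<Sum>a<m. (cmod (c a))\<^sup>2)"
    by (simp add: complex_norm_square del: of_real_power)
  finally show ?thesis unfolding nm_sq[OF s] by simp
qed

lemma ip_sum_sum:
  assumes "\<And>i. i \<in> I ==> f i \<in> cr" "\<And>j. j \<in> J ==> g j \<in> cr"
  shows "ip (\<Sum>i\<in>I. c i *\<^sub>C f i) (\<Sum>j\<in>J. d j *\<^sub>C g j) = (\<Sum>i\<in>I. \<Sum>j\<in>J. c i * cnj (d j) * ip (f i) (g j))"
proof -
  have s: "(\<Sum>j\<in>J. d j *\<^sub>C g j) \<in> cr" using assms by (auto intro: sum_in)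
  have "ip (\<Sum>i\<in>I. c i *\<^sub>C f i) (\<Sum>j\<in>J. d j *\<^sub>C g j) = (\<Sum>i\<in>I. c i * ip (f i) (\<Sum>j\<in>J. d j *\<^sub>C g j))"
    using assms s by (subst ip_sum_left) (auto simp: ip_linear)
  also have "\<dots> = (\<Sum>i\<in>I. c i * (\<Sum>j\<in>J. cnj (d j) * ip (f i) (g j)))"
    using assms by (intro sum.cong refl arg_cong2[of _ _ _ _ "(*)"], subst ip_sum_right) (auto simp: ip_linear)
  finally show ?thesis by (simp add: sum_distrib_left mult.assoc)
qed

lemma tendsto_ip_right:
  assumes "\<And>n. X n \<in> cr" "l \<in> cr" "y \<in> cr" "((\<lambda>n. nm (X n - l)) \<longlongrightarrow> 0) F"
  shows "((\<lambda>n. ip y (X n)) \<longlongrightarrow> ip y l) F"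
proof -
  have "((\<lambda>n. cnj (ip (X n) y)) \<longlongrightarrow> cnj (ip l y)) F" by (intro tendsto_intros tendsto_ip_left assms)
  then show ?thesis using assms ip_commute[of _ y] by simp
qed

lemma clspan_sequence:
  assumes "\<phi> ` X \<subseteq> cr" "v \<in> clspan (\<phi> ` X)"
  shows "\<exists>(F :: nat => 'x set) c. (\<forall>n. finite (F n) \<and> F n \<subseteq> X) \<and>
    (\<lambda>n. nm ((\<Sum>x\<in>F n. c n x *\<^sub>C \<phi> x) - v)) \<longlonglongrightarrow> 0"
proof -
  have vc: "v \<in> cr" using assms(2) by (simp add: clspan_def)
  have "\<exists>F c. finite F \<and> F \<subseteq> X \<and> nm ((\<Sum>x\<in>F. c x *\<^sub>C \<phi> x) - v) < 1 / real (Suc n)" for n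
  proof -
    obtain y where y: "y \<in> complex_vector.span (\<phi> ` X)" "nm (v - y) < 1 / real (Suc n)"
      using clspan_approx[OF assms(2), of "1 / real (Suc n)"] by auto
    then obtain t r where t: "finite t" "t \<subseteq> \<phi> ` X" "y = (\<Sum>a\<in>t. r a *\<^sub>C a)"
      unfolding complex_vector.span_explicit by blast
    obtain F where F: "F \<subseteq> X" "inj_on \<phi> F" "t = \<phi> ` F" using t(2) unfolding subset_image_inj by blast
    have "y \<in> cr" using span_carrier[OF assms(1)] y(1) by blast
    then have "nm (y - v) < 1 / real (Suc n)" using y(2) vc nm_diff_commute by simp
    moreover have "y = (\<Sum>x\<in>F. r (\<phi> x) *\<^sub>C \<phi> x)" using t(3) F by (simp add: sum.reindex)
    moreover have "finite F" using F t(1) finite_image_iff by blast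
    ultimately show ?thesis using F by (intro exI[of _ F] exI[of _ "r \<circ> \<phi>"]) auto
  qed
  then obtain F c where Fc: "\<And>n. finite (F n) \<and> F n \<subseteq> X \<and>
    nm ((\<Sum>x\<in>F n. c n x *\<^sub>C \<phi> x) - v) < 1 / real (Suc n)" by metis
  have "(\<Sum>x\<in>F n. c n x *\<^sub>C \<phi> x) - v \<in> cr" for n 
    using Fc[of n] subsetD[OF assms(1)] vc by (intro diff_in sum_in scale_in) auto
  then have "(\<lambda>n. nm ((\<Sum>x\<in>F n. c n x *\<^sub>C \<phi> x) - v)) \<longlonglongrightarrow> 0"
    using Fc by (intro real_tendsto_sandwich[OF _ _ tendsto_const LIMSEQ_Suc[OF lim_1_over_n]])
      (auto intro!: always_eventually less_imp_le)
  then show ?thesis using Fc by blast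
qed

end

subsection \<open>Extending an isometric correspondence to closed spans\<close>

text \<open>Two families with the same Gram matrix differ by an isometry: send \<open>\<Sum>c x \<phi>
  x\<close> to \<open>\<Sum>c x \<psi> x\<close> and pass to limits.\<close>

lemma isometric_extension:
  fixes H :: "'a::complex_vector hilbert" and H' :: "'b::complex_vector hilbert"
  assumes "hilb H" "hilb H'"
    and \<phi>: "\<phi> ` X \<subseteq> hcarrier H" and \<psi>: "\<psi> ` X \<subseteq> hcarrier H'"
    and gram: "\<And>x y. x \<in> X ==> y \<in> X ==> hinner H' (\<psi> x) (\<psi> y) = hinner H (\<phi> x) (\<phi> y)"
  defines "K \<equiv> hilb.clspan H (\<phi> ` X)"
  shows "\<exists>J. (\<forall>v\<in>K. J v \<in> hilb.clspan H' (\<psi> ` X)) \<and>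
    (\<forall>v\<in>K. \<forall>x\<in>X. hinner H' (J v) (\<psi> x) = hinner H v (\<phi> x)) \<and>
    (\<forall>v\<in>K. \<forall>w\<in>K. hinner H' (J v) (J w) = hinner H v w) \<and>
    (\<forall>v\<in>K. \<forall>w\<in>K. J (v + w) = J v + J w) \<and> (\<forall>v\<in>K. \<forall>c. J (c *\<^sub>C v) = c *\<^sub>C J v) \<and>
    (\<forall>x\<in>X. J (\<phi> x) = \<psi> x)"
proof -
  interpret A: hilb H by fact
  interpret B: hilb H' by fact
  define L where "L = hilb.clspan H' (\<psi> ` X)"
  note Kcl = A.closed_sub_clspan[OF \<phi>, folded K_def] and Lcl = B.closed_sub_clspan[OF \<psi>, folded L_def]
  note Kc = A.closed_subD(2)[OF Kcl] and Lc = B.closed_subD(2)[OF Lcl]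
  let ?s = "\<lambda>F c. \<Sum>x\<in>F. c x *\<^sub>C \<phi> x" and ?t = "\<lambda>F c. \<Sum>x\<in>F. c x *\<^sub>C \<psi> x"
  have sin: "?s F c \<in> hcarrier H" and tin: "?t F c \<in> hcarrier H'" if "F \<subseteq> X" for F c
    using that subsetD[OF \<phi>] subsetD[OF \<psi>] by (auto intro!: A.sum_in B.sum_in A.scale_in B.scale_in)
  have tL: "?t F c \<in> L" if "F \<subseteq> X" for F c
  proof -
    have "?t F c \<in> complex_vector.span (\<psi> ` X)"
      using that by (intro complex_vector.span_sum complex_vector.span_scale complex_vector.span_base) auto
    then show ?thesis using B.clspan_superset[OF \<psi>] by (auto simp: L_def)
  qed
  have st: "hinner H' (?t F c) (?t G d) = hinner H (?s F c) (?s G d)" if "F \<subseteq> X" "G \<subseteq> X" for F c G d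
    using that subsetD[OF \<phi>] subsetD[OF \<psi>] gram[OF subsetD subsetD, OF that(1) _ that(2)]
    by (subst A.ip_sum_sum; (subst B.ip_sum_sum)?) (auto intro!: sum.cong)
  have nst: "hnorm H' (?t F c - ?t G d) = hnorm H (?s F c - ?s G d)" if "F \<subseteq> X" "G \<subseteq> X" for F c G d
  proof -
    have "(hnorm H' (?t F c - ?t G d))\<^sup>2 = (hnorm H (?s F c - ?s G d))\<^sup>2"
      using that sin tin st by (subst A.nm_diff_sq, simp, simp, subst B.nm_diff_sq) (simp_all add: A.nm_sq B.nm_sq)
    then show ?thesis using that sin tin by (simp add: A.diff_in B.diff_in)
  qed
  define R where "R v w \<longleftrightarrow> (\<exists>F c. (\<forall>n::nat. finite (F n) \<and> F n \<subseteq> X) \<and>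
    (\<lambda>n. hnorm H (?s (F n) (c n) - v)) \<longlonglongrightarrow> 0 \<and> (\<lambda>n. hnorm H' (?t (F n) (c n) - w)) \<longlonglongrightarrow> 0)" for v w
  have ex: "\<exists>w\<in>L. R v w" if v: "v \<in> K" for v
  proof -
    obtain F :: "nat => _" and c where F: "\<And>n. finite (F n) \<and> F n \<subseteq> X"
      and lim: "(\<lambda>n. hnorm H (?s (F n) (c n) - v)) \<longlonglongrightarrow> 0"
      using A.clspan_sequence[OF \<phi> v[unfolded K_def]] by blast
    have "\<exists>N. \<forall>m\<ge>N. \<forall>n\<ge>N. hnorm H' (?t (F m) (c m) - ?t (F n) (c n)) < e" if "e > 0" for e
    proof -
      obtain N where N: "\<And>n. n \<ge> N ==> hnorm H (?s (F n) (c n) - v) < e / 2"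
        using order_tendstoD(2)[OF lim, of "e/2"] \<open>e > 0\<close> by (auto simp: eventually_sequentially)
      have "hnorm H (?s (F m) (c m) - ?s (F n) (c n)) < e" if "m \<ge> N" "n \<ge> N" for m n
      proof -
        have i: "?s (F m) (c m) \<in> hcarrier H" "?s (F n) (c n) \<in> hcarrier H" using sin F by blast+
        show ?thesis
          using N[OF that(1)] N[OF that(2)] A.triangle_diff[OF i(1) Kc[OF v] i(2)]
            A.nm_diff_commute[OF Kc[OF v] i(2)] by linarith
      qed
      then show ?thesis using nst F by auto
    qed
    note cauchy = this
    have tF: "?t (F n) (c n) \<in> hcarrier H'" for n using tin F by blast
    obtain w where w: "w \<in> hcarrier H'" "(\<lambda>n. hnorm H' (?t (F n) (c n) - w)) \<longlonglongrightarrow> 0"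
      using B.complete[of "\<lambda>n. ?t (F n) (c n)", OF tF cauchy] by auto
    have "w \<in> L" using B.closed_sub_limit[OF Lcl _ w] tL F by blast
    then show ?thesis using F lim w unfolding R_def by blast
  qed
  then obtain J where J: "\<And>v. v \<in> K ==> J v \<in> L" "\<And>v. v \<in> K ==> R v (J v)" by metis
  have 1: "hinner H' w (\<psi> x) = hinner H v (\<phi> x)" if R: "R v w" and vw: "v \<in> K" "w \<in> L" and x: "x \<in> X" for v w x
  proof -
    obtain F c where F: "\<And>n::nat. finite (F n) \<and> F n \<subseteq> X"
      and lim: "(\<lambda>n. hnorm H (?s (F n) (c n) - v)) \<longlonglongrightarrow> 0" "(\<lambda>n. hnorm H' (?t (F n) (c n) - w)) \<longlonglongrightarrow> 0"
      using R unfolding R_def by blast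
    have xin: "\<phi> x \<in> hcarrier H" "\<psi> x \<in> hcarrier H'" using \<phi> \<psi> x by auto
    have "(\<lambda>n. hinner H (?s (F n) (c n)) (\<phi> x)) \<longlonglongrightarrow> hinner H v (\<phi> x)"
      using A.tendsto_ip_left[OF _ Kc[OF vw(1)] xin(1) lim(1)] sin F by blast
    moreover have "(\<lambda>n. hinner H' (?t (F n) (c n)) (\<psi> x)) \<longlonglongrightarrow> hinner H' w (\<psi> x)"
      using B.tendsto_ip_left[OF _ Lc[OF vw(2)] xin(2) lim(2)] tin F by blast
    moreover have "hinner H (?s (F n) (c n)) (\<phi> x) = hinner H' (?t (F n) (c n)) (\<psi> x)" for n
      using st[of "F n" "{x}" "c n" "\<lambda>_. 1"] F x by (simp add: scaleC_one)
    ultimately show ?thesis using LIMSEQ_unique by simp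
  qed
  have 2: "hinner H' w w2 = hinner H v v2"
    if R: "R v w" "R v2 w2" and vw: "v \<in> K" "w \<in> L" "v2 \<in> K" "w2 \<in> L" for v w v2 w2
  proof -
    obtain F c where F: "\<And>n::nat. finite (F n) \<and> F n \<subseteq> X"
      and lim: "(\<lambda>n. hnorm H (?s (F n) (c n) - v2)) \<longlonglongrightarrow> 0" "(\<lambda>n. hnorm H' (?t (F n) (c n) - w2)) \<longlonglongrightarrow> 0"
      using R(2) unfolding R_def by blast
    have "(\<lambda>n. hinner H v (?s (F n) (c n))) \<longlonglongrightarrow> hinner H v v2"
      using A.tendsto_ip_right[OF _ Kc[OF vw(3)] Kc[OF vw(1)] lim(1)] sin F by blast
    moreover have "(\<lambda>n. hinner H' w (?t (F n) (c n))) \<longlonglongrightarrow> hinner H' w w2"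
      using B.tendsto_ip_right[OF _ Lc[OF vw(4)] Lc[OF vw(2)] lim(2)] tin F by blast
    moreover have "hinner H v (?s (F n) (c n)) = hinner H' w (?t (F n) (c n))" for n
    proof -
      have "hinner H v (?s (F n) (c n)) = (\<Sum>x\<in>F n. cnj (c n x) * hinner H v (\<phi> x))"
        using F[of n] \<phi> Kc[OF vw(1)] by (subst A.ip_sum_right) (auto simp: A.ip_linear subset_iff intro!: sum.cong)
      also have "\<dots> = (\<Sum>x\<in>F n. cnj (c n x) * hinner H' w (\<psi> x))"
        using F[of n] 1[OF R(1) vw(1,2)] by (intro sum.cong) auto
      also have "\<dots> = hinner H' w (?t (F n) (c n))"
        using F[of n] \<psi> Lc[OF vw(2)] by (subst B.ip_sum_right) (auto simp: B.ip_linear subset_iff intro!: sum.cong)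
      finally show ?thesis .
    qed
    ultimately show ?thesis using LIMSEQ_unique by simp
  qed
  have uniq: "w = w'" if wL: "w \<in> L" "w' \<in> L" and eq: "\<And>x. x \<in> X ==> hinner H' w (\<psi> x) = hinner H' w' (\<psi> x)" for w w'
  proof -
    have d: "w - w' \<in> L" using complex_vector.subspace_diff[OF B.closed_subD(1)[OF Lcl] wL] .
    have "hinner H' y (w - w') = 0" if yX: "y \<in> \<psi> ` X" for y
    proof -
      obtain x where x: "x \<in> X" "y = \<psi> x" using yX by blast
      have y: "y \<in> hcarrier H'" using x \<psi> by auto
      have "hinner H' (w - w') y = 0" using eq[OF x(1)] x(2) y Lc[OF wL(1)] Lc[OF wL(2)]
        by (simp add: B.ip_linear)
      then show ?thesis using B.ip_commute[OF Lc[OF d] y] by simp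
    qed
    then have "hinner H' (w - w') (w - w') = 0"
      using B.clspan_orth[OF \<psi> Lc[OF d]] d by (auto simp: L_def)
    then show ?thesis using B.ip_eq_0D[OF Lc[OF d]] by simp
  qed
  note Ksub = A.closed_subD(1)[OF Kcl] and Lsub = B.closed_subD(1)[OF Lcl]
  have \<psi>c: "x \<in> X ==> \<psi> x \<in> hcarrier H'" and \<phi>c: "x \<in> X ==> \<phi> x \<in> hcarrier H" for x using \<psi> \<phi> by auto
  have J1: "hinner H' (J v) (\<psi> x) = hinner H v (\<phi> x)" if "v \<in> K" "x \<in> X" for v x
    using 1[OF J(2)[OF that(1)] that(1) J(1)[OF that(1)] that(2)] .
  have J2: "hinner H' (J v) (J w) = hinner H v w" if "v \<in> K" "w \<in> K" for v w
    using 2[OF J(2)[OF that(1)] J(2)[OF that(2)]] J(1) that by blast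
  have J3: "J (v + w) = J v + J w" if "v \<in> K" "w \<in> K" for v w
  proof (rule uniq)
    have vw: "v + w \<in> K" using complex_vector.subspace_add[OF Ksub that] .
    show "J (v + w) \<in> L" using J(1)[OF vw] .
    show "J v + J w \<in> L" using complex_vector.subspace_add[OF Lsub] J(1) that by blast
    show "hinner H' (J (v + w)) (\<psi> x) = hinner H' (J v + J w) (\<psi> x)" if x: "x \<in> X" for x
      using J1[OF vw x] J1[OF _ x] Lc[OF J(1)] Kc \<psi>c[OF x] \<phi>c[OF x] \<open>v \<in> K\<close> \<open>w \<in> K\<close>
      by (simp add: A.ip_linear B.ip_linear)
  qed
  have J4: "J (c *\<^sub>C v) = c *\<^sub>C J v" if v: "v \<in> K" for v c
  proof (rule uniq)
    have cv: "c *\<^sub>C v \<in> K" using complex_vector.subspace_scale[OF Ksub v] .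
    show "J (c *\<^sub>C v) \<in> L" using J(1)[OF cv] .
    show "c *\<^sub>C J v \<in> L" using complex_vector.subspace_scale[OF Lsub] J(1) v by blast
    show "hinner H' (J (c *\<^sub>C v)) (\<psi> x) = hinner H' (c *\<^sub>C J v) (\<psi> x)" if x: "x \<in> X" for x
      using J1[OF cv x] J1[OF _ x] Lc[OF J(1)] Kc \<psi>c[OF x] \<phi>c[OF x] v
      by (simp add: A.ip_linear B.ip_linear)
  qed
  have J5: "J (\<phi> x) = \<psi> x" if x: "x \<in> X" for x
  proof (rule uniq)
    have p: "\<phi> x \<in> K" using A.clspan_base[OF \<phi>] x by (auto simp: K_def)
    show "J (\<phi> x) \<in> L" using J(1)[OF p] .
    show "\<psi> x \<in> L" using B.clspan_base[OF \<psi>] x by (auto simp: L_def)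
    show "hinner H' (J (\<phi> x)) (\<psi> y) = hinner H' (\<psi> x) (\<psi> y)" if y: "y \<in> X" for y
      using J1[OF p y] gram[OF x y] by simp
  qed
  show ?thesis
    unfolding L_def[symmetric] by (intro exI[of _ J] conjI ballI allI J(1) J1 J2 J3 J4 J5)
qed

section \<open>Hilbert sums\<close>

locale hsum =
  fixes I :: "'i set" and H :: "'i => 'a::complex_vector hilbert"
  assumes summand: "\<And>i. i \<in> I ==> hilb (H i)"
begin

abbreviation (input) "S \<equiv> hilbert_sum I H"

lemma in_sum_iff: "f \<in> hcarrier S \<longleftrightarrow> (\<forall>i\<in>I. f i \<in> hcarrier (H i)) \<and> (\<forall>i. i \<notin> I \<longrightarrow> f i = 0) \<and>
    (\<lambda>i. (hnorm (H i) (f i))\<^sup>2) summable_on I"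
  by (simp add: hilbert_sum_def)

lemma in_sumD:
  assumes "f \<in> hcarrier S"
  shows "\<And>i. i \<in> I ==> f i \<in> hcarrier (H i)" "\<And>i. i \<notin> I ==> f i = 0"
    "(\<lambda>i. (hnorm (H i) (f i))\<^sup>2) summable_on I"
  using assms by (simp_all add: in_sum_iff)

lemma hinner_sum: "hinner S f g = (\<Sum>\<^sub>\<infinity>i\<in>I. hinner (H i) (f i) (g i))"
  by (simp add: hilbert_sum_def)

lemma hinner_sumI:
  assumes "(h has_sum r) I" "\<And>i. i \<in> I ==> h i = hinner (H i) (f i) (g i)"
  shows "hinner S f g = r"
  unfolding hinner_sum using assms has_sum_cong[of I h] by (intro infsumI) auto

lemma ip_abs_summable:
  assumes "f \<in> hcarrier S" "g \<in> hcarrier S"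
  shows "(\<lambda>i. cmod (hinner (H i) (f i) (g i))) summable_on I"
proof (rule summable_on_comparison_test)
  show "(\<lambda>i. (hnorm (H i) (f i))\<^sup>2 + (hnorm (H i) (g i))\<^sup>2) summable_on I"
    by (intro summable_on_add in_sumD assms)
  fix i assume i: "i \<in> I"
  interpret hilb "H i" using summand[OF i] .
  have n: "0 \<le> nm (f i)" "0 \<le> nm (g i)" using in_sumD(1)[OF assms(1) i] in_sumD(1)[OF assms(2) i] by simp_all
  have "cmod (ip (f i) (g i)) \<le> nm (f i) * nm (g i)"
    by (rule cauchy_schwarz[OF in_sumD(1)[OF assms(1) i] in_sumD(1)[OF assms(2) i]])
  also have "\<dots> \<le> 2 * nm (f i) * nm (g i)" using n by simp
  also have "\<dots> \<le> (nm (f i))\<^sup>2 + (nm (g i))\<^sup>2" by (rule sum_squares_bound)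
  finally show "cmod (ip (f i) (g i)) \<le> (nm (f i))\<^sup>2 + (nm (g i))\<^sup>2" .
qed auto

lemma ip_has_sum:
  assumes "f \<in> hcarrier S" "g \<in> hcarrier S"
  shows "((\<lambda>i. hinner (H i) (f i) (g i)) has_sum hinner S f g) I"
  unfolding hinner_sum by (rule has_sum_infsum[OF abs_summable_summable[OF ip_abs_summable[OF assms]]])

lemma nm_sq_has_sum:
  assumes f: "f \<in> hcarrier S"
  shows "((\<lambda>i. (hnorm (H i) (f i))\<^sup>2) has_sum (hnorm S f)\<^sup>2) I"
proof -
  have "((\<lambda>i. Re (hinner (H i) (f i) (f i))) has_sum Re (hinner S f f)) I"
    by (rule has_sum_Re[OF ip_has_sum[OF f f]])
  then have h: "((\<lambda>i. (hnorm (H i) (f i))\<^sup>2) has_sum Re (hinner S f f)) I"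
    by (rule has_sum_cong[THEN iffD1, rotated]) (use hilb.nm_sq[OF summand] in_sumD(1)[OF f] in auto)
  then have "0 \<le> Re (hinner S f f)" by (rule has_sum_nonneg) auto
  then show ?thesis using h by (simp add: hnorm_def)
qed

lemma add_in_sum:
  assumes "f \<in> hcarrier S" "g \<in> hcarrier S"
  shows "f + g \<in> hcarrier S"
  unfolding in_sum_iff
proof (intro conjI ballI allI impI)
  fix i assume "i \<in> I"
  then interpret hilb "H i" using summand by blast
  show "(f + g) i \<in> hcarrier (H i)" using in_sumD(1) assms \<open>i \<in> I\<close> by auto
next
  show "(\<lambda>i. (hnorm (H i) ((f + g) i))\<^sup>2) summable_on I"
  proof (rule summable_on_comparison_test)
    show "(\<lambda>i. 2 * (hnorm (H i) (f i))\<^sup>2 + 2 * (hnorm (H i) (g i))\<^sup>2) summable_on I"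
      by (intro summable_on_add summable_on_cmult_right in_sumD assms)
    fix i assume i: "i \<in> I"
    interpret hilb "H i" using summand[OF i] .
    have fg: "f i \<in> cr" "g i \<in> cr" using in_sumD(1)[OF _ i] assms by auto
    have "(nm (f i + g i))\<^sup>2 + (nm (f i - g i))\<^sup>2 = 2 * (nm (f i))\<^sup>2 + 2 * (nm (g i))\<^sup>2"
      using fg by (simp add: nm_add_sq nm_diff_sq)
    then show "(nm ((f + g) i))\<^sup>2 \<le> 2 * (nm (f i))\<^sup>2 + 2 * (nm (g i))\<^sup>2"
      using zero_le_power2[of "nm (f i - g i)"] unfolding plus_fun_apply by linarith
  qed auto
qed (use in_sumD(2)[OF assms(1)] in_sumD(2)[OF assms(2)] in auto)

lemma scale_in_sum:
  assumes f: "f \<in> hcarrier S"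
  shows "c *\<^sub>C f \<in> hcarrier S"
  unfolding in_sum_iff scaleC_fun_def
proof (intro conjI ballI allI impI)
  fix i assume i: "i \<in> I"
  then interpret hilb "H i" using summand by blast
  show "c *\<^sub>C f i \<in> hcarrier (H i)" using in_sumD(1)[OF f i] by auto
next
  have "(\<lambda>i. (cmod c)\<^sup>2 * (hnorm (H i) (f i))\<^sup>2) summable_on I"
    by (intro summable_on_cmult_right in_sumD f)
  then show "(\<lambda>i. (hnorm (H i) (c *\<^sub>C f i))\<^sup>2) summable_on I"
    by (rule summable_on_cong[THEN iffD1, rotated])
      (use hilb.nm_scale[OF summand in_sumD(1)[OF f]] in \<open>simp add: power_mult_distrib\<close>)
qed (use in_sumD(2) f in auto)

lemma zero_in_sum: "0 \<in> hcarrier S"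
  unfolding in_sum_iff
proof (intro conjI ballI allI impI)
  fix i assume i: "i \<in> I"
  then interpret hilb "H i" using summand by blast
  show "0 i \<in> hcarrier (H i)" by auto
next
  have "(hnorm (H i) (0 i))\<^sup>2 = 0" if "i \<in> I" for i using hilb.nm_zero[OF summand[OF that]] by simp
  then show "(\<lambda>i. (hnorm (H i) (0 i))\<^sup>2) summable_on I" by (simp cong: summable_on_cong)
qed auto

lemma diff_in_sum: "f \<in> hcarrier S ==> g \<in> hcarrier S ==> f - g \<in> hcarrier S"
  using add_in_sum[of f "(-1) *\<^sub>C g"] scale_in_sum[of g "-1"]
  by (simp add: complex_vector.scale_minus_left scaleC_one)

lemma finite_nm_sq_le:
  assumes f: "f \<in> hcarrier S" and F: "finite F" "F \<subseteq> I"
  shows "(\<Sum>i\<in>F. (hnorm (H i) (f i))\<^sup>2) \<le> (hnorm S f)\<^sup>2"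
  by (rule finite_sum_le_has_sum[OF nm_sq_has_sum[OF f]]) (use F in auto)

lemma nm_component_le:
  assumes f: "f \<in> hcarrier S" and i: "i \<in> I"
  shows "hnorm (H i) (f i) \<le> \<bar>hnorm S f\<bar>"
proof -
  have "(hnorm (H i) (f i))\<^sup>2 \<le> (hnorm S f)\<^sup>2" using finite_nm_sq_le[OF f, of "{i}"] i by simp
  then show ?thesis
    using hilb.nm_ge_0[OF summand[OF i] in_sumD(1)[OF f i]] abs_le_square_iff by force
qed

lemma hnorm_sum_nonneg: "f \<in> hcarrier S ==> 0 \<le> hnorm S f"
proof -
  assume f: "f \<in> hcarrier S"
  have "((\<lambda>i. (hnorm (H i) (f i))\<^sup>2) has_sum Re (hinner S f f)) I"
    using has_sum_Re[OF ip_has_sum[OF f f]]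
    by (rule has_sum_cong[THEN iffD1, rotated]) (use hilb.nm_sq[OF summand] in_sumD(1)[OF f] in auto)
  then have "0 \<le> Re (hinner S f f)" by (rule has_sum_nonneg) auto
  then show ?thesis by (simp add: hnorm_def)
qed

text \<open>The limit is taken in each component; the finite partial sums of the square norm are controlled
  uniformly, as for \<open>\<ell>\<^sup>2\<close>.\<close>

lemma complete_sum:
  assumes X: "\<And>n::nat. X n \<in> hcarrier S"
    and cauchy: "\<And>e. e > 0 ==> \<exists>N. \<forall>m\<ge>N. \<forall>n\<ge>N. hnorm S (X m - X n) < e"
  shows "\<exists>l\<in>hcarrier S. (\<lambda>n. hnorm S (X n - l)) \<longlonglongrightarrow> 0"
proof -
  have "\<exists>l\<in>hcarrier (H i). (\<lambda>n. hnorm (H i) (X n i - l)) \<longlonglongrightarrow> 0" if i: "i \<in> I" for i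
  proof -
    interpret hilb "H i" using summand[OF i] .
    show ?thesis
    proof (rule complete)
      show "X n i \<in> cr" for n using in_sumD(1)[OF X i] .
      fix e :: real assume "e > 0"
      then obtain N where N: "\<And>m n. m \<ge> N ==> n \<ge> N ==> hnorm S (X m - X n) < e" using cauchy by blast
      have "nm (X m i - X n i) < e" if "m \<ge> N" "n \<ge> N" for m n
        using N[OF that] nm_component_le[OF diff_in_sum[OF X X] i, of m n]
          hnorm_sum_nonneg[OF diff_in_sum[OF X X], of m n] by simp
      then show "\<exists>N. \<forall>m\<ge>N. \<forall>n\<ge>N. nm (X m i - X n i) < e" by blast
    qed
  qed
  then obtain l0 where l0: "\<And>i. i \<in> I ==> l0 i \<in> hcarrier (H i)"
    "\<And>i. i \<in> I ==> (\<lambda>n. hnorm (H i) (X n i - l0 i)) \<longlonglongrightarrow> 0" by metis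
  define l where "l i = (if i \<in> I then l0 i else 0)" for i
  have l: "\<And>i. i \<in> I ==> l i \<in> hcarrier (H i)" "\<And>i. i \<notin> I ==> l i = 0"
    "\<And>i. i \<in> I ==> (\<lambda>n. hnorm (H i) (X n i - l i)) \<longlonglongrightarrow> 0"
    using l0 by (auto simp: l_def)
  have fin: "(\<Sum>i\<in>F. (hnorm (H i) ((X n - l) i))\<^sup>2) \<le> e\<^sup>2"
    if N: "\<And>m n. m \<ge> N ==> n \<ge> N ==> hnorm S (X m - X n) < e" and n: "n \<ge> N" and F: "finite F" "F \<subseteq> I"
    for N n e F
  proof (rule LIMSEQ_le_const2)
    show "(\<lambda>m. \<Sum>i\<in>F. (hnorm (H i) (X n i - X m i))\<^sup>2) \<longlonglongrightarrow> (\<Sum>i\<in>F. (hnorm (H i) ((X n - l) i))\<^sup>2)"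
    proof (intro tendsto_sum tendsto_power)
      fix i assume "i \<in> F"
      then have i: "i \<in> I" using F by blast
      interpret hilb "H i" using summand[OF i] .
      have Xi: "X m i \<in> cr" for m using in_sumD(1)[OF X i] .
      have "(\<lambda>m. nm ((X n i - X m i) - (X n i - l i))) \<longlonglongrightarrow> 0"
        using l(3)[OF i] Xi l(1)[OF i] by (simp add: nm_diff_commute)
      then show "(\<lambda>m. nm (X n i - X m i)) \<longlonglongrightarrow> nm ((X n - l) i)"
        using tendsto_nm[of "\<lambda>m. X n i - X m i" "X n i - l i"] Xi l(1)[OF i] by simp
    qed
    have "(\<Sum>i\<in>F. (hnorm (H i) (X n i - X m i))\<^sup>2) \<le> e\<^sup>2" if m: "m \<ge> N" for m
    proof -
      have "(\<Sum>i\<in>F. (hnorm (H i) (X n i - X m i))\<^sup>2) \<le> (hnorm S (X n - X m))\<^sup>2"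
        using finite_nm_sq_le[OF diff_in_sum[OF X X] F, of n m] by simp
      also have "\<dots> \<le> e\<^sup>2" using N[OF n m] hnorm_sum_nonneg[OF diff_in_sum[OF X X]] by (intro power_mono) auto
      finally show ?thesis .
    qed
    then show "\<exists>N. \<forall>m\<ge>N. (\<Sum>i\<in>F. (hnorm (H i) (X n i - X m i))\<^sup>2) \<le> e\<^sup>2" by blast
  qed
  have Xl: "X n - l \<in> hcarrier S \<and> hnorm S (X n - l) \<le> e"
    if N: "\<And>m n. m \<ge> N ==> n \<ge> N ==> hnorm S (X m - X n) < e" and n: "n \<ge> N" and e: "e > 0" for N n e
  proof
    have sm: "(\<lambda>i. (hnorm (H i) ((X n - l) i))\<^sup>2) summable_on I"
      using fin[OF N n] by (intro nonneg_bdd_above_summable_on bdd_aboveI[of _ "e\<^sup>2"]) auto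
    show c: "X n - l \<in> hcarrier S"
      unfolding in_sum_iff
    proof (intro conjI ballI allI impI sm)
      fix i assume i: "i \<in> I"
      interpret hilb "H i" using summand[OF i] .
      show "(X n - l) i \<in> cr" using l(1)[OF i] in_sumD(1)[OF X i] by auto
    qed (use l(2) in_sumD(2)[OF X] in auto)
    have "(hnorm S (X n - l))\<^sup>2 \<le> e\<^sup>2"
      by (rule has_sum_le_finite_sums[OF nm_sq_has_sum[OF c]]) (use fin[OF N n] in auto)
    then show "hnorm S (X n - l) \<le> e" using e by (simp add: power2_le_iff_abs_le)
  qed
  have lS: "l \<in> hcarrier S"
  proof -
    obtain N where N: "\<And>m n. m \<ge> N ==> n \<ge> N ==> hnorm S (X m - X n) < 1" using cauchy[of 1] by auto
    have "X N - l \<in> hcarrier S" using Xl[OF N, of N] by auto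
    then show ?thesis using diff_in_sum[OF X, of "X N - l" N] by simp
  qed
  have "(\<lambda>n. hnorm S (X n - l)) \<longlonglongrightarrow> 0"
  proof (rule LIMSEQ_I)
    fix r :: real assume "r > 0"
    then obtain N where N: "\<And>m n. m \<ge> N ==> n \<ge> N ==> hnorm S (X m - X n) < r / 2"
      using cauchy[of "r/2"] by auto
    have "norm (hnorm S (X n - l) - 0) < r" if "n \<ge> N" for n
      using Xl[OF N that] hnorm_sum_nonneg[of "X n - l"] \<open>r > 0\<close> by auto
    then show "\<exists>no. \<forall>n\<ge>no. norm (hnorm S (X n - l) - 0) < r" by blast
  qed
  then show ?thesis using lS by blast
qed

lemma hilbert_sum: "hilb S"
proof (unfold_locales, unfold hilbert_space_def, intro conjI ballI allI impI)
  show "complex_vector.subspace (hcarrier S)"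
    by (rule complex_vector.subspaceI) (auto intro: zero_in_sum add_in_sum scale_in_sum)
  show "hinner S (x + y) z = hinner S x z + hinner S y z"
    if "x \<in> hcarrier S" "y \<in> hcarrier S" "z \<in> hcarrier S" for x y z
  proof (rule hinner_sumI)
    show "((\<lambda>i. hinner (H i) (x i) (z i) + hinner (H i) (y i) (z i)) has_sum hinner S x z + hinner S y z) I"
      by (intro has_sum_add ip_has_sum that)
    fix i assume i: "i \<in> I"
    interpret hilb "H i" using summand[OF i] .
    show "ip (x i) (z i) + ip (y i) (z i) = ip ((x + y) i) (z i)"
      using in_sumD(1)[OF _ i] that by (simp add: ip_linear)
  qed
  show "hinner S (c *\<^sub>C x) y = c * hinner S x y" if "x \<in> hcarrier S" "y \<in> hcarrier S" for x y c
  proof (rule hinner_sumI)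
    show "((\<lambda>i. c * hinner (H i) (x i) (y i)) has_sum c * hinner S x y) I"
      by (intro has_sum_cmult_right ip_has_sum that)
    fix i assume i: "i \<in> I"
    interpret hilb "H i" using summand[OF i] .
    show "c * ip (x i) (y i) = ip ((c *\<^sub>C x) i) (y i)"
      using in_sumD(1)[OF _ i] that by (simp add: ip_linear scaleC_fun_def)
  qed
  show "hinner S y x = cnj (hinner S x y)" if "x \<in> hcarrier S" "y \<in> hcarrier S" for x y
  proof (rule hinner_sumI)
    show "((\<lambda>i. cnj (hinner (H i) (x i) (y i))) has_sum cnj (hinner S x y)) I"
      using ip_has_sum[OF that] by simp
    fix i assume i: "i \<in> I"
    interpret hilb "H i" using summand[OF i] .
    show "cnj (ip (x i) (y i)) = ip (y i) (x i)"
      using in_sumD(1)[OF _ i] that ip_commute by metis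
  qed
  show "0 \<le> Re (hinner S x x)" if x: "x \<in> hcarrier S" for x
    using hnorm_sum_nonneg[OF x] by (simp add: hnorm_def)
  show "x = 0" if x: "x \<in> hcarrier S" and 0: "hinner S x x = 0" for x
  proof
    have n: "hnorm S x = 0" using 0 by (simp add: hnorm_def)
    fix i show "x i = 0 i"
    proof (cases "i \<in> I")
      case True
      then show ?thesis
        using nm_component_le[OF x True] n hilb.nm_eq_0[OF summand[OF True] in_sumD(1)[OF x True]]
          hilb.nm_ge_0[OF summand[OF True] in_sumD(1)[OF x True]] by auto
    qed (use in_sumD(2)[OF x] in auto)
  qed
  show "\<exists>l\<in>hcarrier S. (\<lambda>n. hnorm S (X n - l)) \<longlonglongrightarrow> 0"
    if "range X \<subseteq> hcarrier S \<and> (\<forall>e>0. \<exists>N. \<forall>m\<ge>N. \<forall>n\<ge>N. hnorm S (X m - X n) < e)" for X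
    by (rule complete_sum) (use that in auto)
qed

definition single :: "'i => 'a => 'i => 'a" where
  "single i x = (\<lambda>j. if j = i then x else 0)"

lemma single_in:
  assumes i: "i \<in> I" and x: "x \<in> hcarrier (H i)"
  shows "single i x \<in> hcarrier S"
proof -
  have "(\<lambda>j. (hnorm (H j) (single i x j))\<^sup>2) summable_on I"
  proof (rule finite_nonzero_values_imp_summable_on)
    have "{j \<in> I. (hnorm (H j) (single i x j))\<^sup>2 \<noteq> 0} \<subseteq> {i}"
      using hilb.nm_zero[OF summand] by (auto simp: single_def)
    then show "finite {j \<in> I. (hnorm (H j) (single i x j))\<^sup>2 \<noteq> 0}" by (rule finite_subset) auto
  qed
  then show ?thesis using i x hilb.zero_in[OF summand] by (auto simp: in_sum_iff single_def)
qed

lemma ip_single_left: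
  assumes i: "i \<in> I" and x: "x \<in> hcarrier (H i)" and g: "g \<in> hcarrier S"
  shows "hinner S (single i x) g = hinner (H i) x (g i)"
  unfolding hinner_sum
proof (rule infsumI, rule has_sum_finite_neutralI[of "{i}"])
  show "hinner (H j) (single i x j) (g j) = 0" if "j \<in> I - {i}" for j
    using that hilb.ip_zero_left[OF summand in_sumD(1)[OF g]] by (auto simp: single_def)
qed (use i in \<open>auto simp: single_def\<close>)

lemma ip_single_right:
  assumes i: "i \<in> I" and x: "x \<in> hcarrier (H i)" and g: "g \<in> hcarrier S"
  shows "hinner S g (single i x) = hinner (H i) (g i) x"
  using ip_single_left[OF assms] hilb.ip_commute[OF hilbert_sum single_in[OF i x] g]
    hilb.ip_commute[OF summand[OF i] x in_sumD(1)[OF g i]] by simp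

lemma nm_single: "i \<in> I ==> x \<in> hcarrier (H i) ==> hnorm S (single i x) = hnorm (H i) x"
  using ip_single_left[of i x "single i x"] single_in[of i x] by (simp add: hnorm_def single_def)

end

section \<open>Unitary representations\<close>

lemma unitary_repI:
  fixes \<rho> :: "('g::topological_group_add, 'a::complex_vector) urep"
  defines "H \<equiv> rep_space \<rho>" and "U \<equiv> rep_op \<rho>"
  assumes "hilb H"
    and U_in: "\<And>s x. x \<in> hcarrier H ==> U s x \<in> hcarrier H"
    and U_out: "\<And>s x. x \<notin> hcarrier H ==> U s x = 0"
    and U_add: "\<And>s x y. x \<in> hcarrier H ==> y \<in> hcarrier H ==> U s (x + y) = U s x + U s y"
    and U_scale: "\<And>s c x. x \<in> hcarrier H ==> U s (c *\<^sub>C x) = c *\<^sub>C U s x"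
    and U_ip: "\<And>s x y. x \<in> hcarrier H ==> y \<in> hcarrier H ==> hinner H (U s x) (U s y) = hinner H x y"
    and U_mult: "\<And>s t x. x \<in> hcarrier H ==> U (s + t) x = U s (U t x)"
    and U_0: "\<And>x. x \<in> hcarrier H ==> U 0 x = x"
    and cont: "\<And>x s. x \<in> hcarrier H ==> ((\<lambda>t. hnorm H (U t x - U s x)) \<longlongrightarrow> 0) (at s)"
  shows "unitary_rep \<rho>"
proof -
  interpret hilb H by fact
  have b: "U s \<in> bounded_ops H" for s
    by (rule bounded_opsI[where C = 1]) (use U_in U_out U_add U_scale U_ip in \<open>auto simp: hnorm_def\<close>)
  have "U s ` hcarrier H = hcarrier H" for s
  proof -
    have "x \<in> U s ` hcarrier H" if "x \<in> hcarrier H" for x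
      using U_mult[OF that, of s "- s"] U_0[OF that] U_in[OF that, of "- s"] by (auto intro!: image_eqI[of _ _ "U (- s) x"])
    then show ?thesis using U_in by blast
  qed
  then have u: "U s \<in> unitary_ops H" for s using b U_ip unfolding unitary_ops_def by blast
  have "U (s + t) = U s \<circ> U t" for s t
  proof
    fix x show "U (s + t) x = (U s \<circ> U t) x"
      by (cases "x \<in> hcarrier H") (use U_mult U_out op_zero[OF b] in auto)
  qed
  then show ?thesis using u cont hilbert unfolding unitary_rep_def H_def[symmetric] U_def[symmetric] by blast
qed

locale urep =
  fixes \<rho> :: "('g::topological_group_add, 'a::complex_vector) urep"
  assumes unitary: "unitary_rep \<rho>"

sublocale urep \<subseteq> hilb "rep_space \<rho>"
  using unitary by unfold_locales (simp add: unitary_rep_def)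

context urep
begin

abbreviation (input) "U \<equiv> rep_op \<rho>"

lemma rep_unitary_op: "U s \<in> unitary_ops (rep_space \<rho>)"
  using unitary by (simp add: unitary_rep_def)
lemma rep_bounded: "U s \<in> bounded_ops (rep_space \<rho>)"
  using rep_unitary_op by (simp add: unitary_ops_def)
lemma rep_in [simp, intro]: "x \<in> cr ==> U s x \<in> cr"
  by (rule op_in[OF rep_bounded])
lemma rep_ip: "x \<in> cr ==> y \<in> cr ==> ip (U s x) (U s y) = ip x y"
  using rep_unitary_op by (simp add: unitary_ops_def)
lemma rep_mult: "U (s + t) = U s \<circ> U t"
  using unitary by (simp add: unitary_rep_def)
lemma rep_mult': "U (s + t) x = U s (U t x)"
  by (simp add: rep_mult)
lemma rep_cont: "x \<in> cr ==> ((\<lambda>t. nm (U t x - U s x)) \<longlongrightarrow> 0) (at s)"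
  using unitary by (simp add: unitary_rep_def)
lemma rep_0 [simp]: assumes "x \<in> cr" shows "U 0 x = x"
proof -
  have "x \<in> U 0 ` cr" using rep_unitary_op[of 0] assms by (simp add: unitary_ops_def)
  then obtain y where "x = U 0 y" by blast
  then show ?thesis using rep_mult'[of 0 0 y] by simp
qed
lemma rep_inv: "x \<in> cr ==> U (- s) (U s x) = x" "x \<in> cr ==> U s (U (- s) x) = x"
  using rep_mult'[of "- s" s x] rep_mult'[of s "- s" x] by simp_all
lemma rep_ip_adj: "x \<in> cr ==> y \<in> cr ==> ip (U s x) y = ip x (U (- s) y)"
  using rep_ip[of x "U (- s) y" s] by (simp add: rep_inv)
lemma rep_nm: "x \<in> cr ==> nm (U s x) = nm x"
  using rep_ip by (simp add: hnorm_def)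

end

text \<open>The two ways in which representations are built below, from a representation on a closed
  invariant subspace and from an action on a total set of vectors, both come with a linear injection
  \<open>T\<close> into the vector space on which the new representation is to live.\<close>

lemma transported_rep:
  fixes H :: "'a::complex_vector hilbert" and T :: "'a => 'b::complex_vector"
    and V :: "'g::topological_group_add => 'a => 'a"
  assumes "hilb H" and K: "hilb.closed_sub H K"
    and T_add: "\<And>x y. x \<in> K ==> y \<in> K ==> T (x + y) = T x + T y"
    and T_scale: "\<And>c x. x \<in> K ==> T (c *\<^sub>C x) = c *\<^sub>C T x" and T_inj: "inj_on T K"
    and V_in: "\<And>s x. x \<in> K ==> V s x \<in> K"
    and V_add: "\<And>s x y. x \<in> K ==> y \<in> K ==> V s (x + y) = V s x + V s y"
    and V_scale: "\<And>s c x. x \<in> K ==> V s (c *\<^sub>C x) = c *\<^sub>C V s x"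
    and V_ip: "\<And>s x y. x \<in> K ==> y \<in> K ==> hinner H (V s x) (V s y) = hinner H x y"
    and V_mult: "\<And>s t x. x \<in> K ==> V (s + t) x = V s (V t x)"
    and V_0: "\<And>x. x \<in> K ==> V 0 x = x"
    and cont: "\<And>x s. x \<in> K ==> ((\<lambda>t. hnorm H (V t x - V s x)) \<longlongrightarrow> 0) (at s)"
  shows "\<exists>\<sigma> :: ('g, 'b) urep. unitary_rep \<sigma> \<and> (\<forall>x\<in>K. T x \<in> hcarrier (rep_space \<sigma>)) \<and>
    (\<forall>x\<in>K. \<forall>y\<in>K. hinner (rep_space \<sigma>) (T x) (T y) = hinner H x y) \<and>
    (\<forall>s. \<forall>x\<in>K. rep_op \<sigma> s (T x) = T (V s x))"
proof -
  interpret hilb H by fact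
  let ?i = "inv_into K T"
  define L where "L = \<lparr>hcarrier = T ` K, hinner = (\<lambda>f g. ip (?i f) (?i g))\<rparr>"
  define W where "W s f = (if f \<in> T ` K then T (V s (?i f)) else 0)" for s f
  define \<sigma> where "\<sigma> = \<lparr>rep_space = L, rep_op = W\<rparr>"
  note Ksub = closed_subD(1)[OF K] and Kc = closed_subD(2)[OF K]
  have i: "?i (T x) = x" if "x \<in> K" for x using T_inj that by simp
  have Lc: "hcarrier L = T ` K" by (simp add: L_def)
  have Lip: "hinner L (T x) (T y) = ip x y" if "x \<in> K" "y \<in> K" for x y using that i by (simp add: L_def)
  have Wop: "W s (T x) = T (V s x)" if "x \<in> K" for s x using that i by (simp add: W_def)
  have add: "x + y \<in> K" if "x \<in> K" "y \<in> K" for x y using complex_vector.subspace_add[OF Ksub that] .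
  have scale: "c *\<^sub>C x \<in> K" if "x \<in> K" for x c using complex_vector.subspace_scale[OF Ksub that] .
  have diff: "x - y \<in> K" if "x \<in> K" "y \<in> K" for x y using complex_vector.subspace_diff[OF Ksub that] .
  have zero: "0 \<in> K" using complex_vector.subspace_0[OF Ksub] .
  have T_diff: "T x - T y = T (x - y)" if "x \<in> K" "y \<in> K" for x y
    using T_add[OF that(1) scale[OF that(2), of "-1"]] T_scale[OF that(2), of "-1"]
    by (simp add: complex_vector.scale_minus_left scaleC_one)
  have T_0: "T 0 = 0" using T_scale[OF zero, of 0] by simp
  have Lnm: "hnorm L (T x) = nm x" if "x \<in> K" for x using Lip[OF that that] by (simp add: hnorm_def)
  have "hilb L"
  proof (unfold_locales, unfold hilbert_space_def Lc, intro conjI)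
    show "complex_vector.subspace (T ` K)"
    proof (rule complex_vector.subspaceI)
      show "0 \<in> T ` K" using zero T_0 by (metis image_eqI)
      show "x + y \<in> T ` K" if "x \<in> T ` K" "y \<in> T ` K" for x y
        using that add T_add by (auto simp flip: T_add)
      show "c *\<^sub>C x \<in> T ` K" if "x \<in> T ` K" for x c
        using that scale by (auto simp flip: T_scale)
    qed
    show "\<forall>x\<in>T ` K. \<forall>y\<in>T ` K. \<forall>z\<in>T ` K. hinner L (x + y) z = hinner L x z + hinner L y z"
      by (auto simp: Lip add ip_linear Kc simp flip: T_add)
    show "\<forall>c. \<forall>x\<in>T ` K. \<forall>y\<in>T ` K. hinner L (c *\<^sub>C x) y = c * hinner L x y"
      by (auto simp: Lip scale ip_linear Kc simp flip: T_scale)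
    show "\<forall>x\<in>T ` K. \<forall>y\<in>T ` K. hinner L y x = cnj (hinner L x y)"
      by (auto simp: Lip ip_commute[symmetric] Kc)
    show "\<forall>x\<in>T ` K. 0 \<le> Re (hinner L x x)"
      by (auto simp: Lip ip_ge_0 Kc)
    show "\<forall>x\<in>T ` K. hinner L x x = 0 \<longrightarrow> x = 0"
      using ip_eq_0D Kc T_0 by (auto simp: Lip)
    show "\<forall>X. range X \<subseteq> T ` K \<and> (\<forall>e>0. \<exists>N. \<forall>m\<ge>N. \<forall>n\<ge>N. hnorm L (X m - X n) < e) \<longrightarrow>
      (\<exists>l\<in>T ` K. (\<lambda>n. hnorm L (X n - l)) \<longlonglongrightarrow> 0)"
    proof (intro allI impI)
      fix X :: "nat => 'b"
      assume X: "range X \<subseteq> T ` K \<and> (\<forall>e>0. \<exists>N. \<forall>m\<ge>N. \<forall>n\<ge>N. hnorm L (X m - X n) < e)"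
      have "\<exists>y\<in>K. X n = T y" for n using X by blast
      then obtain Y where Y: "\<And>n. Y n \<in> K" "\<And>n. X n = T (Y n)" by metis
      have "hnorm L (X m - X n) = nm (Y m - Y n)" for m n by (simp add: Y T_diff Lnm diff)
      then have "\<exists>l\<in>cr. (\<lambda>n. nm (Y n - l)) \<longlonglongrightarrow> 0" using X Y(1) Kc by (intro complete) auto
      then obtain l where l: "l \<in> cr" "(\<lambda>n. nm (Y n - l)) \<longlonglongrightarrow> 0" by blast
      have lK: "l \<in> K" by (rule closed_sub_limit[OF K Y(1) l])
      have "hnorm L (X n - T l) = nm (Y n - l)" for n by (simp add: Y T_diff Lnm diff lK)
      then show "\<exists>l\<in>T ` K. (\<lambda>n. hnorm L (X n - l)) \<longlonglongrightarrow> 0" using l(2) lK by (intro bexI[of _ "T l"]) auto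
    qed
  qed
  have "unitary_rep \<sigma>"
  proof (rule unitary_repI; unfold \<sigma>_def urep.simps Lc)
    show "hilb L" by fact
    show "W s x \<in> T ` K" if "x \<in> T ` K" for s x using that V_in by (auto simp: Wop)
    show "W s x = 0" if "x \<notin> T ` K" for s x using that by (simp add: W_def)
    show "W s (x + y) = W s x + W s y" if "x \<in> T ` K" "y \<in> T ` K" for s x y
      using that by (auto simp: Wop add V_add V_in T_add simp flip: T_add)
    show "W s (c *\<^sub>C x) = c *\<^sub>C W s x" if "x \<in> T ` K" for s x c
      using that by (auto simp: Wop scale V_scale V_in T_scale simp flip: T_scale)
    show "hinner L (W s x) (W s y) = hinner L x y" if "x \<in> T ` K" "y \<in> T ` K" for s x y
      using that by (auto simp: Wop Lip V_in V_ip)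
    show "W (s + t) x = W s (W t x)" if "x \<in> T ` K" for s t x
      using that by (auto simp: Wop V_mult V_in)
    show "W 0 x = x" if "x \<in> T ` K" for x using that by (auto simp: Wop V_0)
    show "((\<lambda>t. hnorm L (W t x - W s x)) \<longlongrightarrow> 0) (at s)" if "x \<in> T ` K" for s x
      using that cont by (auto simp: Wop T_diff V_in Lnm diff)
  qed
  then show ?thesis using Lip Wop Lc
    by (intro exI[of _ \<sigma>]) (auto simp: \<sigma>_def)
qed

subsection \<open>Cyclic subspaces\<close>

context urep
begin

definition cyc :: "'a => 'a set" where
  "cyc v = clspan (range (\<lambda>s. U s v))"

lemma orbit_carrier: "v \<in> cr ==> range (\<lambda>s. U s v) \<subseteq> cr" by auto

lemma closed_sub_cyc: "v \<in> cr ==> closed_sub (cyc v)"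
  unfolding cyc_def by (rule closed_sub_clspan) auto

lemma cyc_carrier: "v \<in> cr ==> x \<in> cyc v ==> x \<in> cr"
  using closed_subD(2)[OF closed_sub_cyc] .

lemma orbit_in_cyc: "v \<in> cr ==> U s v \<in> cyc v"
  unfolding cyc_def by (rule clspan_base) auto

lemma self_in_cyc: "v \<in> cr ==> v \<in> cyc v"
  using orbit_in_cyc[of v 0] by simp

lemma cyc_invariant:
  assumes v: "v \<in> cr" and x: "x \<in> cyc v"
  shows "U s x \<in> cyc v"
proof -
  note K = closed_sub_cyc[OF v]
  have "closed_sub {x \<in> cr. U s x \<in> cyc v}"
    unfolding closed_sub_def
  proof safe
    show "complex_vector.subspace {x \<in> cr. U s x \<in> cyc v}"
      by (rule complex_vector.subspaceI)
        (use closed_subD(1)[OF K] in \<open>auto simp: op_zero[OF rep_bounded] op_add[OF rep_bounded] op_scale[OF rep_bounded]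
          complex_vector.subspace_0 complex_vector.subspace_add complex_vector.subspace_scale\<close>)
    fix x assume x: "x \<in> cr" "\<forall>e>0. \<exists>y\<in>{x \<in> cr. U s x \<in> cyc v}. nm (x - y) < e"
    show "U s x \<in> cyc v"
    proof (rule closed_subD(3)[OF K])
      fix e :: real assume "e > 0"
      then obtain y where y: "y \<in> cr" "U s y \<in> cyc v" "nm (x - y) < e" using x(2) by blast
      then have "nm (U s x - U s y) < e"
        using rep_nm[of "x - y" s] x(1) by (simp add: op_diff[OF rep_bounded])
      then show "\<exists>z\<in>cyc v. nm (U s x - z) < e" using y by blast
    qed (use x in auto)
  qed
  moreover have "range (\<lambda>t. U t v) \<subseteq> {x \<in> cr. U s x \<in> cyc v}"
    using v orbit_in_cyc[OF v] by (auto simp flip: rep_mult')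
  ultimately show ?thesis using x clspan_minimal unfolding cyc_def by blast
qed

lemma cyc_orth:
  assumes v: "v \<in> cr" and w: "w \<in> cr" and o: "\<And>y. y \<in> cyc v ==> ip w y = 0"
    and x: "x \<in> cyc w" and y: "y \<in> cyc v"
  shows "ip x y = 0"
proof (rule clspan_orth[OF orbit_carrier[OF w] _ _ x[unfolded cyc_def]])
  show yc: "y \<in> cr" using cyc_carrier[OF v y] .
  show "ip z y = 0" if "z \<in> range (\<lambda>s. U s w)" for z
    using that o[OF cyc_invariant[OF v y]] rep_ip_adj[OF w yc] by auto
qed

text \<open>Both the cyclic subspace and its orthogonal complement are invariant.\<close>

lemma proj_cyc_commute:
  assumes v: "v \<in> cr" and x: "x \<in> cr"
  shows "proj (cyc v) (U s x) = U s (proj (cyc v) x)"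
proof (rule proj_unique[OF closed_sub_cyc[OF v]])
  note K = closed_sub_cyc[OF v]
  show "U s (proj (cyc v) x) \<in> cyc v" by (rule cyc_invariant[OF v proj_in[OF K x]])
  fix y assume y: "y \<in> cyc v"
  have yc: "y \<in> cr" using cyc_carrier[OF v y] .
  show "ip (U s (proj (cyc v) x)) y = ip (U s x) y"
    using ip_proj[OF K x cyc_invariant[OF v y, of "- s"]] x yc proj_carrier[OF K x] by (simp add: rep_ip_adj)
qed (use x in auto)

text \<open>A cyclic representation lives on functions on the group: a vector is determined by its inner
  products with the orbit of the cyclic vector.\<close>

lemma cyclic_small_rep:
  assumes v: "v \<in> cr"
  shows "\<exists>(\<sigma> :: 'g small_urep) T. unitary_rep \<sigma> \<and> (\<forall>x\<in>cyc v. T x \<in> hcarrier (rep_space \<sigma>)) \<and>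
    (\<forall>x\<in>cyc v. \<forall>y\<in>cyc v. hinner (rep_space \<sigma>) (T x) (T y) = ip x y) \<and>
    (\<forall>s. \<forall>x\<in>cyc v. rep_op \<sigma> s (T x) = T (U s x))"
proof -
  note K = closed_sub_cyc[OF v] and Kc = cyc_carrier[OF v]
  define T :: "'a => 'g => complex" where "T x = (\<lambda>s. ip x (U s v))" for x
  have "inj_on T (cyc v)"
  proof (rule inj_onI)
    fix x y assume x: "x \<in> cyc v" and y: "y \<in> cyc v" and e: "T x = T y"
    have d: "x - y \<in> cyc v" using complex_vector.subspace_diff[OF closed_subD(1)[OF K] x y] .
    note c = Kc[OF x] Kc[OF y] Kc[OF d]
    have "ip (U s v) (x - y) = 0" for s
      using fun_cong[OF e, of s] c v ip_commute[of "x - y" "U s v"] by (simp add: T_def ip_linear)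
    then have "ip (x - y) (x - y) = 0"
      using clspan_orth[OF orbit_carrier[OF v] c(3)] d unfolding cyc_def by blast
    then show "x = y" using ip_eq_0D[OF c(3)] by simp
  qed
  then have "\<exists>\<sigma> :: 'g small_urep. unitary_rep \<sigma> \<and> (\<forall>x\<in>cyc v. T x \<in> hcarrier (rep_space \<sigma>)) \<and>
    (\<forall>x\<in>cyc v. \<forall>y\<in>cyc v. hinner (rep_space \<sigma>) (T x) (T y) = ip x y) \<and>
    (\<forall>s. \<forall>x\<in>cyc v. rep_op \<sigma> s (T x) = T (U s x))"
    by (intro transported_rep[OF hilb_axioms K _ _ \<open>inj_on T (cyc v)\<close>])
      (use v Kc cyc_invariant[OF v] rep_cont in \<open>auto simp: T_def fun_eq_iff ip_linear scaleC_fun_def scaleC_complex_def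
        op_add[OF rep_bounded] op_scale[OF rep_bounded] rep_ip rep_mult'\<close>)
  then show ?thesis by blast
qed

text \<open>By induction: a new vector is split into its components in the cyclic subspaces found so far and
  a remainder, and the remainder generates the next cyclic subspace, which is orthogonal to them.\<close>

lemma cyclic_decomposition:
  assumes "finite F" "F \<subseteq> cr"
  shows "\<exists>m (\<tau> :: nat => 'a). (\<forall>n<m. \<tau> n \<in> cr) \<and>
    (\<forall>n<m. \<forall>k<m. n \<noteq> k \<longrightarrow> (\<forall>x\<in>cyc (\<tau> n). \<forall>y\<in>cyc (\<tau> k). ip x y = 0)) \<and>
    (\<forall>x\<in>F. x = (\<Sum>n<m. proj (cyc (\<tau> n)) x))"
  using assms
proof (induction F)
  case empty
  show ?case by (intro exI[of _ 0]) auto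
next
  case (insert x F)
  then obtain m and \<tau> :: "nat => 'a" where \<tau>: "\<And>n. n < m ==> \<tau> n \<in> cr"
    and o: "\<And>n k x y. n < m ==> k < m ==> n \<noteq> k ==> x \<in> cyc (\<tau> n) ==> y \<in> cyc (\<tau> k) ==> ip x y = 0"
    and s: "\<And>x. x \<in> F ==> x = (\<Sum>n<m. proj (cyc (\<tau> n)) x)"
    by (metis insert_subset)
  have x: "x \<in> cr" and Fc: "F \<subseteq> cr" using insert by auto
  have pin: "proj (cyc (\<tau> n)) y \<in> cyc (\<tau> n)" "proj (cyc (\<tau> n)) y \<in> cr" if "n < m" "y \<in> cr" for n y
    using proj_in[OF closed_sub_cyc[OF \<tau>[OF that(1)]] that(2)] cyc_carrier[OF \<tau>[OF that(1)]] by auto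
  define p where "p = (\<Sum>n<m. proj (cyc (\<tau> n)) x)"
  have p: "p \<in> cr" unfolding p_def using pin x by (auto intro: sum_in)
  define w where "w = x - p"
  have w: "w \<in> cr" using x p by (simp add: w_def)
  have wo: "ip w y = 0" if k: "k < m" and y: "y \<in> cyc (\<tau> k)" for k y
  proof -
    have yc: "y \<in> cr" using cyc_carrier[OF \<tau>[OF k] y] .
    have "ip p y = (\<Sum>n<m. ip (proj (cyc (\<tau> n)) x) y)"
      unfolding p_def using pin x yc by (subst ip_sum_left) auto
    also have "\<dots> = (\<Sum>n<m. if n = k then ip x y else 0)"
    proof (rule sum.cong[OF refl])
      fix n assume "n \<in> {..<m}"
      then have n: "n < m" by simp
      show "ip (proj (cyc (\<tau> n)) x) y = (if n = k then ip x y else 0)"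
      proof (cases "n = k")
        case True
        then show ?thesis using ip_proj[OF closed_sub_cyc[OF \<tau>[OF k]] x y] by simp
      next
        case False
        then show ?thesis using o[OF n k False pin(1)[OF n x] y] by simp
      qed
    qed
    also have "\<dots> = ip x y" using k by (subst sum.delta) auto
    finally show ?thesis using x p yc by (simp add: w_def ip_linear)
  qed
  have Ko: "ip a b = 0" "ip b a = 0" if k: "k < m" and a: "a \<in> cyc w" and b: "b \<in> cyc (\<tau> k)" for a b k
  proof -
    show "ip a b = 0" by (rule cyc_orth[OF \<tau>[OF k] w wo[OF k] a b])
    then show "ip b a = 0" using ip_commute[OF cyc_carrier[OF w a] cyc_carrier[OF \<tau>[OF k] b]] by simp
  qed
  define g where "g = \<tau>(m := w)"
  have gsum: "(\<Sum>n<Suc m. proj (cyc (g n)) y) = (\<Sum>n<m. proj (cyc (\<tau> n)) y) + proj (cyc w) y" for y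
    by (simp add: g_def)
  have perp: "ip (\<Sum>n<m. proj (cyc (\<tau> n)) y) z = 0" if "y \<in> cr" "z \<in> cyc w" for y z
  proof -
    have "ip (\<Sum>n<m. proj (cyc (\<tau> n)) y) z = (\<Sum>n<m. ip (proj (cyc (\<tau> n)) y) z)"
      using pin that cyc_carrier[OF w] by (subst ip_sum_left) auto
    also have "\<dots> = 0" using Ko(2)[OF _ that(2) pin(1)[OF _ that(1)]] by (intro sum.neutral) auto
    finally show ?thesis .
  qed
  have "proj (cyc w) x = w"
    by (rule proj_unique[OF closed_sub_cyc[OF w] x self_in_cyc[OF w]])
      (use perp[OF x] x p cyc_carrier[OF w] in \<open>simp add: w_def ip_linear flip: p_def\<close>)
  then have "x = (\<Sum>n<Suc m. proj (cyc (g n)) x)" unfolding gsum by (simp add: w_def flip: p_def)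
  moreover have "y = (\<Sum>n<Suc m. proj (cyc (g n)) y)" if y: "y \<in> F" for y
  proof -
    have yc: "y \<in> cr" using y Fc by blast
    have "proj (cyc w) y = 0"
      by (rule proj_eq_0[OF closed_sub_cyc[OF w] yc]) (subst s[OF y], rule perp[OF yc])
    then show ?thesis unfolding gsum using s[OF y] by simp
  qed
  moreover have "\<forall>n<Suc m. g n \<in> cr" using \<tau> w by (auto simp: g_def less_Suc_eq)
  moreover have "ip a b = 0" if "n < Suc m" "k < Suc m" "n \<noteq> k" "a \<in> cyc (g n)" "b \<in> cyc (g k)" for n k a b
    using that o[of n k a b] Ko(1)[of k a b] Ko(2)[of n b a] by (auto simp: g_def less_Suc_eq split: if_splits)
  ultimately show ?case by (intro exI[of _ "Suc m"] exI[of _ g]) blast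
qed

end

subsection \<open>Direct sums and the universal representation\<close>

text \<open>Dominated convergence for sums, used for the strong continuity of direct sums of
  representations.\<close>

lemma infsum_dominated_tendsto_0:
  fixes g :: "'i => 't => real"
  assumes lim: "\<And>i. i \<in> I ==> (g i \<longlongrightarrow> 0) F"
    and le: "\<And>i t. i \<in> I ==> 0 \<le> g i t \<and> g i t \<le> b i" and b: "b summable_on I"
  shows "((\<lambda>t. \<Sum>\<^sub>\<infinity>i\<in>I. g i t) \<longlongrightarrow> 0) F"
proof (rule tendstoI)
  fix e :: real assume "e > 0"
  obtain G where G: "finite G" "G \<subseteq> I" "dist (sum b G) (infsum b I) \<le> e / 2"
    using infsum_finite_approximation[OF b, of "e/2"] \<open>e > 0\<close> by auto
  have gs: "(\<lambda>i. g i t) summable_on A" if "A \<subseteq> I" for t A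
    by (rule summable_on_comparison_test[OF summable_on_subset_banach[OF b that]]) (use le that in auto)
  have bs: "b summable_on (I - G)" by (rule summable_on_subset_banach[OF b]) auto
  have split: "infsum f I = sum f G + infsum f (I - G)" if "f summable_on I" for f :: "'i => real"
    using infsum_Un_disjoint[of f G "I - G"] G that summable_on_subset_banach[OF that, of "I - G"]
    by (simp add: Un_absorb1)
  have "((\<lambda>t. \<Sum>i\<in>G. g i t) \<longlongrightarrow> (\<Sum>i\<in>G. 0)) F" by (intro tendsto_sum lim) (use G in auto)
  then have "\<forall>\<^sub>F t in F. (\<Sum>i\<in>G. g i t) < e / 2" using \<open>e > 0\<close> by (intro order_tendstoD) auto
  then show "\<forall>\<^sub>F t in F. dist (\<Sum>\<^sub>\<infinity>i\<in>I. g i t) 0 < e"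
  proof eventually_elim
    case (elim t)
    have "(\<Sum>\<^sub>\<infinity>i\<in>I - G. g i t) \<le> infsum b (I - G)"
      by (rule infsum_mono[OF gs bs]) (use le in auto)
    moreover have "infsum b (I - G) \<le> e / 2" using split[OF b] G(3) by (simp add: dist_real_def)
    moreover have "0 \<le> (\<Sum>\<^sub>\<infinity>i\<in>I. g i t)" by (rule infsum_nonneg) (use le in auto)
    ultimately show ?case using split[OF gs[OF order_refl], of t] elim by (simp add: dist_real_def)
  qed
qed

definition sum_rep :: "'i set => ('i => ('g::topological_group_add, 'a::complex_vector) urep) => ('g, 'i => 'a) urep" where
  "sum_rep I R = \<lparr>rep_space = hilbert_sum I (\<lambda>i. rep_space (R i)),
     rep_op = (\<lambda>s f. if f \<in> hcarrier (hilbert_sum I (\<lambda>i. rep_space (R i)))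
       then (\<lambda>i. if i \<in> I then rep_op (R i) s (f i) else 0) else 0)\<rparr>"

lemma rep_space_sum_rep: "rep_space (sum_rep I R) = hilbert_sum I (\<lambda>i. rep_space (R i))"
  by (simp add: sum_rep_def)

lemma sum_rep_op:
  "f \<in> hcarrier (rep_space (sum_rep I R)) ==> i \<in> I ==> rep_op (sum_rep I R) s f i = rep_op (R i) s (f i)"
  by (simp add: sum_rep_def)

text \<open>All properties are componentwise, except strong continuity, for which \<open>4 (nm (f
  i))\<^sup>2\<close> dominates \<open>(nm (U t f i - U s f i))\<^sup>2\<close>.\<close>

lemma unitary_sum_rep:
  assumes R: "\<And>i. i \<in> I ==> unitary_rep (R i)"
  shows "unitary_rep (sum_rep I R)"
proof -
  have u: "urep (R i)" if "i \<in> I" for i using R[OF that] by unfold_locales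
  interpret hsum I "\<lambda>i. rep_space (R i)"
    by unfold_locales (use R in \<open>auto simp: unitary_rep_def\<close>)
  define W where "W s f = (if f \<in> hcarrier S then (\<lambda>i. if i \<in> I then rep_op (R i) s (f i) else 0) else 0)" for s f
  have e: "rep_op (sum_rep I R) = W" "rep_space (sum_rep I R) = S"
    by (auto simp: sum_rep_def W_def fun_eq_iff)
  have Win: "W s f \<in> hcarrier S" if f: "f \<in> hcarrier S" for s f
    unfolding in_sum_iff
  proof (intro conjI ballI allI impI)
    show "W s f i \<in> hcarrier (rep_space (R i))" if i: "i \<in> I" for i
      using urep.rep_in[OF u[OF i] in_sumD(1)[OF f i]] f i by (simp add: W_def)
    show "(\<lambda>i. (hnorm (rep_space (R i)) (W s f i))\<^sup>2) summable_on I"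
      using in_sumD(3)[OF f]
      by (rule summable_on_cong[THEN iffD1, rotated]) (use f urep.rep_nm[OF u in_sumD(1)[OF f]] in \<open>simp add: W_def\<close>)
  qed (simp add: W_def f)
  interpret A: hilb S by (rule hilbert_sum)
  have Wi: "W s f i = rep_op (R i) s (f i)" if "f \<in> hcarrier S" "i \<in> I" for s f i using that by (simp add: W_def)
  show ?thesis
  proof (rule unitary_repI; unfold e)
    show "hilb S" by (rule hilbert_sum)
    show "W s f \<in> hcarrier S" if "f \<in> hcarrier S" for s f by (rule Win[OF that])
    show "W s f = 0" if "f \<notin> hcarrier S" for s f using that by (simp add: W_def)
    show "W s (f + g) = W s f + W s g" if f: "f \<in> hcarrier S" and g: "g \<in> hcarrier S" for s f g
      using f g add_in_sum[OF f g] urep.rep_bounded[OF u]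
      by (auto simp: W_def fun_eq_iff hilb.op_add[OF summand urep.rep_bounded[OF u] in_sumD(1)[OF f] in_sumD(1)[OF g]])
    show "W s (c *\<^sub>C f) = c *\<^sub>C W s f" if f: "f \<in> hcarrier S" for s c f
      using f scale_in_sum[OF f, of c] urep.rep_bounded[OF u]
      by (auto simp: W_def fun_eq_iff scaleC_fun_def hilb.op_scale[OF summand urep.rep_bounded[OF u] in_sumD(1)[OF f]])
    show "hinner S (W s f) (W s g) = hinner S f g" if f: "f \<in> hcarrier S" and g: "g \<in> hcarrier S" for s f g
      by (rule hinner_sumI[OF ip_has_sum[OF f g]])
        (use f g urep.rep_ip[OF u in_sumD(1)[OF f] in_sumD(1)[OF g]] in \<open>simp add: Wi\<close>)
    show "W (s + t) f = W s (W t f)" if f: "f \<in> hcarrier S" for s t f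
      using f Win[OF f, of t] by (auto simp: W_def fun_eq_iff urep.rep_mult'[OF u])
    show "W 0 f = f" if f: "f \<in> hcarrier S" for f
      using f in_sumD(2)[OF f] urep.rep_0[OF u in_sumD(1)[OF f]] by (auto simp: W_def fun_eq_iff)
    show "((\<lambda>t. hnorm S (W t f - W s f)) \<longlongrightarrow> 0) (at s)" if f: "f \<in> hcarrier S" for f s
    proof -
      let ?g = "\<lambda>i t. (hnorm (rep_space (R i)) (rep_op (R i) t (f i) - rep_op (R i) s (f i)))\<^sup>2"
      have d: "W t f - W s f \<in> hcarrier S" for t using Win[OF f] A.diff_in by blast
      have eq: "(hnorm S (W t f - W s f))\<^sup>2 = (\<Sum>\<^sub>\<infinity>i\<in>I. ?g i t)" for t
        using infsumI[OF nm_sq_has_sum[OF d[of t]]] f by (simp add: Wi cong: infsum_cong)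
      have "((\<lambda>t. \<Sum>\<^sub>\<infinity>i\<in>I. ?g i t) \<longlongrightarrow> 0) (at s)"
      proof (rule infsum_dominated_tendsto_0)
        show "(\<lambda>i. 4 * (hnorm (rep_space (R i)) (f i))\<^sup>2) summable_on I"
          by (intro summable_on_cmult_right in_sumD f)
        fix i assume i: "i \<in> I"
        interpret urep "R i" by (rule u[OF i])
        have fi: "f i \<in> cr" by (rule in_sumD(1)[OF f i])
        show "(?g i \<longlongrightarrow> 0) (at s)" using tendsto_power[OF rep_cont[OF fi, of s], of 2] by simp
        fix t
        have "nm (U t (f i) - U s (f i)) \<le> 2 * nm (f i)"
          using nm_diff_triangle[of "U t (f i)" "U s (f i)"] fi by (simp add: rep_nm)
        then have "?g i t \<le> (2 * nm (f i))\<^sup>2" using fi by (intro power_mono) auto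
        then show "0 \<le> ?g i t \<and> ?g i t \<le> 4 * (nm (f i))\<^sup>2" by (simp add: power_mult_distrib)
      qed
      then have "((\<lambda>t. sqrt ((hnorm S (W t f - W s f))\<^sup>2)) \<longlongrightarrow> sqrt 0) (at s)"
        unfolding eq by (rule tendsto_real_sqrt)
      then show ?thesis using A.nm_ge_0[OF d] by simp
    qed
  qed
qed

definition univ :: "('g::topological_group_add, 'g univ_vector) urep" where
  "univ = sum_rep {\<rho>. unitary_rep \<rho>} (\<lambda>\<rho>. \<rho>)"

lemma rep_space_univ: "rep_space univ = univ_space"
  by (simp add: univ_def rep_space_sum_rep univ_space_def)

lemma rep_op_univ: "rep_op univ = univ_rep"
  by (auto simp: univ_def sum_rep_def univ_rep_def univ_space_def fun_eq_iff)

global_interpretation univ: urep "univ :: ('g::topological_group_add, 'g univ_vector) urep"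
  rewrites "rep_space (univ :: ('g, 'g univ_vector) urep) = univ_space"
    and "rep_op (univ :: ('g, 'g univ_vector) urep) = univ_rep"
proof -
  show "urep (univ :: ('g, 'g univ_vector) urep)"
    unfolding univ_def by unfold_locales (rule unitary_sum_rep, simp)
qed (simp_all add: rep_space_univ rep_op_univ)

lemma univ_summand_hsum: "hsum {\<rho> :: 'g::topological_group_add small_urep. unitary_rep \<rho>} rep_space"
  by unfold_locales (simp add: unitary_rep_def)

lemma small_rep_in_univ:
  fixes \<sigma> :: "'g::topological_group_add small_urep"
  assumes \<sigma>: "unitary_rep \<sigma>"
  shows "\<exists>J. (\<forall>x\<in>hcarrier (rep_space \<sigma>). J x \<in> Hu) \<and>
    (\<forall>s. \<forall>x\<in>hcarrier (rep_space \<sigma>). \<forall>y\<in>hcarrier (rep_space \<sigma>).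
      ipu (univ_rep s (J x)) (J y) = hinner (rep_space \<sigma>) (rep_op \<sigma> s x) y)"
proof -
  interpret S: hsum "{\<rho> :: 'g small_urep. unitary_rep \<rho>}" rep_space by (rule univ_summand_hsum)
  have u: "S.S = univ_space" by (simp add: univ_space_def)
  have \<sigma>in: "\<sigma> \<in> {\<rho>. unitary_rep \<rho>}" using \<sigma> by simp
  note sin = S.single_in[OF \<sigma>in, unfolded u] and sip = S.ip_single_right[OF \<sigma>in, unfolded u]
  have "ipu (univ_rep s (S.single \<sigma> x)) (S.single \<sigma> y) = hinner (rep_space \<sigma>) (rep_op \<sigma> s x) y"
    if "x \<in> hcarrier (rep_space \<sigma>)" "y \<in> hcarrier (rep_space \<sigma>)" for s x y
  proof -
    have "univ_rep s (S.single \<sigma> x) \<sigma> = rep_op \<sigma> s x"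
      using sin[OF that(1)] \<sigma> by (simp add: univ_rep_def S.single_def)
    then show ?thesis using sip[OF that(2) univ.rep_in[OF sin[OF that(1)], of s]] by simp
  qed
  then show ?thesis using sin by blast
qed

context urep
begin

lemma cyclic_in_univ:
  assumes v: "v \<in> cr"
  shows "\<exists>J. (\<forall>x\<in>cyc v. J x \<in> Hu) \<and>
    (\<forall>s. \<forall>x\<in>cyc v. \<forall>y\<in>cyc v. ipu (univ_rep s (J x)) (J y) = ip (U s x) y)"
proof -
  obtain \<sigma> :: "'g small_urep" and T where \<sigma>: "unitary_rep \<sigma>" "\<And>x. x \<in> cyc v ==> T x \<in> hcarrier (rep_space \<sigma>)"
    "\<And>x y. x \<in> cyc v ==> y \<in> cyc v ==> hinner (rep_space \<sigma>) (T x) (T y) = ip x y"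
    "\<And>s x. x \<in> cyc v ==> rep_op \<sigma> s (T x) = T (U s x)"
    using cyclic_small_rep[OF v] by blast
  obtain J where J: "\<And>x. x \<in> hcarrier (rep_space \<sigma>) ==> J x \<in> Hu"
    "\<And>s x y. x \<in> hcarrier (rep_space \<sigma>) ==> y \<in> hcarrier (rep_space \<sigma>) ==>
      ipu (univ_rep s (J x)) (J y) = hinner (rep_space \<sigma>) (rep_op \<sigma> s x) y"
    using small_rep_in_univ[OF \<sigma>(1)] by metis
  have "ipu (univ_rep s (J (T x))) (J (T y)) = ip (U s x) y" if "x \<in> cyc v" "y \<in> cyc v" for s x y
    by (simp only: J(2)[OF \<sigma>(2)[OF that(1)] \<sigma>(2)[OF that(2)]] \<sigma>(4)[OF that(1)]
        \<sigma>(3)[OF cyc_invariant[OF v that(1)] that(2)])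
  then show ?thesis using J(1)[OF \<sigma>(2)] by (intro exI[of _ "\<lambda>x. J (T x)"]) blast
qed

lemma ip_rep_proj_cyc:
  assumes x: "x \<in> cr" and y: "y \<in> cr"
  shows "ip (U s x) (proj (cyc x) y) = ip (U s x) y"
  using ip_proj'[OF closed_sub_cyc[OF x] y orbit_in_cyc[OF x]] .

text \<open>A coefficient \<open>\<langle>U s x, y\<rangle>\<close> depends only on the component of
  \<open>y\<close> in the cyclic subspace of \<open>x\<close>, and that cyclic representation is
  one of the summands of the universal one.\<close>

lemma coefficient_in_univ:
  assumes x: "x \<in> cr" and y: "y \<in> cr"
  shows "\<exists>\<xi>\<in>Hu. \<exists>\<eta>\<in>Hu. nmu \<xi> \<le> nm x \<and> nmu \<eta> \<le> nm y \<and>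
    (\<forall>s. ipu (univ_rep s \<xi>) \<eta> = ip (U s x) y)"
proof -
  obtain J where J: "\<And>z. z \<in> cyc x ==> J z \<in> Hu"
    "\<And>s z w. z \<in> cyc x ==> w \<in> cyc x ==> ipu (univ_rep s (J z)) (J w) = ip (U s z) w"
    using cyclic_in_univ[OF x] by metis
  have n: "nmu (J z) = nm z" if "z \<in> cyc x" for z
    using J(2)[OF that that, of 0] J(1)[OF that] cyc_carrier[OF x that] by (simp add: hnorm_def)
  have p: "proj (cyc x) y \<in> cyc x" using proj_in[OF closed_sub_cyc[OF x] y] .
  note xc = self_in_cyc[OF x]
  show ?thesis
  proof (rule bexI[of _ "J x"], rule bexI[of _ "J (proj (cyc x) y)"], intro conjI allI)
    show "J x \<in> Hu" "J (proj (cyc x) y) \<in> Hu" using J(1) xc p by blast+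
    show "nmu (J x) \<le> nm x" using n[OF xc] by simp
    show "nmu (J (proj (cyc x) y)) \<le> nm y"
      using n[OF p] nm_proj_le[OF closed_sub_cyc[OF x] y] by simp
    show "ipu (univ_rep s (J x)) (J (proj (cyc x) y)) = ip (U s x) y" for s
      using J(2)[OF xc p] ip_rep_proj_cyc[OF x y] by simp
  qed
qed

text \<open>Finitely many vectors of an arbitrary representation are modelled, jointly, in finitely many
  copies of the universal one. Several copies are needed because the same cyclic representation may
  occur more than once.\<close>

lemma finite_family_in_univ:
  assumes F: "finite F" "F \<subseteq> cr"
  shows "\<exists>m (\<Psi> :: nat => 'a => 'g univ_vector). (\<forall>n<m. \<forall>x\<in>F. \<Psi> n x \<in> Hu) \<and>
    (\<forall>x\<in>F. \<forall>y\<in>F. \<forall>s. ip (U s x) y = (\<Sum>n<m. ipu (univ_rep s (\<Psi> n x)) (\<Psi> n y)))"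
proof -
  obtain m and \<tau> :: "nat => 'a" where \<tau>: "\<And>n. n < m ==> \<tau> n \<in> cr"
    and o: "\<And>n k x y. n < m ==> k < m ==> n \<noteq> k ==> x \<in> cyc (\<tau> n) ==> y \<in> cyc (\<tau> k) ==> ip x y = 0"
    and d: "\<And>x. x \<in> F ==> x = (\<Sum>n<m. proj (cyc (\<tau> n)) x)"
    using cyclic_decomposition[OF F] by metis
  have "\<exists>J. (\<forall>x\<in>cyc (\<tau> n). J x \<in> Hu) \<and>
    (\<forall>s. \<forall>x\<in>cyc (\<tau> n). \<forall>y\<in>cyc (\<tau> n). ipu (univ_rep s (J x)) (J y) = ip (U s x) y)"
    if "n < m" for n using cyclic_in_univ[OF \<tau>[OF that]] .
  then obtain J where J: "\<And>n x. n < m ==> x \<in> cyc (\<tau> n) ==> J n x \<in> Hu"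
    "\<And>n s x y. n < m ==> x \<in> cyc (\<tau> n) ==> y \<in> cyc (\<tau> n) ==>
      ipu (univ_rep s (J n x)) (J n y) = ip (U s x) y" by metis
  let ?P = "\<lambda>n x. proj (cyc (\<tau> n)) x"
  have Fc: "x \<in> cr" if "x \<in> F" for x using F that by blast
  have P: "?P n x \<in> cyc (\<tau> n)" "?P n x \<in> cr" if "n < m" "x \<in> F" for n x
    using proj_in[OF closed_sub_cyc[OF \<tau>[OF that(1)]] Fc[OF that(2)]] cyc_carrier[OF \<tau>[OF that(1)]] by auto
  have "ip (U s x) y = (\<Sum>n<m. ipu (univ_rep s (J n (?P n x))) (J n (?P n y)))"
    if x: "x \<in> F" and y: "y \<in> F" for s x y
  proof -
    have "ip (U s x) y = ip (U s (\<Sum>n<m. ?P n x)) (\<Sum>k<m. ?P k y)" using d[OF x] d[OF y] by simp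
    also have "\<dots> = ip (\<Sum>n<m. U s (?P n x)) (\<Sum>k<m. ?P k y)"
      by (subst op_sum[OF rep_bounded]) (use P x in auto)
    also have "\<dots> = (\<Sum>n<m. ip (U s (?P n x)) (\<Sum>k<m. ?P k y))"
      using P x y by (intro ip_sum_left sum_in) auto
    also have "\<dots> = (\<Sum>n<m. \<Sum>k<m. ip (U s (?P n x)) (?P k y))"
      using P x y by (intro sum.cong ip_sum_right) auto
    also have "\<dots> = (\<Sum>n<m. \<Sum>k<m. if k = n then ip (U s (?P n x)) (?P n y) else 0)"
    proof (intro sum.cong refl)
      fix n k assume nk: "n \<in> {..<m}" "k \<in> {..<m}"
      show "ip (U s (?P n x)) (?P k y) = (if k = n then ip (U s (?P n x)) (?P n y) else 0)"
        using o[of n k "U s (?P n x)" "?P k y"] nk P x y cyc_invariant[OF \<tau>] by auto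
    qed
    also have "\<dots> = (\<Sum>n<m. ip (U s (?P n x)) (?P n y))" by simp
    also have "\<dots> = (\<Sum>n<m. ipu (univ_rep s (J n (?P n x))) (J n (?P n y)))"
      using J P x y by (intro sum.cong) auto
    finally show ?thesis .
  qed
  then show ?thesis using J P by (intro exI[of _ m] exI[of _ "\<lambda>n x. J n (?P n x)"]) auto
qed

end

subsection \<open>Coefficients of the universal representation\<close>

definition mcoeff :: "'g univ_vector => 'g univ_vector => 'g::topological_group_add => complex" where
  "mcoeff \<xi> \<eta> = (\<lambda>s. ipu (univ_rep s \<xi>) \<eta>)"

lemma coefficient_of_rep:
  fixes \<rho> :: "('g::topological_group_add, 'a::complex_vector) urep"
  assumes "unitary_rep \<rho>" "x \<in> hcarrier (rep_space \<rho>)" "y \<in> hcarrier (rep_space \<rho>)"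
  obtains \<xi> \<eta> where "\<xi> \<in> Hu" "\<eta> \<in> Hu"
    "nmu \<xi> \<le> hnorm (rep_space \<rho>) x" "nmu \<eta> \<le> hnorm (rep_space \<rho>) y"
    "(\<lambda>s. hinner (rep_space \<rho>) (rep_op \<rho> s x) y) = mcoeff \<xi> \<eta>"
proof -
  interpret urep \<rho> by unfold_locales fact
  show ?thesis using coefficient_in_univ[OF assms(2,3)] that by (auto simp: mcoeff_def)
qed

lemma mcoeff_in_FS:
  assumes \<xi>: "\<xi> \<in> Hu" and \<eta>: "\<eta> \<in> Hu"
  shows "mcoeff \<xi> \<eta> \<in> FS"
proof -
  note K = univ.closed_sub_cyc[OF \<xi>]
  obtain \<sigma> :: "'a small_urep" and T where \<sigma>: "unitary_rep \<sigma>" "\<And>x. x \<in> univ.cyc \<xi> ==> T x \<in> hcarrier (rep_space \<sigma>)"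
    "\<And>x y. x \<in> univ.cyc \<xi> ==> y \<in> univ.cyc \<xi> ==> hinner (rep_space \<sigma>) (T x) (T y) = ipu x y"
    "\<And>s x. x \<in> univ.cyc \<xi> ==> rep_op \<sigma> s (T x) = T (univ_rep s x)"
    using univ.cyclic_small_rep[OF \<xi>] by blast
  let ?p = "univ.proj (univ.cyc \<xi>) \<eta>"
  have p: "?p \<in> univ.cyc \<xi>" using univ.proj_in[OF K \<eta>] .
  have "mcoeff \<xi> \<eta> = (\<lambda>s. hinner (rep_space \<sigma>) (rep_op \<sigma> s (T \<xi>)) (T ?p))"
    using \<sigma> p univ.self_in_cyc[OF \<xi>] univ.orbit_in_cyc[OF \<xi>] univ.ip_rep_proj_cyc[OF \<xi> \<eta>]
    by (auto simp: mcoeff_def)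
  then show ?thesis unfolding fourier_stieltjes_def using \<sigma> p univ.self_in_cyc[OF \<xi>] by blast
qed

lemma FS_E:
  assumes "u \<in> FS"
  obtains \<xi> \<eta> where "\<xi> \<in> Hu" "\<eta> \<in> Hu" "u = mcoeff \<xi> \<eta>"
proof -
  obtain \<rho> :: "'a small_urep" and x y where "unitary_rep \<rho>" "x \<in> hcarrier (rep_space \<rho>)" "y \<in> hcarrier (rep_space \<rho>)"
    "u = (\<lambda>s. hinner (rep_space \<rho>) (rep_op \<rho> s x) y)"
    using assms unfolding fourier_stieltjes_def by blast
  then show thesis using coefficient_of_rep[of \<rho> x y] that by metis
qed

text \<open>A square-summable family of coefficients is summed by a single coefficient of the direct sum,
  with no loss in the norms.\<close>

lemma coeff_sum_in_FS:
  assumes I: "\<And>i. i \<in> I ==> \<xi> i \<in> Hu" "\<And>i. i \<in> I ==> \<eta> i \<in> Hu"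
    and a: "((\<lambda>i. (nmu (\<xi> i))\<^sup>2) has_sum a) I" and b: "((\<lambda>i. (nmu (\<eta> i))\<^sup>2) has_sum b) I"
  obtains \<xi>' \<eta>' where "\<xi>' \<in> Hu" "\<eta>' \<in> Hu"
    "(nmu \<xi>')\<^sup>2 \<le> a" "(nmu \<eta>')\<^sup>2 \<le> b"
    "\<And>s::'g::topological_group_add. ((\<lambda>i. mcoeff (\<xi> i) (\<eta> i) s) has_sum mcoeff \<xi>' \<eta>' s) I"
proof -
  let ?R = "sum_rep I (\<lambda>_. univ :: ('g, 'g univ_vector) urep)"
  have u: "unitary_rep ?R" by (rule unitary_sum_rep) (rule univ.unitary)
  interpret S: hsum I "\<lambda>_. univ_space :: 'g univ_vector hilbert"
    by unfold_locales (rule univ.hilbert)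
  have sp: "rep_space ?R = S.S" by (simp add: rep_space_sum_rep rep_space_univ)
  define f where "f i = (if i \<in> I then \<xi> i else 0)" for i
  define g where "g i = (if i \<in> I then \<eta> i else 0)" for i
  have f: "f \<in> hcarrier S.S" unfolding S.in_sum_iff f_def
    using I(1) has_sum_imp_summable[OF a] by (simp cong: summable_on_cong)
  have g: "g \<in> hcarrier S.S" unfolding S.in_sum_iff g_def
    using I(2) has_sum_imp_summable[OF b] by (simp cong: summable_on_cong)
  have nf: "(hnorm S.S f)\<^sup>2 = a"
    using S.nm_sq_has_sum[OF f] a by (simp add: f_def cong: has_sum_cong) (blast intro: has_sum_unique)
  have ng: "(hnorm S.S g)\<^sup>2 = b"
    using S.nm_sq_has_sum[OF g] b by (simp add: g_def cong: has_sum_cong) (blast intro: has_sum_unique)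
  obtain \<xi>' \<eta>' where *: "\<xi>' \<in> Hu" "\<eta>' \<in> Hu"
    "nmu \<xi>' \<le> hnorm S.S f" "nmu \<eta>' \<le> hnorm S.S g"
    "(\<lambda>s. hinner S.S (rep_op ?R s f) g) = mcoeff \<xi>' \<eta>'"
    using coefficient_of_rep[OF u, unfolded sp, OF f g] .
  have "((\<lambda>i. mcoeff (\<xi> i) (\<eta> i) s) has_sum mcoeff \<xi>' \<eta>' s) I" for s
  proof -
    have fs: "rep_op ?R s f \<in> hcarrier S.S" using urep.rep_in[of ?R f s] f u by (simp add: urep_def sp)
    have "((\<lambda>i. ipu (rep_op ?R s f i) (g i)) has_sum mcoeff \<xi>' \<eta>' s) I"
      using S.ip_has_sum[OF fs g] fun_cong[OF *(5), of s] by simp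
    then show ?thesis
      using sum_rep_op[of f I "\<lambda>_. univ" _ s] f
      by (simp add: sp mcoeff_def f_def g_def rep_op_univ rep_space_univ cong: has_sum_cong)
  qed
  moreover have "(nmu \<xi>')\<^sup>2 \<le> a" "(nmu \<eta>')\<^sup>2 \<le> b"
    using *(1-4) nf ng power_mono[OF *(3), of 2] power_mono[OF *(4), of 2] by auto
  ultimately show ?thesis using that * by blast
qed

subsection \<open>Tensor products\<close>

text \<open>For an orthonormal basis \<open>B\<close> of the first space, \<open>x \<otimes> y\<close> is
  the family \<open>e \<mapsto> \<langle>x, e\<rangle> y\<close> over \<open>B\<close>. The group
  action on elementary tensors preserves their Gram matrix, hence extends to their closed span,
  which carries the representation.\<close>

lemma tensor_product_rep:
  fixes \<rho> :: "('g::topological_group_add, 'a::complex_vector) urep" and \<sigma> :: "('g, 'b::complex_vector) urep"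
  assumes \<rho>: "unitary_rep \<rho>" and \<sigma>: "unitary_rep \<sigma>"
  shows "\<exists>(\<tau> :: ('g, 'a => 'b) urep) t. unitary_rep \<tau> \<and>
    (\<forall>x\<in>hcarrier (rep_space \<rho>). \<forall>y\<in>hcarrier (rep_space \<sigma>). t x y \<in> hcarrier (rep_space \<tau>)) \<and>
    (\<forall>x\<in>hcarrier (rep_space \<rho>). \<forall>x'\<in>hcarrier (rep_space \<rho>). \<forall>y\<in>hcarrier (rep_space \<sigma>). \<forall>y'\<in>hcarrier (rep_space \<sigma>).
      hinner (rep_space \<tau>) (t x y) (t x' y') = hinner (rep_space \<rho>) x x' * hinner (rep_space \<sigma>) y y') \<and>
    (\<forall>s. \<forall>x\<in>hcarrier (rep_space \<rho>). \<forall>y\<in>hcarrier (rep_space \<sigma>).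
      rep_op \<tau> s (t x y) = t (rep_op \<rho> s x) (rep_op \<sigma> s y))"
proof -
  interpret R: urep \<rho> by unfold_locales fact
  interpret Q: urep \<sigma> by unfold_locales fact
  obtain B where B: "R.orthonormal B"
    and pars: "\<And>x y. x \<in> R.cr ==> y \<in> R.cr ==> ((\<lambda>e. R.ip x e * cnj (R.ip y e)) has_sum R.ip x y) B"
    using R.orthonormal_basis_exists by blast
  interpret S: hsum B "\<lambda>_. rep_space \<sigma>" by unfold_locales (rule Q.hilbert)
  interpret H: hilb S.S by (rule S.hilbert_sum)
  define t where "t x (y::'b) = (\<lambda>e. if e \<in> B then R.ip x e *\<^sub>C y else 0)" for x y
  have tin: "t x y \<in> hcarrier S.S" if x: "x \<in> R.cr" and y: "y \<in> Q.cr" for x y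
    unfolding S.in_sum_iff
  proof (intro conjI ballI allI impI)
    have "((\<lambda>e. Re (R.ip x e * cnj (R.ip x e))) has_sum Re (R.ip x x)) B"
      by (rule has_sum_Re[OF pars[OF x x]])
    then have "(\<lambda>e. (cmod (R.ip x e))\<^sup>2) summable_on B"
      by (auto simp: complex_norm_square[symmetric] simp del: of_real_power dest: has_sum_imp_summable)
    then have "(\<lambda>e. (cmod (R.ip x e))\<^sup>2 * (Q.nm y)\<^sup>2) summable_on B" by (rule summable_on_cmult_left)
    then show "(\<lambda>e. (Q.nm (t x y e))\<^sup>2) summable_on B"
      by (rule summable_on_cong[THEN iffD1, rotated]) (use y in \<open>simp add: t_def Q.nm_scale power_mult_distrib\<close>)
  qed (use y in \<open>auto simp: t_def\<close>)
  have tip: "hinner S.S (t x y) (t x' y') = R.ip x x' * Q.ip y y'"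
    if "x \<in> R.cr" "x' \<in> R.cr" "y \<in> Q.cr" "y' \<in> Q.cr" for x x' y y'
    by (rule S.hinner_sumI[OF has_sum_cmult_left[OF pars[OF that(1,2)]]])
      (use that in \<open>simp add: t_def Q.ip_linear\<close>)
  let ?X = "R.cr \<times> Q.cr"
  define \<phi> where "\<phi> p = t (fst p) (snd p)" for p
  define act where "act s p = (R.U s (fst p), Q.U s (snd p))" for s p
  have act_in: "act s p \<in> ?X" if "p \<in> ?X" for s p using that by (auto simp: act_def)
  have act_mult: "act (r + s) p = act r (act s p)" for r s p by (simp add: act_def R.rep_mult' Q.rep_mult')
  have act_0: "act 0 p = p" if "p \<in> ?X" for p using that by (auto simp: act_def)
  have \<phi>in: "\<phi> p \<in> hcarrier S.S" if "p \<in> ?X" for p using that tin by (auto simp: \<phi>_def)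
  have \<phi>ip: "hinner S.S (\<phi> (act s p)) (\<phi> (act s q)) = hinner S.S (\<phi> p) (\<phi> q)" if "p \<in> ?X" "q \<in> ?X" for s p q
    using that by (auto simp: \<phi>_def act_def tip R.rep_ip Q.rep_ip)
  have \<phi>X: "\<phi> ` ?X \<subseteq> hcarrier S.S" using \<phi>in by blast
  define K where "K = H.clspan (\<phi> ` ?X)"
  note Kcl = H.closed_sub_clspan[OF \<phi>X, folded K_def]
  note Ksub = H.closed_subD(1)[OF Kcl] and Kc = H.closed_subD(2)[OF Kcl]
  have \<phi>K: "\<phi> p \<in> K" if "p \<in> ?X" for p using H.clspan_base[OF \<phi>X] that by (auto simp: K_def)
  define Q where "Q s L J \<longleftrightarrow> (\<forall>v\<in>K. J v \<in> L) \<and>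
    (\<forall>v\<in>K. \<forall>p\<in>?X. hinner S.S (J v) (\<phi> (act s p)) = hinner S.S v (\<phi> p)) \<and>
    (\<forall>v\<in>K. \<forall>w\<in>K. hinner S.S (J v) (J w) = hinner S.S v w) \<and>
    (\<forall>v\<in>K. \<forall>w\<in>K. J (v + w) = J v + J w) \<and> (\<forall>v\<in>K. \<forall>c. J (c *\<^sub>C v) = c *\<^sub>C J v) \<and>
    (\<forall>p\<in>?X. J (\<phi> p) = \<phi> (act s p))" for s L J
  have "\<exists>J. Q s K J" for s
  proof -
    have a: "(\<lambda>p. \<phi> (act s p)) ` ?X \<subseteq> \<phi> ` ?X" using act_in by blast
    have L: "H.clspan ((\<lambda>p. \<phi> (act s p)) ` ?X) \<subseteq> K"
      by (rule H.clspan_minimal[OF Kcl]) (rule image_subsetI, rule \<phi>K, erule act_in)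
    have "\<exists>J. Q s (H.clspan ((\<lambda>p. \<phi> (act s p)) ` ?X)) J"
      unfolding Q_def K_def
      by (rule isometric_extension[OF H.hilb_axioms H.hilb_axioms \<phi>X order_trans[OF a \<phi>X] \<phi>ip])
    then obtain J where "Q s (H.clspan ((\<lambda>p. \<phi> (act s p)) ` ?X)) J" by (elim exE)
    then have "Q s K J" using L unfolding Q_def by (elim conjE) (intro conjI; (assumption | blast))
    then show ?thesis by (rule exI[of _ J])
  qed
  then obtain V where "\<And>s. Q s K (V s)" by metis
  note V = this[unfolded Q_def]
  note V = V[THEN conjunct1, rule_format]
    V[THEN conjunct2, THEN conjunct1, THEN bspec, THEN bspec]
    V[THEN conjunct2, THEN conjunct2, THEN conjunct1, THEN bspec, THEN bspec]
    V[THEN conjunct2, THEN conjunct2, THEN conjunct2, THEN conjunct1, THEN bspec, THEN bspec]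
    V[THEN conjunct2, THEN conjunct2, THEN conjunct2, THEN conjunct2, THEN conjunct1, THEN bspec, THEN spec]
    V[THEN conjunct2, THEN conjunct2, THEN conjunct2, THEN conjunct2, THEN conjunct2, THEN bspec]
  have V2: "hinner S.S (V s v) (\<phi> q) = hinner S.S v (\<phi> (act (- s) q))" if "v \<in> K" "q \<in> ?X" for s v q
    using V(2)[OF that(1) act_in[OF that(2), of "- s"], of s] act_mult[of s "- s" q] act_0[OF that(2)] by simp
  have uniq: "v = w" if "v \<in> K" "w \<in> K" and eq: "\<And>q. q \<in> ?X ==> hinner S.S v (\<phi> q) = hinner S.S w (\<phi> q)" for v w
  proof -
    have d: "v - w \<in> K" using complex_vector.subspace_diff[OF Ksub \<open>v \<in> K\<close> \<open>w \<in> K\<close>] .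
    have "hinner S.S (\<phi> q) (v - w) = 0" if q: "q \<in> ?X" for q
      using eq[OF q] Kc[OF \<open>v \<in> K\<close>] Kc[OF \<open>w \<in> K\<close>] \<phi>in[OF q] H.ip_commute[OF Kc[OF d] \<phi>in[OF q]]
      by (simp add: H.ip_linear)
    then have "hinner S.S (v - w) (v - w) = 0"
      using H.clspan_orth[OF \<phi>X Kc[OF d]] d unfolding K_def by blast
    then show ?thesis using H.ip_eq_0D[OF Kc[OF d]] by simp
  qed
  have diff: "v - w \<in> K" "V s (v - w) = V s v - V s w" if "v \<in> K" "w \<in> K" for s v w
    using complex_vector.subspace_diff[OF Ksub that] V(4)[OF that(1) complex_vector.subspace_scale[OF Ksub that(2), of "-1"]]
      V(5)[OF that(2), of s "-1"]
    by (simp_all add: complex_vector.scale_minus_left scaleC_one)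
  have Vnm: "hnorm S.S (V s v) = hnorm S.S v" if "v \<in> K" for s v using V(3)[OF that that] by (simp add: hnorm_def)
  have cont: "((\<lambda>r. hnorm S.S (V r v - V s v)) \<longlongrightarrow> 0) (at s)" if v: "v \<in> K" for s v
  proof -
    let ?L = "{v \<in> K. ((\<lambda>r. hnorm S.S (V r v - V s v)) \<longlongrightarrow> 0) (at s)}"
    have "H.closed_sub ?L" unfolding H.closed_sub_def
    proof (intro conjI ballI impI)
      show "?L \<subseteq> hcarrier S.S" using Kc by auto
      show "complex_vector.subspace ?L"
      proof (rule complex_vector.subspaceI)
        have "V r 0 = 0" for r using V(5)[OF complex_vector.subspace_0[OF Ksub], of r 0] by simp
        then show "0 \<in> ?L" using complex_vector.subspace_0[OF Ksub] by simp
        fix x y assume x: "x \<in> ?L" and y: "y \<in> ?L"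
        then have xK: "x \<in> K" and yK: "y \<in> K" by auto
        have "((\<lambda>r. hnorm S.S (V r (x + y) - V s (x + y))) \<longlongrightarrow> 0) (at s)"
        proof (rule Lim_null_comparison)
          show "((\<lambda>r. hnorm S.S (V r x - V s x) + hnorm S.S (V r y - V s y)) \<longlongrightarrow> 0) (at s)"
            using x y by (intro tendsto_add_zero) auto
          have "hnorm S.S (V r (x + y) - V s (x + y)) \<le> hnorm S.S (V r x - V s x) + hnorm S.S (V r y - V s y)"
            "0 \<le> hnorm S.S (V r (x + y) - V s (x + y))" for r
            using H.triangle[of "V r x - V s x" "V r y - V s y"] xK yK V(1) Kc H.nm_ge_0
            by (simp_all add: V(4) algebra_simps)
          then show "\<forall>\<^sub>F r in at s. norm (hnorm S.S (V r (x + y) - V s (x + y)))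
            \<le> hnorm S.S (V r x - V s x) + hnorm S.S (V r y - V s y)" by simp
        qed
        then show "x + y \<in> ?L" using complex_vector.subspace_add[OF Ksub xK yK] by simp
      next
        fix c x assume x: "x \<in> ?L"
        then have xK: "x \<in> K" by auto
        have "hnorm S.S (V r (c *\<^sub>C x) - V s (c *\<^sub>C x)) = cmod c * hnorm S.S (V r x - V s x)" for r
          using H.nm_scale[of "V r x - V s x" c] V(1)[OF xK] Kc V(5)[OF xK]
          by (simp add: complex_vector.scale_right_diff_distrib)
        then show "c *\<^sub>C x \<in> ?L" using x tendsto_mult_right_zero complex_vector.subspace_scale[OF Ksub xK]
          by auto
      qed
      fix x assume x: "x \<in> hcarrier S.S" "\<forall>e>0. \<exists>y\<in>?L. hnorm S.S (x - y) < e"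
      have xK: "x \<in> K" by (rule H.closed_subD(3)[OF Kcl x(1)]) (use x(2) in blast)
      have "((\<lambda>r. hnorm S.S (V r x - V s x)) \<longlongrightarrow> 0) (at s)"
      proof (rule tendstoI)
        fix e :: real assume "e > 0"
        then obtain y where y: "y \<in> ?L" "hnorm S.S (x - y) < e / 3" using x(2) by (meson zero_less_divide_iff zero_less_numeral)
        then have yK: "y \<in> K" by auto
        have "\<forall>\<^sub>F r in at s. hnorm S.S (V r y - V s y) < e / 3"
          using y \<open>e > 0\<close> by (intro order_tendstoD(2)[of _ 0]) auto
        then show "\<forall>\<^sub>F r in at s. dist (hnorm S.S (V r x - V s x)) 0 < e"
        proof eventually_elim
          case (elim r)
          have i: "V r x \<in> hcarrier S.S" "V s x \<in> hcarrier S.S" "V r y \<in> hcarrier S.S" "V s y \<in> hcarrier S.S"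
            using V(1) xK yK Kc by auto
          have a: "hnorm S.S (V r x - V r y) = hnorm S.S (x - y)" "hnorm S.S (V s x - V s y) = hnorm S.S (x - y)"
            using diff[OF xK yK] Vnm by (metis, metis)
          have b: "hnorm S.S (V s y - V s x) = hnorm S.S (V s x - V s y)" by (rule H.nm_diff_commute[OF i(4,2)])
          have "hnorm S.S (V r x - V s x) \<le> hnorm S.S (V r x - V r y) + hnorm S.S (V r y - V s x)"
            by (rule H.triangle_diff[OF i(1,3,2)])
          also have "hnorm S.S (V r y - V s x) \<le> hnorm S.S (V r y - V s y) + hnorm S.S (V s y - V s x)"
            by (rule H.triangle_diff[OF i(3,4,2)])
          finally have "hnorm S.S (V r x - V s x) < e" using a b y(2) elim by linarith
          then show ?case using H.nm_ge_0[OF H.diff_in[OF i(1,2)]] by simp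
        qed
      qed
      then show "x \<in> ?L" using xK by simp
    qed
    moreover have "\<phi> p \<in> ?L" if p: "p \<in> ?X" for p
    proof -
      obtain x y where xy: "p = (x, y)" "x \<in> R.cr" "y \<in> Q.cr" using p by auto
      have "((\<lambda>r. Re (R.ip (R.U r x) (R.U s x) * Q.ip (Q.U r y) (Q.U s y))) \<longlongrightarrow>
        Re (R.ip (R.U s x) (R.U s x) * Q.ip (Q.U s y) (Q.U s y))) (at s)"
        by (intro tendsto_Re tendsto_mult R.tendsto_ip_left Q.tendsto_ip_left R.rep_cont Q.rep_cont)
          (use xy in auto)
      then have lim: "((\<lambda>r. sqrt (2 * Re (R.ip (R.U s x) (R.U s x) * Q.ip (Q.U s y) (Q.U s y)) -
          2 * Re (R.ip (R.U r x) (R.U s x) * Q.ip (Q.U r y) (Q.U s y)))) \<longlongrightarrow>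
        sqrt (2 * Re (R.ip (R.U s x) (R.U s x) * Q.ip (Q.U s y) (Q.U s y)) -
          2 * Re (R.ip (R.U s x) (R.U s x) * Q.ip (Q.U s y) (Q.U s y)))) (at s)"
        by (intro tendsto_real_sqrt tendsto_diff tendsto_mult tendsto_const)
      have "hnorm S.S (V r (\<phi> p) - V s (\<phi> p)) =
        sqrt (2 * Re (R.ip (R.U s x) (R.U s x) * Q.ip (Q.U s y) (Q.U s y)) -
          2 * Re (R.ip (R.U r x) (R.U s x) * Q.ip (Q.U r y) (Q.U s y)))" for r
      proof -
        have i: "V r (\<phi> p) \<in> hcarrier S.S" "V s (\<phi> p) \<in> hcarrier S.S" using V(1)[OF \<phi>K[OF p]] Kc by auto
        have n: "(hnorm S.S (V q (\<phi> p)))\<^sup>2 = Re (R.ip x x * Q.ip y y)" for q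
          using Vnm[OF \<phi>K[OF p], of q] H.nm_sq[OF \<phi>in[OF p]] tip[of x x y y] xy by (simp add: \<phi>_def)
        have "(hnorm S.S (V r (\<phi> p) - V s (\<phi> p)))\<^sup>2 =
          2 * Re (R.ip (R.U s x) (R.U s x) * Q.ip (Q.U s y) (Q.U s y)) -
          2 * Re (R.ip (R.U r x) (R.U s x) * Q.ip (Q.U r y) (Q.U s y))"
          unfolding H.nm_diff_sq[OF i] n using xy p V(6)[OF p]
          by (simp add: \<phi>_def act_def tip R.rep_ip Q.rep_ip)
        then show ?thesis using H.nm_ge_0[OF H.diff_in[OF i]] real_sqrt_unique by metis
      qed
      then show ?thesis using lim \<phi>K[OF p] by simp
    qed
    ultimately have "K \<subseteq> ?L" unfolding K_def by (intro H.clspan_minimal) (auto simp del: mem_Sigma_iff simp: K_def)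
    then show ?thesis using v by blast
  qed
  have "\<exists>\<tau> :: ('g, 'a => 'b) urep. unitary_rep \<tau> \<and> (\<forall>x\<in>K. x \<in> hcarrier (rep_space \<tau>)) \<and>
    (\<forall>x\<in>K. \<forall>y\<in>K. hinner (rep_space \<tau>) x y = hinner S.S x y) \<and>
    (\<forall>s. \<forall>x\<in>K. rep_op \<tau> s x = V s x)"
  proof (rule transported_rep[OF H.hilb_axioms Kcl, where T = "\<lambda>x. x"])
    show "V (r + s) v = V r (V s v)" if "v \<in> K" for r s v
    proof (rule uniq)
      show "hinner S.S (V (r + s) v) (\<phi> q) = hinner S.S (V r (V s v)) (\<phi> q)" if q: "q \<in> ?X" for q
        using V2[OF \<open>v \<in> K\<close> q, of "r + s"] V2[OF V(1)[OF \<open>v \<in> K\<close>] q] V2[OF \<open>v \<in> K\<close> act_in[OF q]]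
          act_mult[of "- s" "- r" q] by (simp add: minus_add)
    qed (use V(1) that in auto)
    show "V 0 v = v" if "v \<in> K" for v
      by (rule uniq) (use V(1) V2[OF that, of _ 0] act_0 that in \<open>auto simp del: mem_Sigma_iff\<close>)
  qed (use V cont in auto)
  then obtain \<tau> :: "('g, 'a => 'b) urep" where \<tau>: "unitary_rep \<tau>" "\<And>x. x \<in> K ==> x \<in> hcarrier (rep_space \<tau>)"
    "\<And>x y. x \<in> K ==> y \<in> K ==> hinner (rep_space \<tau>) x y = hinner S.S x y"
    "\<And>s x. x \<in> K ==> rep_op \<tau> s x = V s x" by blast
  have tK: "t x y \<in> K" if "x \<in> R.cr" "y \<in> Q.cr" for x y using \<phi>K[of "(x, y)"] that by (simp add: \<phi>_def)
  have "rep_op \<tau> s (t x y) = t (R.U s x) (Q.U s y)" if "x \<in> R.cr" "y \<in> Q.cr" for s x y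
    using \<tau>(4)[OF tK[OF that]] V(6)[of "(x, y)"] that by (simp add: \<phi>_def act_def)
  then show ?thesis using \<tau> tK tip by (intro exI[of _ \<tau>] exI[of _ t]) auto
qed

section \<open>The pairing with the universal von Neumann algebra\<close>

lemma vn_bounded: "A \<in> VN ==> A \<in> Bu"
  by (simp add: univ_vn_algebra_def commutant_def)

lemma vn_in [simp, intro]: "A \<in> VN ==> x \<in> Hu ==> A x \<in> Hu"
  using univ.op_in[OF vn_bounded] .

lemma vn_commute:
  assumes "A \<in> VN" "T \<in> Bu" "\<And>s. T \<circ> univ_rep s = univ_rep s \<circ> T"
  shows "A (T x) = T (A x)"
proof -
  have "T \<in> commutant univ_space (range univ_rep)" using assms(2,3) by (auto simp: commutant_def)
  then have "A \<circ> T = T \<circ> A" using assms(1) by (auto simp: univ_vn_algebra_def commutant_def)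
  then show ?thesis by (metis comp_apply)
qed

lemma vnI:
  fixes A :: "'g::topological_group_add univ_op"
  assumes A: "A \<in> Bu"
    and "\<And>(T :: 'g univ_op) (x :: 'g univ_vector). T \<in> Bu ==> (\<And>s. T \<circ> univ_rep s = univ_rep s \<circ> T) ==>
      x \<in> Hu ==> A (T x) = T (A x)"
  shows "A \<in> VN"
proof -
  have "A \<circ> T = T \<circ> A" if "T \<in> commutant univ_space (range univ_rep)" for T :: "'g univ_op"
  proof
    have T: "T \<in> Bu" "\<And>s. T \<circ> univ_rep s = univ_rep s \<circ> T"
      using that by (auto simp: commutant_def)
    fix x show "(A \<circ> T) x = (T \<circ> A) x"
      by (cases "x \<in> Hu")
        (use assms(2)[OF T] univ.op_outside[OF A] univ.op_outside[OF T(1)] univ.op_zero[OF A] univ.op_zero[OF T(1)] in auto)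
  qed
  then show ?thesis using A by (simp add: univ_vn_algebra_def commutant_def)
qed

lemma univ_rep_in_vn: "univ_rep s \<in> VN"
  by (rule vnI[OF univ.rep_bounded]) (metis comp_apply)

text \<open>The commutant of the representation is closed under adjoints, as unitaries are inverted by their
  adjoints.\<close>

lemma commutes_adj:
  fixes T :: "'g::topological_group_add univ_op"
  assumes T: "T \<in> Bu" and c: "\<And>s. T \<circ> univ_rep s = univ_rep s \<circ> T"
  shows "univ.adj T \<circ> univ_rep s = univ_rep s \<circ> univ.adj T"
proof (rule univ.op_eqI)
  note T' = univ.adj_bounded[OF T]
  show "univ.adj T \<circ> univ_rep s \<in> Bu" "univ_rep s \<circ> univ.adj T \<in> Bu"
    by (intro univ.comp_bounded T' univ.rep_bounded)+
  fix x y :: "'g univ_vector" assume x: "x \<in> Hu" and y: "y \<in> Hu"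
  have "univ_rep (- s) (T y) = T (univ_rep (- s) y)" using c[of "- s"] by (metis comp_apply)
  then show "ipu ((univ.adj T \<circ> univ_rep s) x) y = ipu ((univ_rep s \<circ> univ.adj T) x) y"
    using x y T T' by (simp add: univ.ip_adj univ.rep_ip_adj)
qed

lemma vn_adj:
  fixes A :: "'g::topological_group_add univ_op"
  assumes A: "A \<in> VN"
  shows "univ.adj A \<in> VN"
proof (rule vnI)
  note Ab = vn_bounded[OF A]
  show Ab': "univ.adj A \<in> Bu" by (rule univ.adj_bounded[OF Ab])
  fix T :: "'g univ_op" and x :: "'g univ_vector"
  assume T: "T \<in> Bu" "\<And>s. T \<circ> univ_rep s = univ_rep s \<circ> T"
    and x: "x \<in> Hu"
  show "univ.adj A (T x) = T (univ.adj A x)"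
  proof (rule univ.eqI)
    note T' = univ.adj_bounded[OF T(1)]
    fix z :: "'g univ_vector" assume z: "z \<in> Hu"
    have "A (univ.adj T z) = univ.adj T (A z)" by (rule vn_commute[OF A T' commutes_adj[OF T]])
    then show "ipu (univ.adj A (T x)) z = ipu (T (univ.adj A x)) z"
      using x z T(1) T' Ab Ab' univ.ip_adj[OF Ab] univ.ip_adj'[OF T(1)] by (metis univ.op_in)
  qed (use x T(1) Ab' in auto)
qed

text \<open>The amplification of a member of the double commutant to a Hilbert sum of copies of the
  universal space commutes with every projection that commutes with the amplified representation: the
  matrix entries of such a projection lie in the commutant. Applied to the projection onto the cyclic
  subspace of \<open>\<xi>\<close>, this is the step of von Neumann's density theorem that is needed.\<close>

lemma vector_functional_determined:
  fixes \<xi> \<eta> :: "'i => 'g::topological_group_add univ_vector"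
  assumes \<xi>: "\<xi> \<in> hcarrier (hilbert_sum I (\<lambda>_. univ_space))" and \<eta>: "\<eta> \<in> hcarrier (hilbert_sum I (\<lambda>_. univ_space))"
    and zero: "\<And>s. (\<Sum>\<^sub>\<infinity>i\<in>I. ipu (univ_rep s (\<xi> i)) (\<eta> i)) = 0"
    and A: "A \<in> VN"
  shows "(\<Sum>\<^sub>\<infinity>i\<in>I. ipu (A (\<xi> i)) (\<eta> i)) = 0"
proof -
  interpret S: hsum I "\<lambda>_. univ_space :: 'g univ_vector hilbert" by unfold_locales (rule univ.hilbert)
  let ?R = "sum_rep I (\<lambda>_. univ :: ('g, 'g univ_vector) urep)"
  have sp: "rep_space ?R = S.S" by (simp add: rep_space_sum_rep rep_space_univ)
  have u: "urep ?R" by unfold_locales (rule unitary_sum_rep, rule univ.unitary)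
  interpret R: urep ?R rewrites "rep_space ?R = S.S" by (rule u, rule sp)
  have Ri: "rep_op ?R s f i = univ_rep s (f i)" if "f \<in> hcarrier S.S" "i \<in> I" for s f i
    using sum_rep_op[of f I "\<lambda>_. univ" i s] that by (simp add: sp rep_op_univ)
  note Ab = vn_bounded[OF A]
  note A' = vn_adj[OF A]
  define amp where "amp f = (\<lambda>i. A (f i))" for f :: "'i => 'g univ_vector"
  obtain C where C: "C \<ge> 0" "\<And>x. x \<in> Hu ==> nmu (A x) \<le> C * nmu x"
    using univ.op_bound[OF Ab] by blast
  have amp: "amp f \<in> hcarrier S.S" if f: "f \<in> hcarrier S.S" for f
    unfolding S.in_sum_iff
  proof (intro conjI ballI allI impI)
    show "amp f i \<in> Hu" if "i \<in> I" for i using S.in_sumD(1)[OF f that] A by (auto simp: amp_def)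
    show "amp f i = 0" if "i \<notin> I" for i using S.in_sumD(2)[OF f that] univ.op_zero[OF Ab] by (simp add: amp_def)
    show "(\<lambda>i. (nmu (amp f i))\<^sup>2) summable_on I"
    proof (rule summable_on_comparison_test)
      show "(\<lambda>i. C\<^sup>2 * (nmu (f i))\<^sup>2) summable_on I"
        by (intro summable_on_cmult_right S.in_sumD f)
      show "(nmu (amp f i))\<^sup>2 \<le> C\<^sup>2 * (nmu (f i))\<^sup>2" if i: "i \<in> I" for i
        using power_mono[OF C(2)[OF S.in_sumD(1)[OF f i]], of 2] S.in_sumD(1)[OF f i] A
        by (simp add: amp_def power_mult_distrib)
    qed auto
  qed
  let ?K = "R.cyc \<xi>"
  let ?P = "R.proj ?K"
  note K = R.closed_sub_cyc[OF \<xi>]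
  have P: "?P f \<in> hcarrier S.S" if "f \<in> hcarrier S.S" for f using R.proj_carrier[OF K that] .
  have "hinner S.S y \<eta> = 0" if y: "y \<in> ?K" for y
  proof (rule R.clspan_orth[OF R.orbit_carrier[OF \<xi>] \<eta> _ y[unfolded R.cyc_def]])
    fix z assume "z \<in> range (\<lambda>s. rep_op ?R s \<xi>)"
    then obtain s where s: "z = rep_op ?R s \<xi>" by blast
    have "hinner S.S z \<eta> = (\<Sum>\<^sub>\<infinity>i\<in>I. ipu (univ_rep s (\<xi> i)) (\<eta> i))"
      unfolding S.hinner_sum s using Ri[OF \<xi>] by (simp cong: infsum_cong)
    then show "hinner S.S z \<eta> = 0" using zero by simp
  qed
  then have P\<eta>: "?P \<eta> = 0"
    using R.ip_commute[OF R.cyc_carrier[OF \<xi>] \<eta>] by (intro R.proj_eq_0[OF K \<eta>]) (metis complex_cnj_zero)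
  have commute: "?P (amp f) = amp (?P f)" if f: "f \<in> hcarrier S.S" for f
  proof
    fix i show "?P (amp f) i = amp (?P f) i"
    proof (cases "i \<in> I")
      case i: True
      note sin = S.single_in[OF i]
      define T where "T j x = (if x \<in> Hu then ?P (S.single i x) j else 0)" for j x
      have add: "S.single i (x + y) = S.single i x + S.single i y" for x y :: "'g univ_vector"
        by (auto simp: S.single_def fun_eq_iff)
      have scale: "S.single i (c *\<^sub>C x) = c *\<^sub>C S.single i x" for c and x :: "'g univ_vector"
        by (auto simp: S.single_def fun_eq_iff scaleC_fun_def)
      have Tb: "T j \<in> Bu" if j: "j \<in> I" for j
      proof (rule univ.bounded_opsI[where C = 1])
        show "T j x \<in> Hu" if "x \<in> Hu" for x
          using S.in_sumD(1)[OF P[OF sin[OF that]] j] that by (simp add: T_def)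
        show "T j (x + y) = T j x + T j y" if "x \<in> Hu" "y \<in> Hu" for x y
          using that R.proj_add[OF K sin sin, of x y] by (simp add: T_def add univ.add_in)
        show "T j (c *\<^sub>C x) = c *\<^sub>C T j x" if "x \<in> Hu" for c x
          using that R.proj_scale[OF K sin, of x c] univ.scale_in[OF that, of c]
          by (simp add: T_def scale) (simp add: scaleC_fun_def)
        show "nmu (T j x) \<le> 1 * nmu x" if x: "x \<in> Hu" for x
        proof -
          have "nmu (T j x) \<le> \<bar>hnorm S.S (?P (S.single i x))\<bar>"
            using S.nm_component_le[OF P[OF sin[OF x]] j] x by (simp add: T_def)
          also have "\<dots> \<le> hnorm S.S (S.single i x)"
            using R.nm_proj_le[OF K sin[OF x]] R.nm_ge_0[OF P[OF sin[OF x]]] by simp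
          finally show ?thesis using S.nm_single[OF i x] by simp
        qed
      qed (simp add: T_def)
      have Tc: "T j \<circ> univ_rep s = univ_rep s \<circ> T j" if j: "j \<in> I" for j s
      proof (rule univ.op_eqI[OF univ.comp_bounded[OF Tb[OF j] univ.rep_bounded] univ.comp_bounded[OF univ.rep_bounded Tb[OF j]]])
        fix x y :: "'g univ_vector" assume x: "x \<in> Hu"
        have "rep_op ?R s (S.single i x) = S.single i (univ_rep s x)"
        proof
          fix k show "rep_op ?R s (S.single i x) k = S.single i (univ_rep s x) k"
          proof (cases "k \<in> I")
            case True
            show ?thesis using Ri[OF sin[OF x] True]
              by (simp add: S.single_def univ.op_zero[OF univ.rep_bounded])
          next
            case False
            then show ?thesis using S.in_sumD(2)[OF R.rep_in[OF sin[OF x], of s] False] i by (auto simp: S.single_def)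
          qed
        qed
        then have "?P (S.single i (univ_rep s x)) j = univ_rep s (?P (S.single i x) j)"
          using R.proj_cyc_commute[OF \<xi> sin[OF x], of s] Ri[OF P[OF sin[OF x]] j] by metis
        then show "ipu ((T j \<circ> univ_rep s) x) y = ipu ((univ_rep s \<circ> T j) x) y"
          using x by (simp add: T_def univ.rep_in)
      qed
      have "ipu (?P (amp f) i) y = ipu (amp (?P f) i) y"
        if y: "y \<in> Hu" for y
      proof -
        let ?y = "univ.adj A y"
        have y': "?y \<in> Hu" using A' y by blast
        have "ipu (?P (amp f) i) y = hinner S.S (?P (amp f)) (S.single i y)"
          using S.ip_single_right[OF i y P[OF amp[OF f]]] by simp
        also have "\<dots> = hinner S.S (amp f) (?P (S.single i y))"
          using R.proj_symm[OF K amp[OF f] sin[OF y]] .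
        also have "\<dots> = (\<Sum>\<^sub>\<infinity>j\<in>I. ipu (A (f j)) (T j y))"
          unfolding S.hinner_sum using y by (simp add: amp_def T_def)
        also have "\<dots> = (\<Sum>\<^sub>\<infinity>j\<in>I. ipu (f j) (T j ?y))"
        proof (rule infsum_cong)
          fix j assume j: "j \<in> I"
          have "univ.adj A (T j y) = T j ?y" by (rule vn_commute[OF A' Tb[OF j] Tc[OF j]])
          then show "ipu (A (f j)) (T j y) = ipu (f j) (T j ?y)"
            using univ.ip_adj'[OF Ab S.in_sumD(1)[OF f j] univ.op_in[OF Tb[OF j] y]] by simp
        qed
        also have "\<dots> = hinner S.S f (?P (S.single i ?y))"
          unfolding S.hinner_sum using y' by (simp add: T_def)
        also have "\<dots> = hinner S.S (?P f) (S.single i ?y)"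
          using R.proj_symm[OF K f sin[OF y']] by simp
        also have "\<dots> = ipu (?P f i) ?y"
          using S.ip_single_right[OF i y' P[OF f]] .
        also have "\<dots> = ipu (amp (?P f) i) y"
          using univ.ip_adj'[OF Ab S.in_sumD(1)[OF P[OF f] i] y] by (simp add: amp_def)
        finally show ?thesis .
      qed
      then show ?thesis
        by (intro univ.eqI S.in_sumD(1)[OF _ i] P amp f)
    next
      case False
      then show ?thesis using S.in_sumD(2)[OF _ False] P amp f by metis
    qed
  qed
  have "(\<Sum>\<^sub>\<infinity>i\<in>I. ipu (A (\<xi> i)) (\<eta> i)) = hinner S.S (amp \<xi>) \<eta>"
    by (simp add: S.hinner_sum amp_def)
  also have "\<dots> = hinner S.S (?P (amp \<xi>)) \<eta>"
    using commute[OF \<xi>] R.proj_id[OF K R.self_in_cyc[OF \<xi>]] by simp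
  also have "\<dots> = hinner S.S (amp \<xi>) (?P \<eta>)" by (rule R.proj_symm[OF K amp[OF \<xi>] \<eta>])
  also have "\<dots> = 0" using P\<eta> R.ip_zero_right[OF amp[OF \<xi>]] by simp
  finally show ?thesis .
qed

lemma vn_functional_has_sum:
  fixes \<xi> \<eta> :: "'i => 'g::topological_group_add univ_vector"
  assumes \<xi>: "\<xi> \<in> hcarrier (hilbert_sum I (\<lambda>_. univ_space))" and \<eta>: "\<eta> \<in> hcarrier (hilbert_sum I (\<lambda>_. univ_space))"
    and A: "A \<in> VN"
  shows "(\<lambda>i. ipu (A (\<xi> i)) (\<eta> i)) summable_on I"
proof -
  interpret S: hsum I "\<lambda>_. univ_space :: 'g univ_vector hilbert" by unfold_locales (rule univ.hilbert)
  note Ab = vn_bounded[OF A]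
  obtain C where C: "C \<ge> 0" "\<And>x. x \<in> Hu ==> nmu (A x) \<le> C * nmu x"
    using univ.op_bound[OF Ab] by blast
  show ?thesis
  proof (rule abs_summable_summable, rule summable_on_comparison_test)
    show "(\<lambda>i. C * ((nmu (\<xi> i))\<^sup>2 + (nmu (\<eta> i))\<^sup>2)) summable_on I"
      by (intro summable_on_cmult_right summable_on_add S.in_sumD \<xi> \<eta>)
    fix i assume i: "i \<in> I"
    note c = S.in_sumD(1)[OF \<xi> i] S.in_sumD(1)[OF \<eta> i]
    have n: "0 \<le> nmu (\<xi> i)" "0 \<le> nmu (\<eta> i)" using c by auto
    have "cmod (ipu (A (\<xi> i)) (\<eta> i)) \<le> nmu (A (\<xi> i)) * nmu (\<eta> i)"
      by (rule univ.cauchy_schwarz) (use c A in auto)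
    also have "\<dots> \<le> C * nmu (\<xi> i) * nmu (\<eta> i)"
      using C(2)[OF c(1)] n by (intro mult_right_mono) auto
    also have "\<dots> \<le> C * (2 * nmu (\<xi> i) * nmu (\<eta> i))"
      using C(1) n by (simp add: mult.assoc mult_left_mono)
    also have "\<dots> \<le> C * ((nmu (\<xi> i))\<^sup>2 + (nmu (\<eta> i))\<^sup>2)"
      using C(1) sum_squares_bound by (intro mult_left_mono) auto
    finally show "cmod (ipu (A (\<xi> i)) (\<eta> i)) \<le> \<dots>" .
  qed simp
qed

lemma normal_functionalE:
  assumes "normal_functional univ_space VN \<omega>"
  obtains \<xi> \<eta> :: "nat => 'g::topological_group_add univ_vector"
  where "\<xi> \<in> hcarrier (hilbert_sum UNIV (\<lambda>_. univ_space))" "\<eta> \<in> hcarrier (hilbert_sum UNIV (\<lambda>_. univ_space))"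
    "\<And>A. A \<in> VN ==> ((\<lambda>n. ipu (A (\<xi> n)) (\<eta> n)) has_sum \<omega> A) UNIV"
proof -
  obtain \<xi> \<eta> :: "nat => 'g univ_vector" where r: "range \<xi> \<subseteq> Hu" "range \<eta> \<subseteq> Hu"
    and s: "summable (\<lambda>n. (nmu (\<xi> n))\<^sup>2)" "summable (\<lambda>n. (nmu (\<eta> n))\<^sup>2)"
    and \<omega>: "\<And>A. A \<in> VN ==> \<omega> A = (\<Sum>n. ipu (A (\<xi> n)) (\<eta> n))"
    using assms unfolding normal_functional_def by blast
  have c: "\<xi> \<in> hcarrier (hilbert_sum UNIV (\<lambda>_. univ_space))" "\<eta> \<in> hcarrier (hilbert_sum UNIV (\<lambda>_. univ_space))"
    using r s by (auto simp: hilbert_sum_def summable_on_UNIV_nonneg_real_iff)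
  have "((\<lambda>n. ipu (A (\<xi> n)) (\<eta> n)) has_sum \<omega> A) UNIV" if A: "A \<in> VN" for A
    using has_sum_infsum[OF vn_functional_has_sum[OF c A]]
      sums_unique[OF has_sum_imp_sums[OF has_sum_infsum[OF vn_functional_has_sum[OF c A]]]] \<omega>[OF A] by simp
  then show thesis using that c by blast
qed

text \<open>Normal functionals are vector functionals on an amplification, so that agreement on the group
  extends to the von Neumann algebra. This makes the pairing well defined.\<close>

lemma normal_functional_unique:
  fixes \<omega> \<omega>' :: "('g::topological_group_add univ_op) => complex"
  assumes "normal_functional univ_space VN \<omega>" "normal_functional univ_space VN \<omega>'"
    and eq: "\<And>s. \<omega> (univ_rep s) = \<omega>' (univ_rep s)" and A: "A \<in> VN"
  shows "\<omega> A = \<omega>' A"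
proof -
  obtain \<xi> \<eta> :: "nat => 'g univ_vector" where
    x: "\<xi> \<in> hcarrier (hilbert_sum UNIV (\<lambda>_. univ_space))" "\<eta> \<in> hcarrier (hilbert_sum UNIV (\<lambda>_. univ_space))"
    and \<omega>: "\<And>A. A \<in> VN ==> ((\<lambda>n. ipu (A (\<xi> n)) (\<eta> n)) has_sum \<omega> A) UNIV"
    using normal_functionalE[OF assms(1)] by blast
  obtain \<xi>' \<eta>' :: "nat => 'g univ_vector" where
    x': "\<xi>' \<in> hcarrier (hilbert_sum UNIV (\<lambda>_. univ_space))" "\<eta>' \<in> hcarrier (hilbert_sum UNIV (\<lambda>_. univ_space))"
    and \<omega>': "\<And>A. A \<in> VN ==> ((\<lambda>n. ipu (A (\<xi>' n)) (\<eta>' n)) has_sum \<omega>' A) UNIV"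
    using normal_functionalE[OF assms(2)] by blast
  define f where "f = case_sum \<xi> \<xi>'"
  define g where "g = case_sum \<eta> (\<lambda>n. - \<eta>' n)"
  have un: "(UNIV :: (nat + nat) set) = range Inl \<union> range Inr" by (rule UNIV_sum)
  have split: "(h has_sum (a + b)) UNIV"
    if "((\<lambda>n. h (Inl n)) has_sum a) UNIV" "((\<lambda>n. h (Inr n)) has_sum b) UNIV" for h :: "nat + nat => 'b::banach" and a b
    unfolding un by (rule has_sum_Un_disjoint) (use that in \<open>auto simp: has_sum_reindex comp_def\<close>)
  have summ: "h summable_on UNIV"
    if "(\<lambda>n. h (Inl n)) summable_on UNIV" "(\<lambda>n. h (Inr n)) summable_on UNIV" for h :: "nat + nat => real"
    using split[OF has_sum_infsum[OF that(1)] has_sum_infsum[OF that(2)]] has_sum_imp_summable by blast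
  have c: "\<xi> n \<in> Hu" "\<eta> n \<in> Hu" "\<xi>' n \<in> Hu" "\<eta>' n \<in> Hu" for n
    using x x' by (auto simp: hilbert_sum_def)
  have fg: "f \<in> hcarrier (hilbert_sum UNIV (\<lambda>_. univ_space))" "g \<in> hcarrier (hilbert_sum UNIV (\<lambda>_. univ_space))"
    using x x' summ[of "\<lambda>i. (nmu (f i))\<^sup>2"] summ[of "\<lambda>i. (nmu (g i))\<^sup>2"]
    by (auto simp: hilbert_sum_def f_def g_def univ.nm_minus split: sum.splits)
  have B: "((\<lambda>i. ipu (B (f i)) (g i)) has_sum (\<omega> B + - \<omega>' B)) UNIV" if B: "B \<in> VN" for B
    by (rule split)
      (use \<omega>[OF B] has_sum_uminusI[OF \<omega>'[OF B]] B c in \<open>simp_all add: f_def g_def univ.ip_minus_right\<close>)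
  have "(\<Sum>\<^sub>\<infinity>i. ipu (A (f i)) (g i)) = 0"
    by (rule vector_functional_determined[OF fg _ A]) (use infsumI[OF B[OF univ_rep_in_vn]] eq in simp)
  then show ?thesis using infsumI[OF B[OF A]] by simp
qed

lemma fs_pairing_eq:
  assumes "normal_functional univ_space VN \<omega>" "\<And>s. \<omega> (univ_rep s) = u s" "A \<in> VN"
  shows "fs_pairing u A = \<omega> A"
  unfolding fs_pairing_def
proof (rule the_equality)
  show "\<exists>\<omega>'. normal_functional univ_space VN \<omega>' \<and> (\<forall>s. \<omega>' (univ_rep s) = u s) \<and> \<omega> A = \<omega>' A"
    using assms(1,2) by (intro exI[of _ \<omega>]) simp
  fix c assume "\<exists>\<omega>'. normal_functional univ_space VN \<omega>' \<and> (\<forall>s. \<omega>' (univ_rep s) = u s) \<and> c = \<omega>' A"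
  then obtain \<omega>' where "normal_functional univ_space VN \<omega>'" "\<And>s. \<omega>' (univ_rep s) = u s" "c = \<omega>' A"
    by (elim exE conjE) (rule that, assumption, simp_all)
  then show "c = \<omega> A" using normal_functional_unique[OF _ assms(1) _ assms(3)] assms(2) by simp
qed

lemma fs_pairing_sum:
  assumes I: "finite I" and c: "\<And>i. i \<in> I ==> \<xi> i \<in> Hu" "\<And>i. i \<in> I ==> \<eta> i \<in> Hu"
    and A: "A \<in> VN"
  shows "fs_pairing (\<lambda>s. \<Sum>i\<in>I. mcoeff (\<xi> i) (\<eta> i) s) A = (\<Sum>i\<in>I. ipu (A (\<xi> i)) (\<eta> i))"
proof -
  obtain h where h: "bij_betw h {..<card I} I" using ex_bij_betw_nat_finite[OF I] by (auto simp: atLeast0LessThan)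
  define \<xi>' where "\<xi>' n = (if n < card I then \<xi> (h n) else 0)" for n
  define \<eta>' where "\<eta>' n = (if n < card I then \<eta> (h n) else 0)" for n
  have hI: "h n \<in> I" if "n < card I" for n using bij_betwE[OF h] that by auto
  have c': "\<xi>' n \<in> Hu" "\<eta>' n \<in> Hu" for n
    using c hI by (auto simp: \<xi>'_def \<eta>'_def)
  define \<omega> where "\<omega> A = (\<Sum>n. ipu (A (\<xi>' n)) (\<eta>' n))" for A
  have fin: "\<omega> A = (\<Sum>i\<in>I. ipu (A (\<xi> i)) (\<eta> i))" if A: "A \<in> VN" for A
  proof -
    have "\<omega> A = (\<Sum>n<card I. ipu (A (\<xi>' n)) (\<eta>' n))"
      unfolding \<omega>_def by (rule suminf_finite) (use A univ.op_zero[OF vn_bounded[OF A]] in \<open>auto simp: \<xi>'_def \<eta>'_def\<close>)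
    also have "\<dots> = (\<Sum>i\<in>I. ipu (A (\<xi> i)) (\<eta> i))"
      by (rule sum.reindex_bij_betw[OF h, THEN trans[rotated]]) (auto simp: \<xi>'_def \<eta>'_def)
    finally show ?thesis .
  qed
  have "normal_functional univ_space VN \<omega>"
    unfolding normal_functional_def
  proof (intro exI conjI ballI)
    show "summable (\<lambda>n. (nmu (\<xi>' n))\<^sup>2)" "summable (\<lambda>n. (nmu (\<eta>' n))\<^sup>2)"
      by (rule summable_finite[of "{..<card I}"]; auto simp: \<xi>'_def \<eta>'_def)+
  qed (use c' \<omega>_def in auto)
  then show ?thesis
    using fs_pairing_eq[of \<omega> _ A] fin A fin[OF univ_rep_in_vn] by (simp add: mcoeff_def)
qed

lemma fs_pairing_mcoeff:
  assumes "\<xi> \<in> Hu" "\<eta> \<in> Hu" "A \<in> VN"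
  shows "fs_pairing (mcoeff \<xi> \<eta>) A = ipu (A \<xi>) \<eta>"
  using fs_pairing_sum[of "{()}" "\<lambda>_. \<xi>" "\<lambda>_. \<eta>" A] assms by simp

lemma fs_pairing_univ_rep: "u \<in> FS ==> fs_pairing u (univ_rep s) = u s"
  by (erule FS_E) (simp add: fs_pairing_mcoeff univ_rep_in_vn, simp add: mcoeff_def)

subsection \<open>The algebra structure of the space of coefficients\<close>

lemma scaleC_apply: "(c *\<^sub>C f) x = c *\<^sub>C f x"
  by (simp add: scaleC_fun_def)

lemma sum_fun_apply: "(\<Sum>i\<in>I. f i) x = (\<Sum>i\<in>I. f i x)"
  by (induction I rule: infinite_finite_induct) auto

lemma mcoeff_scale:
  assumes "\<xi> \<in> Hu" "\<eta> \<in> Hu"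
  shows "mcoeff (c *\<^sub>C \<xi>) \<eta> = c *\<^sub>C mcoeff \<xi> \<eta>" "mcoeff \<xi> (c *\<^sub>C \<eta>) = cnj c *\<^sub>C mcoeff \<xi> \<eta>"
  using assms by (auto simp: mcoeff_def fun_eq_iff scaleC_apply scaleC_complex_def
      univ.op_scale[OF univ.rep_bounded] univ.ip_linear)

lemma mcoeff_add_left:
  assumes "\<xi> \<in> Hu" "\<xi>' \<in> Hu" "\<eta> \<in> Hu"
  shows "mcoeff (\<xi> + \<xi>') \<eta> = mcoeff \<xi> \<eta> + mcoeff \<xi>' \<eta>"
  using assms by (auto simp: mcoeff_def fun_eq_iff univ.op_add[OF univ.rep_bounded] univ.ip_linear)

lemma mcoeff_add_right:
  assumes "\<xi> \<in> Hu" "\<eta> \<in> Hu" "\<eta>' \<in> Hu"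
  shows "mcoeff \<xi> (\<eta> + \<eta>') = mcoeff \<xi> \<eta> + mcoeff \<xi> \<eta>'"
  using assms by (auto simp: mcoeff_def fun_eq_iff univ.ip_linear)

lemma sum_mcoeff_in:
  assumes I: "finite I" and c: "\<And>i. i \<in> I ==> \<xi> i \<in> Hu" "\<And>i. i \<in> I ==> \<eta> i \<in> Hu"
  shows "(\<Sum>i\<in>I. mcoeff (\<xi> i) (\<eta> i)) \<in> FS"
proof -
  obtain \<xi>' \<eta>' where *: "\<xi>' \<in> Hu" "\<eta>' \<in> Hu"
    "\<And>s. ((\<lambda>i. mcoeff (\<xi> i) (\<eta> i) s) has_sum mcoeff \<xi>' \<eta>' s) I"
    by (rule coeff_sum_in_FS[of I \<xi> \<eta>, OF c has_sum_finite[OF I] has_sum_finite[OF I]]) (assumption | rule that)+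
  have "mcoeff \<xi>' \<eta>' s = (\<Sum>i\<in>I. mcoeff (\<xi> i) (\<eta> i) s)" for s
    using has_sum_unique[OF *(3) has_sum_finite[OF I]] .
  then have "(\<Sum>i\<in>I. mcoeff (\<xi> i) (\<eta> i)) = mcoeff \<xi>' \<eta>'"
    by (auto simp: fun_eq_iff sum_fun_apply)
  then show ?thesis using mcoeff_in_FS * by metis
qed

lemma fs_add:
  assumes "u \<in> FS" "v \<in> FS"
  shows "u + v \<in> FS"
    and "A \<in> VN ==> fs_pairing (u + v) A = fs_pairing u A + fs_pairing v A"
proof -
  obtain \<xi> \<eta> where u: "\<xi> \<in> Hu" "\<eta> \<in> Hu" "u = mcoeff \<xi> \<eta>"
    using assms(1) by (rule FS_E)
  obtain \<xi>' \<eta>' where v: "\<xi>' \<in> Hu" "\<eta>' \<in> Hu" "v = mcoeff \<xi>' \<eta>'"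
    using assms(2) by (rule FS_E)
  let ?f = "\<lambda>b. if b then \<xi> else \<xi>'" and ?g = "\<lambda>b. if b then \<eta> else \<eta>'"
  have e: "u + v = (\<Sum>b\<in>UNIV. mcoeff (?f b) (?g b))" using u v by (simp add: UNIV_bool add.commute)
  show "u + v \<in> FS" unfolding e by (rule sum_mcoeff_in) (use u v in auto)
  have e': "u + v = (\<lambda>s. \<Sum>b\<in>UNIV. mcoeff (?f b) (?g b) s)" using u v by (auto simp: UNIV_bool add.commute)
  show "fs_pairing (u + v) A = fs_pairing u A + fs_pairing v A" if A: "A \<in> VN"
    unfolding e' by (subst fs_pairing_sum) (use u v A in \<open>auto simp: UNIV_bool fs_pairing_mcoeff\<close>)
qed

lemma fs_scale:
  assumes "u \<in> FS"
  shows "c *\<^sub>C u \<in> FS"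
    and "A \<in> VN ==> fs_pairing (c *\<^sub>C u) A = c * fs_pairing u A"
proof -
  obtain \<xi> \<eta> where u: "\<xi> \<in> Hu" "\<eta> \<in> Hu" "u = mcoeff \<xi> \<eta>"
    using assms(1) by (rule FS_E)
  have e: "c *\<^sub>C u = mcoeff (c *\<^sub>C \<xi>) \<eta>" using u by (simp add: mcoeff_scale)
  show "c *\<^sub>C u \<in> FS" unfolding e using u by (intro mcoeff_in_FS) auto
  show "fs_pairing (c *\<^sub>C u) A = c * fs_pairing u A" if "A \<in> VN"
    unfolding e using u that by (simp add: fs_pairing_mcoeff univ.op_scale[OF vn_bounded] univ.ip_linear)
qed

lemma fs_subspace: "complex_vector.subspace FS"
proof (rule complex_vector.subspaceI)
  have "mcoeff 0 0 = (0 :: 'a => complex)"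
    by (auto simp: mcoeff_def fun_eq_iff univ.op_zero[OF univ.rep_bounded])
  then show "0 \<in> (FS :: ('a => complex) set)"
    using mcoeff_in_FS[of 0 0] by (metis univ.zero_in)
qed (auto intro: fs_add fs_scale)

lemma fs_pairing_lincomb:
  assumes "finite I" "\<And>i. i \<in> I ==> u i \<in> FS" and A: "A \<in> VN"
  shows "fs_pairing (\<Sum>i\<in>I. c i *\<^sub>C u i) A = (\<Sum>i\<in>I. c i * fs_pairing (u i) A)"
  using assms(1,2)
proof (induction I)
  case empty
  have "fs_pairing (0 *\<^sub>C 0) A = 0 * fs_pairing 0 A"
    by (rule fs_scale(2)[OF complex_vector.subspace_0[OF fs_subspace] A])
  then show ?case by (simp add: zero_fun_def)
next
  case (insert i I)
  have "(\<Sum>i\<in>I. c i *\<^sub>C u i) \<in> FS"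
    by (intro complex_vector.subspace_sum[OF fs_subspace] fs_scale) (use insert in auto)
  then show ?case
    using insert by (subst (1 2) sum.insert, simp, simp, simp, simp, subst fs_add(2)[OF _ _ A]) (auto simp: fs_scale(2)[OF _ A] fs_scale(1))
qed

text \<open>A representation on a Hilbert space tensor product of the universal space with itself.\<close>

definition is_univ_tensor :: "('g::topological_group_add, 'g univ_op) urep =>
    ('g univ_vector => 'g univ_vector => 'g univ_op) => bool" where
  "is_univ_tensor \<tau> t \<longleftrightarrow> unitary_rep \<tau> \<and>
    (\<forall>x\<in>Hu. \<forall>y\<in>Hu. t x y \<in> hcarrier (rep_space \<tau>)) \<and>
    (\<forall>x\<in>Hu. \<forall>x'\<in>Hu. \<forall>y\<in>Hu. \<forall>y'\<in>Hu.
      hinner (rep_space \<tau>) (t x y) (t x' y') = ipu x x' * ipu y y') \<and>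
    (\<forall>s. \<forall>x\<in>Hu. \<forall>y\<in>Hu.
      rep_op \<tau> s (t x y) = t (univ_rep s x) (univ_rep s y))"

definition univ2 :: "('g::topological_group_add, 'g univ_op) urep" where
  "univ2 = (SOME \<tau>. \<exists>t. is_univ_tensor \<tau> t)"

definition tensor :: "'g::topological_group_add univ_vector => 'g univ_vector => 'g univ_op"
    (infixr \<open>\<otimes>\<close> 75) where
  "tensor = (SOME t. is_univ_tensor univ2 t)"

lemma is_univ_tensor: "is_univ_tensor univ2 tensor"
proof -
  have "\<exists>\<tau> t. is_univ_tensor (\<tau> :: ('a, 'a univ_op) urep) t"
    using tensor_product_rep[OF univ.unitary univ.unitary, unfolded rep_space_univ rep_op_univ]
    unfolding is_univ_tensor_def .
  from someI_ex[OF this, folded univ2_def] show ?thesis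
    unfolding tensor_def by (rule someI_ex)
qed

lemmas univ_tensorD = is_univ_tensor[unfolded is_univ_tensor_def]

lemma univ2: "unitary_rep univ2"
  using univ_tensorD by (rule conjunct1)

global_interpretation univ2: urep univ2
  by unfold_locales (rule univ2)

lemma tensor_in [simp, intro]:
  "x \<in> Hu ==> y \<in> Hu ==> x \<otimes> y \<in> hcarrier (rep_space univ2)"
  using univ_tensorD[THEN conjunct2, THEN conjunct1] by blast

lemma tensor_ip:
  "\<lbrakk>x \<in> Hu; x' \<in> Hu; y \<in> Hu; y' \<in> Hu\<rbrakk> \<Longrightarrow>
    hinner (rep_space univ2) (x \<otimes> y) (x' \<otimes> y') = ipu x x' * ipu y y'"
  using univ_tensorD[THEN conjunct2, THEN conjunct2, THEN conjunct1] by blast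

lemma tensor_rep:
  "x \<in> Hu ==> y \<in> Hu ==> rep_op univ2 s (x \<otimes> y) = univ_rep s x \<otimes> univ_rep s y"
  using univ_tensorD[THEN conjunct2, THEN conjunct2, THEN conjunct2] by blast

lemma tensor_nm:
  assumes "x \<in> Hu" "y \<in> Hu"
  shows "hnorm (rep_space univ2) (x \<otimes> y) = nmu x * nmu y"
proof -
  have "hinner (rep_space univ2) (x \<otimes> y) (x \<otimes> y) = complex_of_real ((nmu x * nmu y)\<^sup>2)"
    using assms by (simp add: tensor_ip univ.ip_self power_mult_distrib)
  then show ?thesis using assms by (simp add: hnorm_def[of "rep_space univ2"])
qed

lemma tensor_coefficient:
  assumes "x \<in> Hu" "y \<in> Hu" "x' \<in> Hu" "y' \<in> Hu"
  shows "hinner (rep_space univ2) (rep_op univ2 s (x \<otimes> y)) (x' \<otimes> y') = mcoeff x x' s * mcoeff y y' s"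
  using assms by (simp add: tensor_rep tensor_ip mcoeff_def univ.rep_in)

text \<open>The product of two coefficients is a coefficient of the tensor product representation.\<close>

lemma fs_mult:
  assumes "u \<in> FS" "v \<in> FS"
  shows "(\<lambda>s. u s * v s) \<in> FS"
proof -
  obtain \<xi> \<eta> where u: "\<xi> \<in> Hu" "\<eta> \<in> Hu" "u = mcoeff \<xi> \<eta>"
    using assms(1) by (rule FS_E)
  obtain \<xi>' \<eta>' where v: "\<xi>' \<in> Hu" "\<eta>' \<in> Hu" "v = mcoeff \<xi>' \<eta>'"
    using assms(2) by (rule FS_E)
  obtain a b where ab: "a \<in> Hu" "b \<in> Hu"
    "(\<lambda>s. hinner (rep_space univ2) (rep_op univ2 s (\<xi> \<otimes> \<xi>')) (\<eta> \<otimes> \<eta>')) = mcoeff a b"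
    by (rule coefficient_of_rep[OF univ2 tensor_in[OF u(1) v(1)] tensor_in[OF u(2) v(2)]])
  have "(\<lambda>s. u s * v s) = mcoeff a b"
    unfolding ab(3)[symmetric] using u v by (simp add: tensor_coefficient)
  then show ?thesis using mcoeff_in_FS[OF ab(1,2)] by simp
qed

section \<open>Matrix norms\<close>

context hilb
begin

lemma L2_nm_zero: "finite J ==> (\<And>j. j \<in> J ==> \<xi> j \<in> cr) ==> L2_set (\<lambda>j. nm (\<xi> j)) J = 0 ==> j \<in> J ==> \<xi> j = 0"
  using nm_eq_0 by (auto simp: L2_set_eq_0_iff)

lemma opmat_set_bdd:
  assumes A: "\<And>i j. i \<in> I ==> j \<in> J ==> A i j \<in> bounded_ops H" and fin: "finite I" "finite J"
  shows "bdd_above {L2_set (\<lambda>i. nm (\<Sum>j\<in>J. A i j (\<xi> j))) I | \<xi>.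
    (\<forall>j\<in>J. \<xi> j \<in> cr) \<and> L2_set (\<lambda>j. nm (\<xi> j)) J \<le> 1}"
proof -
  have "\<exists>C\<ge>0. \<forall>x\<in>cr. nm (A i j x) \<le> C * nm x" if "i \<in> I" "j \<in> J" for i j
    using op_bound[OF A[OF that]] by metis
  then obtain C where C: "\<And>i j. i \<in> I ==> j \<in> J ==> C i j \<ge> (0::real)"
    "\<And>i j x. i \<in> I ==> j \<in> J ==> x \<in> cr ==> nm (A i j x) \<le> C i j * nm x" by metis
  show ?thesis
  proof (rule bdd_aboveI[of _ "\<Sum>i\<in>I. \<Sum>j\<in>J. C i j"], safe)
    fix \<xi> assume \<xi>: "\<forall>j\<in>J. \<xi> j \<in> cr" "L2_set (\<lambda>j. nm (\<xi> j)) J \<le> 1"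
    have n1: "nm (\<xi> j) \<le> 1" if "j \<in> J" for j
      using member_le_L2_set[OF fin(2) that, of "\<lambda>j. nm (\<xi> j)"] \<xi>(2) by simp
    have "L2_set (\<lambda>i. nm (\<Sum>j\<in>J. A i j (\<xi> j))) I \<le> (\<Sum>i\<in>I. nm (\<Sum>j\<in>J. A i j (\<xi> j)))"
      by (rule L2_set_le_sum) (use A \<xi>(1) in \<open>auto intro!: nm_ge_0 sum_in\<close>)
    also have "\<dots> \<le> (\<Sum>i\<in>I. \<Sum>j\<in>J. C i j)"
    proof (rule sum_mono)
      fix i assume i: "i \<in> I"
      have "nm (\<Sum>j\<in>J. A i j (\<xi> j)) \<le> (\<Sum>j\<in>J. nm (A i j (\<xi> j)))"
        by (rule nm_sum) (use A i \<xi>(1) in auto)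
      also have "\<dots> \<le> (\<Sum>j\<in>J. C i j)"
      proof (rule sum_mono)
        fix j assume j: "j \<in> J"
        have "nm (A i j (\<xi> j)) \<le> C i j * nm (\<xi> j)" using C(2) i j \<xi>(1) by blast
        also have "\<dots> \<le> C i j * 1" using C(1)[OF i j] n1[OF j] by (rule mult_left_mono[rotated])
        finally show "nm (A i j (\<xi> j)) \<le> C i j" by simp
      qed
      finally show "nm (\<Sum>j\<in>J. A i j (\<xi> j)) \<le> (\<Sum>j\<in>J. C i j)" .
    qed
    finally show "L2_set (\<lambda>i. nm (\<Sum>j\<in>J. A i j (\<xi> j))) I \<le> (\<Sum>i\<in>I. \<Sum>j\<in>J. C i j)" .
  qed
qed

lemma opmat_norm_upper:
  assumes A: "\<And>i j. i \<in> I ==> j \<in> J ==> A i j \<in> bounded_ops H" and fin: "finite I" "finite J"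
    and \<xi>: "\<And>j. j \<in> J ==> \<xi> j \<in> cr"
  shows "L2_set (\<lambda>i. nm (\<Sum>j\<in>J. A i j (\<xi> j))) I \<le> opmat_norm H I J A * L2_set (\<lambda>j. nm (\<xi> j)) J"
proof (cases "L2_set (\<lambda>j. nm (\<xi> j)) J = 0")
  case True
  have "(\<Sum>j\<in>J. A i j (\<xi> j)) = 0" if "i \<in> I" for i
    by (rule sum.neutral) (use L2_nm_zero[OF fin(2) \<xi> True] op_zero[OF A[OF that]] in auto)
  then show ?thesis using True by (simp add: L2_set_def)
next
  case False
  let ?r = "L2_set (\<lambda>j. nm (\<xi> j)) J"
  have r: "?r > 0" using False by (simp add: order_less_le)
  let ?x = "\<lambda>j. complex_of_real (1 / ?r) *\<^sub>C \<xi> j"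
  have "L2_set (\<lambda>j. nm (?x j)) J = L2_set (\<lambda>j. (1 / ?r) * nm (\<xi> j)) J"
    by (rule L2_set_cong) (use \<xi> r in \<open>auto simp: nm_scale norm_divide\<close>)
  also have "\<dots> = 1" using r by (subst L2_set_right_distrib[symmetric]) auto
  finally have x1: "L2_set (\<lambda>j. nm (?x j)) J \<le> 1" by simp
  have bd: "bdd_above {L2_set (\<lambda>i. nm (\<Sum>j\<in>J. A i j (\<xi> j))) I | \<xi>.
    (\<forall>j\<in>J. \<xi> j \<in> cr) \<and> L2_set (\<lambda>j. nm (\<xi> j)) J \<le> 1}"
    by (rule opmat_set_bdd[OF A fin])
  have h1: "L2_set (\<lambda>i. nm (\<Sum>j\<in>J. A i j (?x j))) I \<le> opmat_norm H I J A"
    unfolding opmat_norm_def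
  proof (rule cSup_upper[OF _ bd], rule CollectI, rule exI[of _ ?x], intro conjI refl)
    show "\<forall>j\<in>J. ?x j \<in> cr" using \<xi> by blast
    show "L2_set (\<lambda>j. nm (?x j)) J \<le> 1" by (rule x1)
  qed
  have h2: "L2_set (\<lambda>i. nm (\<Sum>j\<in>J. A i j (?x j))) I = L2_set (\<lambda>i. (1 / ?r) * nm (\<Sum>j\<in>J. A i j (\<xi> j))) I"
  proof (rule L2_set_cong[OF refl])
    fix i assume i: "i \<in> I"
    have "(\<Sum>j\<in>J. A i j (?x j)) = complex_of_real (1 / ?r) *\<^sub>C (\<Sum>j\<in>J. A i j (\<xi> j))"
      using op_scale[OF A[OF i]] \<xi> by (simp add: complex_vector.scale_sum_right)
    moreover have "(\<Sum>j\<in>J. A i j (\<xi> j)) \<in> cr" using A i \<xi> by (auto intro!: sum_in)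
    ultimately show "nm (\<Sum>j\<in>J. A i j (?x j)) = (1 / ?r) * nm (\<Sum>j\<in>J. A i j (\<xi> j))"
      using r by (simp add: nm_scale norm_divide)
  qed
  have h3: "L2_set (\<lambda>i. (1 / ?r) * nm (\<Sum>j\<in>J. A i j (\<xi> j))) I = (1 / ?r) * L2_set (\<lambda>i. nm (\<Sum>j\<in>J. A i j (\<xi> j))) I"
    using r by (subst L2_set_right_distrib[symmetric]) auto
  show ?thesis using h1[unfolded h2 h3] r by (simp add: pos_divide_le_eq)
qed

text \<open>Operator matrices are used through their sesquilinear forms only: the norm is the least constant
  bounding the form.\<close>

lemma opmat_norm_bound:
  assumes A: "\<And>i j. i \<in> I ==> j \<in> J ==> A i j \<in> bounded_ops H" and fin: "finite I" "finite J"
    and \<xi>: "\<And>j. j \<in> J ==> \<xi> j \<in> cr" and \<eta>: "\<And>i. i \<in> I ==> \<eta> i \<in> cr"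
  shows "cmod (\<Sum>i\<in>I. \<Sum>j\<in>J. ip (A i j (\<xi> j)) (\<eta> i))
    \<le> opmat_norm H I J A * L2_set (\<lambda>j. nm (\<xi> j)) J * L2_set (\<lambda>i. nm (\<eta> i)) I"
proof -
  let ?v = "\<lambda>i. \<Sum>j\<in>J. A i j (\<xi> j)"
  have v: "?v i \<in> cr" if "i \<in> I" for i using A that \<xi> by (auto intro!: sum_in)
  have "(\<Sum>i\<in>I. \<Sum>j\<in>J. ip (A i j (\<xi> j)) (\<eta> i)) = (\<Sum>i\<in>I. ip (?v i) (\<eta> i))"
    using A \<xi> \<eta> by (intro sum.cong refl ip_sum_left[symmetric]) auto
  also have "cmod \<dots> \<le> (\<Sum>i\<in>I. cmod (ip (?v i) (\<eta> i)))" by (rule norm_sum)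
  also have "\<dots> \<le> (\<Sum>i\<in>I. \<bar>nm (?v i)\<bar> * \<bar>nm (\<eta> i)\<bar>)"
    using v \<eta> by (intro sum_mono) (simp add: cauchy_schwarz)
  also have "\<dots> \<le> L2_set (\<lambda>i. nm (?v i)) I * L2_set (\<lambda>i. nm (\<eta> i)) I" by (rule L2_set_mult_ineq)
  also have "\<dots> \<le> opmat_norm H I J A * L2_set (\<lambda>j. nm (\<xi> j)) J * L2_set (\<lambda>i. nm (\<eta> i)) I"
    by (rule mult_right_mono[OF opmat_norm_upper[OF A fin \<xi>]]) auto
  finally show ?thesis .
qed

lemma opmat_norm_le:
  assumes A: "\<And>i j. i \<in> I ==> j \<in> J ==> A i j \<in> bounded_ops H" and c: "0 \<le> c"
    and bound: "\<And>\<xi> \<eta>. (\<And>j. j \<in> J ==> \<xi> j \<in> cr) ==> (\<And>i. i \<in> I ==> \<eta> i \<in> cr) ==>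
      cmod (\<Sum>i\<in>I. \<Sum>j\<in>J. ip (A i j (\<xi> j)) (\<eta> i)) \<le> c * L2_set (\<lambda>j. nm (\<xi> j)) J * L2_set (\<lambda>i. nm (\<eta> i)) I"
  shows "opmat_norm H I J A \<le> c"
  unfolding opmat_norm_def
proof (rule cSup_least)
  show "{L2_set (\<lambda>i. nm (\<Sum>j\<in>J. A i j (\<xi> j))) I |\<xi>. (\<forall>j\<in>J. \<xi> j \<in> cr) \<and> L2_set (\<lambda>j. nm (\<xi> j)) J \<le> 1} \<noteq> {}"
    by (auto intro!: exI[of _ "\<lambda>_. 0"] simp: L2_set_def)
  fix x assume "x \<in> {L2_set (\<lambda>i. nm (\<Sum>j\<in>J. A i j (\<xi> j))) I |\<xi>. (\<forall>j\<in>J. \<xi> j \<in> cr) \<and> L2_set (\<lambda>j. nm (\<xi> j)) J \<le> 1}"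
  then obtain \<xi> where x: "x = L2_set (\<lambda>i. nm (\<Sum>j\<in>J. A i j (\<xi> j))) I" and \<xi>: "\<And>j. j \<in> J ==> \<xi> j \<in> cr"
    and l: "L2_set (\<lambda>j. nm (\<xi> j)) J \<le> 1" by blast
  let ?v = "\<lambda>i. \<Sum>j\<in>J. A i j (\<xi> j)"
  have v: "?v i \<in> cr" if "i \<in> I" for i using A that \<xi> by (auto intro!: sum_in)
  have "(\<Sum>i\<in>I. \<Sum>j\<in>J. ip (A i j (\<xi> j)) (?v i)) = (\<Sum>i\<in>I. ip (?v i) (?v i))"
    using A \<xi> v by (intro sum.cong refl ip_sum_left[symmetric]) auto
  also have "\<dots> = complex_of_real (\<Sum>i\<in>I. (nm (?v i))\<^sup>2)" using v by (simp add: ip_self)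
  also have "\<dots> = complex_of_real (x\<^sup>2)" by (simp add: x L2_set_def sum_nonneg)
  finally have e: "(\<Sum>i\<in>I. \<Sum>j\<in>J. ip (A i j (\<xi> j)) (?v i)) = complex_of_real (x\<^sup>2)" .
  have "cmod (\<Sum>i\<in>I. \<Sum>j\<in>J. ip (A i j (\<xi> j)) (?v i)) \<le> c * L2_set (\<lambda>j. nm (\<xi> j)) J * x"
    unfolding x by (rule bound[of \<xi> ?v]) (use \<xi> v in auto)
  then have "x\<^sup>2 \<le> c * L2_set (\<lambda>j. nm (\<xi> j)) J * x"
    unfolding e by (simp add: norm_power)
  also have "\<dots> \<le> c * 1 * x" using c l x by (intro mult_right_mono mult_left_mono) auto
  finally have "x * x \<le> c * x" by (simp add: power2_eq_square)
  moreover have "0 \<le> x" by (simp add: x)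
  ultimately show "x \<le> c" using c by (cases "x = 0") auto
qed

lemma opmat_norm_nonneg:
  assumes "\<And>i j. i \<in> I ==> j \<in> J ==> A i j \<in> bounded_ops H" "finite I" "finite J"
  shows "0 \<le> opmat_norm H I J A"
  unfolding opmat_norm_def
  by (rule cSup_upper2[OF _ _ opmat_set_bdd[OF assms], of "L2_set (\<lambda>i. nm (\<Sum>j\<in>J. A i j 0)) I"])
    (auto intro!: exI[of _ "\<lambda>_. 0"] simp: L2_set_def sum_nonneg)

end

text \<open>Scalar matrices are operator matrices over the one-dimensional Hilbert space.\<close>

definition complex_hilbert :: "complex hilbert" where
  "complex_hilbert = \<lparr>hcarrier = UNIV, hinner = (\<lambda>z w. z * cnj w)\<rparr>"

lemma hnorm_complex: "hnorm complex_hilbert z = cmod z"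
  by (simp add: hnorm_def complex_hilbert_def complex_mult_cnj cmod_def power2_eq_square)

lemma complex_hilb: "hilb complex_hilbert"
proof (unfold_locales, unfold hilbert_space_def, intro conjI)
  show "\<forall>X. range X \<subseteq> hcarrier complex_hilbert \<and>
        (\<forall>e>0. \<exists>N. \<forall>m\<ge>N. \<forall>n\<ge>N. hnorm complex_hilbert (X m - X n) < e) \<longrightarrow>
        (\<exists>l\<in>hcarrier complex_hilbert. (\<lambda>n. hnorm complex_hilbert (X n - l)) \<longlonglongrightarrow> 0)"
  proof (intro allI impI)
    fix X :: "nat => complex"
    assume "range X \<subseteq> hcarrier complex_hilbert \<and>
      (\<forall>e>0. \<exists>N. \<forall>m\<ge>N. \<forall>n\<ge>N. hnorm complex_hilbert (X m - X n) < e)"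
    then have "Cauchy X" unfolding Cauchy_iff hnorm_complex by blast
    then obtain l where "X \<longlonglongrightarrow> l" using Cauchy_convergent convergent_def by blast
    then have "(\<lambda>n. cmod (X n - l)) \<longlonglongrightarrow> 0" using tendsto_norm_zero LIM_zero by blast
    then show "\<exists>l\<in>hcarrier complex_hilbert. (\<lambda>n. hnorm complex_hilbert (X n - l)) \<longlonglongrightarrow> 0"
      unfolding hnorm_complex by (auto simp: complex_hilbert_def)
  qed
qed (auto simp: complex_hilbert_def scaleC_complex_def algebra_simps complex_vector.subspace_UNIV)

interpretation cplx: hilb complex_hilbert by (rule complex_hilb)

lemma cmat_norm_eq: "cmat_norm I J A = opmat_norm complex_hilbert I J (\<lambda>i j z. A i j * z)"
  by (simp add: cmat_norm_def opmat_norm_def hnorm_complex) (simp add: complex_hilbert_def)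

lemma mult_bounded: "(\<lambda>z. a * z) \<in> bounded_ops complex_hilbert"
  by (rule cplx.bounded_opsI[where C = "cmod a"])
    (simp_all add: hnorm_complex norm_mult, simp_all add: complex_hilbert_def scaleC_complex_def algebra_simps)

lemma cmat_norm_bound:
  assumes "finite I" "finite J"
  shows "cmod (\<Sum>i\<in>I. \<Sum>j\<in>J. A i j * z j * cnj (w i))
    \<le> cmat_norm I J A * L2_set (\<lambda>j. cmod (z j)) J * L2_set (\<lambda>i. cmod (w i)) I"
  using cplx.opmat_norm_bound[of I J "\<lambda>i j z. A i j * z" z w, OF mult_bounded assms]
  unfolding cmat_norm_eq hnorm_complex by (simp add: complex_hilbert_def)

lemma cmat_norm_le:
  assumes "0 \<le> c" "\<And>z w. cmod (\<Sum>i\<in>I. \<Sum>j\<in>J. A i j * z j * cnj (w i))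
    \<le> c * L2_set (\<lambda>j. cmod (z j)) J * L2_set (\<lambda>i. cmod (w i)) I"
  shows "cmat_norm I J A \<le> c"
  unfolding cmat_norm_eq
  by (rule cplx.opmat_norm_le[OF mult_bounded assms(1)])
    (use assms(2) in \<open>simp add: hnorm_complex\<close>, use assms(2) in \<open>simp add: complex_hilbert_def hnorm_complex[unfolded complex_hilbert_def]\<close>)

lemma cmat_norm_nonneg: "finite I ==> finite J ==> 0 \<le> cmat_norm I J A"
  unfolding cmat_norm_eq by (rule cplx.opmat_norm_nonneg[OF mult_bounded])

subsection \<open>The operator space structure of the predual\<close>

definition vn_matrix_ball :: "nat => (nat => nat => 'g::topological_group_add univ_op) set" where
  "vn_matrix_ball m = {A. (\<forall>k<m. \<forall>l<m. A k l \<in> VN) \<and> opmat_norm univ_space {..<m} {..<m} A \<le> 1}"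

text \<open>The sesquilinear form of the scalar matrix \<open>[\<langle>u i j, A k l\<rangle>]\<close>.\<close>

definition fs_form :: "nat => nat => (nat => nat => 'g::topological_group_add => complex) =>
    (nat => nat => 'g univ_op) => (nat \<times> nat => complex) => (nat \<times> nat => complex) => complex" where
  "fs_form n m u A z w =
     (\<Sum>i<n. \<Sum>j<n. \<Sum>k<m. \<Sum>l<m. fs_pairing (u i j) (A k l) * z (j, l) * cnj (w (i, k)))"

lemma fs_form_eq:
  "(\<Sum>ik\<in>{..<n} \<times> {..<m}. \<Sum>jl\<in>{..<n} \<times> {..<m}.
      fs_pairing (u (fst ik) (fst jl)) (A (snd ik) (snd jl)) * z jl * cnj (w ik)) = fs_form n m u A z w"
proof -
  have "(\<Sum>ik\<in>{..<n} \<times> {..<m}. \<Sum>jl\<in>{..<n} \<times> {..<m}.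
      fs_pairing (u (fst ik) (fst jl)) (A (snd ik) (snd jl)) * z jl * cnj (w ik)) =
    (\<Sum>i<n. \<Sum>k<m. \<Sum>j<n. \<Sum>l<m. fs_pairing (u i j) (A k l) * z (j, l) * cnj (w (i, k)))"
    by (simp add: sum.cartesian_product' flip: sum.cartesian_product)
  also have "\<dots> = fs_form n m u A z w"
    unfolding fs_form_def by (intro sum.cong refl sum.swap)
  finally show ?thesis .
qed

lemma fs_matnorm_eq:
  "fs_matnorm n u = Sup {cmat_norm ({..<n} \<times> {..<m}) ({..<n} \<times> {..<m})
     (\<lambda>ik jl. fs_pairing (u (fst ik) (fst jl)) (A (snd ik) (snd jl))) | m A. A \<in> vn_matrix_ball m}"
  by (simp add: fs_matnorm_def vn_matrix_ball_def)

abbreviation "L2 (n::nat) (m::nat) z \<equiv> L2_set (\<lambda>jl. cmod (z jl)) ({..<n} \<times> {..<m})"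

lemma zero_in_ball: "(\<lambda>k l. univ_rep 0) \<in> vn_matrix_ball 0"
  using univ.opmat_norm_le[of "{}" "{}" "\<lambda>k l. univ_rep 0" 1] by (simp add: vn_matrix_ball_def)

text \<open>The matrix norm is the least constant that bounds these forms for all contractive operator
  matrices; the lemmas \<open>fs_matnorm_le\<close> and \<open>fs_form_bound\<close> are all that
  is used of its definition.\<close>

lemma fs_matnorm_le:
  assumes c: "0 \<le> c" and bound: "\<And>m A z w. A \<in> vn_matrix_ball m ==> cmod (fs_form n m u A z w) \<le> c * L2 n m z * L2 n m w"
  shows "fs_matnorm n u \<le> c"
  unfolding fs_matnorm_eq
proof (rule cSup_least)
  show "{cmat_norm ({..<n} \<times> {..<m}) ({..<n} \<times> {..<m})
     (\<lambda>ik jl. fs_pairing (u (fst ik) (fst jl)) (A (snd ik) (snd jl))) | m A. A \<in> vn_matrix_ball m} \<noteq> {}"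
    using zero_in_ball by blast
  fix x assume "x \<in> {cmat_norm ({..<n} \<times> {..<m}) ({..<n} \<times> {..<m})
     (\<lambda>ik jl. fs_pairing (u (fst ik) (fst jl)) (A (snd ik) (snd jl))) | m A. A \<in> vn_matrix_ball m}"
  then obtain m A where x: "x = cmat_norm ({..<n} \<times> {..<m}) ({..<n} \<times> {..<m})
     (\<lambda>ik jl. fs_pairing (u (fst ik) (fst jl)) (A (snd ik) (snd jl)))" and A: "A \<in> vn_matrix_ball m" by blast
  show "x \<le> c" unfolding x by (rule cmat_norm_le[OF c]) (unfold fs_form_eq, rule bound[OF A])
qed

lemma L2_row_le: "finite J ==> j \<in> I ==> finite I ==> L2_set (\<lambda>l. z (j, l)) J \<le> L2_set z (I \<times> J)"
proof -
  assume f: "finite J" "j \<in> I" "finite I"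
  have "(\<Sum>l\<in>J. (z (j, l))\<^sup>2) = (\<Sum>p\<in>{j} \<times> J. (z p)\<^sup>2)"
    by (simp add: sum.cartesian_product')
  also have "\<dots> \<le> (\<Sum>p\<in>I \<times> J. (z p)\<^sup>2)" using f by (intro sum_mono2) auto
  finally show ?thesis by (simp add: L2_set_def)
qed

lemma vn_ballD:
  assumes "A \<in> vn_matrix_ball m"
  shows "\<And>k l. k \<in> {..<m} ==> l \<in> {..<m} ==> A k l \<in> VN"
    "\<And>k l. k \<in> {..<m} ==> l \<in> {..<m} ==> A k l \<in> Bu"
    "opmat_norm univ_space {..<m} {..<m} A \<le> 1"
  using assms vn_bounded by (auto simp: vn_matrix_ball_def)

lemma vn_ball_bound:
  assumes A: "A \<in> vn_matrix_ball m" and \<xi>: "\<And>l. l < m ==> \<xi> l \<in> Hu"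
    and \<eta>: "\<And>k. k < m ==> \<eta> k \<in> Hu"
  shows "cmod (\<Sum>k<m. \<Sum>l<m. ipu (A k l (\<xi> l)) (\<eta> k))
    \<le> L2_set (\<lambda>l. nmu (\<xi> l)) {..<m} * L2_set (\<lambda>k. nmu (\<eta> k)) {..<m}"
proof -
  have "cmod (\<Sum>k<m. \<Sum>l<m. ipu (A k l (\<xi> l)) (\<eta> k)) \<le>
    opmat_norm univ_space {..<m} {..<m} A * L2_set (\<lambda>l. nmu (\<xi> l)) {..<m} * L2_set (\<lambda>k. nmu (\<eta> k)) {..<m}"
    by (rule univ.opmat_norm_bound[OF vn_ballD(2)[OF A]]) (use \<xi> \<eta> in auto)
  also have "\<dots> \<le> 1 * L2_set (\<lambda>l. nmu (\<xi> l)) {..<m} * L2_set (\<lambda>k. nmu (\<eta> k)) {..<m}"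
    using vn_ballD(3)[OF A] by (intro mult_right_mono) auto
  finally show ?thesis by simp
qed

text \<open>A bound that is far from optimal but shows that the supremum in the definition of the matrix
  norm is over a bounded set.\<close>

lemma fs_form_crude_bound:
  assumes c: "\<And>i j. i < n ==> j < n ==> \<xi> i j \<in> Hu" "\<And>i j. i < n ==> j < n ==> \<eta> i j \<in> Hu"
    and A: "A \<in> vn_matrix_ball m"
  shows "cmod (fs_form n m (\<lambda>i j. mcoeff (\<xi> i j) (\<eta> i j)) A z w)
    \<le> (\<Sum>i<n. \<Sum>j<n. nmu (\<xi> i j) * nmu (\<eta> i j)) * L2 n m z * L2 n m w"
proof -
  let ?n = "nmu"
  have one: "cmod (\<Sum>k<m. \<Sum>l<m. fs_pairing (mcoeff (\<xi> i j) (\<eta> i j)) (A k l) * z (j, l) * cnj (w (i, k)))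
    \<le> ?n (\<xi> i j) * ?n (\<eta> i j) * (L2 n m z * L2 n m w)" if ij: "i < n" "j < n" for i j
  proof -
    note cc = c[OF ij]
    have "(\<Sum>k<m. \<Sum>l<m. fs_pairing (mcoeff (\<xi> i j) (\<eta> i j)) (A k l) * z (j, l) * cnj (w (i, k)))
      = (\<Sum>k<m. \<Sum>l<m. ipu (A k l (z (j, l) *\<^sub>C \<xi> i j)) (w (i, k) *\<^sub>C \<eta> i j))"
      using cc vn_ballD(1,2)[OF A]
      by (intro sum.cong refl) (auto simp: fs_pairing_mcoeff univ.op_scale univ.ip_linear)
    also have "cmod \<dots> \<le> L2_set (\<lambda>l. ?n (z (j, l) *\<^sub>C \<xi> i j)) {..<m} * L2_set (\<lambda>k. ?n (w (i, k) *\<^sub>C \<eta> i j)) {..<m}"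
      by (rule vn_ball_bound[OF A]) (use cc in auto)
    also have "\<dots> = (L2_set (\<lambda>l. cmod (z (j, l))) {..<m} * ?n (\<xi> i j)) * (L2_set (\<lambda>k. cmod (w (i, k))) {..<m} * ?n (\<eta> i j))"
      using cc by (simp add: univ.nm_scale L2_set_left_distrib)
    also have "\<dots> \<le> (L2 n m z * ?n (\<xi> i j)) * (L2 n m w * ?n (\<eta> i j))"
      using ij cc L2_row_le[of "{..<m}" j "{..<n}" "\<lambda>p. cmod (z p)"] L2_row_le[of "{..<m}" i "{..<n}" "\<lambda>p. cmod (w p)"]
      by (intro mult_mono mult_right_mono) auto
    finally show ?thesis by (simp add: algebra_simps)
  qed
  have "cmod (fs_form n m (\<lambda>i j. mcoeff (\<xi> i j) (\<eta> i j)) A z w) \<le>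
    (\<Sum>i<n. \<Sum>j<n. ?n (\<xi> i j) * ?n (\<eta> i j) * (L2 n m z * L2 n m w))"
    unfolding fs_form_def by (intro order_trans[OF norm_sum] sum_mono one) auto
  then show ?thesis by (simp add: sum_distrib_right mult.assoc)
qed

lemma fs_form_bound:
  assumes u: "\<And>i j. i < n ==> j < n ==> u i j \<in> FS" and A: "A \<in> vn_matrix_ball m"
  shows "cmod (fs_form n m u A z w) \<le> fs_matnorm n u * L2 n m z * L2 n m w"
proof -
  have "\<exists>\<xi> \<eta>. \<xi> \<in> Hu \<and> \<eta> \<in> Hu \<and> u i j = mcoeff \<xi> \<eta>" if "i < n" "j < n" for i j
    using FS_E[OF u[OF that]] by metis
  then obtain \<xi> \<eta> where x: "\<And>i j. i < n ==> j < n ==> \<xi> i j \<in> Hu"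
    "\<And>i j. i < n ==> j < n ==> \<eta> i j \<in> Hu" "\<And>i j. i < n ==> j < n ==> u i j = mcoeff (\<xi> i j) (\<eta> i j)"
    by metis
  have fe: "fs_form n m u A z w = fs_form n m (\<lambda>i j. mcoeff (\<xi> i j) (\<eta> i j)) A z w" for m A z w
    unfolding fs_form_def using x(3) by (intro sum.cong refl) auto
  let ?c = "\<Sum>i<n. \<Sum>j<n. nmu (\<xi> i j) * nmu (\<eta> i j)"
  let ?S = "{cmat_norm ({..<n} \<times> {..<m}) ({..<n} \<times> {..<m})
     (\<lambda>ik jl. fs_pairing (u (fst ik) (fst jl)) (A (snd ik) (snd jl))) | m A. A \<in> vn_matrix_ball m}"
  have c0: "0 \<le> ?c" using x by (intro sum_nonneg) auto
  have "bdd_above ?S"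
  proof (rule bdd_aboveI[of _ ?c])
    fix r assume "r \<in> ?S"
    then obtain m A where r: "r = cmat_norm ({..<n} \<times> {..<m}) ({..<n} \<times> {..<m})
     (\<lambda>ik jl. fs_pairing (u (fst ik) (fst jl)) (A (snd ik) (snd jl)))" and A: "A \<in> vn_matrix_ball m" by blast
    show "r \<le> ?c" unfolding r
      by (rule cmat_norm_le[OF c0]) (unfold fs_form_eq fe, rule fs_form_crude_bound[OF x(1,2) A])
  qed
  then have "cmat_norm ({..<n} \<times> {..<m}) ({..<n} \<times> {..<m})
     (\<lambda>ik jl. fs_pairing (u (fst ik) (fst jl)) (A (snd ik) (snd jl))) \<le> fs_matnorm n u" (is "?cm \<le> _")
    unfolding fs_matnorm_eq using A by (intro cSup_upper) auto
  then have "?cm * L2 n m z * L2 n m w \<le> fs_matnorm n u * L2 n m z * L2 n m w"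
    by (intro mult_right_mono) auto
  then show ?thesis using cmat_norm_bound[of "{..<n} \<times> {..<m}" "{..<n} \<times> {..<m}"
      "\<lambda>ik jl. fs_pairing (u (fst ik) (fst jl)) (A (snd ik) (snd jl))" z w] unfolding fs_form_eq by simp
qed

lemma fs_matnorm_nonneg:
  fixes u :: "nat => nat => 'g::topological_group_add => complex"
  assumes u: "\<And>i j. i < n ==> j < n ==> u i j \<in> FS"
  shows "0 \<le> fs_matnorm n u"
proof (cases "n = 0")
  case True
  have "cmat_norm {} {} A = 0" for A :: "nat \<times> nat => nat \<times> nat => complex"
    using cmat_norm_nonneg[where I = "{}" and J = "{}" and A = A] cmat_norm_le[where c = 0 and I = "{}" and J = "{}" and A = A]
    by simp
  then have "fs_matnorm n u = Sup {0}"
    unfolding fs_matnorm_eq True using zero_in_ball by (intro arg_cong[of _ _ Sup]) auto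
  then show ?thesis by simp
next
  case False
  have id: "(\<lambda>k l. univ_rep (0 :: 'g)) \<in> vn_matrix_ball 1"
  proof -
    have one: "{..<1::nat} = {0}" by auto
    have "opmat_norm univ_space {..<1::nat} {..<1::nat} (\<lambda>k l. univ_rep (0 :: 'g)) \<le> 1"
      unfolding one
      by (rule univ.opmat_norm_le[OF univ.rep_bounded]) (use univ.cauchy_schwarz in \<open>auto simp: L2_set_def\<close>)
    then show ?thesis using univ_rep_in_vn by (simp add: vn_matrix_ball_def)
  qed
  define e :: "nat \<times> nat => complex" where "e p = (if p = (0, 0) then 1 else 0)" for p
  have "cmod (fs_form n 1 u (\<lambda>k l. univ_rep (0 :: 'g)) e e) \<le> fs_matnorm n u * L2 n 1 e * L2 n 1 e"
    by (rule fs_form_bound[OF _ id]) (rule u)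
  then have "0 \<le> fs_matnorm n u * L2 n 1 e * L2 n 1 e"
    using norm_ge_zero order_trans by blast
  moreover have "L2 n 1 e = 1"
    using False by (simp add: e_def L2_set_def if_distrib[of "\<lambda>x. x\<^sup>2"] if_distrib[of cmod] cong: if_cong)
  ultimately show ?thesis by simp
qed

section \<open>The norm of the Fourier--Stieltjes algebra\<close>

subsection \<open>The Hahn--Banach theorem for seminorms\<close>

text \<open>Real-linear functionals dominated by \<open>p\<close> on subspaces are represented by their graphs, which
  are ordered by inclusion; domination by \<open>p\<close> makes them single-valued.\<close>

definition dominated_graph :: "'a::complex_vector set => ('a => real) => ('a \<times> real) set => bool" where
  "dominated_graph V p G \<longleftrightarrow> (\<forall>(x, r)\<in>G. x \<in> V \<and> r \<le> p x) \<and>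
     (\<forall>(x, r)\<in>G. \<forall>(y, s)\<in>G. (x + y, r + s) \<in> G) \<and>
     (\<forall>(x, r)\<in>G. \<forall>t. (complex_of_real t *\<^sub>C x, t * r) \<in> G)"

lemma dominated_graphD:
  assumes "dominated_graph V p G"
  shows "(x, r) \<in> G ==> x \<in> V" "(x, r) \<in> G ==> r \<le> p x"
    "(x, r) \<in> G ==> (y, s) \<in> G ==> (x + y, r + s) \<in> G"
    "(x, r) \<in> G ==> (complex_of_real t *\<^sub>C x, t * r) \<in> G"
  using assms unfolding dominated_graph_def by fast+

text \<open>The one-dimensional step of the Hahn--Banach theorem: the value at \<open>y\<close> is chosen
  between the lower and the upper bounds imposed by the domination.\<close>

lemma dominated_graph_extend:
  assumes V: "complex_vector.subspace V"
    and p_add: "\<And>x y. x \<in> V ==> y \<in> V ==> p (x + y) \<le> p x + p y"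
    and p_scale: "\<And>c x. x \<in> V ==> p (c *\<^sub>C x) = cmod c * p x"
    and G: "dominated_graph V p G" and ne: "G \<noteq> {}" and y: "y \<in> V"
  obtains G' a where "dominated_graph V p G'" "G \<subseteq> G'" "(y, a) \<in> G'"
proof -
  note GD = dominated_graphD[OF G]
  have add: "u + v \<in> V" if "u \<in> V" "v \<in> V" for u v using complex_vector.subspace_add[OF V that] .
  have scale: "c *\<^sub>C u \<in> V" if "u \<in> V" for c u using complex_vector.subspace_scale[OF V that] .
  have diff: "u - v \<in> V" if "u \<in> V" "v \<in> V" for u v using complex_vector.subspace_diff[OF V that] .
  have key: "s - p (v - y) \<le> p (x + y) - r" if "(x, r) \<in> G" "(v, s) \<in> G" for x r v s
  proof -
    have "r + s \<le> p (x + v)" using GD(2)[OF GD(3)[OF that]] .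
    also have "\<dots> = p ((x + y) + (v - y))" by simp
    also have "\<dots> \<le> p (x + y) + p (v - y)" using GD(1)[OF that(1)] GD(1)[OF that(2)] y by (intro p_add add diff)
    finally show ?thesis by simp
  qed
  obtain x0 r0 where x0: "(x0, r0) \<in> G" using ne by (metis all_not_in_conv surj_pair)
  let ?S = "(\<lambda>(v, s). s - p (v - y)) ` G"
  define a where "a = Sup ?S"
  have bdd: "bdd_above ?S" using key[OF x0] by (intro bdd_aboveI[of _ "p (x0 + y) - r0"]) auto
  have a1: "s - p (v - y) \<le> a" if "(v, s) \<in> G" for v s
    unfolding a_def by (rule cSup_upper[OF _ bdd]) (use that in force)
  have a2: "a \<le> p (x + y) - r" if "(x, r) \<in> G" for x r
    unfolding a_def by (rule cSup_least) (use key[OF that] x0 in auto)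
  define G' where "G' = {(x + complex_of_real t *\<^sub>C y, r + t * a) | x r t. (x, r) \<in> G}"
  have dom: "r + t * a \<le> p (x + complex_of_real t *\<^sub>C y)" if xr: "(x, r) \<in> G" for x r t
  proof -
    note xV = GD(1)[OF xr]
    consider "t = 0" | "t > 0" | "t < 0" by linarith
    then show ?thesis
    proof cases
      case 1
      then show ?thesis using GD(2)[OF xr] by simp
    next
      case 2
      have "a \<le> p (complex_of_real (1 / t) *\<^sub>C x + y) - (1 / t) * r" by (rule a2[OF GD(4)[OF xr]])
      then have "t * a \<le> t * (p (complex_of_real (1 / t) *\<^sub>C x + y) - (1 / t) * r)"
        using 2 by (intro mult_left_mono) auto
      also have "\<dots> = t * p (complex_of_real (1 / t) *\<^sub>C x + y) - r" using 2 by (simp add: right_diff_distrib)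
      also have "t * p (complex_of_real (1 / t) *\<^sub>C x + y) = p (complex_of_real t *\<^sub>C (complex_of_real (1 / t) *\<^sub>C x + y))"
        using 2 xV y by (subst p_scale) (auto intro: add scale)
      also have "complex_of_real t *\<^sub>C (complex_of_real (1 / t) *\<^sub>C x + y) = x + complex_of_real t *\<^sub>C y"
        using 2 by (simp add: scaleC_add_right scaleC_scaleC scaleC_one)
      finally show ?thesis by simp
    next
      case 3
      have V3: "complex_of_real (1 / - t) *\<^sub>C x - y \<in> V" by (intro diff scale xV y)
      have "(1 / - t) * r - p (complex_of_real (1 / - t) *\<^sub>C x - y) \<le> a" by (rule a1[OF GD(4)[OF xr]])
      then have "- t * ((1 / - t) * r - p (complex_of_real (1 / - t) *\<^sub>C x - y)) \<le> - t * a"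
        using 3 by (intro mult_left_mono) auto
      moreover have "- t * ((1 / - t) * r - p (complex_of_real (1 / - t) *\<^sub>C x - y)) =
          r - (- t) * p (complex_of_real (1 / - t) *\<^sub>C x - y)" using 3 by (simp add: right_diff_distrib)
      moreover have "(- t) * p (complex_of_real (1 / - t) *\<^sub>C x - y) =
          p (complex_of_real (- t) *\<^sub>C (complex_of_real (1 / - t) *\<^sub>C x - y))"
        using 3 unfolding p_scale[OF V3] by simp
      moreover have "complex_of_real (- t) *\<^sub>C (complex_of_real (1 / - t) *\<^sub>C x - y) = x + complex_of_real t *\<^sub>C y"
      proof -
        have "complex_of_real (- t) *\<^sub>C (complex_of_real (1 / - t) *\<^sub>C x - y) =
            (complex_of_real (- t) * complex_of_real (1 / - t)) *\<^sub>C x - complex_of_real (- t) *\<^sub>C y"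
          by (simp only: complex_vector.scale_right_diff_distrib scaleC_scaleC)
        also have "complex_of_real (- t) * complex_of_real (1 / - t) = 1" using 3 by simp
        finally show ?thesis by (simp add: scaleC_one complex_vector.scale_minus_left)
      qed
      ultimately show ?thesis by simp
    qed
  qed
  have "dominated_graph V p G'"
    unfolding dominated_graph_def
  proof (intro conjI)
    show "\<forall>(x, r)\<in>G'. x \<in> V \<and> r \<le> p x"
      unfolding G'_def using dom by (auto intro!: add scale y dest: GD(1))
    have "(x + complex_of_real t *\<^sub>C y + (x' + complex_of_real t' *\<^sub>C y), r + t * a + (r' + t' * a)) \<in> G'"
      if "(x, r) \<in> G" "(x', r') \<in> G" for x x' t t' r r'
      unfolding G'_def using GD(3)[OF that]
      by (intro CollectI exI[of _ "x + x'"] exI[of _ "r + r'"] exI[of _ "t + t'"])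
        (simp add: scaleC_add_left algebra_simps)
    then show "\<forall>(x, r)\<in>G'. \<forall>(y, s)\<in>G'. (x + y, r + s) \<in> G'" unfolding G'_def by blast
    have "(complex_of_real k *\<^sub>C (x + complex_of_real t *\<^sub>C y), k * (r + t * a)) \<in> G'"
      if "(x, r) \<in> G" for x t r k
      unfolding G'_def using GD(4)[OF that, of k]
      by (intro CollectI exI[of _ "complex_of_real k *\<^sub>C x"] exI[of _ "k * r"] exI[of _ "k * t"])
        (simp add: scaleC_add_right scaleC_scaleC algebra_simps)
    then show "\<forall>(x, r)\<in>G'. \<forall>t. (complex_of_real t *\<^sub>C x, t * r) \<in> G'" unfolding G'_def by blast
  qed
  moreover have "G \<subseteq> G'"
  proof
    fix q assume q: "q \<in> G"
    show "q \<in> G'" unfolding G'_def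
      by (rule CollectI, rule exI[of _ "fst q"], rule exI[of _ "snd q"], rule exI[of _ 0]) (use q in simp)
  qed
  moreover have "(y, a) \<in> G'"
    unfolding G'_def using GD(4)[OF x0, of 0]
    by (intro CollectI exI[of _ 0] exI[of _ 0] exI[of _ 1]) (simp add: scaleC_one)
  ultimately show thesis by (rule that)
qed

text \<open>Zorn's lemma gives a real functional \<open>f\<close>; then \<open>f x - \<i> f (\<i> x)\<close>
  is complex linear and satisfies the same bound.\<close>

lemma hahn_banach:
  fixes V :: "'a::complex_vector set"
  assumes V: "complex_vector.subspace V"
    and p_add: "\<And>x y. x \<in> V ==> y \<in> V ==> p (x + y) \<le> p x + p y"
    and p_scale: "\<And>c x. x \<in> V ==> p (c *\<^sub>C x) = cmod c * p x"
    and u0: "u0 \<in> V"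
  obtains \<Phi> :: "'a => complex" where
    "\<And>x y. x \<in> V ==> y \<in> V ==> \<Phi> (x + y) = \<Phi> x + \<Phi> y" "\<And>c x. x \<in> V ==> \<Phi> (c *\<^sub>C x) = c * \<Phi> x"
    "\<And>x. x \<in> V ==> cmod (\<Phi> x) \<le> p x" "cmod (\<Phi> u0) = p u0"
proof -
  note scale = complex_vector.subspace_scale[OF V] and addV = complex_vector.subspace_add[OF V]
  define G0 where "G0 = {(complex_of_real t *\<^sub>C u0, t * p u0) | t. True}"
  have p_neg: "p (- x) = p x" if "x \<in> V" for x
    using p_scale[OF that, of "-1"] by (simp add: complex_vector.scale_minus_left scaleC_one)
  have p0: "p 0 = 0" using p_scale[OF complex_vector.subspace_0[OF V], of 0] by simp
  have pnn: "0 \<le> p x" if "x \<in> V" for x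
    using p_add[OF that, of "- x"] p_neg[OF that] complex_vector.subspace_neg[OF V that] p0 by simp
  have G0: "dominated_graph V p G0"
    unfolding dominated_graph_def
  proof (intro conjI)
    show "\<forall>(x, r)\<in>G0. x \<in> V \<and> r \<le> p x"
      using pnn[OF u0] by (auto simp: G0_def scale u0 p_scale mult_right_mono)
    have "(complex_of_real t *\<^sub>C u0 + complex_of_real t' *\<^sub>C u0, t * p u0 + t' * p u0) \<in> G0" for t t'
      unfolding G0_def by (rule CollectI, rule exI[of _ "t + t'"]) (simp add: scaleC_add_left distrib_right)
    then show "\<forall>(x, r)\<in>G0. \<forall>(y, s)\<in>G0. (x + y, r + s) \<in> G0" by (auto simp: G0_def)
    have "(complex_of_real k *\<^sub>C complex_of_real t *\<^sub>C u0, k * (t * p u0)) \<in> G0" for k t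
      unfolding G0_def by (rule CollectI, rule exI[of _ "k * t"]) (simp add: scaleC_scaleC)
    then show "\<forall>(x, r)\<in>G0. \<forall>t. (complex_of_real t *\<^sub>C x, t * r) \<in> G0" by (auto simp: G0_def)
  qed
  have "\<exists>M\<in>{G. dominated_graph V p G \<and> G0 \<subseteq> G}. \<forall>X\<in>{G. dominated_graph V p G \<and> G0 \<subseteq> G}. M \<subseteq> X \<longrightarrow> X = M"
  proof (rule subset_Zorn_nonempty)
    show "{G. dominated_graph V p G \<and> G0 \<subseteq> G} \<noteq> {}" using G0 by blast
    fix \<C> assume \<C>: "\<C> \<noteq> {}" "subset.chain {G. dominated_graph V p G \<and> G0 \<subseteq> G} \<C>"
    have D: "dominated_graph V p X" "G0 \<subseteq> X" if "X \<in> \<C>" for X using \<C>(2) that by (auto simp: subset.chain_def)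
    have two: "\<exists>X\<in>\<C>. q \<in> X \<and> q' \<in> X" if "q \<in> \<Union> \<C>" "q' \<in> \<Union> \<C>" for q q'
      using \<C>(2) that unfolding subset.chain_def by blast
    have "dominated_graph V p (\<Union> \<C>)"
      unfolding dominated_graph_def
    proof (intro conjI)
      show "\<forall>(x, r)\<in>\<Union> \<C>. x \<in> V \<and> r \<le> p x" using D(1) unfolding dominated_graph_def by blast
      have "(x + y, r + s) \<in> \<Union> \<C>" if "(x, r) \<in> \<Union> \<C>" "(y, s) \<in> \<Union> \<C>" for x y r s
        using two[OF that] dominated_graphD(3)[OF D(1)] by blast
      then show "\<forall>(x, r)\<in>\<Union> \<C>. \<forall>(y, s)\<in>\<Union> \<C>. (x + y, r + s) \<in> \<Union> \<C>" by blast
      show "\<forall>(x, r)\<in>\<Union> \<C>. \<forall>t. (complex_of_real t *\<^sub>C x, t * r) \<in> \<Union> \<C>"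
        using D(1) unfolding dominated_graph_def by blast
    qed
    then show "\<Union> \<C> \<in> {G. dominated_graph V p G \<and> G0 \<subseteq> G}" using D(2) \<C>(1) by blast
  qed
  then obtain G where G': "G \<in> {G. dominated_graph V p G \<and> G0 \<subseteq> G}"
    "\<forall>X\<in>{G. dominated_graph V p G \<and> G0 \<subseteq> G}. G \<subseteq> X \<longrightarrow> X = G" by (rule bexE)
  have G: "dominated_graph V p G" "G0 \<subseteq> G" using G'(1) by simp_all
  have max: "X = G" if "dominated_graph V p X" "G \<subseteq> X" for X using G'(2) that G(2) by auto
  note GD = dominated_graphD[OF G(1)]
  have u0G: "(u0, p u0) \<in> G" using G(2) unfolding G0_def by (auto intro!: exI[of _ 1] simp: scaleC_one)
  have total: "\<exists>r. (y, r) \<in> G" if y: "y \<in> V" for y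
  proof -
    obtain G' a where "dominated_graph V p G'" "G \<subseteq> G'" "(y, a) \<in> G'"
      using dominated_graph_extend[OF V p_add p_scale G(1) _ y] u0G by blast
    then show ?thesis using max by blast
  qed
  have single: "r = s" if "(x, r) \<in> G" "(x, s) \<in> G" for x r s
  proof -
    have "(0, r - s) \<in> G" if "(x, r) \<in> G" "(x, s) \<in> G" for r s
      using GD(3)[OF that(1) GD(4)[OF that(2), of "-1"]] by (simp add: complex_vector.scale_minus_left scaleC_one)
    then show ?thesis using GD(2) p0 that by (metis diff_le_0_iff_le order_antisym)
  qed
  define f where "f x = (THE r. (x, r) \<in> G)" for x
  have fG: "(x, f x) \<in> G" if "x \<in> V" for x
    unfolding f_def using total[OF that] single by (metis theI)
  have feq: "f x = r" if "(x, r) \<in> G" for x r using single[OF fG[OF GD(1)[OF that]] that] .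
  have f_add: "f (x + y) = f x + f y" if "x \<in> V" "y \<in> V" for x y by (rule feq[OF GD(3)[OF fG fG]]) (use that in auto)
  have f_scale: "f (complex_of_real t *\<^sub>C x) = t * f x" if "x \<in> V" for t x by (rule feq[OF GD(4)[OF fG[OF that]]])
  have f_le: "f x \<le> p x" if "x \<in> V" for x by (rule GD(2)[OF fG[OF that]])
  define \<Phi> where "\<Phi> x = Complex (f x) (- f (\<i> *\<^sub>C x))" for x
  have \<Phi>_add: "\<Phi> (x + y) = \<Phi> x + \<Phi> y" if "x \<in> V" "y \<in> V" for x y
    using that by (simp add: \<Phi>_def f_add scale scaleC_add_right complex_eq_iff)
  have \<Phi>_scale: "\<Phi> (c *\<^sub>C x) = c * \<Phi> x" if x: "x \<in> V" for c x
  proof -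
    have r: "f (d *\<^sub>C x) = Re d * f x + Im d * f (\<i> *\<^sub>C x)" for d
    proof -
      have e: "d *\<^sub>C x = complex_of_real (Re d) *\<^sub>C x + complex_of_real (Im d) *\<^sub>C \<i> *\<^sub>C x"
      proof -
        have "complex_of_real (Re d) + complex_of_real (Im d) * \<i> = d" by (simp add: complex_eq_iff)
        then show ?thesis unfolding scaleC_scaleC scaleC_add_left[symmetric] by simp
      qed
      have "f (d *\<^sub>C x) = f (complex_of_real (Re d) *\<^sub>C x) + f (complex_of_real (Im d) *\<^sub>C \<i> *\<^sub>C x)"
        by (subst e) (rule f_add[OF scale[OF x] scale[OF scale[OF x]]])
      then show ?thesis unfolding f_scale[OF x] f_scale[OF scale[OF x]] .
    qed
    have "f (\<i> *\<^sub>C c *\<^sub>C x) = Re (\<i> * c) * f x + Im (\<i> * c) * f (\<i> *\<^sub>C x)"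
      unfolding scaleC_scaleC by (rule r)
    then show ?thesis unfolding \<Phi>_def r[of c] by (simp add: complex_eq_iff algebra_simps)
  qed
  have \<Phi>_le: "cmod (\<Phi> x) \<le> p x" if x: "x \<in> V" for x
  proof (cases "\<Phi> x = 0")
    case False
    let ?c = "cnj (\<Phi> x) / cmod (\<Phi> x)"
    have "\<Phi> (?c *\<^sub>C x) = complex_of_real (cmod (\<Phi> x))"
      using False by (simp add: \<Phi>_scale[OF x] complex_norm_square[symmetric] mult.commute power2_eq_square
        flip: of_real_mult) simp
    then have "cmod (\<Phi> x) = f (?c *\<^sub>C x)" by (simp add: \<Phi>_def complex_eq_iff)
    also have "\<dots> \<le> p (?c *\<^sub>C x)" by (rule f_le[OF scale[OF x]])
    also have "\<dots> = p x" using False by (simp add: p_scale[OF x] norm_divide)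
    finally show ?thesis .
  qed (use pnn[OF x] in simp)
  have "p u0 = Re (\<Phi> u0)" using feq[OF u0G] by (simp add: \<Phi>_def)
  also have "\<dots> \<le> cmod (\<Phi> u0)" by (rule complex_Re_le_cmod)
  finally have "cmod (\<Phi> u0) = p u0" using \<Phi>_le[OF u0] by simp
  note facts = \<Phi>_add \<Phi>_scale \<Phi>_le this
  show thesis by (rule that; fact facts)
qed

subsection \<open>The norm by coefficients\<close>

text \<open>This turns out to be the norm of \<open>B\<close> as the predual of the universal von Neumann
  algebra.\<close>

definition coeff_norm :: "('g::topological_group_add => complex) => real" where
  "coeff_norm u = Inf {nmu \<xi> * nmu \<eta> | \<xi> \<eta>.
     \<xi> \<in> Hu \<and> \<eta> \<in> Hu \<and> u = mcoeff \<xi> \<eta>}"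

lemma coeff_norm_set_bdd: "bdd_below {nmu \<xi> * nmu \<eta> | \<xi> \<eta>.
     \<xi> \<in> Hu \<and> \<eta> \<in> Hu \<and> u = mcoeff \<xi> \<eta>}"
  by (rule bdd_belowI[of _ 0]) auto

lemma coeff_norm_le:
  "\<xi> \<in> Hu ==> \<eta> \<in> Hu ==> coeff_norm (mcoeff \<xi> \<eta>) \<le> nmu \<xi> * nmu \<eta>"
  unfolding coeff_norm_def by (rule cInf_lower[OF _ coeff_norm_set_bdd]) auto

lemma coeff_norm_lessE:
  assumes "u \<in> FS" "coeff_norm u < r"
  obtains \<xi> \<eta> where "\<xi> \<in> Hu" "\<eta> \<in> Hu" "u = mcoeff \<xi> \<eta>"
    "nmu \<xi> * nmu \<eta> < r"
proof -
  have "{nmu \<xi> * nmu \<eta> | \<xi> \<eta>.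
     \<xi> \<in> Hu \<and> \<eta> \<in> Hu \<and> u = mcoeff \<xi> \<eta>} \<noteq> {}"
    by (rule FS_E[OF assms(1)]) blast
  from cInf_lessD[OF this assms(2)[unfolded coeff_norm_def]] that show thesis by blast
qed

lemma coeff_norm_nonneg: "u \<in> FS ==> 0 \<le> coeff_norm u"
  by (rule ccontr) (auto elim!: coeff_norm_lessE[of u 0] simp: not_le mult_less_0_iff dest!: univ.nm_ge_0)

lemma coeff_norm_balancedE:
  assumes "u \<in> FS" "coeff_norm u < r"
  obtains \<xi> \<eta> where "\<xi> \<in> Hu" "\<eta> \<in> Hu" "u = mcoeff \<xi> \<eta>"
    "(nmu \<xi>)\<^sup>2 \<le> r" "(nmu \<eta>)\<^sup>2 \<le> r"
proof -
  obtain \<xi> \<eta> where x: "\<xi> \<in> Hu" "\<eta> \<in> Hu" "u = mcoeff \<xi> \<eta>"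
    "nmu \<xi> * nmu \<eta> < r" using assms by (rule coeff_norm_lessE)
  let ?a = "nmu \<xi>" and ?b = "nmu \<eta>"
  have r0: "r > 0" using coeff_norm_nonneg[OF assms(1)] assms(2) by simp
  show thesis
  proof (cases "?a = 0 \<or> ?b = 0")
    case True
    then have "\<xi> = 0 \<or> \<eta> = 0" using univ.nm_eq_0[OF x(1)] univ.nm_eq_0[OF x(2)] by blast
    then have "u s = mcoeff 0 0 s" for s
      using x(1,2) unfolding x(3) mcoeff_def
      by (elim disjE) (simp_all only: univ.op_zero[OF univ.rep_bounded] univ.ip_zero_left univ.ip_zero_right univ.zero_in univ.rep_in)
    then have "u = mcoeff 0 0" by (rule ext)
    then show thesis using that[of 0 0] r0 by simp
  next
    case False
    then have pos: "?a > 0" "?b > 0" using x univ.nm_ge_0 by (auto simp: order_less_le)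
    define t where "t = sqrt (?b / ?a)"
    have t: "t > 0" "t\<^sup>2 = ?b / ?a" using pos by (auto simp: t_def)
    show thesis
    proof (rule that[of "complex_of_real t *\<^sub>C \<xi>" "complex_of_real (1 / t) *\<^sub>C \<eta>"])
      show "u = mcoeff (complex_of_real t *\<^sub>C \<xi>) (complex_of_real (1 / t) *\<^sub>C \<eta>)"
        using x t by (subst mcoeff_scale(1), simp, simp, subst mcoeff_scale(2)) (simp_all add: scaleC_scaleC scaleC_one)
      show "(nmu (complex_of_real t *\<^sub>C \<xi>))\<^sup>2 \<le> r"
      proof -
        have "(nmu (complex_of_real t *\<^sub>C \<xi>))\<^sup>2 = t\<^sup>2 * ?a\<^sup>2"
          using x t by (simp add: univ.nm_scale power_mult_distrib)
        also have "\<dots> = ?a * ?b" using pos unfolding t(2) by (simp add: power2_eq_square)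
        finally show ?thesis using x(4) by simp
      qed
      show "(nmu (complex_of_real (1 / t) *\<^sub>C \<eta>))\<^sup>2 \<le> r"
      proof -
        have "(nmu (complex_of_real (1 / t) *\<^sub>C \<eta>))\<^sup>2 = ?b\<^sup>2 / t\<^sup>2"
          using x t by (simp add: univ.nm_scale norm_divide power_divide)
        also have "\<dots> = ?a * ?b" using pos unfolding t(2) by (simp add: power2_eq_square)
        finally show ?thesis using x(4) by simp
      qed
    qed (use x in auto)
  qed
qed

lemma coeff_norm_scale:
  assumes u: "u \<in> FS"
  shows "coeff_norm (c *\<^sub>C u) = cmod c * coeff_norm u"
proof -
  have le: "coeff_norm (d *\<^sub>C v) \<le> cmod d * coeff_norm v" if v: "v \<in> FS" for d and v :: "'a => complex"
  proof (rule field_le_epsilon)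
    fix e :: real assume "e > 0"
    then have e': "e / (cmod d + 1) > 0" by (simp add: add_nonneg_pos)
    obtain \<xi> \<eta> where x: "\<xi> \<in> Hu" "\<eta> \<in> Hu" "v = mcoeff \<xi> \<eta>"
      "nmu \<xi> * nmu \<eta> < coeff_norm v + e / (cmod d + 1)"
      by (rule coeff_norm_lessE[OF v, of "coeff_norm v + e / (cmod d + 1)"]) (use e' in auto)
    have "coeff_norm (d *\<^sub>C v) \<le> nmu (d *\<^sub>C \<xi>) * nmu \<eta>"
      using coeff_norm_le[of "d *\<^sub>C \<xi>" \<eta>] x by (simp add: mcoeff_scale univ.scale_in)
    also have "\<dots> = cmod d * (nmu \<xi> * nmu \<eta>)" using x by (simp add: univ.nm_scale)
    also have "\<dots> \<le> cmod d * (coeff_norm v + e / (cmod d + 1))" using x(4) by (intro mult_left_mono) auto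
    also have "\<dots> = cmod d * coeff_norm v + e * (cmod d / (cmod d + 1))" by (simp add: algebra_simps)
    also have "e * (cmod d / (cmod d + 1)) \<le> e * 1"
      using \<open>e > 0\<close> by (intro mult_left_mono) (auto simp: divide_le_eq add_nonneg_pos)
    finally show "coeff_norm (d *\<^sub>C v) \<le> cmod d * coeff_norm v + e" by simp
  qed
  show ?thesis
  proof (cases "c = 0")
    case True
    have z: "0 \<in> (FS :: ('a => complex) set)" using fs_subspace complex_vector.subspace_0 by blast
    have "coeff_norm (0 *\<^sub>C u) = 0" using le[OF u, of 0] coeff_norm_nonneg[OF z] by simp
    then show ?thesis using True by simp
  next
    case False
    have "u = (1 / c) *\<^sub>C c *\<^sub>C u" using False by (simp add: scaleC_scaleC scaleC_one)
    then have "coeff_norm u \<le> cmod (1 / c) * coeff_norm (c *\<^sub>C u)" using le[OF fs_scale(1)[OF u, of c], of "1 / c"] by simp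
    then have "cmod c * coeff_norm u \<le> coeff_norm (c *\<^sub>C u)" using False by (simp add: norm_divide field_simps)
    then show ?thesis using le[OF u, of c] by simp
  qed
qed

text \<open>An absolutely convergent series of coefficients is a coefficient, of a direct sum.\<close>

lemma coeff_series:
  assumes u: "\<And>n::nat. u n \<in> FS" and N: "\<And>n. coeff_norm (u n) < r n" and r: "r sums R"
  obtains v where "v \<in> FS" "coeff_norm v \<le> R" "\<And>s. (\<lambda>n. u n s) sums v s"
proof -
  have "\<exists>\<xi> \<eta>. \<xi> \<in> Hu \<and> \<eta> \<in> Hu \<and> u n = mcoeff \<xi> \<eta> \<and>
    (nmu \<xi>)\<^sup>2 \<le> r n \<and> (nmu \<eta>)\<^sup>2 \<le> r n" for n
    using coeff_norm_balancedE[OF u N, of n] by metis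
  then obtain \<xi> \<eta> where x: "\<And>n. \<xi> n \<in> Hu" "\<And>n. \<eta> n \<in> Hu"
    "\<And>n. u n = mcoeff (\<xi> n) (\<eta> n)" "\<And>n. (nmu (\<xi> n))\<^sup>2 \<le> r n" "\<And>n. (nmu (\<eta> n))\<^sup>2 \<le> r n" by metis
  have rs: "(r has_sum R) UNIV"
    using r N coeff_norm_nonneg[OF u] by (intro sums_nonneg_imp_has_sum) (auto intro: less_imp_le order_le_less_trans)
  have s: "(\<lambda>n. (nmu (\<xi> n))\<^sup>2) summable_on UNIV" "(\<lambda>n. (nmu (\<eta> n))\<^sup>2) summable_on UNIV"
    by (rule summable_on_comparison_test[OF has_sum_imp_summable[OF rs]]; use x(4,5) in simp)+
  obtain \<xi>' \<eta>' where y: "\<xi>' \<in> Hu" "\<eta>' \<in> Hu"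
    "(nmu \<xi>')\<^sup>2 \<le> (\<Sum>\<^sub>\<infinity>n. (nmu (\<xi> n))\<^sup>2)" "(nmu \<eta>')\<^sup>2 \<le> (\<Sum>\<^sub>\<infinity>n. (nmu (\<eta> n))\<^sup>2)"
    "\<And>s. ((\<lambda>n. mcoeff (\<xi> n) (\<eta> n) s) has_sum mcoeff \<xi>' \<eta>' s) UNIV"
    by (rule coeff_sum_in_FS[of UNIV \<xi> \<eta>, OF x(1,2) has_sum_infsum[OF s(1)] has_sum_infsum[OF s(2)]]) (rule that)
  have "(\<Sum>\<^sub>\<infinity>n. (nmu (\<xi> n))\<^sup>2) \<le> R" "(\<Sum>\<^sub>\<infinity>n. (nmu (\<eta> n))\<^sup>2) \<le> R"
    using has_sum_mono[OF has_sum_infsum[OF s(1)] rs] has_sum_mono[OF has_sum_infsum[OF s(2)] rs] x(4,5) by auto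
  then have "(nmu \<xi>')\<^sup>2 \<le> R" "(nmu \<eta>')\<^sup>2 \<le> R" using y by linarith+
  then have "2 * nmu \<xi>' * nmu \<eta>' \<le> 2 * R"
    using sum_squares_bound[of "nmu \<xi>'" "nmu \<eta>'"] by linarith
  then have "coeff_norm (mcoeff \<xi>' \<eta>') \<le> R" using coeff_norm_le[OF y(1,2)] by simp
  moreover have "(\<lambda>n. u n s) sums mcoeff \<xi>' \<eta>' s" for s using has_sum_imp_sums[OF y(5)] x(3) by simp
  ultimately show thesis using that mcoeff_in_FS[OF y(1,2)] by blast
qed

lemma coeff_norm_zero: "coeff_norm (0 :: 'g::topological_group_add => complex) = 0"
proof -
  have "coeff_norm ((0::complex) *\<^sub>C (0 :: 'g => complex)) = cmod 0 * coeff_norm (0 :: 'g => complex)"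
    by (rule coeff_norm_scale) (use fs_subspace complex_vector.subspace_0 in blast)
  then show ?thesis by simp
qed

text \<open>A finite sum is treated as a series, padded by zeros.\<close>

lemma coeff_norm_triangle:
  fixes u v :: "'g::topological_group_add => complex"
  assumes u: "u \<in> FS" and v: "v \<in> FS"
  shows "coeff_norm (u + v) \<le> coeff_norm u + coeff_norm v"
proof (rule field_le_epsilon)
  fix e :: real assume e: "e > 0"
  \<comment> \<open>The bounds must be strict at every index, so \<open>e\<close> is spread over a geometric series.\<close>
  let ?u = "\<lambda>n::nat. if n = 0 then u else if n = 1 then v else 0"
  let ?r = "\<lambda>n::nat. (if n = 0 then coeff_norm u else if n = 1 then coeff_norm v else 0) + e * (1/2) ^ Suc n"
  have f: "(\<lambda>n::nat. if n = 0 then a else if n = 1 then b else 0) sums (a + b)" for a b :: "'b::real_normed_vector"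
    using sums_finite[of "{0, 1::nat}" "\<lambda>n. if n = 0 then a else if n = 1 then b else 0"] by simp
  have "(\<lambda>n. e * (1/2) ^ Suc n) sums (e * 1)" by (intro sums_mult power_half_series)
  then have r: "?r sums ((coeff_norm u + coeff_norm v) + e)" using sums_add[OF f] by simp
  have uin: "?u n \<in> FS" for n using u v complex_vector.subspace_0[OF fs_subspace] by auto
  obtain w where w: "w \<in> FS" "coeff_norm w \<le> coeff_norm u + coeff_norm v + e" "\<And>s. (\<lambda>n. ?u n s) sums w s"
    by (rule coeff_series[OF uin _ r]) (use e in \<open>auto simp: coeff_norm_zero coeff_norm_zero[unfolded zero_fun_def] intro: that\<close>)
  have "w s = (u + v) s" for s
  proof -
    have "(\<lambda>n. ?u n s) = (\<lambda>n::nat. if n = 0 then u s else if n = 1 then v s else 0)" by auto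
    then show ?thesis using w(3)[of s] f[of "u s" "v s"] sums_unique2 by simp
  qed
  then have "w = u + v" by blast
  then show "coeff_norm (u + v) \<le> coeff_norm u + coeff_norm v + e" using w(2) by simp
qed

lemma fs_pairing_bound:
  assumes u: "u \<in> FS" and A: "A \<in> VN"
    and a: "\<And>x. x \<in> Hu ==> nmu (A x) \<le> a * nmu x" "0 \<le> a"
  shows "cmod (fs_pairing u A) \<le> a * coeff_norm u"
proof (rule field_le_epsilon)
  fix e :: real assume "e > 0"
  then have e': "e / (a + 1) > 0" using a by simp
  obtain \<xi> \<eta> where x: "\<xi> \<in> Hu" "\<eta> \<in> Hu" "u = mcoeff \<xi> \<eta>"
    "nmu \<xi> * nmu \<eta> < coeff_norm u + e / (a + 1)"
    by (rule coeff_norm_lessE[OF u, of "coeff_norm u + e / (a + 1)"]) (use e' in auto)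
  have "cmod (fs_pairing u A) \<le> nmu (A \<xi>) * nmu \<eta>"
    using x A univ.cauchy_schwarz[of "A \<xi>" \<eta>] by (simp add: fs_pairing_mcoeff vn_in)
  also have "\<dots> \<le> a * nmu \<xi> * nmu \<eta>" using a(1)[OF x(1)] x(2) by (intro mult_right_mono) auto
  also have "\<dots> \<le> a * (coeff_norm u + e / (a + 1))" using x(4) a(2) by (simp add: mult.assoc mult_left_mono)
  also have "\<dots> = a * coeff_norm u + e * (a / (a + 1))" by (simp add: algebra_simps)
  also have "e * (a / (a + 1)) \<le> e * 1"
    using \<open>e > 0\<close> a(2) by (intro mult_left_mono) (auto simp: divide_le_eq)
  finally show "cmod (fs_pairing u A) \<le> a * coeff_norm u + e" by simp
qed

text \<open>\<open>B(G)\<close> with the norm by coefficients has the universal von Neumann algebra as its dual: a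
  bounded functional induces a bounded sesquilinear form on the universal space, and the operator
  representing that form commutes with the commutant of the universal representation.\<close>

lemma dual_functional:
  fixes \<Phi> :: "('g::topological_group_add => complex) => complex"
  assumes add: "\<And>u v. u \<in> FS ==> v \<in> FS ==> \<Phi> (u + v) = \<Phi> u + \<Phi> v"
    and scale: "\<And>c u. u \<in> FS ==> \<Phi> (c *\<^sub>C u) = c * \<Phi> u"
    and bound: "\<And>u. u \<in> FS ==> cmod (\<Phi> u) \<le> c * coeff_norm u" and c: "0 \<le> c"
  obtains A where "A \<in> VN" "\<And>x. x \<in> Hu ==> nmu (A x) \<le> c * nmu x"
    "\<And>u. u \<in> FS ==> fs_pairing u A = \<Phi> u"
proof -
  have "\<exists>A\<in>Bu. (\<forall>x\<in>Hu. nmu (A x) \<le> c * nmu x) \<and>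
    (\<forall>x\<in>Hu. \<forall>y\<in>Hu. ipu (A x) y = \<Phi> (mcoeff x y))"
  proof (rule univ.sesquilinear_op[where c = c])
    show "\<Phi> (mcoeff (x + y) z) = \<Phi> (mcoeff x z) + \<Phi> (mcoeff y z)"
      if "x \<in> Hu" "y \<in> Hu" "z \<in> Hu" for x y z :: "'g univ_vector"
      using that by (simp only: mcoeff_add_left add mcoeff_in_FS)
    show "\<Phi> (mcoeff z (x + y)) = \<Phi> (mcoeff z x) + \<Phi> (mcoeff z y)"
      if "x \<in> Hu" "y \<in> Hu" "z \<in> Hu" for x y z :: "'g univ_vector"
      using that by (simp only: mcoeff_add_right add mcoeff_in_FS)
    show "\<Phi> (mcoeff (k *\<^sub>C x) y) = k * \<Phi> (mcoeff x y)" "\<Phi> (mcoeff x (k *\<^sub>C y)) = cnj k * \<Phi> (mcoeff x y)"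
      if "x \<in> Hu" "y \<in> Hu" for k and x y :: "'g univ_vector"
      using that by (simp_all only: mcoeff_scale scale mcoeff_in_FS)
    show "cmod (\<Phi> (mcoeff x y)) \<le> c * nmu x * nmu y"
      if "x \<in> Hu" "y \<in> Hu" for x y :: "'g univ_vector"
      using order_trans[OF bound[OF mcoeff_in_FS[OF that]] mult_left_mono[OF coeff_norm_le[OF that] c]]
      by (simp add: mult.assoc)
  qed (rule c)
  then obtain A where A: "A \<in> Bu" "\<And>x. x \<in> Hu ==> nmu (A x) \<le> c * nmu x"
    "\<And>x y. x \<in> Hu ==> y \<in> Hu ==> ipu (A x) y = \<Phi> (mcoeff x y)" by blast
  have M: "A \<in> VN"
  proof (rule vnI[OF A(1)])
    fix T :: "'g univ_op" and x :: "'g univ_vector"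
    assume T: "T \<in> Bu" "\<And>s. T \<circ> univ_rep s = univ_rep s \<circ> T" and x: "x \<in> Hu"
    show "A (T x) = T (A x)"
    proof (rule univ.eqI)
      fix y :: "'g univ_vector" assume y: "y \<in> Hu"
      have "mcoeff (T x) y = mcoeff x (univ.adj T y)"
      proof
        fix s
        have "univ_rep s (T x) = T (univ_rep s x)" using T(2)[of s] by (metis comp_apply)
        then show "mcoeff (T x) y s = mcoeff x (univ.adj T y) s"
          using x y by (simp add: mcoeff_def univ.ip_adj'[OF T(1)] univ.rep_in)
      qed
      then have "ipu (A (T x)) y = ipu (A x) (univ.adj T y)"
        using A(3)[of "T x" y] A(3)[of x "univ.adj T y"] x y T(1) univ.adj_bounded[OF T(1)] by auto
      then show "ipu (A (T x)) y = ipu (T (A x)) y"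
        using univ.ip_adj'[OF T(1) univ.op_in[OF A(1) x] y] by simp
    qed (use x T(1) A(1) in auto)
  qed
  have "fs_pairing u A = \<Phi> u" if "u \<in> FS" for u
    using that by (rule FS_E) (simp add: fs_pairing_mcoeff M A(3))
  then show thesis using that M A(2) by blast
qed

text \<open>A norming functional exists by the Hahn--Banach theorem and is given by an operator.\<close>

lemma norming_operator:
  assumes u: "u \<in> FS"
  obtains A where "A \<in> VN" "\<And>x. x \<in> Hu ==> nmu (A x) \<le> nmu x"
    "cmod (fs_pairing u A) = coeff_norm u"
proof -
  obtain \<Phi> where \<Phi>: "\<And>x y. x \<in> FS ==> y \<in> FS ==> \<Phi> (x + y) = \<Phi> x + \<Phi> y"
    "\<And>c x. x \<in> FS ==> \<Phi> (c *\<^sub>C x) = c * \<Phi> x"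
    "\<And>x. x \<in> FS ==> cmod (\<Phi> x) \<le> coeff_norm x" "cmod (\<Phi> u) = coeff_norm u"
    by (rule hahn_banach[OF fs_subspace coeff_norm_triangle coeff_norm_scale u]) (assumption | rule that)+
  obtain A where A: "A \<in> VN" "\<And>x. x \<in> Hu ==> nmu (A x) \<le> 1 * nmu x"
    "\<And>u. u \<in> FS ==> fs_pairing u A = \<Phi> u"
    by (rule dual_functional[OF \<Phi>(1,2), of 1]) (use \<Phi>(3) in \<open>simp_all add: that\<close>)
  show thesis by (rule that[OF A(1)]) (use A(2,3) \<Phi>(4) u in simp_all)
qed

lemma single_in_vn_ball:
  assumes "A \<in> VN" "\<And>x. x \<in> Hu ==> nmu (A x) \<le> nmu x"
  shows "(\<lambda>k l. A) \<in> vn_matrix_ball 1"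
proof -
  have one: "{..<1::nat} = {0}" by auto
  have "opmat_norm univ_space {..<1::nat} {..<1::nat} (\<lambda>k l. A) \<le> 1"
    unfolding one
  proof (rule univ.opmat_norm_le[OF vn_bounded[OF assms(1)]])
    fix \<xi> \<eta> :: "nat => 'a univ_vector"
    assume x: "\<And>j. j \<in> {0} ==> \<xi> j \<in> Hu" "\<And>i. i \<in> {0} ==> \<eta> i \<in> Hu"
    have "cmod (ipu (A (\<xi> 0)) (\<eta> 0)) \<le> nmu (A (\<xi> 0)) * nmu (\<eta> 0)"
      by (rule univ.cauchy_schwarz) (use x assms(1) in auto)
    also have "\<dots> \<le> nmu (\<xi> 0) * nmu (\<eta> 0)"
      by (rule mult_right_mono[OF assms(2)]) (use x in auto)
    finally show "cmod (\<Sum>i\<in>{0}. \<Sum>j\<in>{0}. ipu (A (\<xi> j)) (\<eta> i))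
        \<le> 1 * L2_set (\<lambda>j. nmu (\<xi> j)) {0} * L2_set (\<lambda>i. nmu (\<eta> i)) {0}"
      using x by (simp add: L2_set_def)
  qed simp
  then show ?thesis using assms(1) by (simp add: vn_matrix_ball_def)
qed

text \<open>The upper bound is the Cauchy--Schwarz inequality; the lower bound tests against a norming
  operator.\<close>

lemma fs_matnorm_1:
  fixes u :: "'g::topological_group_add => complex"
  assumes u: "u \<in> FS"
  shows "fs_matnorm 1 (\<lambda>_ _. u) = coeff_norm u"
proof (rule antisym)
  show "fs_matnorm 1 (\<lambda>_ _. u) \<le> coeff_norm u"
  proof (rule field_le_epsilon)
    fix e :: real assume "e > 0"
    obtain \<xi> \<eta> where x: "\<xi> \<in> Hu" "\<eta> \<in> Hu" "u = mcoeff \<xi> \<eta>"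
      "nmu \<xi> * nmu \<eta> < coeff_norm u + e"
      by (rule coeff_norm_lessE[OF u, of "coeff_norm u + e"]) (use \<open>e > 0\<close> in auto)
    have "fs_matnorm 1 (\<lambda>_ _. u) \<le> nmu \<xi> * nmu \<eta>"
    proof (rule fs_matnorm_le)
      show "cmod (fs_form 1 m (\<lambda>_ _. u) A z w) \<le> nmu \<xi> * nmu \<eta> * L2 1 m z * L2 1 m w"
        if "A \<in> vn_matrix_ball m" for m A z w
        using fs_form_crude_bound[of 1 "\<lambda>_ _. \<xi>" "\<lambda>_ _. \<eta>" A m z w] x that by simp
    qed (use x in auto)
    then show "fs_matnorm 1 (\<lambda>_ _. u) \<le> coeff_norm u + e" using x(4) by simp
  qed
  obtain A where A: "A \<in> VN" "\<And>x. x \<in> Hu ==> nmu (A x) \<le> nmu x"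
    "cmod (fs_pairing u A) = coeff_norm u" by (rule norming_operator[OF u]) (assumption | rule that)+
  have "cmod (fs_form 1 1 (\<lambda>_ _. u) (\<lambda>k l. A) (\<lambda>_. 1) (\<lambda>_. 1)) \<le> fs_matnorm 1 (\<lambda>_ _. u) * L2 1 1 (\<lambda>_. 1) * L2 1 1 (\<lambda>_. 1)"
    by (rule fs_form_bound) (rule u, rule single_in_vn_ball[OF A(1,2)])
  then show "coeff_norm u \<le> fs_matnorm 1 (\<lambda>_ _. u)" by (simp add: fs_form_def A(3) L2_set_def)
qed

text \<open>A rapidly converging subsequence is a telescoping series, which is summed by
  \<open>coeff_series\<close>.\<close>

lemma coeff_norm_complete:
  fixes u :: "nat => 'g::topological_group_add => complex"
  assumes u: "\<And>n. u n \<in> FS"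
    and cauchy: "\<And>e. e > 0 ==> \<exists>N. \<forall>m\<ge>N. \<forall>n\<ge>N. coeff_norm (u m - u n) < e"
  obtains v where "v \<in> FS" "(\<lambda>n. coeff_norm (u n - v)) \<longlonglongrightarrow> 0"
proof -
  have "\<exists>N. \<forall>m\<ge>N. \<forall>n\<ge>N. coeff_norm (u m - u n) < (1/2) ^ Suc k" for k by (rule cauchy) simp
  then obtain N0 where N0: "\<And>k m n. m \<ge> N0 k ==> n \<ge> N0 k ==> coeff_norm (u m - u n) < (1/2) ^ Suc k" by metis
  define N where "N k = Max (N0 ` {..k})" for k
  have Nk: "N0 k \<le> N k" for k unfolding N_def by (intro Max_ge) auto
  have Nmono: "N k \<le> N (Suc k)" for k unfolding N_def by (intro Max_mono) auto
  have diff: "a - b \<in> FS" if "a \<in> FS" "b \<in> FS" for a b :: "'g => complex"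
    using complex_vector.subspace_diff[OF fs_subspace that] .
  define d where "d k = u (N (Suc k)) - u (N k)" for k
  have din: "d k \<in> FS" for k unfolding d_def by (intro diff u)
  have dN: "coeff_norm (d k) < (1/2) ^ Suc k" for k
    unfolding d_def by (rule N0) (use Nk[of k] Nmono[of k] in auto)
  have tele: "(\<Sum>k<n. d (k + K) s) = u (N (n + K)) s - u (N K) s" for n K s
    by (induction n) (auto simp: d_def)
  have tail: "\<exists>w\<in>FS. coeff_norm w \<le> (1/2) ^ K \<and> (\<forall>s. (\<lambda>k. d (k + K) s) sums w s)" for K
  proof -
    have r: "(\<lambda>k. (1/2::real) ^ Suc (k + K)) sums ((1/2) ^ K * 1)"
      using sums_mult[OF power_half_series, of "(1/2) ^ K"] by (simp add: power_add mult.commute)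
    obtain w where "w \<in> FS" "coeff_norm w \<le> (1/2) ^ K * 1" "\<And>s. (\<lambda>k. d (k + K) s) sums w s"
      by (rule coeff_series[OF din _ r]) (use dN in \<open>auto intro: that\<close>)
    then show ?thesis by auto
  qed
  obtain w0 where w0: "w0 \<in> FS" "\<And>s. (\<lambda>k. d k s) sums w0 s" using tail[of 0] by auto
  define v where "v = u (N 0) + w0"
  have v: "v \<in> FS" unfolding v_def by (intro fs_add u w0)
  have lim: "(\<lambda>n. u (N n) s) \<longlonglongrightarrow> v s" for s
  proof -
    have "(\<lambda>n. u (N n) s - u (N 0) s) \<longlonglongrightarrow> w0 s" using w0(2)[of s] tele[of 0] by (simp add: sums_def)
    from tendsto_add[OF this tendsto_const[of "u (N 0) s"]] show ?thesis by (simp add: v_def add.commute)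
  qed
  have close: "coeff_norm (v - u (N K)) \<le> (1/2) ^ K" for K
  proof -
    obtain w where w: "w \<in> FS" "coeff_norm w \<le> (1/2) ^ K" "\<And>s. (\<lambda>k. d (k + K) s) sums w s"
      using tail by blast
    have "w s = v s - u (N K) s" for s
    proof (rule LIMSEQ_unique)
      show "(\<lambda>n. u (N (n + K)) s - u (N K) s) \<longlonglongrightarrow> w s" using w(3)[of s] tele[of K] by (simp add: sums_def)
      show "(\<lambda>n. u (N (n + K)) s - u (N K) s) \<longlonglongrightarrow> v s - u (N K) s"
        by (intro tendsto_diff tendsto_const LIMSEQ_ignore_initial_segment[OF lim])
    qed
    then have "w = v - u (N K)" by (simp add: fun_eq_iff)
    then show ?thesis using w(2) by simp
  qed
  have "(\<lambda>n. coeff_norm (u n - v)) \<longlonglongrightarrow> 0"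
  proof (rule LIMSEQ_I)
    fix r :: real assume r: "r > 0"
    obtain K where K: "(1/2::real) ^ K < r / 2" using real_arch_pow_inv[of "r/2" "1/2"] r by auto
    have "norm (coeff_norm (u n - v) - 0) < r" if n: "n \<ge> N K" for n
    proof -
      have "coeff_norm (u n - v) = coeff_norm ((u n - u (N K)) + (-1) *\<^sub>C (v - u (N K)))"
        by (simp add: complex_vector.scale_minus_left scaleC_one)
      also have "\<dots> \<le> coeff_norm (u n - u (N K)) + coeff_norm ((-1) *\<^sub>C (v - u (N K)))"
        by (intro coeff_norm_triangle fs_scale diff u v)
      also have "coeff_norm ((-1) *\<^sub>C (v - u (N K))) = coeff_norm (v - u (N K))"
        using coeff_norm_scale[OF diff[OF v u], of "-1"] by simp
      also have "coeff_norm (u n - u (N K)) < (1/2) ^ Suc K" by (rule N0) (use n Nk[of K] in auto)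
      finally have "coeff_norm (u n - v) < r" using close[of K] K r unfolding power_Suc by linarith
      then show ?thesis using coeff_norm_nonneg[OF diff[OF u v]] by simp
    qed
    then show "\<exists>no. \<forall>n\<ge>no. norm (coeff_norm (u n - v) - 0) < r" by blast
  qed
  then show thesis using that v by blast
qed

section \<open>Bounds for bilinear forms\<close>

text \<open>The vectors of an arbitrary representation are first moved into finitely many copies of the
  universal one; the bound in each copy is that for contractive operator matrices, and the copies
  are added by the Cauchy--Schwarz inequality.\<close>

lemma rep_matrix_bound:
  fixes \<sigma> :: "('g::topological_group_add, 'a::complex_vector) urep"
  assumes \<sigma>: "unitary_rep \<sigma>" and A: "A \<in> vn_matrix_ball m"
    and \<zeta>: "\<And>l. l < m ==> \<zeta> l \<in> hcarrier (rep_space \<sigma>)" and \<theta>: "\<And>k. k < m ==> \<theta> k \<in> hcarrier (rep_space \<sigma>)"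
  shows "cmod (\<Sum>k<m. \<Sum>l<m. fs_pairing (\<lambda>s. hinner (rep_space \<sigma>) (rep_op \<sigma> s (\<zeta> l)) (\<theta> k)) (A k l))
    \<le> L2_set (\<lambda>l. hnorm (rep_space \<sigma>) (\<zeta> l)) {..<m} * L2_set (\<lambda>k. hnorm (rep_space \<sigma>) (\<theta> k)) {..<m}"
proof -
  interpret urep \<sigma> by unfold_locales fact
  let ?n = "nmu"
  define F where "F = \<zeta> ` {..<m} \<union> \<theta> ` {..<m}"
  have F: "finite F" "F \<subseteq> cr" using \<zeta> \<theta> by (auto simp: F_def)
  obtain N and \<Psi> :: "nat => 'a => 'g univ_vector" where \<Psi>0: "(\<forall>n<N. \<forall>x\<in>F. \<Psi> n x \<in> Hu) \<and>
    (\<forall>x\<in>F. \<forall>y\<in>F. \<forall>s. ip (U s x) y = (\<Sum>n<N. ipu (univ_rep s (\<Psi> n x)) (\<Psi> n y)))"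
    using finite_family_in_univ[OF F] by (elim exE) (rule that, assumption)
  have \<Psi>: "\<Psi> n x \<in> Hu" if "n < N" "x \<in> F" for n x
    using \<Psi>0[THEN conjunct1] that by simp
  have \<Psi>ip: "ip (U s x) y = (\<Sum>n<N. ipu (univ_rep s (\<Psi> n x)) (\<Psi> n y))"
    if "x \<in> F" "y \<in> F" for x y s
    using \<Psi>0[THEN conjunct2] that by blast
  have FF: "l < m ==> \<zeta> l \<in> F" "l < m ==> \<theta> l \<in> F" for l by (auto simp: F_def)
  have pair: "fs_pairing (\<lambda>s. ip (U s x) y) B = (\<Sum>n<N. ipu (B (\<Psi> n x)) (\<Psi> n y))"
    if "x \<in> F" "y \<in> F" "B \<in> VN" for x y B
    using fs_pairing_sum[of "{..<N}" "\<lambda>n. \<Psi> n x" "\<lambda>n. \<Psi> n y" B] \<Psi> that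
    unfolding \<Psi>ip[OF that(1,2)] mcoeff_def by simp
  have nsq: "(\<Sum>n<N. (?n (\<Psi> n x))\<^sup>2) = (nm x)\<^sup>2" if x: "x \<in> F" for x
  proof -
    have xc: "x \<in> cr" using x F by blast
    have "ip x x = (\<Sum>n<N. ipu (\<Psi> n x) (\<Psi> n x))"
      using \<Psi>ip[OF x x, of 0] \<Psi>[OF _ x] xc by simp
    also have "\<dots> = complex_of_real (\<Sum>n<N. (?n (\<Psi> n x))\<^sup>2)"
      using \<Psi>[OF _ x] by (simp add: univ.ip_self)
    finally show ?thesis using ip_self[OF xc] by (simp only: of_real_eq_iff)
  qed
  have L2: "L2_set (\<lambda>n. L2_set (\<lambda>l. ?n (\<Psi> n (\<zeta> l))) {..<m}) {..<N} = L2_set (\<lambda>l. nm (\<zeta> l)) {..<m}"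
    if "\<And>l. l < m ==> \<zeta> l \<in> F" for \<zeta>
  proof -
    have "(\<Sum>n<N. \<Sum>l<m. (?n (\<Psi> n (\<zeta> l)))\<^sup>2) = (\<Sum>l<m. (nm (\<zeta> l))\<^sup>2)"
      by (subst sum.swap) (use nsq that in \<open>auto intro!: sum.cong\<close>)
    then show ?thesis by (simp add: L2_set_def sum_nonneg)
  qed
  have "(\<Sum>k<m. \<Sum>l<m. fs_pairing (\<lambda>s. ip (U s (\<zeta> l)) (\<theta> k)) (A k l))
    = (\<Sum>k<m. \<Sum>l<m. \<Sum>n<N. ipu (A k l (\<Psi> n (\<zeta> l))) (\<Psi> n (\<theta> k)))"
    using FF vn_ballD(1)[OF A] by (intro sum.cong refl pair) auto
  also have "\<dots> = (\<Sum>k<m. \<Sum>n<N. \<Sum>l<m. ipu (A k l (\<Psi> n (\<zeta> l))) (\<Psi> n (\<theta> k)))"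
    by (intro sum.cong refl sum.swap)
  also have "\<dots> = (\<Sum>n<N. \<Sum>k<m. \<Sum>l<m. ipu (A k l (\<Psi> n (\<zeta> l))) (\<Psi> n (\<theta> k)))"
    by (rule sum.swap)
  also have "cmod \<dots> \<le> (\<Sum>n<N. cmod (\<Sum>k<m. \<Sum>l<m. ipu (A k l (\<Psi> n (\<zeta> l))) (\<Psi> n (\<theta> k))))"
    by (rule norm_sum)
  also have "\<dots> \<le> (\<Sum>n<N. \<bar>L2_set (\<lambda>l. ?n (\<Psi> n (\<zeta> l))) {..<m}\<bar> * \<bar>L2_set (\<lambda>k. ?n (\<Psi> n (\<theta> k))) {..<m}\<bar>)"
  proof (rule sum_mono)
    fix n assume n: "n \<in> {..<N}"
    show "cmod (\<Sum>k<m. \<Sum>l<m. ipu (A k l (\<Psi> n (\<zeta> l))) (\<Psi> n (\<theta> k)))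
      \<le> \<bar>L2_set (\<lambda>l. ?n (\<Psi> n (\<zeta> l))) {..<m}\<bar> * \<bar>L2_set (\<lambda>k. ?n (\<Psi> n (\<theta> k))) {..<m}\<bar>"
      using vn_ball_bound[OF A, of "\<lambda>l. \<Psi> n (\<zeta> l)" "\<lambda>k. \<Psi> n (\<theta> k)"] \<Psi> n FF by simp
  qed
  also have "\<dots> \<le> L2_set (\<lambda>n. L2_set (\<lambda>l. ?n (\<Psi> n (\<zeta> l))) {..<m}) {..<N} * L2_set (\<lambda>n. L2_set (\<lambda>k. ?n (\<Psi> n (\<theta> k))) {..<m}) {..<N}"
    by (rule L2_set_mult_ineq)
  also have "\<dots> = L2_set (\<lambda>l. nm (\<zeta> l)) {..<m} * L2_set (\<lambda>k. nm (\<theta> k)) {..<m}"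
    using L2[of \<zeta>] L2[of \<theta>] FF by simp
  finally show ?thesis .
qed

lemma coeff_norm_rep:
  assumes "unitary_rep \<sigma>" "x \<in> hcarrier (rep_space \<sigma>)" "y \<in> hcarrier (rep_space \<sigma>)"
  shows "(\<lambda>s. hinner (rep_space \<sigma>) (rep_op \<sigma> s x) y) \<in> FS"
    and "coeff_norm (\<lambda>s. hinner (rep_space \<sigma>) (rep_op \<sigma> s x) y) \<le> hnorm (rep_space \<sigma>) x * hnorm (rep_space \<sigma>) y"
proof -
  obtain \<xi> \<eta> where *: "\<xi> \<in> Hu" "\<eta> \<in> Hu"
    "nmu \<xi> \<le> hnorm (rep_space \<sigma>) x" "nmu \<eta> \<le> hnorm (rep_space \<sigma>) y"
    "(\<lambda>s. hinner (rep_space \<sigma>) (rep_op \<sigma> s x) y) = mcoeff \<xi> \<eta>"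
    using assms by (rule coefficient_of_rep)
  show "(\<lambda>s. hinner (rep_space \<sigma>) (rep_op \<sigma> s x) y) \<in> FS"
    unfolding *(5) by (rule mcoeff_in_FS[OF *(1,2)])
  show "coeff_norm (\<lambda>s. hinner (rep_space \<sigma>) (rep_op \<sigma> s x) y) \<le> hnorm (rep_space \<sigma>) x * hnorm (rep_space \<sigma>) y"
    unfolding *(5)
    by (rule order_trans[OF coeff_norm_le[OF *(1,2)] mult_mono[OF *(3,4)]])
      (use *(1-3) order_trans[OF univ.nm_ge_0 *(3)] in auto)
qed

lemma mcoeff_mult:
  assumes "\<xi> \<in> Hu" "\<eta> \<in> Hu" "\<xi>' \<in> Hu" "\<eta>' \<in> Hu"
  shows "(\<lambda>s. mcoeff \<xi> \<eta> s * mcoeff \<xi>' \<eta>' s) =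
    (\<lambda>s. hinner (rep_space univ2) (rep_op univ2 s (\<xi> \<otimes> \<xi>')) (\<eta> \<otimes> \<eta>'))"
  using assms by (simp add: tensor_coefficient)

lemma coeff_norm_mult_le:
  assumes a: "\<xi> \<in> Hu" "\<eta> \<in> Hu" and u: "u \<in> FS"
  shows "coeff_norm (\<lambda>s. mcoeff \<xi> \<eta> s * u s) \<le> (nmu \<xi> * nmu \<eta> + 1) * coeff_norm u"
proof (rule field_le_epsilon)
  fix e :: real assume "e > 0"
  let ?c = "nmu \<xi> * nmu \<eta> + 1"
  have c: "?c > 0" "nmu \<xi> * nmu \<eta> \<ge> 0" using a by (auto simp: add_nonneg_pos)
  then have e': "e / ?c > 0" using \<open>e > 0\<close> by simp
  obtain \<xi>' \<eta>' where x: "\<xi>' \<in> Hu" "\<eta>' \<in> Hu" "u = mcoeff \<xi>' \<eta>'"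
    "nmu \<xi>' * nmu \<eta>' < coeff_norm u + e / ?c"
    by (rule coeff_norm_lessE[OF u, of "coeff_norm u + e / ?c"]) (use e' in auto)
  have "coeff_norm (\<lambda>s. mcoeff \<xi> \<eta> s * u s) \<le> (nmu \<xi> * nmu \<xi>') * (nmu \<eta> * nmu \<eta>')"
    unfolding x(3) mcoeff_mult[OF a x(1,2)]
    using coeff_norm_rep(2)[OF univ2 tensor_in[OF a(1) x(1)] tensor_in[OF a(2) x(2)]]
    by (simp add: tensor_nm a x)
  also have "\<dots> = (nmu \<xi> * nmu \<eta>) * (nmu \<xi>' * nmu \<eta>')" by simp
  also have "\<dots> \<le> ?c * (coeff_norm u + e / ?c)"
    using c x by (intro mult_mono) auto
  also have "\<dots> = ?c * coeff_norm u + e" using c by (simp add: distrib_left)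
  finally show "coeff_norm (\<lambda>s. mcoeff \<xi> \<eta> s * u s) \<le> ?c * coeff_norm u + e" .
qed

lemma L2_tensor:
  assumes "\<xi> \<in> Hu" "\<And>l. l < m ==> \<zeta> l \<in> Hu"
  shows "L2_set (\<lambda>l. hnorm (rep_space univ2) (\<xi> \<otimes> \<zeta> l)) {..<m} = nmu \<xi> * L2_set (\<lambda>l. nmu (\<zeta> l)) {..<m}"
  using assms by (subst L2_set_right_distrib) (auto simp: tensor_nm intro: L2_set_cong)

text \<open>Multiplication by \<open>a = mcoeff \<xi> \<eta>\<close> is completely bounded. Its adjoint
  sends \<open>A\<close> to the slice of the image of \<open>A\<close> in the tensor square along
  \<open>\<xi>\<close> and \<open>\<eta>\<close>, and slicing a contractive matrix costs the
  factor \<open>\<parallel>\<xi>\<parallel> \<parallel>\<eta>\<parallel>\<close>; adding 1 keeps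
  the constant invertible.\<close>

lemma fs_matnorm_mult_le:
  fixes \<xi> \<eta> :: "'g::topological_group_add univ_vector"
  assumes a: "\<xi> \<in> Hu" "\<eta> \<in> Hu"
    and x: "\<And>i j. i < n ==> j < n ==> x i j \<in> FS"
  shows "fs_matnorm n (\<lambda>i j s. mcoeff \<xi> \<eta> s * x i j s)
    \<le> (nmu \<xi> * nmu \<eta> + 1) * fs_matnorm n x"
proof -
  let ?c = "nmu \<xi> * nmu \<eta> + 1"
  let ?a = "mcoeff \<xi> \<eta>"
  have c: "?c > 0" using a by (auto simp: add_nonneg_pos)
  have av: "?a \<in> FS" by (rule mcoeff_in_FS[OF a])
  have au: "(\<lambda>s. ?a s * u s) \<in> FS" if "u \<in> FS" for u by (rule fs_mult[OF av that])
  have slice: "\<exists>B\<in>VN. \<forall>u\<in>FS. fs_pairing u B = fs_pairing (\<lambda>s. ?a s * u s) A / ?c"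
    if A: "A \<in> VN" for A
  proof -
    obtain C where C: "C \<ge> 0" "\<And>x. x \<in> Hu ==> nmu (A x) \<le> C * nmu x"
      using univ.op_bound[OF vn_bounded[OF A]] by blast
    obtain B where "B \<in> VN" "\<And>x. x \<in> Hu ==> nmu (B x) \<le> C * nmu x"
      "\<And>u. u \<in> FS ==> fs_pairing u B = fs_pairing (\<lambda>s. ?a s * u s) A / ?c"
    proof (rule dual_functional)
      show "fs_pairing (\<lambda>s. ?a s * (u + v) s) A / ?c = fs_pairing (\<lambda>s. ?a s * u s) A / ?c + fs_pairing (\<lambda>s. ?a s * v s) A / ?c"
        if uv: "u \<in> FS" "v \<in> FS" for u v
      proof -
        have "(\<lambda>s. ?a s * (u + v) s) = (\<lambda>s. ?a s * u s) + (\<lambda>s. ?a s * v s)" by (auto simp: algebra_simps)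
        then show ?thesis using fs_add(2)[OF au[OF uv(1)] au[OF uv(2)] A] by (simp only: add_divide_distrib)
      qed
      show "fs_pairing (\<lambda>s. ?a s * (k *\<^sub>C u) s) A / ?c = k * (fs_pairing (\<lambda>s. ?a s * u s) A / ?c)"
        if u: "u \<in> FS" for k u
      proof -
        have "(\<lambda>s. ?a s * (k *\<^sub>C u) s) = k *\<^sub>C (\<lambda>s. ?a s * u s)"
          by (auto simp: scaleC_fun_def scaleC_complex_def algebra_simps)
        then show ?thesis using fs_scale(2)[OF au[OF u] A, of k] by (simp only: times_divide_eq_right)
      qed
      show "cmod (fs_pairing (\<lambda>s. ?a s * u s) A / ?c) \<le> C * coeff_norm u" if u: "u \<in> FS" for u
      proof -
        have "cmod (fs_pairing (\<lambda>s. ?a s * u s) A) \<le> C * coeff_norm (\<lambda>s. ?a s * u s)"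
          by (rule fs_pairing_bound[OF au[OF u] A C(2,1)])
        also have "\<dots> \<le> C * (?c * coeff_norm u)" by (rule mult_left_mono[OF coeff_norm_mult_le[OF a u] C(1)])
        finally have "cmod (fs_pairing (\<lambda>s. ?a s * u s) A) \<le> (C * coeff_norm u) * ?c" by (simp only: mult_ac)
        moreover have "cmod (fs_pairing (\<lambda>s. ?a s * u s) A / ?c) = cmod (fs_pairing (\<lambda>s. ?a s * u s) A) / ?c"
          using c by (simp only: norm_divide norm_of_real abs_of_pos)
        ultimately show ?thesis using c by (simp only: pos_divide_le_eq)
      qed
    qed (use C in auto)
    then show ?thesis by blast
  qed
  show ?thesis
  proof (rule fs_matnorm_le)
    show "0 \<le> ?c * fs_matnorm n x" using c fs_matnorm_nonneg[of n x] x by simp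
    fix m and A :: "nat => nat => 'g univ_op" and z w
    assume A: "A \<in> vn_matrix_ball m"
    define B where "B k l = (SOME B. B \<in> VN \<and>
      (\<forall>u\<in>FS. fs_pairing u B = fs_pairing (\<lambda>s. ?a s * u s) (A k l) / ?c))" for k l
    have B0: "B k l \<in> VN \<and> (\<forall>u\<in>FS. fs_pairing u (B k l) = fs_pairing (\<lambda>s. ?a s * u s) (A k l) / ?c)"
      if "k < m" "l < m" for k l
      unfolding B_def by (rule someI_ex[OF slice[OF vn_ballD(1)[OF A], unfolded Bex_def]]) (use that in auto)
    have B: "B k l \<in> VN" if "k < m" "l < m" for k l using B0[OF that] by (rule conjunct1)
    have Bp: "fs_pairing u (B k l) = fs_pairing (\<lambda>s. ?a s * u s) (A k l) / ?c"
      if "k < m" "l < m" "u \<in> FS" for k l u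
      using B0[OF that(1,2), THEN conjunct2] that(3) by (rule bspec)
    have "opmat_norm univ_space {..<m} {..<m} B \<le> 1"
    proof (rule univ.opmat_norm_le)
      show "B k l \<in> Bu" if "k \<in> {..<m}" "l \<in> {..<m}" for k l using B that vn_bounded by auto
      fix \<zeta> \<theta> :: "nat => 'g univ_vector"
      assume "\<And>j. j \<in> {..<m} ==> \<zeta> j \<in> Hu" "\<And>i. i \<in> {..<m} ==> \<theta> i \<in> Hu"
      then have zt: "\<And>j. j < m ==> \<zeta> j \<in> Hu" "\<And>i. i < m ==> \<theta> i \<in> Hu" by auto
      let ?T = "\<Sum>k<m. \<Sum>l<m. fs_pairing (\<lambda>s. hinner (rep_space univ2) (rep_op univ2 s (\<xi> \<otimes> \<zeta> l)) (\<eta> \<otimes> \<theta> k)) (A k l)"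
      have e1: "(\<Sum>k<m. \<Sum>l<m. ipu (B k l (\<zeta> l)) (\<theta> k)) = ?T / ?c"
        unfolding sum_divide_distrib
      proof (intro sum.cong refl)
        fix k l assume "k \<in> {..<m}" "l \<in> {..<m}"
        then have kl: "k < m" "l < m" by auto
        note z = zt(1)[OF kl(2)] and t = zt(2)[OF kl(1)]
        show "ipu (B k l (\<zeta> l)) (\<theta> k) =
          fs_pairing (\<lambda>s. hinner (rep_space univ2) (rep_op univ2 s (\<xi> \<otimes> \<zeta> l)) (\<eta> \<otimes> \<theta> k)) (A k l) / ?c"
          using Bp[OF kl mcoeff_in_FS[OF z t]] fs_pairing_mcoeff[OF z t B[OF kl]]
          unfolding mcoeff_mult[OF a z t] by simp
      qed
      have "cmod (\<Sum>k<m. \<Sum>l<m. ipu (B k l (\<zeta> l)) (\<theta> k)) = cmod ?T / ?c"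
        unfolding e1 using c by (simp only: norm_divide norm_of_real abs_of_pos)
      also have "\<dots> \<le> (L2_set (\<lambda>l. hnorm (rep_space univ2) (\<xi> \<otimes> \<zeta> l)) {..<m} * L2_set (\<lambda>k. hnorm (rep_space univ2) (\<eta> \<otimes> \<theta> k)) {..<m}) / ?c"
        using c by (intro divide_right_mono rep_matrix_bound[OF univ2 A] tensor_in a zt) auto
      also have "\<dots> = ((nmu \<xi> * L2_set (\<lambda>l. nmu (\<zeta> l)) {..<m}) * (nmu \<eta> * L2_set (\<lambda>k. nmu (\<theta> k)) {..<m})) / ?c"
        by (simp only: L2_tensor[OF a(1) zt(1)] L2_tensor[OF a(2) zt(2)])
      also have "\<dots> = (nmu \<xi> * nmu \<eta> / ?c) * (L2_set (\<lambda>l. nmu (\<zeta> l)) {..<m} * L2_set (\<lambda>k. nmu (\<theta> k)) {..<m})"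
        by (simp only: mult_ac times_divide_eq_left times_divide_eq_right)
      also have "\<dots> \<le> 1 * (L2_set (\<lambda>l. nmu (\<zeta> l)) {..<m} * L2_set (\<lambda>k. nmu (\<theta> k)) {..<m})"
        using c by (intro mult_right_mono) (auto simp: divide_le_eq)
      finally show "cmod (\<Sum>k<m. \<Sum>l<m. ipu (B k l (\<zeta> l)) (\<theta> k))
        \<le> 1 * L2_set (\<lambda>l. nmu (\<zeta> l)) {..<m} * L2_set (\<lambda>k. nmu (\<theta> k)) {..<m}" by simp
    qed simp
    then have Bb: "B \<in> vn_matrix_ball m" using B by (simp add: vn_matrix_ball_def)
    have "fs_form n m (\<lambda>i j s. ?a s * x i j s) A z w = ?c * fs_form n m x B z w"
      unfolding fs_form_def sum_distrib_left
      using c Bp x by (intro sum.cong refl) (auto simp del: of_real_add of_real_mult)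
    also have "cmod \<dots> = ?c * cmod (fs_form n m x B z w)" using c by (simp only: norm_mult norm_of_real abs_of_pos)
    also have "\<dots> \<le> ?c * (fs_matnorm n x * L2 n m z * L2 n m w)"
      using c by (intro mult_left_mono fs_form_bound[OF x Bb]) auto
    finally show "cmod (fs_form n m (\<lambda>i j s. ?a s * x i j s) A z w) \<le> ?c * fs_matnorm n x * L2 n m z * L2 n m w"
      by (simp only: mult.assoc)
  qed
qed

text \<open>A bilinear form on \<open>B(G)\<close> that is given by a contraction on the Hilbert space tensor product of
  the universal space with itself.\<close>

definition contractive_form :: "(('g::topological_group_add => complex) => ('g => complex) => complex) => bool" where
  "contractive_form \<phi> \<longleftrightarrow> \<phi> \<in> bilinear_forms FS FS \<and>
     (\<forall>m (f :: nat => 'g univ_vector) x g y.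
       (\<forall>b<m. f b \<in> Hu \<and> x b \<in> Hu \<and> g b \<in> Hu \<and> y b \<in> Hu) \<longrightarrow>
       cmod (\<Sum>a<m. \<Sum>b<m. \<phi> (mcoeff (f b) (g a)) (mcoeff (x b) (y a)))
         \<le> hnorm (rep_space univ2) (\<Sum>b<m. f b \<otimes> x b) * hnorm (rep_space univ2) (\<Sum>a<m. g a \<otimes> y a))"

lemma bilinear_formsD:
  assumes "\<phi> \<in> bilinear_forms V W"
  shows "a \<in> V ==> a' \<in> V ==> b \<in> W ==> \<phi> (a + a') b = \<phi> a b + \<phi> a' b"
    "a \<in> V ==> b \<in> W ==> b' \<in> W ==> \<phi> a (b + b') = \<phi> a b + \<phi> a b'"
    "a \<in> V ==> b \<in> W ==> \<phi> (c *\<^sub>C a) b = c * \<phi> a b"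
    "a \<in> V ==> b \<in> W ==> \<phi> a (c *\<^sub>C b) = c * \<phi> a b"
  using assms unfolding bilinear_forms_def by auto

lemma contractive_formD:
  fixes m :: nat
  assumes "contractive_form \<phi>" "\<And>b. b < m ==> f b \<in> Hu" "\<And>b. b < m ==> x b \<in> Hu"
    "\<And>b. b < m ==> g b \<in> Hu" "\<And>b. b < m ==> y b \<in> Hu"
  shows "cmod (\<Sum>a<m. \<Sum>b<m. \<phi> (mcoeff (f b) (g a)) (mcoeff (x b) (y a)))
         \<le> hnorm (rep_space univ2) (\<Sum>b<m. f b \<otimes> x b) * hnorm (rep_space univ2) (\<Sum>a<m. g a \<otimes> y a)"
  by (rule assms(1)[unfolded contractive_form_def, THEN conjunct2, THEN spec[of _ m], THEN spec[of _ f], THEN spec[of _ x],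
        THEN spec[of _ g], THEN spec[of _ y], THEN mp]) (use assms(2-) in simp)

lemma contractive_form_bound:
  assumes \<phi>: "contractive_form \<phi>" and u: "u \<in> FS" and v: "v \<in> FS"
  shows "cmod (\<phi> u v) \<le> coeff_norm u * coeff_norm v"
proof -
  have 1: "cmod (\<phi> u v) \<le> r * q" if rq: "coeff_norm u < r" "coeff_norm v < q" for r q
  proof -
    obtain \<xi> \<eta> where x: "\<xi> \<in> Hu" "\<eta> \<in> Hu" "u = mcoeff \<xi> \<eta>"
      "nmu \<xi> * nmu \<eta> < r" by (rule coeff_norm_lessE[OF u rq(1)])
    obtain \<xi>' \<eta>' where y: "\<xi>' \<in> Hu" "\<eta>' \<in> Hu" "v = mcoeff \<xi>' \<eta>'"
      "nmu \<xi>' * nmu \<eta>' < q" by (rule coeff_norm_lessE[OF v rq(2)])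
    have "cmod (\<phi> u v) \<le> hnorm (rep_space univ2) (\<xi> \<otimes> \<xi>') * hnorm (rep_space univ2) (\<eta> \<otimes> \<eta>')"
      using contractive_formD[OF \<phi>, of 1 "\<lambda>_. \<xi>" "\<lambda>_. \<xi>'" "\<lambda>_. \<eta>" "\<lambda>_. \<eta>'"] x y by simp
    also have "\<dots> = (nmu \<xi> * nmu \<eta>) * (nmu \<xi>' * nmu \<eta>')"
      using x y by (simp add: tensor_nm)
    also have "\<dots> \<le> r * q" by (rule mult_mono) (use x y rq coeff_norm_nonneg[OF u] in auto)
    finally show ?thesis .
  qed
  have "((\<lambda>e. (coeff_norm u + e) * (coeff_norm v + e)) \<longlongrightarrow> (coeff_norm u + 0) * (coeff_norm v + 0)) (at_right 0)"
    by (intro tendsto_intros)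
  then have lim: "((\<lambda>e. (coeff_norm u + e) * (coeff_norm v + e)) \<longlongrightarrow> coeff_norm u * coeff_norm v) (at_right 0)" by simp
  have "\<forall>\<^sub>F e in at_right (0::real). cmod (\<phi> u v) \<le> (coeff_norm u + e) * (coeff_norm v + e)"
    by (rule eventually_mono[OF eventually_at_right_less]) (use 1 in auto)
  then show ?thesis by (rule tendsto_lowerbound[OF lim]) simp
qed

text \<open>Sesquilinear expansion in an orthonormal family, in the first argument of the form.\<close>

lemma form_lincomb:
  fixes m :: nat
  assumes \<phi>: "\<phi> \<in> bilinear_forms FS FS" and v: "v \<in> FS"
    and f: "\<And>b. b < m ==> f b \<in> Hu"
  shows "\<phi> (mcoeff (\<Sum>b<m. z b *\<^sub>C f b) (\<Sum>a<m. w a *\<^sub>C f a)) v =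
    (\<Sum>a<m. \<Sum>b<m. z b * cnj (w a) * \<phi> (mcoeff (f b) (f a)) v)"
proof -
  note D = bilinear_formsD[OF \<phi>]
  have zero: "mcoeff 0 y = 0" "mcoeff y 0 = 0" if "y \<in> Hu" for y :: "'a univ_vector"
    using mcoeff_scale[of 0 y 0] mcoeff_scale[of y 0 0] that by (simp_all only: complex_vector.scale_zero_left univ.zero_in complex_cnj_zero)
  have fs0: "0 \<in> FS" using complex_vector.subspace_0[OF fs_subspace] .
  have \<phi>0: "\<phi> 0 v = 0" using D(3)[OF fs0 v, of 0] by (simp only: complex_vector.scale_zero_left mult_zero_left)
  have left: "\<phi> (mcoeff (\<Sum>b<n. z b *\<^sub>C f b) y) v = (\<Sum>b<n. z b * \<phi> (mcoeff (f b) y) v)"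
    if "y \<in> Hu" "n \<le> m" for y n
    using that(2)
  proof (induction n)
    case 0
    then show ?case using zero(1)[OF that(1)] \<phi>0 by (simp only: lessThan_0 sum.empty)
  next
    case (Suc n)
    have s: "(\<Sum>b<n. z b *\<^sub>C f b) \<in> Hu" using f Suc.prems by (intro univ.sum_in) auto
    have fn: "f n \<in> Hu" using f Suc.prems by simp
    have "\<phi> (mcoeff (\<Sum>b<Suc n. z b *\<^sub>C f b) y) v = \<phi> (mcoeff (\<Sum>b<n. z b *\<^sub>C f b) y) v + z n * \<phi> (mcoeff (f n) y) v"
      using s fn that(1) v
      by (simp only: sum.lessThan_Suc mcoeff_add_left mcoeff_scale univ.scale_in D mcoeff_in_FS fs_scale(1))
    then show ?case using Suc.IH[OF Suc_leD[OF Suc.prems]] by (simp only: sum.lessThan_Suc)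
  qed
  have right: "\<phi> (mcoeff y (\<Sum>a<n. w a *\<^sub>C f a)) v = (\<Sum>a<n. cnj (w a) * \<phi> (mcoeff y (f a)) v)"
    if "y \<in> Hu" "n \<le> m" for y n
    using that(2)
  proof (induction n)
    case 0
    then show ?case using zero(2)[OF that(1)] \<phi>0 by (simp only: lessThan_0 sum.empty)
  next
    case (Suc n)
    have s: "(\<Sum>b<n. w b *\<^sub>C f b) \<in> Hu" using f Suc.prems by (intro univ.sum_in) auto
    have fn: "f n \<in> Hu" using f Suc.prems by simp
    have "\<phi> (mcoeff y (\<Sum>b<Suc n. w b *\<^sub>C f b)) v = \<phi> (mcoeff y (\<Sum>b<n. w b *\<^sub>C f b)) v + cnj (w n) * \<phi> (mcoeff y (f n)) v"
      using s fn that(1) v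
      by (simp only: sum.lessThan_Suc mcoeff_add_right mcoeff_scale univ.scale_in D mcoeff_in_FS fs_scale(1))
    then show ?case using Suc.IH[OF Suc_leD[OF Suc.prems]] by (simp only: sum.lessThan_Suc)
  qed
  have sz: "(\<Sum>b<m. z b *\<^sub>C f b) \<in> Hu" using f by (intro univ.sum_in) auto
  have "\<phi> (mcoeff (\<Sum>b<m. z b *\<^sub>C f b) (\<Sum>a<m. w a *\<^sub>C f a)) v = (\<Sum>a<m. cnj (w a) * (\<Sum>b<m. z b * \<phi> (mcoeff (f b) (f a)) v))"
    using right[OF sz order_refl] left[OF f order_refl] by simp
  then show ?thesis by (simp add: sum_distrib_left mult_ac)
qed

text \<open>This is the heart of the estimates. A contractive form \<open>\<phi>\<close> gives operators
  with \<open>\<langle>u, \<Lambda> v\<rangle> = \<phi> u v = \<langle>v, \<Gamma>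
  u\<rangle>\<close>. Given vectors, expand them in an orthonormal family \<open>f\<close>:
  contractivity of \<open>\<phi>\<close> says that the matrix \<open>[\<Gamma> (mcoeff (f b) (f
  a))]\<close> is a contraction, and pairing it with \<open>y\<close> bounds the operator matrix
  \<open>[\<Lambda> (y k l)]\<close> by the norm of \<open>y\<close>. Pairing the latter with
  \<open>x\<close> gives the assertion.\<close>

lemma contractive_form_matrix_bound:
  fixes \<phi> :: "('g::topological_group_add => complex) => ('g => complex) => complex"
  assumes \<phi>: "contractive_form \<phi>"
    and x: "\<And>i j. i < p ==> j < p ==> x i j \<in> FS" and y: "\<And>k l. k < q ==> l < q ==> y k l \<in> FS"
  shows "cmod (\<Sum>i<p. \<Sum>k<q. \<Sum>j<p. \<Sum>l<q. \<alpha> (i, k) * \<beta> (j, l) * \<phi> (x i j) (y k l))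
    \<le> L2 p q \<alpha> * fs_matnorm p x * fs_matnorm q y * L2 p q \<beta>"
proof -
  have bil: "\<phi> \<in> bilinear_forms FS FS" using \<phi> by (simp add: contractive_form_def)
  note D = bilinear_formsD[OF bil]
  have "\<exists>B\<in>VN. \<forall>u\<in>FS. fs_pairing u B = \<phi> u v" if v: "v \<in> FS" for v
  proof -
    obtain B where "B \<in> VN" "\<And>x. x \<in> Hu ==> nmu (B x) \<le> coeff_norm v * nmu x"
      "\<And>u. u \<in> FS ==> fs_pairing u B = \<phi> u v"
      by (rule dual_functional[of "\<lambda>u. \<phi> u v" "coeff_norm v"])
        (use D v contractive_form_bound[OF \<phi> _ v] coeff_norm_nonneg[OF v] in \<open>simp_all add: mult.commute\<close>)
    then show ?thesis by blast
  qed
  note ex\<Lambda> = this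
  define \<Lambda> where "\<Lambda> v = (SOME B. B \<in> VN \<and> (\<forall>u\<in>FS. fs_pairing u B = \<phi> u v))" for v
  have \<Lambda>0: "\<Lambda> v \<in> VN \<and> (\<forall>u\<in>FS. fs_pairing u (\<Lambda> v) = \<phi> u v)" if "v \<in> FS" for v
    unfolding \<Lambda>_def by (rule someI_ex[OF ex\<Lambda>[OF that, unfolded Bex_def]])
  note \<Lambda> = \<Lambda>0[THEN conjunct1] \<Lambda>0[THEN conjunct2, THEN bspec]
  have "\<exists>B\<in>VN. \<forall>v\<in>FS. fs_pairing v B = \<phi> u v" if u: "u \<in> FS" for u
  proof -
    obtain B where "B \<in> VN" "\<And>x. x \<in> Hu ==> nmu (B x) \<le> coeff_norm u * nmu x"
      "\<And>v. v \<in> FS ==> fs_pairing v B = \<phi> u v"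
      by (rule dual_functional[of "\<phi> u" "coeff_norm u"])
        (use D u contractive_form_bound[OF \<phi> u] coeff_norm_nonneg[OF u] in \<open>simp_all\<close>)
    then show ?thesis by blast
  qed
  note ex\<Gamma> = this
  define \<Gamma> where "\<Gamma> u = (SOME B. B \<in> VN \<and> (\<forall>v\<in>FS. fs_pairing v B = \<phi> u v))" for u
  have \<Gamma>0: "\<Gamma> u \<in> VN \<and> (\<forall>v\<in>FS. fs_pairing v (\<Gamma> u) = \<phi> u v)" if "u \<in> FS" for u
    unfolding \<Gamma>_def by (rule someI_ex[OF ex\<Gamma>[OF that, unfolded Bex_def]])
  note \<Gamma> = \<Gamma>0[THEN conjunct1] \<Gamma>0[THEN conjunct2, THEN bspec]
  let ?n = "nmu"
  let ?Y = "fs_matnorm q y" and ?X = "fs_matnorm p x"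
  have Y0: "0 \<le> ?Y" by (rule fs_matnorm_nonneg[OF y])
  have main: "cmod (\<Sum>k<q. \<Sum>l<q. ipu (\<Lambda> (y k l) (\<xi> l)) (\<eta> k))
      \<le> ?Y * L2_set (\<lambda>l. ?n (\<xi> l)) {..<q} * L2_set (\<lambda>k. ?n (\<eta> k)) {..<q}"
    if \<xi>: "\<And>l. l < q ==> \<xi> l \<in> Hu" and \<eta>: "\<And>k. k < q ==> \<eta> k \<in> Hu" for \<xi> \<eta>
  proof -
    have "finite (\<xi> ` {..<q} \<union> \<eta> ` {..<q})" "\<xi> ` {..<q} \<union> \<eta> ` {..<q} \<subseteq> Hu" using \<xi> \<eta> by auto
    from univ.finite_gram_schmidt[OF this] obtain m and f :: "nat => 'g univ_vector"
      where f0: "(\<forall>a<m. f a \<in> Hu) \<and>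
        (\<forall>a<m. \<forall>b<m. ipu (f a) (f b) = (if a = b then 1 else 0)) \<and>
        (\<forall>v\<in>\<xi> ` {..<q} \<union> \<eta> ` {..<q}. v = (\<Sum>a<m. ipu v (f a) *\<^sub>C f a))"
      by (elim exE) (rule that, assumption)
    have f: "f a \<in> Hu" if "a < m" for a using f0 that by blast
    have o: "ipu (f a) (f b) = (if a = b then 1 else 0)" if "a < m" "b < m" for a b using f0 that by blast
    have e: "v = (\<Sum>a<m. ipu v (f a) *\<^sub>C f a)" if "v \<in> \<xi> ` {..<q} \<union> \<eta> ` {..<q}" for v
      by (rule f0[THEN conjunct2, THEN conjunct2, THEN bspec, OF that])
    define z where "z p = ipu (\<xi> (fst p)) (f (snd p))" for p :: "nat \<times> nat"
    define w where "w p = ipu (\<eta> (fst p)) (f (snd p))" for p :: "nat \<times> nat"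
    have \<xi>e: "\<xi> l = (\<Sum>b<m. z (l, b) *\<^sub>C f b)" if "l < q" for l using e[of "\<xi> l"] that by (simp add: z_def)
    have \<eta>e: "\<eta> k = (\<Sum>a<m. w (k, a) *\<^sub>C f a)" if "k < q" for k using e[of "\<eta> k"] that by (simp add: w_def)
    define C where "C a b = \<Gamma> (mcoeff (f b) (f a))" for a b
    have Cin: "C a b \<in> VN" if "a < m" "b < m" for a b
      unfolding C_def by (intro \<Gamma> mcoeff_in_FS f that)
    have tn: "hnorm (rep_space univ2) (\<Sum>b<m. f b \<otimes> \<zeta> b) = L2_set (\<lambda>b. ?n (\<zeta> b)) {..<m}"
      if \<zeta>: "\<And>b. b < m ==> \<zeta> b \<in> Hu" for \<zeta>
    proof -
      let ?t = "\<Sum>b<m. f b \<otimes> \<zeta> b"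
      have t: "?t \<in> hcarrier (rep_space univ2)" using f \<zeta> by (intro univ2.sum_in tensor_in) auto
      have "hinner (rep_space univ2) ?t ?t = (\<Sum>a<m. \<Sum>b<m. 1 * cnj 1 * hinner (rep_space univ2) (f a \<otimes> \<zeta> a) (f b \<otimes> \<zeta> b))"
        using univ2.ip_sum_sum[of "{..<m}" "\<lambda>a. f a \<otimes> \<zeta> a" "{..<m}" "\<lambda>a. f a \<otimes> \<zeta> a" "\<lambda>_. 1" "\<lambda>_. 1"] f \<zeta>
        by (simp only: scaleC_one tensor_in lessThan_iff)
      also have "\<dots> = (\<Sum>a<m. \<Sum>b<m. if a = b then complex_of_real ((?n (\<zeta> a))\<^sup>2) else 0)"
        using f \<zeta> o by (intro sum.cong refl) (auto simp: tensor_ip univ.ip_self)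
      also have "\<dots> = complex_of_real (\<Sum>a<m. (?n (\<zeta> a))\<^sup>2)" by simp
      finally show ?thesis unfolding hnorm_def[of "rep_space univ2"] L2_set_def by simp
    qed
    have "opmat_norm univ_space {..<m} {..<m} C \<le> 1"
    proof (rule univ.opmat_norm_le)
      show "C a b \<in> Bu" if "a \<in> {..<m}" "b \<in> {..<m}" for a b using Cin that vn_bounded by auto
      fix \<zeta> \<theta> :: "nat => 'g univ_vector"
      assume "\<And>j. j \<in> {..<m} ==> \<zeta> j \<in> Hu" "\<And>i. i \<in> {..<m} ==> \<theta> i \<in> Hu"
      then have zt: "\<And>j. j < m ==> \<zeta> j \<in> Hu" "\<And>i. i < m ==> \<theta> i \<in> Hu" by auto
      have "(\<Sum>a<m. \<Sum>b<m. ipu (C a b (\<zeta> b)) (\<theta> a)) = (\<Sum>a<m. \<Sum>b<m. \<phi> (mcoeff (f b) (f a)) (mcoeff (\<zeta> b) (\<theta> a)))"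
      proof (intro sum.cong refl)
        fix a b assume "a \<in> {..<m}" "b \<in> {..<m}"
        then have ab: "a < m" "b < m" by auto
        show "ipu (C a b (\<zeta> b)) (\<theta> a) = \<phi> (mcoeff (f b) (f a)) (mcoeff (\<zeta> b) (\<theta> a))"
          unfolding fs_pairing_mcoeff[OF zt(1)[OF ab(2)] zt(2)[OF ab(1)] Cin[OF ab], symmetric]
          unfolding C_def by (intro \<Gamma>(2) mcoeff_in_FS f zt ab)
      qed
      also have "cmod \<dots> \<le> hnorm (rep_space univ2) (\<Sum>b<m. f b \<otimes> \<zeta> b) * hnorm (rep_space univ2) (\<Sum>a<m. f a \<otimes> \<theta> a)"
        by (rule contractive_formD[OF \<phi>]) (use f zt in auto)
      finally show "cmod (\<Sum>a<m. \<Sum>b<m. ipu (C a b (\<zeta> b)) (\<theta> a))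
        \<le> 1 * L2_set (\<lambda>l. ?n (\<zeta> l)) {..<m} * L2_set (\<lambda>k. ?n (\<theta> k)) {..<m}" using tn zt by simp
    qed simp
    then have Cb: "C \<in> vn_matrix_ball m" using Cin by (simp add: vn_matrix_ball_def)
    have "(\<Sum>k<q. \<Sum>l<q. ipu (\<Lambda> (y k l) (\<xi> l)) (\<eta> k)) = fs_form q m y C z w"
      unfolding fs_form_def
    proof (intro sum.cong refl)
      fix k l assume "k \<in> {..<q}" "l \<in> {..<q}"
      then have kl: "k < q" "l < q" by auto
      have "ipu (\<Lambda> (y k l) (\<xi> l)) (\<eta> k) = \<phi> (mcoeff (\<xi> l) (\<eta> k)) (y k l)"
        unfolding fs_pairing_mcoeff[OF \<xi>[OF kl(2)] \<eta>[OF kl(1)] \<Lambda>(1)[OF y[OF kl]], symmetric]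
        by (intro \<Lambda>(2) mcoeff_in_FS \<xi> \<eta> y kl)
      also have "\<dots> = (\<Sum>a<m. \<Sum>b<m. z (l, b) * cnj (w (k, a)) * \<phi> (mcoeff (f b) (f a)) (y k l))"
        by (subst \<xi>e[OF kl(2)], subst \<eta>e[OF kl(1)], rule form_lincomb[OF bil y[OF kl] f])
      also have "\<dots> = (\<Sum>a<m. \<Sum>b<m. fs_pairing (y k l) (C a b) * z (l, b) * cnj (w (k, a)))"
        using \<Gamma>(2)[OF mcoeff_in_FS[OF f f] y[OF kl]] by (intro sum.cong refl) (auto simp: C_def mult_ac)
      finally show "ipu (\<Lambda> (y k l) (\<xi> l)) (\<eta> k) =
        (\<Sum>a<m. \<Sum>b<m. fs_pairing (y k l) (C a b) * z (l, b) * cnj (w (k, a)))" .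
    qed
    moreover have "cmod (fs_form q m y C z w) \<le> ?Y * L2 q m z * L2 q m w" by (rule fs_form_bound[OF y Cb])
    moreover have on: "(?n (\<Sum>b<m. c b *\<^sub>C f b))\<^sup>2 = (\<Sum>b<m. (cmod (c b))\<^sup>2)" for c
      by (rule univ.orthonormal_combination_sq[OF f o])
    moreover have "L2 q m z = L2_set (\<lambda>l. ?n (\<xi> l)) {..<q}"
    proof -
      have "(\<Sum>l<q. \<Sum>b<m. (cmod (z (l, b)))\<^sup>2) = (\<Sum>l<q. (?n (\<xi> l))\<^sup>2)"
        by (intro sum.cong refl) (simp only: on[symmetric] \<xi>e[symmetric] lessThan_iff)
      then show ?thesis by (simp add: L2_set_def sum.cartesian_product')
    qed
    moreover have "L2 q m w = L2_set (\<lambda>k. ?n (\<eta> k)) {..<q}"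
    proof -
      have "(\<Sum>l<q. \<Sum>b<m. (cmod (w (l, b)))\<^sup>2) = (\<Sum>l<q. (?n (\<eta> l))\<^sup>2)"
        by (intro sum.cong refl) (simp only: on[symmetric] \<eta>e[symmetric] lessThan_iff)
      then show ?thesis by (simp add: L2_set_def sum.cartesian_product')
    qed
    ultimately show ?thesis by simp
  qed
  let ?K = "L2 p q \<alpha> * ?X * L2 p q \<beta>"
  let ?s = "\<Sum>i<p. \<Sum>k<q. \<Sum>j<p. \<Sum>l<q. \<alpha> (i, k) * \<beta> (j, l) * \<phi> (x i j) (y k l)"
  have step: "cmod ?s \<le> c * ?K" if c: "?Y < c" for c
  proof -
    have c0: "c > 0" using c Y0 by simp
    define B where "B k l = (\<lambda>v. complex_of_real (1 / c) *\<^sub>C \<Lambda> (y k l) v)" for k l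
    have \<Lambda>y: "\<Lambda> (y k l) \<in> VN" if "k < q" "l < q" for k l using \<Lambda>(1)[OF y[OF that]] .
    have Bin: "B k l \<in> VN" "\<And>u. u \<in> FS ==> fs_pairing u (B k l) = complex_of_real (1 / c) * \<phi> u (y k l)"
      if kl: "k < q" "l < q" for k l
    proof -
      note L = vn_bounded[OF \<Lambda>y[OF kl]]
      have Bb: "B k l \<in> Bu"
      proof -
        obtain C where C: "\<And>x. x \<in> Hu ==> ?n (\<Lambda> (y k l) x) \<le> C * ?n x" using univ.op_bound[OF L] by blast
        show ?thesis
        proof (rule univ.bounded_opsI[where C = "C / c"])
          show "?n (B k l x) \<le> C / c * ?n x" if "x \<in> Hu" for x
            using C[OF that] that c0 univ.op_in[OF L that] by (simp add: B_def univ.nm_scale norm_divide divide_right_mono)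
          show "B k l x \<in> Hu" if "x \<in> Hu" for x
            unfolding B_def by (intro univ.scale_in univ.op_in[OF L] that)
          show "B k l x = 0" if "x \<notin> Hu" for x
            by (simp only: B_def univ.op_outside[OF L that] complex_vector.scale_zero_right)
          show "B k l (x + v) = B k l x + B k l v" if "x \<in> Hu" "v \<in> Hu" for x v
            by (simp only: B_def univ.op_add[OF L that] scaleC_add_right)
          show "B k l (r *\<^sub>C x) = r *\<^sub>C B k l x" if "x \<in> Hu" for r x
            by (simp only: B_def univ.op_scale[OF L that] scaleC_scaleC mult.commute)
        qed
      qed
      show M: "B k l \<in> VN"
      proof (rule vnI[OF Bb])
        fix T :: "'g univ_op" and v :: "'g univ_vector"
        assume T: "T \<in> Bu" "\<And>s. T \<circ> univ_rep s = univ_rep s \<circ> T" and v: "v \<in> Hu"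
        show "B k l (T v) = T (B k l v)"
          using vn_commute[OF \<Lambda>y[OF kl] T] univ.op_scale[OF T(1) univ.op_in[OF L v]] by (simp add: B_def)
      qed
      fix u :: "'g => complex" assume u: "u \<in> FS"
      obtain \<xi> \<eta> where ux: "\<xi> \<in> Hu" "\<eta> \<in> Hu" "u = mcoeff \<xi> \<eta>"
        using u by (rule FS_E)
      show "fs_pairing u (B k l) = complex_of_real (1 / c) * \<phi> u (y k l)"
        using \<Lambda>(2)[OF y[OF kl] u] ux M \<Lambda>y[OF kl]
        by (simp add: fs_pairing_mcoeff B_def univ.ip_scale_left vn_in)
    qed
    have "opmat_norm univ_space {..<q} {..<q} B \<le> 1"
    proof (rule univ.opmat_norm_le)
      show "B k l \<in> Bu" if "k \<in> {..<q}" "l \<in> {..<q}" for k l using Bin(1) that vn_bounded by auto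
      fix \<zeta> \<theta> :: "nat => 'g univ_vector"
      assume "\<And>j. j \<in> {..<q} ==> \<zeta> j \<in> Hu" "\<And>i. i \<in> {..<q} ==> \<theta> i \<in> Hu"
      then have zt: "\<And>j. j < q ==> \<zeta> j \<in> Hu" "\<And>i. i < q ==> \<theta> i \<in> Hu" by auto
      have "(\<Sum>k<q. \<Sum>l<q. ipu (B k l (\<zeta> l)) (\<theta> k)) =
        complex_of_real (1 / c) * (\<Sum>k<q. \<Sum>l<q. ipu (\<Lambda> (y k l) (\<zeta> l)) (\<theta> k))"
        unfolding sum_distrib_left B_def
        by (intro sum.cong refl univ.ip_scale_left) (use \<Lambda>y zt in auto)
      also have "cmod \<dots> = (1 / c) * cmod (\<Sum>k<q. \<Sum>l<q. ipu (\<Lambda> (y k l) (\<zeta> l)) (\<theta> k))"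
        using c0 by (simp only: norm_mult norm_of_real) simp
      also have "\<dots> \<le> (1 / c) * (?Y * L2_set (\<lambda>l. ?n (\<zeta> l)) {..<q} * L2_set (\<lambda>k. ?n (\<theta> k)) {..<q})"
        using c0 by (intro mult_left_mono main zt) auto
      also have "\<dots> = (?Y / c) * (L2_set (\<lambda>l. ?n (\<zeta> l)) {..<q} * L2_set (\<lambda>k. ?n (\<theta> k)) {..<q})" by simp
      also have "\<dots> \<le> 1 * (L2_set (\<lambda>l. ?n (\<zeta> l)) {..<q} * L2_set (\<lambda>k. ?n (\<theta> k)) {..<q})"
        using c c0 by (intro mult_right_mono) auto
      finally show "cmod (\<Sum>k<q. \<Sum>l<q. ipu (B k l (\<zeta> l)) (\<theta> k))
        \<le> 1 * L2_set (\<lambda>l. ?n (\<zeta> l)) {..<q} * L2_set (\<lambda>k. ?n (\<theta> k)) {..<q}" by simp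
    qed simp
    then have Bb: "B \<in> vn_matrix_ball q" using Bin(1) by (simp add: vn_matrix_ball_def)
    let ?w = "\<lambda>p. cnj (\<alpha> p)"
    have "complex_of_real c * fs_form p q x B \<beta> ?w = (\<Sum>i<p. \<Sum>j<p. \<Sum>k<q. \<Sum>l<q. \<alpha> (i, k) * \<beta> (j, l) * \<phi> (x i j) (y k l))"
      unfolding fs_form_def sum_distrib_left
      by (intro sum.cong refl) (use Bin(2)[OF _ _ x] c0 in \<open>simp add: mult_ac\<close>)
    also have "\<dots> = ?s" by (intro sum.cong refl sum.swap)
    finally have "cmod ?s = c * cmod (fs_form p q x B \<beta> ?w)" using c0 by (metis norm_mult norm_of_real abs_of_pos)
    also have "\<dots> \<le> c * (?X * L2 p q \<beta> * L2 p q ?w)"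
      using c0 by (intro mult_left_mono fs_form_bound[OF x Bb]) auto
    finally show ?thesis by (simp add: mult_ac)
  qed
  have "cmod ?s \<le> ?Y * ?K"
  proof -
    have "((\<lambda>c. c * ?K) \<longlongrightarrow> ?Y * ?K) (at_right ?Y)" by (intro tendsto_intros)
    moreover have "\<forall>\<^sub>F c in at_right ?Y. cmod ?s \<le> c * ?K"
      by (rule eventually_mono[OF eventually_at_right_less]) (rule step)
    ultimately show ?thesis by (rule tendsto_lowerbound) simp
  qed
  then show ?thesis by (simp add: mult_ac)
qed

section \<open>Completions of seminormed spaces\<close>

locale seminormed =
  fixes E :: "'e::complex_vector set" and \<nu> :: "'e => real"
  assumes sub: "complex_vector.subspace E"
    and \<nu>_zero: "\<nu> 0 = 0" and \<nu>_nonneg: "\<And>s. s \<in> E ==> 0 \<le> \<nu> s"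
    and \<nu>_add: "\<And>s t. s \<in> E ==> t \<in> E ==> \<nu> (s + t) \<le> \<nu> s + \<nu> t"
    and \<nu>_neg_le: "\<And>s. s \<in> E ==> \<nu> (- s) \<le> \<nu> s"
begin

lemma E_diff: "s \<in> E ==> t \<in> E ==> s - t \<in> E"
  by (rule complex_vector.subspace_diff[OF sub])
lemma E_neg: "s \<in> E ==> - s \<in> E"
  by (rule complex_vector.subspace_neg[OF sub])
lemma \<nu>_neg: "s \<in> E ==> \<nu> (- s) = \<nu> s"
  using \<nu>_neg_le[of s] \<nu>_neg_le[OF E_neg, of s] by simp
lemma \<nu>_commute: "s \<in> E ==> t \<in> E ==> \<nu> (s - t) = \<nu> (t - s)"
  using \<nu>_neg[OF E_diff, of s t] by (simp only: minus_diff_eq)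
lemma \<nu>_triangle: "s \<in> E ==> t \<in> E ==> r \<in> E ==> \<nu> (s - r) \<le> \<nu> (s - t) + \<nu> (t - r)"
  using \<nu>_add[OF E_diff[of s t] E_diff[of t r]] by simp
lemma \<nu>_diff_le: "s \<in> E ==> t \<in> E ==> \<nu> (s - t) \<le> \<nu> s + \<nu> t"
  using \<nu>_add[OF _ E_neg, of s t] \<nu>_neg[of t] by (simp only: diff_conv_add_uminus)
lemma \<nu>_reverse: assumes "s \<in> E" "t \<in> E" shows "\<bar>\<nu> s - \<nu> t\<bar> \<le> \<nu> (s - t)"
proof -
  have "\<nu> s \<le> \<nu> (s - t) + \<nu> t" "\<nu> t \<le> \<nu> (t - s) + \<nu> s"
    using \<nu>_add[OF E_diff[OF assms] assms(2)] \<nu>_add[OF E_diff[OF assms(2,1)] assms(1)] by (simp_all only: diff_add_cancel)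
  then show ?thesis using \<nu>_commute[OF assms] by linarith
qed

abbreviation (input) "CS \<equiv> cauchy_seqs E \<nu>"
abbreviation (input) "REL \<equiv> completion_rel E \<nu>"

lemma cauchy_inD: "x \<in> CS ==> x n \<in> E"
  by (auto simp: cauchy_seqs_def)
lemma cauchyD: "x \<in> CS ==> e > 0 ==> \<exists>N. \<forall>m\<ge>N. \<forall>n\<ge>N. \<nu> (x m - x n) < e"
  by (auto simp: cauchy_seqs_def)
lemma cauchyI: "(\<And>n. x n \<in> E) ==> (\<And>e. e > 0 ==> \<exists>N. \<forall>m\<ge>N. \<forall>n\<ge>N. \<nu> (x m - x n) < e) ==> x \<in> CS"
  by (auto simp: cauchy_seqs_def)
lemma rel_iff: "(x, y) \<in> REL \<longleftrightarrow> x \<in> CS \<and> y \<in> CS \<and> (\<lambda>n. \<nu> (x n - y n)) \<longlonglongrightarrow> 0"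
  by (simp add: completion_rel_def)
lemma rel_refl: "x \<in> CS ==> (x, x) \<in> REL"
  by (simp add: rel_iff \<nu>_zero)
lemma rel_sym: "(x, y) \<in> REL ==> (y, x) \<in> REL"
  by (auto simp only: rel_iff \<nu>_commute[OF cauchy_inD cauchy_inD])
lemma rel_trans:
  assumes "(x, y) \<in> REL" "(y, z) \<in> REL" shows "(x, z) \<in> REL"
proof -
  have c: "x \<in> CS" "y \<in> CS" "z \<in> CS" using assms by (auto simp: rel_iff)
  have "(\<lambda>n. \<nu> (x n - y n) + \<nu> (y n - z n)) \<longlonglongrightarrow> 0"
    using assms by (intro tendsto_add_zero) (auto simp: rel_iff)
  then have "(\<lambda>n. \<nu> (x n - z n)) \<longlonglongrightarrow> 0"
    by (rule Lim_null_comparison[rotated])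
      (use \<nu>_triangle[OF cauchy_inD cauchy_inD cauchy_inD, OF c] \<nu>_nonneg[OF E_diff[OF cauchy_inD cauchy_inD, OF c(1,3)]] in
        \<open>simp add: always_eventually\<close>)
  then show ?thesis using c by (simp add: rel_iff)
qed

lemma class_in: "x \<in> CS ==> REL `` {x} \<in> completion E \<nu>"
  unfolding completion_def by (rule quotientI)

lemma completionE:
  assumes "X \<in> completion E \<nu>"
  obtains x where "x \<in> CS" "x \<in> X" "X = REL `` {x}"
  using assms rel_refl unfolding completion_def by (auto elim!: quotientE)

lemma completion_memD: "X \<in> completion E \<nu> ==> x \<in> X ==> x \<in> CS"
  by (erule completionE) (auto simp: rel_iff)
lemma completion_mem_rel: "X \<in> completion E \<nu> ==> x \<in> X ==> y \<in> X ==> (x, y) \<in> REL"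
  by (erule completionE) (auto intro: rel_trans rel_sym)

text \<open>The definite description in \<open>completion_norm\<close> has a unique solution, by the reverse
  triangle inequality.\<close>

lemma completion_norm_limit:
  assumes X: "X \<in> completion E \<nu>" and x: "x \<in> X"
  shows "(\<lambda>n. \<nu> (x n)) \<longlonglongrightarrow> completion_norm \<nu> X"
proof -
  have xc: "x \<in> CS" by (rule completion_memD[OF X x])
  have "Cauchy (\<lambda>n. \<nu> (x n))"
    unfolding Cauchy_iff
  proof (intro allI impI)
    fix e :: real assume "e > 0"
    then obtain N where N: "\<And>m n. m \<ge> N ==> n \<ge> N ==> \<nu> (x m - x n) < e" using cauchyD[OF xc] by blast
    have "norm (\<nu> (x m) - \<nu> (x n)) < e" if "m \<ge> N" "n \<ge> N" for m n
      using order_le_less_trans[OF \<nu>_reverse[OF cauchy_inD[OF xc] cauchy_inD[OF xc]] N[OF that]] by simp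
    then show "\<exists>M. \<forall>m\<ge>M. \<forall>n\<ge>M. norm (\<nu> (x m) - \<nu> (x n)) < e" by blast
  qed
  then obtain r where r: "(\<lambda>n. \<nu> (x n)) \<longlonglongrightarrow> r" using Cauchy_convergent convergent_def by blast
  have "completion_norm \<nu> X = r"
    unfolding completion_norm_def
  proof (rule the_equality)
    show "\<exists>x\<in>X. (\<lambda>n. \<nu> (x n)) \<longlonglongrightarrow> r" using x r by blast
    fix q assume "\<exists>y\<in>X. (\<lambda>n. \<nu> (y n)) \<longlonglongrightarrow> q"
    then obtain y where y: "y \<in> X" "(\<lambda>n. \<nu> (y n)) \<longlonglongrightarrow> q" by blast
    have yc: "y \<in> CS" by (rule completion_memD[OF X y(1)])
    have "(\<lambda>n. \<nu> (y n - x n)) \<longlonglongrightarrow> 0" using completion_mem_rel[OF X y(1) x] by (simp add: rel_iff)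
    then have "(\<lambda>n. \<nu> (y n) - \<nu> (x n)) \<longlonglongrightarrow> 0"
      by (rule Lim_null_comparison[rotated]) (use \<nu>_reverse[OF cauchy_inD[OF yc] cauchy_inD[OF xc]] in simp)
    moreover have "(\<lambda>n. \<nu> (y n) - \<nu> (x n)) \<longlonglongrightarrow> q - r" by (intro tendsto_diff y r)
    ultimately show "q = r" using LIMSEQ_unique by fastforce
  qed
  then show ?thesis using r by simp
qed

text \<open>A contractive functional on a seminormed space extends continuously to its completion; only the
  values along representing sequences are needed.\<close>

lemma functional_limit:
  fixes F :: "'e => complex"
  assumes F_diff: "\<And>s t. s \<in> E ==> t \<in> E ==> F (s - t) = F s - F t"
    and F_le: "\<And>s. s \<in> E ==> cmod (F s) \<le> \<nu> s" and X: "X \<in> completion E \<nu>"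
  obtains l where "\<And>x. x \<in> X ==> (\<lambda>n. F (x n)) \<longlonglongrightarrow> l" "cmod l \<le> completion_norm \<nu> X"
proof -
  obtain x where x: "x \<in> CS" "x \<in> X" using X by (rule completionE)
  have "Cauchy (\<lambda>n. F (x n))"
    unfolding Cauchy_iff
  proof (intro allI impI)
    fix e :: real assume "e > 0"
    then obtain N where N: "\<And>m n. m \<ge> N ==> n \<ge> N ==> \<nu> (x m - x n) < e" using cauchyD[OF x(1)] by blast
    have "norm (F (x m) - F (x n)) < e" if "m \<ge> N" "n \<ge> N" for m n
      using order_le_less_trans[OF F_le[OF E_diff[OF cauchy_inD[OF x(1)] cauchy_inD[OF x(1)]]] N[OF that]]
        F_diff[OF cauchy_inD[OF x(1)] cauchy_inD[OF x(1)], of m n] by (simp only:)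
    then show "\<exists>M. \<forall>m\<ge>M. \<forall>n\<ge>M. norm (F (x m) - F (x n)) < e" by blast
  qed
  then obtain l where l: "(\<lambda>n. F (x n)) \<longlonglongrightarrow> l" using Cauchy_convergent convergent_def by blast
  have all: "(\<lambda>n. F (y n)) \<longlonglongrightarrow> l" if y: "y \<in> X" for y
  proof -
    have yc: "y \<in> CS" by (rule completion_memD[OF X y])
    have "(\<lambda>n. \<nu> (y n - x n)) \<longlonglongrightarrow> 0" using completion_mem_rel[OF X y x(2)] by (simp add: rel_iff)
    then have "(\<lambda>n. F (y n) - F (x n)) \<longlonglongrightarrow> 0"
      by (rule Lim_null_comparison[rotated])
        (use F_le[OF E_diff[OF cauchy_inD[OF yc] cauchy_inD[OF x(1)]]] F_diff[OF cauchy_inD[OF yc] cauchy_inD[OF x(1)]] in simp)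
    from tendsto_add[OF this l] show ?thesis by simp
  qed
  have "cmod l \<le> completion_norm \<nu> X"
    by (rule LIMSEQ_le[OF tendsto_norm[OF l] completion_norm_limit[OF X x(2)]]) (use F_le cauchy_inD[OF x(1)] in blast)
  then show thesis using that all by blast
qed

lemma cauchy_map:
  assumes f: "\<And>s. s \<in> E ==> f s \<in> E" and f_diff: "\<And>s t. s \<in> E ==> t \<in> E ==> f (s - t) = f s - f t"
    and f_le: "\<And>s. s \<in> E ==> \<nu> (f s) \<le> K * \<nu> s" and K: "K > 0" and x: "x \<in> CS"
  shows "(\<lambda>n. f (x n)) \<in> CS"
proof (rule cauchyI)
  note xE = cauchy_inD[OF x]
  show "f (x n) \<in> E" for n by (rule f[OF xE])
  fix e :: real assume "e > 0"
  then have "e / K > 0" using K by simp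
  then obtain N where N: "\<And>m n. m \<ge> N ==> n \<ge> N ==> \<nu> (x m - x n) < e / K" using cauchyD[OF x] by blast
  have "\<nu> (f (x m) - f (x n)) < e" if "m \<ge> N" "n \<ge> N" for m n
    using f_le[OF E_diff[OF xE xE], of m n] f_diff[OF xE xE, of m n] N[OF that] K
    by (simp add: pos_less_divide_eq mult.commute)
  then show "\<exists>N. \<forall>m\<ge>N. \<forall>n\<ge>N. \<nu> (f (x m) - f (x n)) < e" by blast
qed

lemma completion_map_in:
  assumes f: "\<And>s. s \<in> E ==> f s \<in> E" and f_diff: "\<And>s t. s \<in> E ==> t \<in> E ==> f (s - t) = f s - f t"
    and f_le: "\<And>s. s \<in> E ==> \<nu> (f s) \<le> K * \<nu> s" and K: "K > 0" and X: "X \<in> completion E \<nu>"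
  shows "completion_map E \<nu> f X \<in> completion E \<nu>" and "\<And>x. x \<in> X ==> (\<lambda>n. f (x n)) \<in> completion_map E \<nu> f X"
proof -
  have cm: "(\<lambda>n. f (x n)) \<in> CS" if "x \<in> CS" for x
    by (rule cauchy_map[OF f f_diff f_le K that])
  show in_map: "(\<lambda>n. f (x n)) \<in> completion_map E \<nu> f X" if "x \<in> X" for x
    unfolding completion_map_def using rel_refl[OF cm[OF completion_memD[OF X that]]] that by blast
  obtain x where x: "x \<in> CS" "x \<in> X" using X by (rule completionE)
  have "completion_map E \<nu> f X = REL `` {\<lambda>n. f (x n)}"
  proof (rule set_eqI, rule iffI)
    fix z assume "z \<in> completion_map E \<nu> f X"
    then obtain y where y: "y \<in> X" "((\<lambda>n. f (y n)), z) \<in> REL" unfolding completion_map_def by blast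
    have yc: "y \<in> CS" by (rule completion_memD[OF X y(1)])
    have "(\<lambda>n. K * \<nu> (x n - y n)) \<longlonglongrightarrow> 0"
      using completion_mem_rel[OF X x(2) y(1)] by (intro tendsto_mult_right_zero) (simp add: rel_iff)
    then have "(\<lambda>n. \<nu> (f (x n) - f (y n))) \<longlonglongrightarrow> 0"
    proof (rule Lim_null_comparison[rotated], intro always_eventually allI)
      fix n
      note d = E_diff[OF cauchy_inD[OF x(1)] cauchy_inD[OF yc], of n n]
      show "norm (\<nu> (f (x n) - f (y n))) \<le> K * \<nu> (x n - y n)"
        using f_le[OF d] \<nu>_nonneg[OF f[OF d]] f_diff[OF cauchy_inD[OF x(1)] cauchy_inD[OF yc], of n n] by simp
    qed
    then have "((\<lambda>n. f (x n)), (\<lambda>n. f (y n))) \<in> REL" using cm x(1) yc by (simp add: rel_iff)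
    then show "z \<in> REL `` {\<lambda>n. f (x n)}" using rel_trans y(2) by blast
  next
    fix z assume "z \<in> REL `` {\<lambda>n. f (x n)}"
    then show "z \<in> completion_map E \<nu> f X" unfolding completion_map_def using x(2) by blast
  qed
  then show "completion_map E \<nu> f X \<in> completion E \<nu>" using class_in[OF cm[OF x(1)]] by simp
qed

lemma completion_diff_in:
  assumes X: "X \<in> completion E \<nu>" and Y: "Y \<in> completion E \<nu>"
  shows "completion_diff E \<nu> X Y \<in> completion E \<nu>"
    and "\<And>x y. x \<in> X ==> y \<in> Y ==> (\<lambda>n. x n - y n) \<in> completion_diff E \<nu> X Y"
proof -
  have swap: "(x n - y n) - (x' m - y' m) = (x n - x' m) - (y n - y' m)" for x y x' y' :: "nat => 'e" and m n by simp
  have cd: "(\<lambda>n. x n - y n) \<in> CS" if x: "x \<in> CS" and y: "y \<in> CS" for x y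
  proof (rule cauchyI)
    show "x n - y n \<in> E" for n using cauchy_inD x y E_diff by blast
    fix e :: real assume "e > 0"
    then have e: "e / 2 > 0" by simp
    obtain N where N: "\<And>m n. m \<ge> N ==> n \<ge> N ==> \<nu> (x m - x n) < e / 2" using cauchyD[OF x e] by blast
    obtain M where M: "\<And>m n. m \<ge> M ==> n \<ge> M ==> \<nu> (y m - y n) < e / 2" using cauchyD[OF y e] by blast
    have "\<nu> ((x m - y m) - (x n - y n)) < e" if "m \<ge> max N M" "n \<ge> max N M" for m n
      using \<nu>_diff_le[OF E_diff[OF cauchy_inD[OF x] cauchy_inD[OF x]] E_diff[OF cauchy_inD[OF y] cauchy_inD[OF y]], of m n m n]
        N[of m n] M[of m n] that unfolding swap by simp
    then show "\<exists>N. \<forall>m\<ge>N. \<forall>n\<ge>N. \<nu> ((x m - y m) - (x n - y n)) < e" by blast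
  qed
  show in_diff: "(\<lambda>n. x n - y n) \<in> completion_diff E \<nu> X Y" if "x \<in> X" "y \<in> Y" for x y
    unfolding completion_diff_def
    using rel_refl[OF cd[OF completion_memD[OF X that(1)] completion_memD[OF Y that(2)]]] that by blast
  obtain x where x: "x \<in> CS" "x \<in> X" using X by (rule completionE)
  obtain y where y: "y \<in> CS" "y \<in> Y" using Y by (rule completionE)
  have "completion_diff E \<nu> X Y = REL `` {\<lambda>n. x n - y n}"
  proof (rule set_eqI, rule iffI)
    fix z assume "z \<in> completion_diff E \<nu> X Y"
    then obtain x' y' where x': "x' \<in> X" and y': "y' \<in> Y" and z: "((\<lambda>n. x' n - y' n), z) \<in> REL"
      unfolding completion_diff_def by blast
    note xc = completion_memD[OF X x'] and yc = completion_memD[OF Y y']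
    have "(\<lambda>n. \<nu> (x n - x' n) + \<nu> (y n - y' n)) \<longlonglongrightarrow> 0"
      using completion_mem_rel[OF X x(2) x'] completion_mem_rel[OF Y y(2) y'] by (intro tendsto_add_zero) (simp_all add: rel_iff)
    then have "(\<lambda>n. \<nu> ((x n - y n) - (x' n - y' n))) \<longlonglongrightarrow> 0"
    proof (rule Lim_null_comparison[rotated], intro always_eventually allI)
      fix n
      note d = E_diff[OF cauchy_inD[OF x(1)] cauchy_inD[OF xc], of n n] E_diff[OF cauchy_inD[OF y(1)] cauchy_inD[OF yc], of n n]
      show "norm (\<nu> ((x n - y n) - (x' n - y' n))) \<le> \<nu> (x n - x' n) + \<nu> (y n - y' n)"
        unfolding swap using \<nu>_diff_le[OF d] \<nu>_nonneg[OF E_diff[OF d]] by simp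
    qed
    then have "((\<lambda>n. x n - y n), (\<lambda>n. x' n - y' n)) \<in> REL" using cd x(1) y(1) xc yc by (simp add: rel_iff)
    then show "z \<in> REL `` {\<lambda>n. x n - y n}" using rel_trans z by blast
  next
    fix z assume "z \<in> REL `` {\<lambda>n. x n - y n}"
    then show "z \<in> completion_diff E \<nu> X Y" unfolding completion_diff_def using x(2) y(2) by blast
  qed
  then show "completion_diff E \<nu> X Y \<in> completion E \<nu>" using class_in[OF cd[OF x(1) y(1)]] by simp
qed

end

section \<open>The operator projective norm\<close>

abbreviation "FSA \<equiv> fourier_stieltjes_algebra"

lemma FSA_simps: "os_carrier FSA = FS" "os_matnorm FSA = fs_matnorm" "oa_mult FSA = (\<lambda>u v s. u s * v s)"
  by (simp_all add: fourier_stieltjes_algebra_def)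

lemma elem_tensor_apply: "\<phi> \<in> bilinear_forms V W ==> elem_tensor V W a b \<phi> = \<phi> a b"
  by (simp add: elem_tensor_def)

text \<open>A tensor is a functional on bilinear forms, so the extension of a bilinear form \<open>\<phi>\<close> to the
  algebraic tensor product is evaluation at \<open>\<phi>\<close>.\<close>

definition ftensor :: "nat => nat => (nat \<times> nat => complex) => (nat \<times> nat => complex) =>
    (nat => nat => 'a::complex_vector) => (nat => nat => 'b::complex_vector) => 'a set => 'b set => ('a, 'b) tensor" where
  "ftensor p q \<alpha> \<beta> x y V W = (\<Sum>i<p. \<Sum>k<q. \<Sum>j<p. \<Sum>l<q. (\<alpha> (i, k) * \<beta> (j, l)) *\<^sub>C elem_tensor V W (x i j) (y k l))"

lemma ftensor_apply:
  "ftensor p q \<alpha> \<beta> x y V W \<phi> = (if \<phi> \<in> bilinear_forms V W then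
    (\<Sum>i<p. \<Sum>k<q. \<Sum>j<p. \<Sum>l<q. \<alpha> (i, k) * \<beta> (j, l) * \<phi> (x i j) (y k l)) else 0)"
  by (simp add: ftensor_def sum_fun_apply scaleC_apply scaleC_complex_def elem_tensor_def)

lemma alg_tensorI:
  "(\<And>i. i < n ==> a i \<in> V) ==> (\<And>i. i < n ==> b i \<in> W) ==> (\<Sum>i<(n::nat). elem_tensor V W (a i) (b i)) \<in> alg_tensor V W"
  unfolding alg_tensor_def by blast

lemma alg_tensorE:
  assumes "t \<in> alg_tensor V W"
  obtains n a b where "\<And>i. i < (n::nat) ==> a i \<in> V" "\<And>i. i < n ==> b i \<in> W" "t = (\<Sum>i<n. elem_tensor V W (a i) (b i))"
  using assms unfolding alg_tensor_def by blast

lemma alg_tensor_add_elem: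
  assumes "t \<in> alg_tensor V W" "a \<in> V" "b \<in> W"
  shows "t + elem_tensor V W a b \<in> alg_tensor V W"
proof -
  obtain n f g where t: "\<And>i. i < (n::nat) ==> f i \<in> V" "\<And>i. i < n ==> g i \<in> W" "t = (\<Sum>i<n. elem_tensor V W (f i) (g i))"
    using assms(1) by (rule alg_tensorE) ((assumption | rule that)+)?
  have "t + elem_tensor V W a b = (\<Sum>i<Suc n. elem_tensor V W (if i < n then f i else a) (if i < n then g i else b))"
    unfolding t(3) by simp
  also have "\<dots> \<in> alg_tensor V W" by (rule alg_tensorI) (use t assms in auto)
  finally show ?thesis .
qed

lemma subspace_alg_tensor:
  fixes V :: "'a::complex_vector set" and W :: "'b::complex_vector set"
  assumes V: "complex_vector.subspace V"
  shows "complex_vector.subspace (alg_tensor V W)"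
proof (rule complex_vector.subspaceI)
  show z: "0 \<in> alg_tensor V W" using alg_tensorI[of 0 "\<lambda>_. undefined" V "\<lambda>_. undefined" W] by (simp only: lessThan_0 sum.empty not_less0)
  show "s + t \<in> alg_tensor V W" if s: "s \<in> alg_tensor V W" and t: "t \<in> alg_tensor V W" for s t
  proof -
    obtain n f g where t: "\<And>i. i < (n::nat) ==> f i \<in> V" "\<And>i. i < n ==> g i \<in> W" "t = (\<Sum>i<n. elem_tensor V W (f i) (g i))"
      using t by (rule alg_tensorE) ((assumption | rule that)+)?
    have "s + (\<Sum>i<k. elem_tensor V W (f i) (g i)) \<in> alg_tensor V W" if "k \<le> n" for k
      using that
    proof (induction k)
      case 0
      then show ?case using s by (simp only: lessThan_0 sum.empty add_0_right)
    next
      case (Suc k)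
      then show ?case using alg_tensor_add_elem[of "s + (\<Sum>i<k. elem_tensor V W (f i) (g i))" V W "f k" "g k"] t
        by (simp only: sum.lessThan_Suc add.assoc)
    qed
    then show ?thesis using t(3) by blast
  qed
  show "c *\<^sub>C t \<in> alg_tensor V W" if t: "t \<in> alg_tensor V W" for c t
  proof -
    obtain n f g where t: "\<And>i. i < (n::nat) ==> f i \<in> V" "\<And>i. i < n ==> g i \<in> W" "t = (\<Sum>i<n. elem_tensor V W (f i) (g i))"
      using t by (rule alg_tensorE) (assumption | rule that)+
    have "c *\<^sub>C t = (\<Sum>i<n. elem_tensor V W (c *\<^sub>C f i) (g i))"
      unfolding t(3) complex_vector.scale_sum_right
    proof (rule sum.cong[OF refl], rule ext)
      fix i \<phi> assume i: "i \<in> {..<n}"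
      show "(c *\<^sub>C elem_tensor V W (f i) (g i)) \<phi> = elem_tensor V W (c *\<^sub>C f i) (g i) \<phi>"
        using bilinear_formsD(3)[of \<phi> V W "f i" "g i" c] t(1,2) i
        by (simp add: scaleC_apply scaleC_complex_def elem_tensor_def)
    qed
    also have "\<dots> \<in> alg_tensor V W" by (rule alg_tensorI) (use t complex_vector.subspace_scale[OF V] in auto)
    finally show ?thesis .
  qed
qed

lemma elem_tensor_in: "a \<in> V ==> b \<in> W ==> elem_tensor V W a b \<in> alg_tensor V W"
  using alg_tensorI[of 1 "\<lambda>_. a" V "\<lambda>_. b" W] by simp

lemma ftensor_in:
  assumes V: "complex_vector.subspace V" and x: "\<And>i j. i < p ==> j < p ==> x i j \<in> V" and y: "\<And>k l. k < q ==> l < q ==> y k l \<in> W"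
  shows "ftensor p q \<alpha> \<beta> x y V W \<in> alg_tensor V W"
  unfolding ftensor_def
  by (intro complex_vector.subspace_sum[OF subspace_alg_tensor[OF V]] complex_vector.subspace_scale[OF subspace_alg_tensor[OF V]]
      elem_tensor_in x y) auto

abbreviation FE :: "('g::topological_group_add => complex, 'g => complex) tensor set" where
  "FE \<equiv> alg_tensor FS FS"
abbreviation fnorm :: "('g::topological_group_add => complex, 'g => complex) tensor => real" where
  "fnorm \<equiv> op_proj_norm FSA FSA"

lemmas subspace_FE = subspace_alg_tensor[OF fs_subspace, where W = FS]

lemma fnorm_eq: "fnorm t = Inf {L2 p q \<alpha> * fs_matnorm p x * fs_matnorm q y * L2 p q \<beta> | p q \<alpha> \<beta> x y.
    (\<forall>i<p. \<forall>j<p. x i j \<in> FS) \<and> (\<forall>k<q. \<forall>l<q. y k l \<in> FS) \<and> t = ftensor p q \<alpha> \<beta> x y FS FS}"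
  unfolding op_proj_norm_def FSA_simps ftensor_def ..

lemma factorization_nonneg:
  assumes "\<forall>i<p. \<forall>j<p. x i j \<in> FS" "\<forall>k<q. \<forall>l<q. y k l \<in> FS"
  shows "0 \<le> L2 p q \<alpha> * fs_matnorm p x * fs_matnorm q y * L2 p q \<beta>"
  by (intro mult_nonneg_nonneg fs_matnorm_nonneg L2_set_nonneg) (use assms in auto)

lemma fnorm_set_bdd: "bdd_below {L2 p q \<alpha> * fs_matnorm p x * fs_matnorm q y * L2 p q \<beta> | p q \<alpha> \<beta> x y.
    (\<forall>i<p. \<forall>j<p. x i j \<in> FS) \<and> (\<forall>k<q. \<forall>l<q. y k l \<in> FS) \<and> t = ftensor p q \<alpha> \<beta> x y FS FS}"
  by (rule bdd_belowI[of _ 0]) (use factorization_nonneg in blast)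

lemma fnorm_le:
  assumes "\<And>i j. i < p ==> j < p ==> x i j \<in> FS" "\<And>k l. k < q ==> l < q ==> y k l \<in> FS"
  shows "fnorm (ftensor p q \<alpha> \<beta> x y FS FS) \<le> L2 p q \<alpha> * fs_matnorm p x * fs_matnorm q y * L2 p q \<beta>"
  unfolding fnorm_eq by (rule cInf_lower[OF _ fnorm_set_bdd]) (use assms in blast)

text \<open>Put the entries of \<open>t = \<Sum>a i \<otimes> b i\<close> on the diagonals of two matrices
  and let \<open>\<alpha>\<close> and \<open>\<beta>\<close> be the characteristic function of the
  diagonal.\<close>

lemma factorization_exists:
  fixes t :: "('a::topological_group_add => complex, 'a => complex) tensor"
  assumes t: "t \<in> FE"
  shows "\<exists>p q \<alpha> \<beta> x y. (\<forall>i<p. \<forall>j<p. x i j \<in> FS) \<and> (\<forall>k<q. \<forall>l<q. y k l \<in> FS) \<and> t = ftensor p q \<alpha> \<beta> x y FS FS"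
proof -
  obtain n a b where ab: "\<And>i. i < (n::nat) ==> a i \<in> FS" "\<And>i. i < n ==> b i \<in> FS" "t = (\<Sum>i<n. elem_tensor FS FS (a i) (b i))"
    using t by (rule alg_tensorE) ((assumption | rule that)+)?
  let ?x = "\<lambda>i j. if i = j then a i else 0" and ?y = "\<lambda>i j. if i = j then b i else 0"
  let ?\<alpha> = "\<lambda>(i, k). if i = k then 1 else (0::complex)"
  have z: "(0 :: 'a => complex) \<in> FS" using complex_vector.subspace_0[OF fs_subspace] .
  have "t = ftensor n n ?\<alpha> ?\<alpha> ?x ?y FS FS"
  proof
    fix \<phi> :: "('a => complex) => ('a => complex) => complex"
    show "t \<phi> = ftensor n n ?\<alpha> ?\<alpha> ?x ?y FS FS \<phi>"
    proof (cases "\<phi> \<in> bilinear_forms FS FS")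
      case True
      have \<phi>0: "\<phi> 0 0 = 0" using bilinear_formsD(3)[OF True z z, of 0] by (simp only: complex_vector.scale_zero_left mult_zero_left)
      have d: "(\<Sum>l<n. (if j = l then 1 else 0) * F l) = F j" if "j < n" for j and F :: "nat => complex"
      proof -
        have "(\<Sum>l<n. (if j = l then 1 else 0) * F l) = (\<Sum>l<n. if l = j then F l else 0)"
          by (intro sum.cong) auto
        then show ?thesis using that by simp
      qed
      have "(\<Sum>i<n. \<Sum>k<n. \<Sum>j<n. \<Sum>l<n. ?\<alpha> (i, k) * ?\<alpha> (j, l) * \<phi> (?x i j) (?y k l)) =
          (\<Sum>i<n. \<Sum>k<n. \<Sum>j<n. ?\<alpha> (i, k) * \<phi> (?x i j) (?y k j))"
      proof (intro sum.cong refl)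
        fix i k j assume "j \<in> {..<n}"
        then show "(\<Sum>l<n. ?\<alpha> (i, k) * ?\<alpha> (j, l) * \<phi> (?x i j) (?y k l)) = ?\<alpha> (i, k) * \<phi> (?x i j) (?y k j)"
          using d[of j "\<lambda>l. \<phi> (?x i j) (?y k l)"] by (simp only: prod.case mult.assoc sum_distrib_left[symmetric] lessThan_iff)
      qed
      also have "\<dots> = (\<Sum>i<n. \<Sum>j<n. \<phi> (?x i j) (?y i j))"
      proof (rule sum.cong[OF refl])
        fix i assume "i \<in> {..<n}"
        then show "(\<Sum>k<n. \<Sum>j<n. ?\<alpha> (i, k) * \<phi> (?x i j) (?y k j)) = (\<Sum>j<n. \<phi> (?x i j) (?y i j))"
          using d[of i "\<lambda>k. \<Sum>j<n. \<phi> (?x i j) (?y k j)"] by (simp only: prod.case sum_distrib_left[symmetric] lessThan_iff)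
      qed
      also have "\<dots> = (\<Sum>i<n. \<Sum>j<n. if j = i then \<phi> (a i) (b i) else 0)"
      proof (rule sum.cong[OF refl], rule sum.cong[OF refl])
        fix i j
        show "\<phi> (?x i j) (?y i j) = (if j = i then \<phi> (a i) (b i) else 0)"
        proof (cases "i = j")
          case False
          then have "j \<noteq> i" by blast
          with False show ?thesis by (simp only: if_False \<phi>0)
        qed (simp only: simp_thms if_True)
      qed
      also have "\<dots> = (\<Sum>i<n. \<phi> (a i) (b i))"
        by (rule sum.cong[OF refl]) (simp only: sum.delta finite_lessThan if_True)
      finally show ?thesis using True by (simp add: ab(3) sum_fun_apply elem_tensor_def ftensor_apply)
    qed (simp add: ab(3) sum_fun_apply elem_tensor_def ftensor_apply)
  qed
  moreover have "\<forall>i<n. \<forall>j<n. ?x i j \<in> FS"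
  proof (intro allI impI)
    fix i j assume "i < n" then show "?x i j \<in> FS" using z ab(1)[of i] by (simp only: split: if_split) blast
  qed
  moreover have "\<forall>i<n. \<forall>j<n. ?y i j \<in> FS"
  proof (intro allI impI)
    fix i j assume "i < n" then show "?y i j \<in> FS" using z ab(2)[of i] by (simp only: split: if_split) blast
  qed
  ultimately show ?thesis
    by (intro exI[of _ n] exI[of _ ?\<alpha>] exI[of _ ?x] exI[of _ ?y] conjI) assumption+
qed

lemma fnorm_lessE:
  assumes "t \<in> FE" "fnorm t < r"
  obtains p q \<alpha> \<beta> x y where "\<And>i j. i < p ==> j < p ==> x i j \<in> FS" "\<And>k l. k < q ==> l < q ==> y k l \<in> FS"
    "t = ftensor p q \<alpha> \<beta> x y FS FS" "L2 p q \<alpha> * fs_matnorm p x * fs_matnorm q y * L2 p q \<beta> < r"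
proof -
  have "{L2 p q \<alpha> * fs_matnorm p x * fs_matnorm q y * L2 p q \<beta> | p q \<alpha> \<beta> x y.
    (\<forall>i<p. \<forall>j<p. x i j \<in> FS) \<and> (\<forall>k<q. \<forall>l<q. y k l \<in> FS) \<and> t = ftensor p q \<alpha> \<beta> x y FS FS} \<noteq> {}"
    using factorization_exists[OF assms(1)] by blast
  from cInf_lessD[OF this assms(2)[unfolded fnorm_eq]] that show thesis by blast
qed

lemma fnorm_nonneg: assumes "t \<in> FE" shows "0 \<le> fnorm t"
proof (rule ccontr)
  assume "\<not> 0 \<le> fnorm t"
  then have "fnorm t < 0" by simp
  then obtain p q \<alpha> \<beta> x y where f: "\<And>i j. i < p ==> j < p ==> x i j \<in> FS" "\<And>k l. k < q ==> l < q ==> y k l \<in> FS"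
    "t = ftensor p q \<alpha> \<beta> x y FS FS" "L2 p q \<alpha> * fs_matnorm p x * fs_matnorm q y * L2 p q \<beta> < 0"
    by (rule fnorm_lessE[OF assms]) ((assumption | rule that)+)?
  show False using factorization_nonneg[where p = p and q = q and x = x and y = y and \<alpha> = \<alpha> and \<beta> = \<beta>] f(1,2,4) by force
qed

text \<open>Every factorisation bounds the value of \<open>t\<close> at a contractive form.\<close>

lemma contractive_form_fnorm:
  assumes \<phi>: "contractive_form \<phi>" and t: "t \<in> FE"
  shows "cmod (t \<phi>) \<le> fnorm t"
proof (rule dense_ge)
  fix r assume "fnorm t < r"
  then obtain p q \<alpha> \<beta> x y where f: "\<And>i j. i < p ==> j < p ==> x i j \<in> FS" "\<And>k l. k < q ==> l < q ==> y k l \<in> FS"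
    "t = ftensor p q \<alpha> \<beta> x y FS FS" "L2 p q \<alpha> * fs_matnorm p x * fs_matnorm q y * L2 p q \<beta> < r"
    by (rule fnorm_lessE[OF t]) ((assumption | rule that)+)?
  have "\<phi> \<in> bilinear_forms FS FS" using \<phi> by (simp add: contractive_form_def)
  then have "cmod (t \<phi>) \<le> L2 p q \<alpha> * fs_matnorm p x * fs_matnorm q y * L2 p q \<beta>"
    unfolding f(3) ftensor_apply by (simp only: if_True) (rule contractive_form_matrix_bound[OF \<phi> f(1,2)])
  then show "cmod (t \<phi>) \<le> r" using f(4) by simp
qed

text \<open>Block-diagonal sum of two matrices.\<close>

definition blk :: "nat => nat => (nat => nat => 'c) => (nat => nat => 'c) => nat => nat => 'c::zero" where
  "blk p q a b i k = (if i < p \<and> k < q then a i k else if p \<le> i \<and> q \<le> k then b (i - p) (k - q) else 0)"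

lemma blk_simps:
  "i < p ==> k < q ==> blk p q a b i k = a i k" "i < p ==> blk p q a b i (q + k) = 0"
  "k < q ==> blk p q a b (p + i) k = 0" "blk p q a b (p + i) (q + k) = b i k"
  by (simp_all add: blk_def)

lemma sum_lessThan_add: "(\<Sum>i<m + n. g i) = (\<Sum>i<m. g i) + (\<Sum>i<n. g (m + i :: nat) :: 'b::comm_monoid_add)"
  by (induction n) (simp_all add: add.assoc)

lemma L2_power2: "(L2 n m z)\<^sup>2 = (\<Sum>j<n. \<Sum>l<m. (cmod (z (j, l)))\<^sup>2)"
  by (simp add: L2_set_def sum_nonneg sum.cartesian_product case_prod_unfold)

lemma L2_split: "(L2 (n + n') m z)\<^sup>2 = (L2 n m z)\<^sup>2 + (L2 n' m (\<lambda>(j, l). z (n + j, l)))\<^sup>2"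
  by (simp add: L2_power2 sum_lessThan_add)

lemma L2_blk: "(L2 (p + p') (q + q') (\<lambda>(i, k). blk p q (\<lambda>i k. \<alpha> (i, k)) (\<lambda>i k. \<alpha>' (i, k)) i k))\<^sup>2 = (L2 p q \<alpha>)\<^sup>2 + (L2 p' q' \<alpha>')\<^sup>2"
  by (simp add: L2_power2 sum_lessThan_add blk_simps cong: sum.cong_simp)

lemma L2_scale: "L2 n m (\<lambda>jl. c * z jl) = cmod c * L2 n m z"
  by (simp add: norm_mult L2_set_right_distrib)

lemma two_products_le:
  fixes a b c d :: real
  shows "a * b + c * d \<le> sqrt (a\<^sup>2 + c\<^sup>2) * sqrt (b\<^sup>2 + d\<^sup>2)"
proof -
  have "(a * b + c * d)\<^sup>2 + (a * d - b * c)\<^sup>2 = (a\<^sup>2 + c\<^sup>2) * (b\<^sup>2 + d\<^sup>2)"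
    by (simp add: power2_eq_square algebra_simps)
  then have "(a * b + c * d)\<^sup>2 \<le> (a\<^sup>2 + c\<^sup>2) * (b\<^sup>2 + d\<^sup>2)" by (metis le_add_same_cancel1 zero_le_power2)
  then have "a * b + c * d \<le> sqrt ((a\<^sup>2 + c\<^sup>2) * (b\<^sup>2 + d\<^sup>2))" by (rule real_le_rsqrt)
  then show ?thesis by (simp add: real_sqrt_mult)
qed

lemma fs_zero: "0 \<in> FS" by (rule complex_vector.subspace_0[OF fs_subspace])

lemma fs_pairing_zero: "A \<in> VN ==> fs_pairing 0 A = 0"
  using fs_scale(2)[OF fs_zero, of A 0] by (simp only: complex_vector.scale_zero_left mult_zero_left)

lemma fs_matnorm_blk:
  fixes u v :: "nat => nat => 'g::topological_group_add => complex"
  assumes u: "\<And>i j. i < n ==> j < n ==> u i j \<in> FS" and v: "\<And>i j. i < n' ==> j < n' ==> v i j \<in> FS"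
    and le: "fs_matnorm n u \<le> 1" "fs_matnorm n' v \<le> 1"
  shows "fs_matnorm (n + n') (blk n n u v) \<le> 1"
proof (rule fs_matnorm_le)
  fix m and A :: "nat => nat => 'g univ_op" and z w :: "nat \<times> nat => complex" assume A: "A \<in> vn_matrix_ball m"
  let ?z = "\<lambda>(j, l). z (n + j, l)" and ?w = "\<lambda>(j, l). w (n + j, l)"
  have A0: "fs_pairing 0 (A k l) = 0" if "k < m" "l < m" for k l
    using fs_pairing_zero vn_ballD(1)[OF A] that by blast
  have split: "fs_form (n + n') m (blk n n u v) A z w = fs_form n m u A z w + fs_form n' m v A ?z ?w"
    unfolding fs_form_def sum_lessThan_add by (simp add: blk_simps A0 cong: sum.cong_simp)
  have "cmod (fs_form (n + n') m (blk n n u v) A z w) \<le> 1 * L2 n m z * L2 n m w + 1 * L2 n' m ?z * L2 n' m ?w"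
    unfolding split
  proof (rule order_trans[OF norm_triangle_ineq], rule add_mono)
    show "cmod (fs_form n m u A z w) \<le> 1 * L2 n m z * L2 n m w"
      by (rule order_trans[OF fs_form_bound[OF u A]]) (assumption | intro mult_right_mono le(1) L2_set_nonneg)+
    show "cmod (fs_form n' m v A ?z ?w) \<le> 1 * L2 n' m ?z * L2 n' m ?w"
      by (rule order_trans[OF fs_form_bound[OF v A]]) (assumption | intro mult_right_mono le(2) L2_set_nonneg)+
  qed
  also have "\<dots> \<le> sqrt ((L2 n m z)\<^sup>2 + (L2 n' m ?z)\<^sup>2) * sqrt ((L2 n m w)\<^sup>2 + (L2 n' m ?w)\<^sup>2)"
    using two_products_le[of "L2 n m z" "L2 n m w" "L2 n' m ?z" "L2 n' m ?w"] by (simp only: mult_1_left)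
  also have "\<dots> = 1 * L2 (n + n') m z * L2 (n + n') m w"
    unfolding L2_split[symmetric] by simp
  finally show "cmod (fs_form (n + n') m (blk n n u v) A z w) \<le> 1 * L2 (n + n') m z * L2 (n + n') m w" .
qed simp

lemma fs_matnorm_scale_le:
  fixes u :: "nat => nat => 'g::topological_group_add => complex"
  assumes u: "\<And>i j. i < n ==> j < n ==> u i j \<in> FS"
  shows "fs_matnorm n (\<lambda>i j. c *\<^sub>C u i j) \<le> cmod c * fs_matnorm n u"
proof (rule fs_matnorm_le)
  show "0 \<le> cmod c * fs_matnorm n u" using fs_matnorm_nonneg[OF u] by simp
  fix m and A :: "nat => nat => 'g univ_op" and z w :: "nat \<times> nat => complex" assume A: "A \<in> vn_matrix_ball m"
  have "fs_form n m (\<lambda>i j. c *\<^sub>C u i j) A z w = c * fs_form n m u A z w"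
    unfolding fs_form_def sum_distrib_left
  proof (intro sum.cong refl)
    fix i j k l assume "i \<in> {..<n}" "j \<in> {..<n}" "k \<in> {..<m}" "l \<in> {..<m}"
    then show "fs_pairing (c *\<^sub>C u i j) (A k l) * z (j, l) * cnj (w (i, k)) = c * (fs_pairing (u i j) (A k l) * z (j, l) * cnj (w (i, k)))"
      using fs_scale(2)[OF u vn_ballD(1)[OF A], of i j k l c] by simp
  qed
  moreover have "cmod (fs_form n m u A z w) \<le> fs_matnorm n u * L2 n m z * L2 n m w" by (rule fs_form_bound[OF u A])
  from mult_left_mono[OF this norm_ge_zero[of c]]
  have "cmod (c * fs_form n m u A z w) \<le> cmod c * fs_matnorm n u * L2 n m z * L2 n m w" by (simp only: norm_mult mult.assoc)
  ultimately show "cmod (fs_form n m (\<lambda>i j. c *\<^sub>C u i j) A z w) \<le> cmod c * fs_matnorm n u * L2 n m z * L2 n m w" by (simp only:)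
qed

lemma ftensor_scale:
  assumes x: "\<And>i j. i < p ==> j < p ==> x i j \<in> V" and y: "\<And>k l. k < q ==> l < q ==> y k l \<in> W"
    and V: "complex_vector.subspace V"
  shows "ftensor p q (\<lambda>ik. a * \<alpha> ik) (\<lambda>jl. b * \<beta> jl) (\<lambda>i j. c *\<^sub>C x i j) (\<lambda>k l. d *\<^sub>C y k l) V W
    = (a * b * c * d) *\<^sub>C ftensor p q \<alpha> \<beta> x y V W"
proof
  fix \<phi>
  show "ftensor p q (\<lambda>ik. a * \<alpha> ik) (\<lambda>jl. b * \<beta> jl) (\<lambda>i j. c *\<^sub>C x i j) (\<lambda>k l. d *\<^sub>C y k l) V W \<phi>
    = ((a * b * c * d) *\<^sub>C ftensor p q \<alpha> \<beta> x y V W) \<phi>"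
  proof (cases "\<phi> \<in> bilinear_forms V W")
    case True
    have "\<phi> (c *\<^sub>C x i j) (d *\<^sub>C y k l) = c * d * \<phi> (x i j) (y k l)"
      if "i \<in> {..<p}" "j \<in> {..<p}" "k \<in> {..<q}" "l \<in> {..<q}" for i j k l
      using that x[of i j] y[of k l] complex_vector.subspace_scale[OF V x[of i j], of c] by (simp add: bilinear_formsD(3,4)[OF True])
    then have "(\<Sum>i<p. \<Sum>k<q. \<Sum>j<p. \<Sum>l<q. a * \<alpha> (i, k) * (b * \<beta> (j, l)) * \<phi> (c *\<^sub>C x i j) (d *\<^sub>C y k l))
      = (\<Sum>i<p. \<Sum>k<q. \<Sum>j<p. \<Sum>l<q. (a * b * c * d) * (\<alpha> (i, k) * \<beta> (j, l) * \<phi> (x i j) (y k l)))"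
      by (intro sum.cong refl) (simp only: mult_ac)
    then show ?thesis using True by (simp add: ftensor_apply scaleC_apply scaleC_complex_def sum_distrib_left)
  qed (simp add: ftensor_apply scaleC_apply scaleC_complex_def)
qed

text \<open>Scalars are moved from \<open>x\<close> and \<open>y\<close> into \<open>\<alpha>\<close> and
  \<open>\<beta>\<close> and distributed evenly between these. In this form factorisations can be
  added.\<close>

lemma normalised_factorization:
  assumes t: "t \<in> FE" and r: "fnorm t < r"
  obtains p q \<alpha> \<beta> x y where "\<And>i j. i < p ==> j < p ==> x i j \<in> FS" "\<And>k l. k < q ==> l < q ==> y k l \<in> FS"
    "t = ftensor p q \<alpha> \<beta> x y FS FS" "fs_matnorm p x \<le> 1" "fs_matnorm q y \<le> 1" "(L2 p q \<alpha>)\<^sup>2 \<le> r" "(L2 p q \<beta>)\<^sup>2 \<le> r"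
proof -
  obtain p q \<alpha> \<beta> x y where f: "\<And>i j. i < p ==> j < p ==> x i j \<in> FS" "\<And>k l. k < q ==> l < q ==> y k l \<in> FS"
    "t = ftensor p q \<alpha> \<beta> x y FS FS" "L2 p q \<alpha> * fs_matnorm p x * fs_matnorm q y * L2 p q \<beta> < r"
    by (rule fnorm_lessE[OF t r]) ((assumption | rule that)+)?
  define A X Y B where "A = L2 p q \<alpha>" and "X = fs_matnorm p x" and "Y = fs_matnorm q y" and "B = L2 p q \<beta>"
  have nn: "0 \<le> A" "0 \<le> X" "0 \<le> Y" "0 \<le> B"
    unfolding A_def X_def Y_def B_def by (rule L2_set_nonneg fs_matnorm_nonneg f(1,2) | assumption)+
  have r0: "0 < r" using fnorm_nonneg[OF t] r by simp
  \<comment> \<open>The factors may vanish, so each is enlarged a little before dividing by it.\<close>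
  have "((\<lambda>\<delta>. (A + \<delta>) * (X + \<delta>) * (Y + \<delta>) * (B + \<delta>)) \<longlongrightarrow> (A + 0) * (X + 0) * (Y + 0) * (B + 0)) (at_right 0)"
    by (intro tendsto_intros)
  then have "\<forall>\<^sub>F \<delta> in at_right 0. (A + \<delta>) * (X + \<delta>) * (Y + \<delta>) * (B + \<delta>) < r"
    by (rule order_tendstoD(2)) (use f(4) in \<open>simp add: A_def X_def Y_def B_def\<close>)
  then have "\<forall>\<^sub>F \<delta> in at_right 0. (A + \<delta>) * (X + \<delta>) * (Y + \<delta>) * (B + \<delta>) < r \<and> 0 < \<delta>"
    using eventually_at_right_less[of "0::real"] by (rule eventually_conj)
  then obtain \<delta> where \<delta>: "(A + \<delta>) * (X + \<delta>) * (Y + \<delta>) * (B + \<delta>) < r" "0 < \<delta>"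
    using eventually_happens[of _ "at_right (0::real)"] by (auto simp: trivial_limit_at_right_real)
  define X' Y' where "X' = X + \<delta>" and "Y' = Y + \<delta>"
  define c d where "c = sqrt r / (A + \<delta>)" and "d = X' * Y' * (A + \<delta>) / sqrt r"
  have pos: "0 < X'" "0 < Y'" "0 < A + \<delta>" "0 < sqrt r" "0 < c" "0 < d" "X \<le> X'" "Y \<le> Y'" "A \<le> A + \<delta>"
    using nn \<delta>(2) r0 by (auto simp: X'_def Y'_def c_def d_def)
  have cd: "c * d = X' * Y'" using pos by (simp add: c_def d_def)
  have cA: "c * A \<le> sqrt r" using pos nn by (simp add: c_def field_simps mult_left_mono)
  have "d * B \<le> d * (B + \<delta>)" using pos \<delta> by (intro mult_left_mono) auto
  also have "\<dots> = (A + \<delta>) * X' * Y' * (B + \<delta>) / sqrt r" by (simp add: d_def)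
  also have "\<dots> \<le> r / sqrt r" using \<delta>(1) r0 by (intro divide_right_mono) (auto simp: X'_def Y'_def)
  also have "\<dots> = sqrt r" using r0 by (simp add: real_div_sqrt)
  finally have dB: "d * B \<le> sqrt r" .
  let ?\<alpha> = "\<lambda>ik. complex_of_real c * \<alpha> ik" and ?\<beta> = "\<lambda>jl. complex_of_real d * \<beta> jl"
  let ?x = "\<lambda>i j. complex_of_real (1 / X') *\<^sub>C x i j" and ?y = "\<lambda>k l. complex_of_real (1 / Y') *\<^sub>C y k l"
  show thesis
  proof (rule that[of p ?x q ?y ?\<alpha> ?\<beta>])
    show "?x i j \<in> FS" if "i < p" "j < p" for i j using f(1)[OF that] by (rule fs_scale)
    show "?y i j \<in> FS" if "i < q" "j < q" for i j using f(2)[OF that] by (rule fs_scale)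
    have "complex_of_real c * complex_of_real d * complex_of_real (1 / X') * complex_of_real (1 / Y') = complex_of_real (c * d * (1 / X') * (1 / Y'))"
      by simp
    also have "\<dots> = 1" unfolding cd using pos by simp
    finally have one: "complex_of_real c * complex_of_real d * complex_of_real (1 / X') * complex_of_real (1 / Y') = 1" .
    have "ftensor p q ?\<alpha> ?\<beta> ?x ?y FS FS = (complex_of_real c * complex_of_real d * complex_of_real (1 / X') * complex_of_real (1 / Y')) *\<^sub>C ftensor p q \<alpha> \<beta> x y FS FS"
      by (rule ftensor_scale) (fact f fs_subspace)+
    then show "t = ftensor p q ?\<alpha> ?\<beta> ?x ?y FS FS"
      unfolding one f(3) by (simp only: scaleC_one)
    have "fs_matnorm p ?x \<le> cmod (complex_of_real (1 / X')) * X" unfolding X_def by (rule fs_matnorm_scale_le[OF f(1)])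
    also have "\<dots> \<le> 1" using pos by (simp add: norm_divide)
    finally show "fs_matnorm p ?x \<le> 1" .
    have "fs_matnorm q ?y \<le> cmod (complex_of_real (1 / Y')) * Y" unfolding Y_def by (rule fs_matnorm_scale_le[OF f(2)])
    also have "\<dots> \<le> 1" using pos by (simp add: norm_divide)
    finally show "fs_matnorm q ?y \<le> 1" .
    have "L2 p q ?\<alpha> \<le> sqrt r" "L2 p q ?\<beta> \<le> sqrt r" using cA dB pos unfolding L2_scale by (simp_all add: A_def B_def)
    then show "(L2 p q ?\<alpha>)\<^sup>2 \<le> r" "(L2 p q ?\<beta>)\<^sup>2 \<le> r"
      using power_mono[of "L2 p q ?\<alpha>" "sqrt r" 2] power_mono[of "L2 p q ?\<beta>" "sqrt r" 2] r0 L2_set_nonneg by simp_all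
  qed
qed

lemma ftensor_blk:
  fixes x y :: "nat => nat => 'g::topological_group_add => complex"
  shows "ftensor (p + p') (q + q') (\<lambda>(i, k). blk p q (\<lambda>i k. \<alpha> (i, k)) (\<lambda>i k. \<alpha>' (i, k)) i k)
      (\<lambda>(i, k). blk p q (\<lambda>i k. \<beta> (i, k)) (\<lambda>i k. \<beta>' (i, k)) i k) (blk p p x x') (blk q q y y') FS FS
    = ftensor p q \<alpha> \<beta> x y FS FS + ftensor p' q' \<alpha>' \<beta>' x' y' FS FS" (is "?t = ?s")
proof
  fix \<phi> :: "('g => complex) => ('g => complex) => complex"
  show "?t \<phi> = ?s \<phi>"
  proof (cases "\<phi> \<in> bilinear_forms FS FS")
    case True
    have \<phi>0: "\<phi> 0 0 = 0" using bilinear_formsD(3)[OF True fs_zero fs_zero, of 0] by (simp only: complex_vector.scale_zero_left mult_zero_left)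
    show ?thesis using True by (simp add: ftensor_apply sum_lessThan_add blk_simps \<phi>0[unfolded zero_fun_def] \<phi>0 cong: sum.cong_simp)
  qed (simp add: ftensor_apply)
qed

text \<open>The block-diagonal sum of normalised factorisations of \<open>s\<close> and \<open>t\<close> is
  a factorisation of \<open>s + t\<close>: the matrix norms stay at most 1, and the squares of the
  norms of the scalar row and column add up.\<close>

lemma fnorm_add:
  assumes s: "s \<in> FE" and t: "t \<in> FE" shows "fnorm (s + t) \<le> fnorm s + fnorm t"
proof (rule field_le_epsilon)
  fix e :: real assume e: "0 < e"
  define a b where "a = fnorm s + e / 2" and "b = fnorm t + e / 2"
  have lt: "fnorm s < a" "fnorm t < b" using e by (auto simp: a_def b_def)
  obtain p q \<alpha> \<beta> x y where f: "\<And>i j. i < p ==> j < p ==> x i j \<in> FS" "\<And>k l. k < q ==> l < q ==> y k l \<in> FS"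
    "s = ftensor p q \<alpha> \<beta> x y FS FS" "fs_matnorm p x \<le> 1" "fs_matnorm q y \<le> 1" "(L2 p q \<alpha>)\<^sup>2 \<le> a" "(L2 p q \<beta>)\<^sup>2 \<le> a"
    by (rule normalised_factorization[OF s lt(1)]) ((assumption | rule that)+)?
  obtain p' q' \<alpha>' \<beta>' x' y' where f': "\<And>i j. i < p' ==> j < p' ==> x' i j \<in> FS" "\<And>k l. k < q' ==> l < q' ==> y' k l \<in> FS"
    "t = ftensor p' q' \<alpha>' \<beta>' x' y' FS FS" "fs_matnorm p' x' \<le> 1" "fs_matnorm q' y' \<le> 1" "(L2 p' q' \<alpha>')\<^sup>2 \<le> b" "(L2 p' q' \<beta>')\<^sup>2 \<le> b"
    by (rule normalised_factorization[OF t lt(2)]) ((assumption | rule that)+)?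
  let ?\<alpha> = "\<lambda>(i, k). blk p q (\<lambda>i k. \<alpha> (i, k)) (\<lambda>i k. \<alpha>' (i, k)) i k"
  let ?\<beta> = "\<lambda>(i, k). blk p q (\<lambda>i k. \<beta> (i, k)) (\<lambda>i k. \<beta>' (i, k)) i k"
  let ?x = "blk p p x x'" and ?y = "blk q q y y'"
  have x: "?x i j \<in> FS" if "i < p + p'" "j < p + p'" for i j
    using that f(1)[of i j] f'(1)[of "i - p" "j - p"] fs_zero unfolding blk_def by (simp only: split: if_split) auto
  have y: "?y i j \<in> FS" if "i < q + q'" "j < q + q'" for i j
    using that f(2)[of i j] f'(2)[of "i - q" "j - q"] fs_zero unfolding blk_def by (simp only: split: if_split) auto
  have ab: "0 \<le> a + b" using fnorm_nonneg[OF s] fnorm_nonneg[OF t] e by (simp add: a_def b_def)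
  have L: "L2 (p + p') (q + q') ?\<alpha> \<le> sqrt (a + b)" "L2 (p + p') (q + q') ?\<beta> \<le> sqrt (a + b)"
    by (rule real_le_rsqrt, unfold L2_blk, rule add_mono, fact+)+
  have "fnorm (s + t) \<le> L2 (p + p') (q + q') ?\<alpha> * fs_matnorm (p + p') ?x * fs_matnorm (q + q') ?y * L2 (p + p') (q + q') ?\<beta>"
    unfolding f(3) f'(3) ftensor_blk[symmetric] by (rule fnorm_le) (fact x y)+
  also have "\<dots> \<le> sqrt (a + b) * 1 * 1 * sqrt (a + b)"
    by (intro mult_mono L fs_matnorm_blk f f' mult_nonneg_nonneg fs_matnorm_nonneg x y L2_set_nonneg real_sqrt_ge_zero ab) auto
  also have "\<dots> = fnorm s + fnorm t + e" using ab by (simp add: a_def b_def)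
  finally show "fnorm (s + t) \<le> fnorm s + fnorm t + e" .
qed

lemma fnorm_uminus_le:
  assumes t: "t \<in> FE" shows "fnorm (- t) \<le> fnorm t"
proof (rule dense_ge)
  fix r assume "fnorm t < r"
  then obtain p q \<alpha> \<beta> x y where f: "\<And>i j. i < p ==> j < p ==> x i j \<in> FS" "\<And>k l. k < q ==> l < q ==> y k l \<in> FS"
    "t = ftensor p q \<alpha> \<beta> x y FS FS" "L2 p q \<alpha> * fs_matnorm p x * fs_matnorm q y * L2 p q \<beta> < r"
    by (rule fnorm_lessE[OF t]) ((assumption | rule that)+)?
  have e: "- t = ftensor p q (\<lambda>ik. - \<alpha> ik) \<beta> x y FS FS"
    unfolding f(3) by (rule ext) (simp add: ftensor_apply sum_negf)
  have "fnorm (- t) \<le> L2 p q (\<lambda>ik. - \<alpha> ik) * fs_matnorm p x * fs_matnorm q y * L2 p q \<beta>"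
    unfolding e by (rule fnorm_le) (fact f)+
  then show "fnorm (- t) \<le> r" using f(4) by simp
qed

lemma fnorm_zero: "fnorm 0 = 0"
proof (rule antisym)
  have "fnorm (ftensor 0 0 (\<lambda>_. 0) (\<lambda>_. 0) (\<lambda>_ _. 0) (\<lambda>_ _. 0) FS FS) \<le> 0"
    by (rule order_trans[OF fnorm_le]) simp_all
  moreover have "ftensor 0 0 (\<lambda>_. 0) (\<lambda>_. 0) (\<lambda>_ _. 0) (\<lambda>_ _. 0) FS FS = 0" by (rule ext) (simp add: ftensor_apply)
  ultimately show "fnorm 0 \<le> 0" by metis
  show "0 \<le> fnorm 0" by (rule fnorm_nonneg[OF complex_vector.subspace_0[OF subspace_FE]])
qed

global_interpretation fsem: seminormed FE fnorm
  by unfold_locales (fact subspace_FE fnorm_zero fnorm_nonneg fnorm_add fnorm_uminus_le)+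

section \<open>Linear maps on the tensor product\<close>

lemma bilinear_formsI:
  assumes "\<And>a a' b. a \<in> V ==> a' \<in> V ==> b \<in> W ==> \<phi> (a + a') b = \<phi> a b + \<phi> a' b"
    "\<And>a b b'. a \<in> V ==> b \<in> W ==> b' \<in> W ==> \<phi> a (b + b') = \<phi> a b + \<phi> a b'"
    "\<And>c a b. a \<in> V ==> b \<in> W ==> \<phi> (c *\<^sub>C a) b = c * \<phi> a b"
    "\<And>c a b. a \<in> V ==> b \<in> W ==> \<phi> a (c *\<^sub>C b) = c * \<phi> a b"
  shows "\<phi> \<in> bilinear_forms V W"
  unfolding bilinear_forms_def using assms by (intro CollectI conjI ballI allI)

text \<open>A function-valued lift is computed pointwise, as an evaluation of the tensor, which also shows
  that it does not depend on the decomposition of \<open>t\<close>.\<close>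

lemma tensor_lift_eq:
  fixes f :: "'a::complex_vector => 'b::complex_vector => 'i => complex"
  assumes f: "\<And>s. (\<lambda>a b. f a b s) \<in> bilinear_forms V W" and t: "t \<in> alg_tensor V W"
  shows "tensor_lift V W f t = (\<lambda>s. t (\<lambda>a b. f a b s))"
  unfolding tensor_lift_def
proof (rule the_equality)
  have val: "(\<Sum>i<n. f (a i) (b i)) = (\<lambda>s. (\<Sum>i<n. elem_tensor V W (a i) (b i)) (\<lambda>a b. f a b s))"
    for n :: nat and a b
    by (rule ext) (simp add: sum_fun_apply elem_tensor_apply[OF f])
  obtain n a b where ab: "\<And>i. i < (n::nat) ==> a i \<in> V" "\<And>i. i < n ==> b i \<in> W" "t = (\<Sum>i<n. elem_tensor V W (a i) (b i))"
    using t by (rule alg_tensorE) ((assumption | rule that)+)?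
  show "\<exists>(n::nat) a b. (\<forall>i<n. a i \<in> V \<and> b i \<in> W) \<and> t = (\<Sum>i<n. elem_tensor V W (a i) (b i)) \<and>
      (\<lambda>s. t (\<lambda>a b. f a b s)) = (\<Sum>i<n. f (a i) (b i))"
    unfolding val using ab by (intro exI[of _ n] exI[of _ a] exI[of _ b]) simp
  fix c assume "\<exists>(n::nat) a b. (\<forall>i<n. a i \<in> V \<and> b i \<in> W) \<and> t = (\<Sum>i<n. elem_tensor V W (a i) (b i)) \<and>
      c = (\<Sum>i<n. f (a i) (b i))"
  then show "c = (\<lambda>s. t (\<lambda>a b. f a b s))" unfolding val by blast
qed

text \<open>The completely bounded linear maps of \<open>B\<close> into itself, with a bound for all matrix
  norms.\<close>

definition cb_map :: "real => (('g::topological_group_add => complex) => ('g => complex)) => bool" where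
  "cb_map K L \<longleftrightarrow> 0 < K \<and> (\<forall>u\<in>FS. L u \<in> FS) \<and> (\<forall>u\<in>FS. \<forall>v\<in>FS. L (u + v) = L u + L v) \<and>
     (\<forall>c. \<forall>u\<in>FS. L (c *\<^sub>C u) = c *\<^sub>C L u) \<and>
     (\<forall>n x. (\<forall>i<n. \<forall>j<n. x i j \<in> FS) \<longrightarrow> fs_matnorm n (\<lambda>i j. L (x i j)) \<le> K * fs_matnorm n x)"

lemma cb_mapD:
  assumes "cb_map K L"
  shows "0 < K" "u \<in> FS ==> L u \<in> FS" "u \<in> FS ==> v \<in> FS ==> L (u + v) = L u + L v"
    "u \<in> FS ==> L (c *\<^sub>C u) = c *\<^sub>C L u"
    "(\<And>i j. i < n ==> j < n ==> x i j \<in> FS) ==> fs_matnorm n (\<lambda>i j. L (x i j)) \<le> K * fs_matnorm n x"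
  using assms unfolding cb_map_def by blast+

lemma cb_map_id: "cb_map 1 (\<lambda>u. u)"
  by (simp add: cb_map_def)

lemma cb_map_mult:
  assumes a: "a \<in> FS"
  obtains K where "cb_map K (\<lambda>u s. a s * u s)" "cb_map K (\<lambda>u s. u s * a s)"
proof -
  obtain \<xi> \<eta> where x: "\<xi> \<in> Hu" "\<eta> \<in> Hu" "a = mcoeff \<xi> \<eta>"
    using a by (rule FS_E)
  let ?K = "nmu \<xi> * nmu \<eta> + 1"
  have "cb_map ?K (\<lambda>u s. a s * u s)"
    unfolding cb_map_def
  proof (intro conjI ballI allI impI)
    show "0 < ?K" using x by (simp add: add_nonneg_pos)
    show "(\<lambda>s. a s * u s) \<in> FS" if "u \<in> FS" for u by (rule fs_mult[OF a that])
    show "fs_matnorm n (\<lambda>i j s. a s * x i j s) \<le> ?K * fs_matnorm n x" if "\<forall>i<n. \<forall>j<n. x i j \<in> FS" for n x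
      unfolding x(3) by (rule fs_matnorm_mult_le) (use x that in auto)
  qed (auto simp: fun_eq_iff algebra_simps scaleC_apply scaleC_complex_def)
  then show thesis using that[of ?K] by (simp add: mult.commute)
qed

lemma ftensor_form: "\<phi> \<in> bilinear_forms V W ==> ftensor p q \<alpha> \<beta> x y V W \<phi> =
    (\<Sum>i<p. \<Sum>k<q. \<Sum>j<p. \<Sum>l<q. \<alpha> (i, k) * \<beta> (j, l) * \<phi> (x i j) (y k l))"
  by (simp add: ftensor_apply)

context
  fixes K K' :: real and L R :: "('g::topological_group_add => complex) => ('g => complex)"
  assumes L: "cb_map K L" and R: "cb_map K' R"
begin

lemma cb_tensor_bilinear: "(\<lambda>b c. elem_tensor FS FS (L b) (R c) \<phi>) \<in> bilinear_forms FS FS"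
proof (cases "\<phi> \<in> bilinear_forms FS FS")
  case True
  then show ?thesis
    unfolding elem_tensor_apply[OF True]
    by (intro bilinear_formsI) (simp_all add: cb_mapD[OF L] cb_mapD[OF R] bilinear_formsD[OF True])
next
  case False
  then show ?thesis by (intro bilinear_formsI) (simp_all add: elem_tensor_def)
qed

abbreviation "cb_tensor \<equiv> tensor_lift FS FS (\<lambda>b c. elem_tensor FS FS (L b) (R c))"

lemma cb_tensor_eq: "t \<in> FE ==> cb_tensor t = (\<lambda>\<phi>. t (\<lambda>b c. elem_tensor FS FS (L b) (R c) \<phi>))"
  by (rule tensor_lift_eq[OF cb_tensor_bilinear])

lemma cb_tensor_diff: "s \<in> FE ==> t \<in> FE ==> cb_tensor (s - t) = cb_tensor s - cb_tensor t"
  by (simp add: cb_tensor_eq complex_vector.subspace_diff[OF subspace_FE] fun_eq_iff)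

lemma cb_tensor_ftensor:
  assumes "\<And>i j. i < p ==> j < p ==> x i j \<in> FS" "\<And>k l. k < q ==> l < q ==> y k l \<in> FS"
  shows "cb_tensor (ftensor p q \<alpha> \<beta> x y FS FS) = ftensor p q \<alpha> \<beta> (\<lambda>i j. L (x i j)) (\<lambda>k l. R (y k l)) FS FS"
proof -
  have "ftensor p q \<alpha> \<beta> x y FS FS \<in> FE" by (rule ftensor_in[OF fs_subspace assms])
  note e = cb_tensor_eq[OF this]
  show ?thesis
    unfolding e
  proof
    fix \<phi> :: "('g => complex) => ('g => complex) => complex"
    show "ftensor p q \<alpha> \<beta> x y FS FS (\<lambda>b c. elem_tensor FS FS (L b) (R c) \<phi>) =
      ftensor p q \<alpha> \<beta> (\<lambda>i j. L (x i j)) (\<lambda>k l. R (y k l)) FS FS \<phi>"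
      unfolding ftensor_form[OF cb_tensor_bilinear] by (simp add: elem_tensor_def ftensor_apply)
  qed
qed

lemma cb_tensor_in: assumes t: "t \<in> FE" shows "cb_tensor t \<in> FE"
proof -
  obtain p q \<alpha> \<beta> x y where f: "\<And>i j. i < p ==> j < p ==> x i j \<in> FS" "\<And>k l. k < q ==> l < q ==> y k l \<in> FS"
    "t = ftensor p q \<alpha> \<beta> x y FS FS" "L2 p q \<alpha> * fs_matnorm p x * fs_matnorm q y * L2 p q \<beta> < fnorm t + 1"
    by (rule fnorm_lessE[OF t, of "fnorm t + 1"]) (simp | (assumption | rule that)+)+
  have "cb_tensor (ftensor p q \<alpha> \<beta> x y FS FS) = ftensor p q \<alpha> \<beta> (\<lambda>i j. L (x i j)) (\<lambda>k l. R (y k l)) FS FS"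
    by (rule cb_tensor_ftensor) (fact f)+
  moreover have "ftensor p q \<alpha> \<beta> (\<lambda>i j. L (x i j)) (\<lambda>k l. R (y k l)) FS FS \<in> FE"
    by (rule ftensor_in[OF fs_subspace]) (use f(1,2) cb_mapD(2)[OF L] cb_mapD(2)[OF R] in blast)+
  ultimately show ?thesis unfolding f(3) by (simp only:)
qed

text \<open>Apply \<open>L\<close> and \<open>R\<close> to the entries of the matrices in a factorisation.\<close>

lemma cb_tensor_le: assumes t: "t \<in> FE" shows "fnorm (cb_tensor t) \<le> (K * K') * fnorm t"
proof -
  have K: "0 < K" "0 < K'" using cb_mapD(1)[OF L] cb_mapD(1)[OF R] by auto
  have "fnorm (cb_tensor t) / (K * K') \<le> fnorm t"
  proof (rule dense_ge)
    fix r assume r: "fnorm t < r"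
    obtain p q \<alpha> \<beta> x y where f: "\<And>i j. i < p ==> j < p ==> x i j \<in> FS" "\<And>k l. k < q ==> l < q ==> y k l \<in> FS"
      "t = ftensor p q \<alpha> \<beta> x y FS FS" "L2 p q \<alpha> * fs_matnorm p x * fs_matnorm q y * L2 p q \<beta> < r"
      by (rule fnorm_lessE[OF t r]) ((assumption | rule that)+)?
    have Lx: "\<And>i j. i < p ==> j < p ==> L (x i j) \<in> FS" and Ry: "\<And>k l. k < q ==> l < q ==> R (y k l) \<in> FS"
      using f(1,2) cb_mapD(2)[OF L] cb_mapD(2)[OF R] by blast+
    have e: "cb_tensor (ftensor p q \<alpha> \<beta> x y FS FS) = ftensor p q \<alpha> \<beta> (\<lambda>i j. L (x i j)) (\<lambda>k l. R (y k l)) FS FS"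
      by (rule cb_tensor_ftensor) (fact f)+
    have "fnorm (cb_tensor t) \<le> L2 p q \<alpha> * fs_matnorm p (\<lambda>i j. L (x i j)) * fs_matnorm q (\<lambda>k l. R (y k l)) * L2 p q \<beta>"
      unfolding f(3) e by (rule fnorm_le) (fact Lx Ry)+
    also have "\<dots> \<le> L2 p q \<alpha> * (K * fs_matnorm p x) * (K' * fs_matnorm q y) * L2 p q \<beta>"
      by (intro mult_mono mult_right_mono mult_left_mono cb_mapD(5)[OF L] cb_mapD(5)[OF R] f(1,2)
          mult_nonneg_nonneg fs_matnorm_nonneg Lx Ry L2_set_nonneg) (use K in auto)
    also have "\<dots> = (K * K') * (L2 p q \<alpha> * fs_matnorm p x * fs_matnorm q y * L2 p q \<beta>)" by (simp only: mult_ac)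
    also have "\<dots> \<le> (K * K') * r" using f(4) K by (intro mult_left_mono) auto
    finally show "fnorm (cb_tensor t) / (K * K') \<le> r" using K by (simp add: pos_divide_le_eq mult.commute)
  qed
  then show ?thesis using K by (simp add: pos_divide_le_eq mult.commute)
qed

lemma cb_tensor_completion:
  assumes "X \<in> completion FE fnorm"
  shows "completion_map FE fnorm cb_tensor X \<in> completion FE fnorm"
    and "x \<in> X ==> (\<lambda>n. cb_tensor (x n)) \<in> completion_map FE fnorm cb_tensor X"
proof -
  have K: "0 < K * K'" using cb_mapD(1)[OF L] cb_mapD(1)[OF R] by simp
  show "completion_map FE fnorm cb_tensor X \<in> completion FE fnorm"
    by (rule fsem.completion_map_in(1)[OF cb_tensor_in cb_tensor_diff cb_tensor_le K assms])
  show "x \<in> X ==> (\<lambda>n. cb_tensor (x n)) \<in> completion_map FE fnorm cb_tensor X"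
    by (rule fsem.completion_map_in(2)[OF cb_tensor_in cb_tensor_diff cb_tensor_le K assms])
qed

end

section \<open>The multiplication map\<close>

abbreviation "fmult \<equiv> tensor_lift FS FS (\<lambda>u v s. u s * v s)"

lemma pointwise_product_bilinear: "(\<lambda>u v. u s * v s) \<in> bilinear_forms FS FS"
  by (rule bilinear_formsI) (simp_all add: algebra_simps scaleC_apply scaleC_complex_def)

lemma fmult_eq: "t \<in> FE ==> fmult t = (\<lambda>s. t (\<lambda>u v. u s * v s))"
  by (rule tensor_lift_eq[OF pointwise_product_bilinear])

lemma fmult_diff: "s \<in> FE ==> t \<in> FE ==> fmult (s - t) = fmult s - fmult t"
  by (simp add: fmult_eq complex_vector.subspace_diff[OF subspace_FE] fun_eq_iff)

text \<open>The bilinear form behind the image of \<open>A\<close> in the von Neumann tensor square.\<close>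

definition product_form :: "('g::topological_group_add univ_op) => ('g => complex) => ('g => complex) => complex" where
  "product_form A u v = fs_pairing (\<lambda>s. u s * v s) A"

lemma product_form_bilinear:
  fixes A :: "'g::topological_group_add univ_op"
  assumes A: "A \<in> VN" shows "product_form A \<in> bilinear_forms FS FS"
proof (rule bilinear_formsI)
  fix a a' b :: "'g => complex" and c assume v: "a \<in> FS" "b \<in> FS"
  have "(\<lambda>s. (a + a') s * b s) = (\<lambda>s. a s * b s) + (\<lambda>s. a' s * b s)" by (rule ext) (simp add: algebra_simps)
  then show "product_form A (a + a') b = product_form A a b + product_form A a' b" if "a' \<in> FS"
    unfolding product_form_def using fs_add(2)[OF fs_mult[OF v] fs_mult[OF that v(2)] A] by (simp only:)
  have "(\<lambda>s. b s * (a + a') s) = (\<lambda>s. b s * a s) + (\<lambda>s. b s * a' s)" by (rule ext) (simp add: algebra_simps)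
  then show "product_form A b (a + a') = product_form A b a + product_form A b a'" if "a' \<in> FS"
    unfolding product_form_def using fs_add(2)[OF fs_mult[OF v(2,1)] fs_mult[OF v(2) that] A] by (simp only:)
  have "(\<lambda>s. (c *\<^sub>C a) s * b s) = c *\<^sub>C (\<lambda>s. a s * b s)" by (rule ext) (simp add: scaleC_apply scaleC_complex_def)
  then show "product_form A (c *\<^sub>C a) b = c * product_form A a b"
    unfolding product_form_def using fs_scale(2)[OF fs_mult[OF v] A, of c] by (simp only:)
  have "(\<lambda>s. b s * (c *\<^sub>C a) s) = c *\<^sub>C (\<lambda>s. b s * a s)" by (rule ext) (simp add: scaleC_apply scaleC_complex_def)
  then show "product_form A b (c *\<^sub>C a) = c * product_form A b a"
    unfolding product_form_def using fs_scale(2)[OF fs_mult[OF v(2,1)] A, of c] by (simp only:)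
qed

text \<open>The sum over the entries is the pairing of \<open>A\<close> with one coefficient of the tensor
  square, and a contraction is bounded by the norms of its two vectors.\<close>

lemma product_form_contractive:
  fixes A :: "'g::topological_group_add univ_op"
  assumes A: "A \<in> VN" and c: "\<And>x. x \<in> Hu ==> nmu (A x) \<le> nmu x"
  shows "contractive_form (product_form A)"
  unfolding contractive_form_def
proof (intro conjI allI impI)
  show "product_form A \<in> bilinear_forms FS FS" by (rule product_form_bilinear[OF A])
  fix m :: nat and f x g y :: "nat => 'g univ_vector"
  assume H: "\<forall>b<m. f b \<in> Hu \<and> x b \<in> Hu \<and> g b \<in> Hu \<and> y b \<in> Hu"
  let ?u = "\<lambda>a b s. mcoeff (f b) (g a) s * mcoeff (x b) (y a) s"
  let ?F = "\<Sum>b<m. f b \<otimes> x b" and ?G = "\<Sum>a<m. g a \<otimes> y a"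
  have F: "?F \<in> hcarrier (rep_space univ2)" "?G \<in> hcarrier (rep_space univ2)" using H by (auto intro!: univ2.sum_in)
  have u: "?u a b \<in> FS" if "a < m" "b < m" for a b using H that by (intro fs_mult mcoeff_in_FS) auto
  have "(\<Sum>a<m. \<Sum>b<m. product_form A (mcoeff (f b) (g a)) (mcoeff (x b) (y a))) = (\<Sum>ab\<in>{..<m} \<times> {..<m}. 1 * fs_pairing (?u (fst ab) (snd ab)) A)"
    unfolding product_form_def by (simp add: sum.cartesian_product case_prod_unfold)
  also have "\<dots> = fs_pairing (\<Sum>ab\<in>{..<m} \<times> {..<m}. 1 *\<^sub>C ?u (fst ab) (snd ab)) A"
    by (rule fs_pairing_lincomb[symmetric]) (use u A in auto)
  also have "(\<Sum>ab\<in>{..<m} \<times> {..<m}. 1 *\<^sub>C ?u (fst ab) (snd ab)) = (\<lambda>s. hinner (rep_space univ2) (rep_op univ2 s ?F) ?G)"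
  proof
    fix s
    have "rep_op univ2 s ?F = (\<Sum>b<m. rep_op univ2 s (f b \<otimes> x b))"
      by (rule univ2.op_sum[OF univ2.rep_bounded]) (use H in auto)
    then have "hinner (rep_space univ2) (rep_op univ2 s ?F) ?G = (\<Sum>b<m. \<Sum>a<m. hinner (rep_space univ2) (rep_op univ2 s (f b \<otimes> x b)) (g a \<otimes> y a))"
      by (simp only:) (subst univ2.ip_sum_left, use H F(2) in simp, rule F(2), intro sum.cong refl univ2.ip_sum_right, use H in auto)
    also have "\<dots> = (\<Sum>b<m. \<Sum>a<m. ?u a b s)" using H by (intro sum.cong refl) (simp add: tensor_coefficient)
    also have "\<dots> = (\<Sum>a<m. \<Sum>b<m. ?u a b s)" by (rule sum.swap)
    finally show "(\<Sum>ab\<in>{..<m} \<times> {..<m}. 1 *\<^sub>C ?u (fst ab) (snd ab)) s = hinner (rep_space univ2) (rep_op univ2 s ?F) ?G"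
      by (simp add: sum_fun_apply scaleC_one sum.cartesian_product case_prod_unfold)
  qed
  finally have e: "(\<Sum>a<m. \<Sum>b<m. product_form A (mcoeff (f b) (g a)) (mcoeff (x b) (y a)))
    = fs_pairing (\<lambda>s. hinner (rep_space univ2) (rep_op univ2 s ?F) ?G) A" .
  have "cmod (fs_pairing (\<lambda>s. hinner (rep_space univ2) (rep_op univ2 s ?F) ?G) A)
      \<le> 1 * coeff_norm (\<lambda>s. hinner (rep_space univ2) (rep_op univ2 s ?F) ?G)"
    by (rule fs_pairing_bound) (use coeff_norm_rep[OF univ2 F] A c in auto)
  then show "cmod (\<Sum>a<m. \<Sum>b<m. product_form A (mcoeff (f b) (g a)) (mcoeff (x b) (y a)))
    \<le> hnorm (rep_space univ2) ?F * hnorm (rep_space univ2) ?G"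
    unfolding e using coeff_norm_rep(2)[OF univ2 F] by simp
qed

lemma fmult_pairing:
  assumes t: "t \<in> FE"
  shows "fmult t \<in> FS" and "A \<in> VN ==> fs_pairing (fmult t) A = t (product_form A)"
proof -
  obtain n a b where ab: "\<And>i. i < (n::nat) ==> a i \<in> FS" "\<And>i. i < n ==> b i \<in> FS" "t = (\<Sum>i<n. elem_tensor FS FS (a i) (b i))"
    using t by (rule alg_tensorE) ((assumption | rule that)+)?
  have "fmult t = (\<Sum>i<n. 1 *\<^sub>C (\<lambda>s. a i s * b i s))"
    by (subst fmult_eq[OF t], rule ext) (simp add: ab(3) sum_fun_apply scaleC_one elem_tensor_apply[OF pointwise_product_bilinear])
  note e = this
  have m: "(\<lambda>s. a i s * b i s) \<in> FS" if "i \<in> {..<n}" for i using ab(1,2)[of i] that by (intro fs_mult) auto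
  show "fmult t \<in> FS" unfolding e by (intro complex_vector.subspace_sum[OF fs_subspace] complex_vector.subspace_scale[OF fs_subspace] m)
  show "fs_pairing (fmult t) A = t (product_form A)" if A: "A \<in> VN"
  proof -
    have "fs_pairing (fmult t) A = (\<Sum>i<n. 1 * fs_pairing (\<lambda>s. a i s * b i s) A)"
      unfolding e by (rule fs_pairing_lincomb[OF _ m A]) simp_all
    then show ?thesis unfolding ab(3) sum_fun_apply elem_tensor_apply[OF product_form_bilinear[OF A]] by (simp add: product_form_def)
  qed
qed

lemma coeff_norm_fmult: assumes t: "t \<in> FE" shows "coeff_norm (fmult t) \<le> fnorm t"
proof -
  obtain A where A: "A \<in> VN" "\<And>x. x \<in> Hu ==> nmu (A x) \<le> nmu x"
    "cmod (fs_pairing (fmult t) A) = coeff_norm (fmult t)"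
    by (rule norming_operator[OF fmult_pairing(1)[OF t]]) ((assumption | rule that)+)?
  then show ?thesis using contractive_form_fnorm[OF product_form_contractive[OF A(1,2)] t] fmult_pairing(2)[OF t A(1)] by simp
qed

lemma os_norm_FSA: "u \<in> FS ==> os_norm FSA u = coeff_norm u"
  unfolding os_norm_def FSA_simps by (rule fs_matnorm_1)

abbreviation "cmult \<equiv> completion_extend FS (os_norm FSA) fmult"

lemma coeff_norm_eq_0: assumes u: "u \<in> FS" and z: "coeff_norm u = 0" shows "u = 0"
proof
  fix s
  have "cmod (fs_pairing u (univ_rep s)) \<le> 1 * coeff_norm u"
    by (rule fs_pairing_bound[OF u univ_rep_in_vn]) (simp_all add: univ.rep_nm)
  then show "u s = 0 s" using z fs_pairing_univ_rep[OF u] by simp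
qed

text \<open>Multiplication is contractive and \<open>B\<close> is complete and separated in
  \<open>coeff_norm\<close>, so the images of a Cauchy sequence have exactly one limit.\<close>

lemma cmult_limit:
  assumes X: "X \<in> completion FE fnorm"
  shows "cmult X \<in> FS" and "x \<in> X ==> (\<lambda>n. coeff_norm (fmult (x n) - cmult X)) \<longlonglongrightarrow> 0"
proof -
  note sub = complex_vector.subspace_diff[OF fs_subspace]
  have xE: "x n \<in> FE" if "x \<in> X" for x n by (rule fsem.cauchy_inD[OF fsem.completion_memD[OF X that]])
  have mF: "fmult (x n) \<in> FS" if "x \<in> X" for x n by (rule fmult_pairing(1)[OF xE[OF that]])
  have tri: "coeff_norm (u - w) \<le> coeff_norm (u - v) + coeff_norm (v - w)" if "u \<in> FS" "v \<in> FS" "w \<in> FS" for u v w :: "'a => complex"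
    using coeff_norm_triangle[OF sub[OF that(1,2)] sub[OF that(2,3)]] by simp
  have comm: "coeff_norm (u - v) = coeff_norm (v - u)" if "u \<in> FS" "v \<in> FS" for u v :: "'a => complex"
    using coeff_norm_scale[OF sub[OF that], of "-1"] by (simp add: complex_vector.scale_minus_left scaleC_one)
  have le: "coeff_norm (fmult (x n) - fmult (y m)) \<le> fnorm (x n - y m)" if "x \<in> X" "y \<in> X" for x y n m
    using coeff_norm_fmult[OF fsem.E_diff[OF xE[OF that(1)] xE[OF that(2)]], of n m] fmult_diff[OF xE[OF that(1)] xE[OF that(2)], of n m] by (simp only:)
  obtain x where x: "x \<in> cauchy_seqs FE fnorm" "x \<in> X" using X by (rule fsem.completionE)
  have "\<exists>N. \<forall>m\<ge>N. \<forall>n\<ge>N. coeff_norm (fmult (x m) - fmult (x n)) < e" if e: "e > 0" for e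
    using fsem.cauchyD[OF x(1) e] le[OF x(2) x(2)] order_le_less_trans by blast
  then obtain v where v: "v \<in> FS" "(\<lambda>n. coeff_norm (fmult (x n) - v)) \<longlonglongrightarrow> 0"
    by (rule coeff_norm_complete[OF mF[OF x(2)]]) ((assumption | rule that)+)?
  have lim: "(\<lambda>n. coeff_norm (fmult (y n) - v)) \<longlonglongrightarrow> 0" if y: "y \<in> X" for y
  proof -
    have "(\<lambda>n. fnorm (y n - x n) + coeff_norm (fmult (x n) - v)) \<longlonglongrightarrow> 0"
      using fsem.completion_mem_rel[OF X y x(2)] v(2) by (intro tendsto_add_zero) (simp_all add: fsem.rel_iff)
    then show ?thesis
    proof (rule Lim_null_comparison[rotated], intro always_eventually allI)
      fix n
      show "norm (coeff_norm (fmult (y n) - v)) \<le> fnorm (y n - x n) + coeff_norm (fmult (x n) - v)"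
        using tri[OF mF[OF y] mF[OF x(2)] v(1), of n n] le[OF y x(2), of n n] coeff_norm_nonneg[OF sub[OF mF[OF y] v(1)], of n] by simp
    qed
  qed
  have "cmult X = v"
    unfolding completion_extend_def
  proof (rule the_equality)
    have "(\<lambda>n. os_norm FSA (fmult (x n) - v)) = (\<lambda>n. coeff_norm (fmult (x n) - v))"
      by (rule ext, rule os_norm_FSA, rule sub[OF mF[OF x(2)] v(1)])
    then show "v \<in> FS \<and> (\<exists>x\<in>X. (\<lambda>n. os_norm FSA (fmult (x n) - v)) \<longlonglongrightarrow> 0)"
      using v x(2) by (intro conjI bexI[of _ x]) simp_all
    fix w assume "w \<in> FS \<and> (\<exists>y\<in>X. (\<lambda>n. os_norm FSA (fmult (y n) - w)) \<longlonglongrightarrow> 0)"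
    then obtain y where w: "w \<in> FS" and y: "y \<in> X" "(\<lambda>n. os_norm FSA (fmult (y n) - w)) \<longlonglongrightarrow> 0" by blast
    have "(\<lambda>n. os_norm FSA (fmult (y n) - w)) = (\<lambda>n. coeff_norm (w - fmult (y n)))"
      by (rule ext, subst os_norm_FSA, rule sub[OF mF[OF y(1)] w], rule comm[OF mF[OF y(1)] w])
    then have "(\<lambda>n. coeff_norm (w - fmult (y n)) + coeff_norm (fmult (y n) - v)) \<longlonglongrightarrow> 0"
      using y lim[OF y(1)] by (intro tendsto_add_zero) simp_all
    then have "coeff_norm (w - v) \<le> 0"
      by (rule LIMSEQ_le_const) (use tri[OF w mF[OF y(1)] v(1)] in blast)
    then have "w - v = 0" using coeff_norm_eq_0[OF sub[OF w v(1)]] coeff_norm_nonneg[OF sub[OF w v(1)]] by simp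
    then show "w = v" by simp
  qed
  then show "cmult X \<in> FS" "x \<in> X ==> (\<lambda>n. coeff_norm (fmult (x n) - cmult X)) \<longlonglongrightarrow> 0" for x
    using v lim by simp_all
qed

section \<open>The Eberlein compactification\<close>

abbreviation "WOT \<equiv> weak_op_topology univ_space"
abbreviation "EB \<equiv> eberlein_compactification"

lemma topspace_WOT: "topspace WOT = Bu"
  unfolding weak_op_topology_def topology_generated_by_topspace
proof (rule equalityI; rule subsetI)
  fix A :: "'a univ_op" assume "A \<in> Bu"
  then have "A \<in> {A \<in> Bu. ipu (A 0) 0 \<in> UNIV}" by simp
  moreover have "{A \<in> Bu. ipu (A 0) 0 \<in> UNIV} \<in>
      {{A \<in> Bu. ipu (A x) y \<in> U} | x y U. x \<in> Hu \<and> y \<in> Hu \<and> open U}"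
    by (rule CollectI, rule exI[of _ 0], rule exI[of _ 0], rule exI[of _ UNIV]) simp
  ultimately show "A \<in> \<Union> {{A \<in> Bu. ipu (A x) y \<in> U} | x y U. x \<in> Hu \<and> y \<in> Hu \<and> open U}"
    by (rule UnionI[rotated])
qed blast

lemma WOT_basis: "x \<in> Hu ==> y \<in> Hu ==> open U ==> openin WOT {A \<in> Bu. ipu (A x) y \<in> U}"
  unfolding weak_op_topology_def by (rule topology_generated_by_Basis) blast

lemma continuous_WOT_eval: "x \<in> Hu ==> y \<in> Hu ==> continuous_map WOT euclidean (\<lambda>A. ipu (A x) y)"
  unfolding continuous_map_def topspace_WOT by (auto simp: WOT_basis)

lemma continuous_map_complex_mult:
  fixes f g :: "'a => complex"
  shows "continuous_map X euclidean f ==> continuous_map X euclidean g ==> continuous_map X euclidean (\<lambda>x. f x * g x)"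
  by (simp add: continuous_map_atin limitin_canonical_iff tendsto_mult)

text \<open>Multiplication on one side by a fixed operator moves that operator to one of the two vectors;
  this is the form in which it is checked to be continuous.\<close>

lemma continuous_WOT_WOT:
  fixes f :: "('g::topological_group_add univ_op) => 'g univ_op"
  assumes f: "\<And>A. A \<in> Bu ==> f A \<in> Bu"
    and e: "\<And>x y :: 'g univ_vector. x \<in> Hu ==> y \<in> Hu ==> \<exists>x'\<in>Hu. \<exists>y'\<in>Hu. \<forall>A\<in>Bu. ipu (f A x) y = ipu (A x') y'"
  shows "continuous_map WOT WOT f"
  unfolding weak_op_topology_def[of univ_space]
proof (rule continuous_on_generated_topo, fold weak_op_topology_def[of univ_space])
  fix V :: "('g univ_op) set" assume "V \<in> {{A \<in> Bu. ipu (A x) y \<in> U} | x y U. x \<in> Hu \<and> y \<in> Hu \<and> open U}"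
  then obtain x y :: "'g univ_vector" and U where V: "V = {A \<in> Bu. ipu (A x) y \<in> U}" "x \<in> Hu" "y \<in> Hu" "open U" by blast
  obtain x' y' :: "'g univ_vector" where x: "x' \<in> Hu" "y' \<in> Hu" "\<forall>A\<in>Bu. ipu (f A x) y = ipu (A x') y'"
    using e[OF V(2,3)] by (elim bexE)
  have "f -` V \<inter> topspace WOT = {A \<in> Bu. ipu (A x') y' \<in> U}"
    unfolding V(1) topspace_WOT by (rule set_eqI) (use f bspec[OF x(3)] in \<open>simp only: vimage_eq Int_iff mem_Collect_eq, metis\<close>)
  then show "openin WOT (f -` V \<inter> topspace WOT)" using WOT_basis[OF x(1,2) V(4)] by simp
next
  show "f ` topspace WOT \<subseteq> \<Union> {{A \<in> Bu. ipu (A x) y \<in> U} | x y U. x \<in> Hu \<and> y \<in> Hu \<and> open U}"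
    using f topspace_WOT unfolding weak_op_topology_def topology_generated_by_topspace by blast
qed

lemma EB_iff:
  fixes p :: "'g::topological_group_add univ_op"
  shows "p \<in> EB \<longleftrightarrow> p \<in> ops_unit_ball univ_space \<and> p \<in> WOT closure_of range univ_rep"
proof -
  have "univ_rep s \<in> ops_unit_ball univ_space" for s :: 'g
    by (simp add: ops_unit_ball_def univ.rep_bounded univ.rep_nm)
  then have "ops_unit_ball univ_space \<inter> range (univ_rep :: 'g => _) = range univ_rep" by blast
  then show ?thesis by (simp add: eberlein_compactification_def closure_of_subtopology)
qed

text \<open>An identity between weakly continuous functions propagates from the group to its closure.\<close>

lemma EB_eqI:
  fixes f g :: "_ => complex"
  assumes "p \<in> EB" "continuous_map WOT euclidean f" "continuous_map WOT euclidean g" "\<And>s. f (univ_rep s) = g (univ_rep s)"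
  shows "f p = g p"
  by (rule forall_in_closure_of_eq[of p WOT "range univ_rep" euclidean]) (use assms in \<open>auto simp: EB_iff\<close>)

lemma EB_bounded: "p \<in> EB ==> p \<in> Bu"
  and EB_contraction: "p \<in> EB ==> x \<in> Hu ==> nmu (p x) \<le> nmu x"
  by (auto simp: EB_iff ops_unit_ball_def)

text \<open>Commuting with a fixed operator is a condition on matrix entries, hence weakly closed.\<close>

lemma EB_in_vn: 
  fixes p :: "'g::topological_group_add univ_op"
  assumes p: "p \<in> EB" shows "p \<in> VN"
proof (rule vnI[OF EB_bounded[OF p]])
  fix T :: "'g univ_op" and x :: "'g univ_vector"
  assume T: "T \<in> Bu" "\<And>s. T \<circ> univ_rep s = univ_rep s \<circ> T" and x: "x \<in> Hu"
  note Tin = univ.op_in[OF T(1)]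
  show "p (T x) = T (p x)"
  proof (rule univ.eqI)
    show "p (T x) \<in> Hu" "T (p x) \<in> Hu" using Tin univ.op_in[OF EB_bounded[OF p]] x by auto
    fix z :: "'g univ_vector" assume z: "z \<in> Hu"
    have a: "univ.adj T z \<in> Hu" by (rule univ.op_in[OF univ.adj_bounded[OF T(1)] z])
    have "ipu (p (T x)) z = ipu (p x) (univ.adj T z)"
    proof (rule EB_eqI[OF p])
      fix s show "ipu (univ_rep s (T x)) z = ipu (univ_rep s x) (univ.adj T z)"
        using fun_cong[OF T(2)[of s], of x] univ.ip_adj'[OF T(1) univ.rep_in[OF x] z, of s] by simp
    qed (use continuous_WOT_eval Tin x z a in auto)
    then show "ipu (p (T x)) z = ipu (T (p x)) z"
      using univ.ip_adj'[OF T(1) univ.op_in[OF EB_bounded[OF p] x] z] by simp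
  qed
qed

text \<open>Point evaluations are multiplicative, and both sides are built from matrix entries of the
  operator, for \<open>u\<close>, \<open>v\<close> and their product.\<close>

lemma EB_multiplicative:
  fixes p :: "'g::topological_group_add univ_op"
  assumes p: "p \<in> EB" and u: "u \<in> FS" and v: "v \<in> FS"
  shows "fs_pairing (\<lambda>s. u s * v s) p = fs_pairing u p * fs_pairing v p"
proof -
  obtain \<xi> \<eta> where x: "\<xi> \<in> Hu" "\<eta> \<in> Hu" "u = mcoeff \<xi> \<eta>" using u by (rule FS_E)
  obtain \<xi>' \<eta>' where y: "\<xi>' \<in> Hu" "\<eta>' \<in> Hu" "v = mcoeff \<xi>' \<eta>'" using v by (rule FS_E)
  obtain a b where z: "a \<in> Hu" "b \<in> Hu" "(\<lambda>s. u s * v s) = mcoeff a b" using fs_mult[OF u v] by (rule FS_E)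
  have "ipu (p a) b = ipu (p \<xi>) \<eta> * ipu (p \<xi>') \<eta>'"
  proof (rule EB_eqI[OF p])
    show "ipu (univ_rep s a) b = ipu (univ_rep s \<xi>) \<eta> * ipu (univ_rep s \<xi>') \<eta>'" for s
      using fun_cong[OF z(3), of s] x(3) y(3) by (simp add: mcoeff_def)
  qed (intro continuous_map_complex_mult continuous_WOT_eval x y z)+
  then show ?thesis unfolding z(3) unfolding x(3) y(3) using x y z EB_in_vn[OF p] by (simp add: fs_pairing_mcoeff)
qed

text \<open>Multiplication is separately continuous: first the group multiplied with \<open>q\<close> stays
  in the closure, and then so does the closure multiplied with \<open>q\<close>.\<close>

lemma EB_comp:
  fixes p q :: "'g::topological_group_add univ_op"
  assumes p: "p \<in> EB" and q: "q \<in> EB" shows "p \<circ> q \<in> EB"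
proof -
  note b = EB_bounded[OF p] EB_bounded[OF q]
  let ?C = "WOT closure_of range (univ_rep :: 'g => _)"
  have left: "continuous_map WOT WOT (\<lambda>A. univ_rep s \<circ> A)" for s :: 'g
  proof (rule continuous_WOT_WOT[OF univ.comp_bounded[OF univ.rep_bounded]])
    fix x y :: "'g univ_vector" assume "x \<in> Hu" "y \<in> Hu"
    then show "\<exists>x'\<in>Hu. \<exists>y'\<in>Hu. \<forall>A\<in>Bu. ipu ((univ_rep s \<circ> A) x) y = ipu (A x') y'"
      by (intro bexI[of _ x] bexI[of _ "univ_rep (- s) y"] ballI) (auto simp: univ.rep_ip_adj univ.op_in)
  qed
  have right: "continuous_map WOT WOT (\<lambda>A. A \<circ> q)"
  proof (rule continuous_WOT_WOT[OF univ.comp_bounded[OF _ b(2)]])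
    fix x y :: "'g univ_vector" assume "x \<in> Hu" "y \<in> Hu"
    then show "\<exists>x'\<in>Hu. \<exists>y'\<in>Hu. \<forall>A\<in>Bu. ipu ((A \<circ> q) x) y = ipu (A x') y'"
      by (intro bexI[of _ "q x"] bexI[of _ y] ballI) (auto simp: univ.op_in[OF b(2)])
  qed
  have "(\<lambda>A. univ_rep s \<circ> A) ` range univ_rep \<subseteq> range univ_rep" for s :: 'g
    by (auto simp flip: univ.rep_mult)
  then have "(\<lambda>A. univ_rep s \<circ> A) ` ?C \<subseteq> ?C" for s :: 'g
    by (rule order_trans[OF continuous_map_image_closure_subset[OF left] closure_of_mono])
  then have "(\<lambda>A. A \<circ> q) ` range univ_rep \<subseteq> ?C" using q by (auto simp: EB_iff)
  then have "(\<lambda>A. A \<circ> q) ` ?C \<subseteq> WOT closure_of ?C"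
    by (rule order_trans[OF continuous_map_image_closure_subset[OF right] closure_of_mono])
  then have "p \<circ> q \<in> ?C" using p by (auto simp: EB_iff)
  moreover have "nmu ((p \<circ> q) x) \<le> nmu x" if "x \<in> Hu" for x
    using EB_contraction[OF p univ.op_in[OF b(2) that]] EB_contraction[OF q that] by simp
  ultimately show ?thesis using univ.comp_bounded[OF b] by (simp add: EB_iff ops_unit_ball_def)
qed

section \<open>Central projections\<close>

context hilb begin

text \<open>Range and kernel are orthogonal: if \<open>u\<close> is in the range and \<open>v\<close> in the
  kernel, moving \<open>u\<close> along \<open>v\<close> against their inner product would
  otherwise decrease the norm of \<open>u\<close>, while the projection brings it back to
  \<open>u\<close>.\<close>

lemma idempotent_contraction_symm:
  assumes P: "P \<in> bounded_ops H" and idem: "\<And>x. x \<in> cr ==> P (P x) = P x"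
    and contr: "\<And>x. x \<in> cr ==> nm (P x) \<le> nm x" and x: "x \<in> cr" and y: "y \<in> cr"
  shows "ip (P x) y = ip x (P y)"
proof -
  have orth: "ip u v = 0" if u: "u \<in> cr" "P u = u" and v: "v \<in> cr" "P v = 0" for u v
  proof -
    define c where "c = ip u v"
    define e where "e = 1 / ((nm v)\<^sup>2 + 1)"
    have e: "0 < e" "e * (nm v)\<^sup>2 < 1" by (auto simp: e_def add_nonneg_pos)
    \<comment> \<open>The step length \<open>e\<close> is so small that the quadratic term cannot make up for the linear one.\<close>
    define w where "w = (- complex_of_real e * c) *\<^sub>C v"
    have "P w = (- complex_of_real e * c) *\<^sub>C P v" unfolding w_def by (rule op_scale[OF P v(1)])
    then have w: "w \<in> cr" "P w = 0" using v(1) by (simp_all only: w_def v(2) complex_vector.scale_zero_right scale_in)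
    have "nm u \<le> nm (u + w)" using contr[of "u + w"] op_add[OF P u(1) w(1)] u v w by simp
    then have "(nm u)\<^sup>2 \<le> (nm (u + w))\<^sup>2" using u by (intro power_mono) auto
    also have "\<dots> = (nm u)\<^sup>2 + (nm w)\<^sup>2 + 2 * Re (ip u w)" by (rule nm_add_sq[OF u(1) w(1)])
    also have "ip u w = cnj (- complex_of_real e * c) * c" unfolding w_def c_def by (rule ip_scale_right[OF v(1) u(1)])
    also have "\<dots> = - complex_of_real e * (cnj c * c)" by simp
    also have "Re \<dots> = - e * (cmod c)\<^sup>2" by (simp add: cmod_power2 power2_eq_square[of "Re c"] power2_eq_square[of "Im c"])
    also have "(nm w)\<^sup>2 = e * (cmod c)\<^sup>2 * (e * (nm v)\<^sup>2)"
      unfolding w_def nm_scale[OF v(1)] using e(1) by (simp add: norm_mult power_mult_distrib power2_eq_square)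
    finally have "0 \<le> e * (cmod c)\<^sup>2 * (e * (nm v)\<^sup>2 - 2)" by (simp add: algebra_simps)
    then have "e * (cmod c)\<^sup>2 \<le> 0" using e(2) by (simp add: zero_le_mult_iff)
    then show ?thesis using e(1) by (simp add: c_def mult_le_0_iff)
  qed
  note Pin = op_in[OF P]
  have "ip (P x) (y - P y) = 0" by (rule orth) (use x y Pin idem op_diff[OF P] in auto)
  moreover have "ip (P y) (x - P x) = 0" by (rule orth) (use x y Pin idem op_diff[OF P] in auto)
  then have "ip (x - P x) (P y) = 0" using ip_commute[of "P y" "x - P x"] x y Pin by simp
  ultimately show ?thesis using x y Pin by (simp add: ip_diff_left ip_diff_right)
qed

end

text \<open>The projections in the centre of the universal von Neumann algebra. Contrary to the central
  idempotents they are also closed under forming \<open>A (1 - B)\<close>.\<close>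

definition central_projection :: "('g::topological_group_add univ_op) => bool" where
  "central_projection A \<longleftrightarrow> A \<in> VN \<and> A \<circ> A = A \<and> (\<forall>s. A \<circ> univ_rep s = univ_rep s \<circ> A) \<and>
     (\<forall>x\<in>Hu. \<forall>y\<in>Hu. ipu (A x) y = ipu x (A y))"

abbreviation "ZE \<equiv> central_idempotents"

lemma ZE_central_projection:
  assumes p: "p \<in> ZE" shows "central_projection p"
proof -
  have p': "p \<in> EB" "p \<circ> p = p" "\<And>s. univ_rep s \<circ> p = p \<circ> univ_rep s" using p by (auto simp: central_idempotents_def)
  show ?thesis
    unfolding central_projection_def
  proof (intro conjI ballI allI)
    show "ipu (p x) y = ipu x (p y)" if "x \<in> Hu" "y \<in> Hu" for x y
      by (rule univ.idempotent_contraction_symm[OF EB_bounded[OF p'(1)] _ EB_contraction[OF p'(1)] that])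
        (use fun_cong[OF p'(2)] in simp)
  qed (use p' in \<open>simp_all add: EB_in_vn\<close>)
qed

lemma central_projectionD:
  assumes "central_projection A"
  shows "A \<in> VN" "A \<in> Bu" "A (A x) = A x" "A \<circ> univ_rep s = univ_rep s \<circ> A"
    "x \<in> Hu ==> y \<in> Hu ==> ipu (A x) y = ipu x (A y)" "x \<in> Hu ==> A x \<in> Hu"
  using assms vn_bounded[of A] unfolding central_projection_def by (blast, blast, metis comp_apply, blast, blast, blast intro: univ.op_in)

lemma central_projection_comm:
  assumes A: "central_projection A" and B: "central_projection B"
  shows "A (B x) = B (A x)"
  using vn_commute[OF central_projectionD(1)[OF A] central_projectionD(2,4)[OF B]] .

lemma vn_comp:
  fixes A B :: "'g::topological_group_add univ_op"
  assumes "A \<in> VN" "B \<in> VN" shows "A \<circ> B \<in> VN"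
  by (rule vnI[OF univ.comp_bounded[OF vn_bounded vn_bounded, OF assms]]) (simp add: vn_commute[OF assms(1)] vn_commute[OF assms(2)])

lemma vn_diff:
  fixes A B :: "'g::topological_group_add univ_op"
  assumes A: "A \<in> VN" and B: "B \<in> VN" shows "A - B \<in> VN"
proof (rule vnI)
  note b = vn_bounded[OF A] vn_bounded[OF B]
  obtain C where C: "\<And>x. x \<in> Hu ==> nmu (A x) \<le> C * nmu x" by (rule univ.op_bound[OF b(1)]) ((assumption | rule that)+)?
  obtain D where D: "\<And>x. x \<in> Hu ==> nmu (B x) \<le> D * nmu x" by (rule univ.op_bound[OF b(2)]) ((assumption | rule that)+)?
  show "A - B \<in> Bu"
  proof (rule univ.bounded_opsI)
    show "nmu ((A - B) x) \<le> (C + D) * nmu x" if x: "x \<in> Hu" for x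
      using univ.triangle[of "A x" "- B x"] univ.nm_minus[of "B x"] C[OF x] D[OF x] univ.op_in[OF b(1) x] univ.op_in[OF b(2) x] by (simp add: algebra_simps)
  qed (auto simp: univ.op_in[OF b(1)] univ.op_in[OF b(2)] univ.op_outside[OF b(1)] univ.op_outside[OF b(2)]
      univ.op_add[OF b(1)] univ.op_add[OF b(2)] univ.op_scale[OF b(1)] univ.op_scale[OF b(2)] complex_vector.scale_right_diff_distrib)
  show "(A - B) (T x) = T ((A - B) x)"
    if T: "T \<in> Bu" "\<And>s. T \<circ> univ_rep s = univ_rep s \<circ> T" and x: "x \<in> Hu" for T and x :: "'g univ_vector"
    using vn_commute[OF A T] vn_commute[OF B T] univ.op_diff[OF T(1) univ.op_in[OF b(1) x] univ.op_in[OF b(2) x]] by simp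
qed

lemma central_projection_comp:
  assumes A: "central_projection A" and B: "central_projection B"
  shows "central_projection (A \<circ> B)"
proof -
  note a = central_projectionD[OF A] and b = central_projectionD[OF B] and c = central_projection_comm[OF A B]
  have "(A \<circ> B) \<circ> (A \<circ> B) = A \<circ> B" by (rule ext) (simp add: c a(3) b(3) flip: c)
  moreover have "(A \<circ> B) \<circ> univ_rep s = univ_rep s \<circ> (A \<circ> B)" for s
    using fun_cong[OF a(4)[of s]] fun_cong[OF b(4)[of s]] by (intro ext) simp
  ultimately show ?thesis
    unfolding central_projection_def using vn_comp[OF a(1) b(1)] a(5,6) b(5,6) c by simp
qed

lemma central_projection_diff:
  assumes A: "central_projection A" and B: "central_projection B"
  shows "central_projection (A - (A \<circ> B))"
proof -
  note AB = central_projection_comp[OF A B]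
  note a = central_projectionD[OF A] and b = central_projectionD[OF AB] and c = central_projection_comm[OF A B]
  have [simp]: "A (A x) = A x" "B (A x) = A (B x)" "B (B x) = B x" for x using a(3) c central_projectionD(3)[OF B] by simp_all
  have out: "A x = 0" if "x \<notin> Hu" for x using univ.op_outside[OF a(2) that] .
  have Z: "A 0 = 0" "B 0 = 0" using univ.op_zero a(2) central_projectionD(2)[OF B] by blast+
  have d: "A (A x - A (B x)) = A x - A (B x)" "B (A x - A (B x)) = 0" for x
  proof -
    have "A x \<in> Hu \<and> A (B x) \<in> Hu" 
    proof (cases "x \<in> Hu")
      case True then show ?thesis using a(6) central_projectionD(6)[OF B] by blast
    next
      case False then show ?thesis using out[OF False] univ.op_outside[OF central_projectionD(2)[OF B] False] Z univ.zero_in by simp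
    qed
    then show "A (A x - A (B x)) = A x - A (B x)" "B (A x - A (B x)) = 0"
      using univ.op_diff[OF a(2), of "A x" "A (B x)"] univ.op_diff[OF central_projectionD(2)[OF B], of "A x" "A (B x)"] by simp_all
  qed
  have idem: "(A - (A \<circ> B)) \<circ> (A - (A \<circ> B)) = A - (A \<circ> B)" by (rule ext) (simp add: d Z)
  have comm: "(A - (A \<circ> B)) \<circ> univ_rep s = univ_rep s \<circ> (A - (A \<circ> B))" for s
  proof
    fix x
    have "A x \<in> Hu \<and> (A \<circ> B) x \<in> Hu"
      by (cases "x \<in> Hu") (use a(6) b(6) univ.zero_in out univ.op_outside[OF b(2)] in simp_all)
    then show "((A - (A \<circ> B)) \<circ> univ_rep s) x = (univ_rep s \<circ> (A - (A \<circ> B))) x"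
      using fun_cong[OF a(4)[of s], of x] fun_cong[OF b(4)[of s], of x] univ.op_diff[OF univ.rep_bounded, of "A x" "(A \<circ> B) x" s]
        univ.op_zero[OF univ.rep_bounded] by simp
  qed
  have symm: "ipu ((A - (A \<circ> B)) x) y = ipu x ((A - (A \<circ> B)) y)" if "x \<in> Hu" "y \<in> Hu" for x y
    using that a(5)[OF that] a(6) b(5)[OF that] b(6) by (simp add: univ.ip_diff_left univ.ip_diff_right)
  show ?thesis unfolding central_projection_def
    by (intro conjI ballI allI) (rule vn_diff[OF a(1) b(1)] idem comm symm, assumption?)+
qed

lemma ZE_comp:
  assumes p: "p \<in> ZE" and q: "q \<in> ZE" shows "p \<circ> q \<in> ZE"
proof -
  have "p \<in> EB" "q \<in> EB" using p q by (auto simp: central_idempotents_def)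
  moreover have "central_projection (p \<circ> q)" by (intro central_projection_comp ZE_central_projection p q)
  ultimately show ?thesis by (simp add: central_idempotents_def EB_comp central_projection_def)
qed

lemma fs_pairing_diff:
  assumes u: "u \<in> FS" and "A \<in> VN" "B \<in> VN"
  shows "fs_pairing u (A - B) = fs_pairing u A - fs_pairing u B"
proof -
  obtain \<xi> \<eta> where "\<xi> \<in> Hu" "\<eta> \<in> Hu" "u = mcoeff \<xi> \<eta>" using u by (rule FS_E)
  then show ?thesis using assms vn_diff[OF assms(2,3)] by (simp add: fs_pairing_mcoeff univ.ip_diff_left)
qed

lemma fs_separates:
  fixes A B :: "'g::topological_group_add univ_op"
  assumes A: "A \<in> VN" and B: "B \<in> VN" and "A \<noteq> B"
  obtains u where "u \<in> FS" "fs_pairing u A \<noteq> fs_pairing u B"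
proof -
  obtain x y where "x \<in> Hu" "y \<in> Hu" "ipu (A x) y \<noteq> ipu (B x) y"
    using univ.op_eqI[OF vn_bounded[OF A] vn_bounded[OF B]] \<open>A \<noteq> B\<close> by blast
  then show thesis using that[of "mcoeff x y"] A B by (simp add: fs_pairing_mcoeff mcoeff_in_FS)
qed

section \<open>Forms given by central projections\<close>

definition tensor_form :: "('g::topological_group_add univ_op) => ('g univ_op) =>
    ('g => complex) => ('g => complex) => complex" where
  "tensor_form A B u v = fs_pairing u A * fs_pairing v B"

lemma tensor_form_bilinear:
  "A \<in> VN ==> B \<in> VN ==> tensor_form A B \<in> bilinear_forms FS FS"
  by (intro bilinear_formsI) (simp_all add: tensor_form_def fs_add fs_scale algebra_simps)

lemma bilinear_forms_sum:
  assumes "\<And>i. i \<in> I ==> \<phi> i \<in> bilinear_forms V W"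
  shows "(\<lambda>u v. \<Sum>i\<in>I. \<phi> i u v) \<in> bilinear_forms V W"
  by (rule bilinear_formsI; unfold sum.distrib[symmetric] sum_distrib_left; rule sum.cong[OF refl])
    (simp_all add: bilinear_formsD[OF assms])

text \<open>The form is given by the projection \<open>\<Sum>i. A i \<otimes> B i\<close> of the Hilbert
  space tensor square; it is contractive by Bessel's inequality.\<close>

lemma orthogonal_tensors_contractive:
  fixes A B :: "'i => 'g::topological_group_add univ_op"
  assumes I: "finite I" and A: "\<And>i. i \<in> I ==> central_projection (A i)" and B: "\<And>i. i \<in> I ==> central_projection (B i)"
    and orth: "\<And>i j x. i \<in> I ==> j \<in> I ==> i \<noteq> j ==> x \<in> Hu ==> B i (B j x) = 0"
  shows "contractive_form (\<lambda>u v. \<Sum>i\<in>I. tensor_form (A i) (B i) u v)"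
  unfolding contractive_form_def
proof (intro conjI allI impI)
  show "(\<lambda>u v. \<Sum>i\<in>I. tensor_form (A i) (B i) u v) \<in> bilinear_forms FS FS"
    by (intro bilinear_forms_sum tensor_form_bilinear central_projectionD A B)
  fix m :: nat and f x g y :: "nat => 'g univ_vector"
  assume H: "\<forall>b<m. f b \<in> Hu \<and> x b \<in> Hu \<and> g b \<in> Hu \<and> y b \<in> Hu"
  let ?ip = "hinner (rep_space univ2 :: ('g univ_op) hilbert)" and ?n = "hnorm (rep_space univ2 :: ('g univ_op) hilbert)"
  let ?F = "\<Sum>b<m. f b \<otimes> x b" and ?G = "\<Sum>a<m. g a \<otimes> y a"
  define v where "v i = (\<Sum>b<m. A i (f b) \<otimes> B i (x b))" for i
  define w where "w = (\<Sum>i\<in>I. v i)"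
  have h: "f b \<in> Hu" "x b \<in> Hu" "g b \<in> Hu" "y b \<in> Hu" if "b \<in> {..<m}" for b using H that by auto
  note Ain = central_projectionD(6)[OF A] and Bin = central_projectionD(6)[OF B]
  have FG: "?F \<in> hcarrier (rep_space univ2)" "?G \<in> hcarrier (rep_space univ2)" using H by (auto intro!: univ2.sum_in)
  have vin: "v i \<in> hcarrier (rep_space univ2)" if "i \<in> I" for i
    unfolding v_def by (intro univ2.sum_in tensor_in Ain Bin h that)
  have win: "w \<in> hcarrier (rep_space univ2)" unfolding w_def by (intro univ2.sum_in vin)
  have tin: "A i (f b) \<otimes> B i (x b) \<in> hcarrier (rep_space univ2)" if "i \<in> I" "b \<in> {..<m}" for i b
    using h[OF that(2)] Ain[OF that(1)] Bin[OF that(1)] by auto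
  have vv: "?ip (v i) (v j) = (\<Sum>b<m. \<Sum>c<m. ipu (A i (f b)) (A j (f c)) * ipu (B i (x b)) (B j (x c)))" if "i \<in> I" "j \<in> I" for i j
  proof -
    have "?ip (v i) (v j) = (\<Sum>b<m. ?ip (A i (f b) \<otimes> B i (x b)) (v j))"
      unfolding v_def[of i] by (rule univ2.ip_sum_left[OF _ vin[OF that(2)]]) (use h Ain[OF that(1)] Bin[OF that(1)] in auto)
    also have "\<dots> = (\<Sum>b<m. \<Sum>c<m. ?ip (A i (f b) \<otimes> B i (x b)) (A j (f c) \<otimes> B j (x c)))"
      unfolding v_def[of j] by (rule sum.cong[OF refl], rule univ2.ip_sum_right) (auto intro: tin that)
    also have "\<dots> = (\<Sum>b<m. \<Sum>c<m. ipu (A i (f b)) (A j (f c)) * ipu (B i (x b)) (B j (x c)))"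
      by (rule sum.cong[OF refl], rule sum.cong[OF refl], rule tensor_ip) (auto intro: Ain Bin h that)
    finally show ?thesis .
  qed
  have vo: "?ip (v i) (v j) = 0" if ij: "i \<in> I" "j \<in> I" "i \<noteq> j" for i j
  proof -
    have "ipu (B i (x b)) (B j (x c)) = 0" if "b \<in> {..<m}" "c \<in> {..<m}" for b c
      using central_projectionD(5)[OF B[OF ij(1)], of "x b" "B j (x c)"] orth[OF ij, of "x c"] h(2) that Bin[OF ij(2)] by simp
    then show ?thesis unfolding vv[OF ij(1,2)] by simp
  qed
  have Fv: "?ip ?F (v i) = ?ip (v i) (v i)" if i: "i \<in> I" for i
  proof -
    have "?ip ?F (v i) = (\<Sum>b<m. ?ip (f b \<otimes> x b) (v i))"
      by (rule univ2.ip_sum_left[OF _ vin[OF i]]) (intro tensor_in h)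
    also have "\<dots> = (\<Sum>b<m. \<Sum>c<m. ?ip (f b \<otimes> x b) (A i (f c) \<otimes> B i (x c)))"
      unfolding v_def[of i] by (rule sum.cong[OF refl], rule univ2.ip_sum_right) (auto intro: tin i h)
    also have "\<dots> = (\<Sum>b<m. \<Sum>c<m. ipu (A i (f b)) (A i (f c)) * ipu (B i (x b)) (B i (x c)))"
    proof (rule sum.cong[OF refl], rule sum.cong[OF refl])
      fix b c assume bc: "b \<in> {..<m}" "c \<in> {..<m}"
      show "?ip (f b \<otimes> x b) (A i (f c) \<otimes> B i (x c)) = ipu (A i (f b)) (A i (f c)) * ipu (B i (x b)) (B i (x c))"
        using h[OF bc(1)] h[OF bc(2)] Ain[OF i] Bin[OF i]
          central_projectionD(5)[OF A[OF i], of "f b" "A i (f c)"] central_projectionD(5)[OF B[OF i], of "x b" "B i (x c)"]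
        by (simp add: tensor_ip central_projectionD(3)[OF A[OF i]] central_projectionD(3)[OF B[OF i]])
    qed
    finally show ?thesis using vv[OF i i] by simp
  qed
  \<comment> \<open>\<open>w\<close> is the image of \<open>?F\<close> under the projection \<open>\<Sum>i. A i \<otimes> B i\<close>.\<close>
  have "?ip w w = (\<Sum>i\<in>I. \<Sum>j\<in>I. ?ip (v i) (v j))"
    unfolding w_def by (simp add: univ2.ip_sum_left univ2.ip_sum_right vin univ2.sum_in) (rule sum.swap)
  also have "\<dots> = (\<Sum>i\<in>I. \<Sum>j\<in>I. if j = i then ?ip (v i) (v i) else 0)"
    by (intro sum.cong refl) (auto simp: vo)
  also have "\<dots> = (\<Sum>i\<in>I. ?ip ?F (v i))" using I Fv by simp
  also have "\<dots> = ?ip ?F w" unfolding w_def using FG(1) by (simp add: univ2.ip_sum_right vin)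
  finally have e: "complex_of_real ((?n w)\<^sup>2) = ?ip ?F w" using univ2.ip_self[OF win] by simp
  have "(?n w)\<^sup>2 = cmod (?ip ?F w)" unfolding e[symmetric] by (simp add: norm_power)
  also have "\<dots> \<le> ?n ?F * ?n w" by (rule univ2.cauchy_schwarz[OF FG(1) win])
  finally have "?n w \<le> ?n ?F" using univ2.nm_ge_0[OF win] univ2.nm_ge_0[OF FG(1)] by (cases "?n w = 0") (auto simp: power2_eq_square)
  have "(\<Sum>a<m. \<Sum>b<m. \<Sum>i\<in>I. tensor_form (A i) (B i) (mcoeff (f b) (g a)) (mcoeff (x b) (y a)))
    = (\<Sum>a<m. \<Sum>b<m. \<Sum>i\<in>I. ?ip (A i (f b) \<otimes> B i (x b)) (g a \<otimes> y a))"
  proof (rule sum.cong[OF refl], rule sum.cong[OF refl], rule sum.cong[OF refl])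
    fix a b i assume "a \<in> {..<m}" "b \<in> {..<m}" "i \<in> I"
    then show "tensor_form (A i) (B i) (mcoeff (f b) (g a)) (mcoeff (x b) (y a)) = ?ip (A i (f b) \<otimes> B i (x b)) (g a \<otimes> y a)"
      using h[of a] h[of b] Ain[of i] Bin[of i] central_projectionD(1)[OF A, of i] central_projectionD(1)[OF B, of i]
      by (simp add: tensor_form_def fs_pairing_mcoeff tensor_ip)
  qed
  also have "\<dots> = (\<Sum>i\<in>I. \<Sum>b<m. \<Sum>a<m. ?ip (A i (f b) \<otimes> B i (x b)) (g a \<otimes> y a))"
    by (subst sum.swap, subst sum.swap[where A = I], rule sum.cong[OF refl], rule sum.swap)
  also have "\<dots> = ?ip w ?G"
  proof -
    have "?ip w ?G = (\<Sum>i\<in>I. ?ip (v i) ?G)" unfolding w_def by (rule univ2.ip_sum_left[OF vin FG(2)])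
    also have "\<dots> = (\<Sum>i\<in>I. \<Sum>b<m. ?ip (A i (f b) \<otimes> B i (x b)) ?G)"
      unfolding v_def by (rule sum.cong[OF refl], rule univ2.ip_sum_left[OF _ FG(2)]) (rule tin)
    also have "\<dots> = (\<Sum>i\<in>I. \<Sum>b<m. \<Sum>a<m. ?ip (A i (f b) \<otimes> B i (x b)) (g a \<otimes> y a))"
      by (rule sum.cong[OF refl], rule sum.cong[OF refl], rule univ2.ip_sum_right) (auto intro: tin h)
    finally show ?thesis by (simp only:)
  qed
  finally have s: "(\<Sum>a<m. \<Sum>b<m. \<Sum>i\<in>I. tensor_form (A i) (B i) (mcoeff (f b) (g a)) (mcoeff (x b) (y a))) = ?ip w ?G" .
  have "cmod (?ip w ?G) \<le> ?n w * ?n ?G" by (rule univ2.cauchy_schwarz[OF win FG(2)])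
  also have "\<dots> \<le> ?n ?F * ?n ?G" using \<open>?n w \<le> ?n ?F\<close> univ2.nm_ge_0[OF FG(2)] by (rule mult_right_mono)
  finally show "cmod (\<Sum>a<m. \<Sum>b<m. \<Sum>i\<in>I. tensor_form (A i) (B i) (mcoeff (f b) (g a)) (mcoeff (x b) (y a))) \<le> ?n ?F * ?n ?G"
    unfolding s .
qed

lemma tensor_form_contractive:
  fixes A B :: "'g::topological_group_add univ_op"
  assumes "central_projection A" "central_projection B"
  shows "contractive_form (tensor_form A B)"
proof -
  have "contractive_form (\<lambda>u v. \<Sum>i\<in>{()}. tensor_form A B u v)"
    by (rule orthogonal_tensors_contractive) (use assms in auto)
  then show ?thesis by (simp only: sum.insert sum.empty finite.emptyI empty_iff not_False_eq_True add_0_right)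
qed

section \<open>Values of contractive forms on the completed tensor product\<close>

lemma FE_eval:
  assumes t: "t \<in> FE"
  obtains n a b where "\<And>i. i < (n::nat) ==> a i \<in> FS" "\<And>i. i < n ==> b i \<in> FS" "\<And>\<phi>. \<phi> \<in> bilinear_forms FS FS ==> t \<phi> = (\<Sum>i<n. \<phi> (a i) (b i))"
proof -
  obtain n a b where ab: "\<And>i. i < (n::nat) ==> a i \<in> FS" "\<And>i. i < n ==> b i \<in> FS" "t = (\<Sum>i<n. elem_tensor FS FS (a i) (b i))"
    using t by (rule alg_tensorE) ((assumption | rule that)+)?
  show thesis by (rule that[OF ab(1,2)]) (simp_all add: ab(3) sum_fun_apply elem_tensor_apply)
qed

lemma FE_sum_form:
  assumes t: "t \<in> FE" and \<phi>: "\<And>i. i \<in> I ==> \<phi> i \<in> bilinear_forms FS FS"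
  shows "t (\<lambda>u v. \<Sum>i\<in>I. \<phi> i u v) = (\<Sum>i\<in>I. t (\<phi> i))"
proof -
  obtain n a b where ab: "\<And>\<phi>. \<phi> \<in> bilinear_forms FS FS ==> t \<phi> = (\<Sum>i<(n::nat). \<phi> (a i) (b i))"
    using t by (rule FE_eval) ((assumption | rule that)+)?
  have "t (\<lambda>u v. \<Sum>i\<in>I. \<phi> i u v) = (\<Sum>k<n. \<Sum>i\<in>I. \<phi> i (a k) (b k))" by (rule ab, rule bilinear_forms_sum, rule \<phi>)
  also have "\<dots> = (\<Sum>i\<in>I. \<Sum>k<n. \<phi> i (a k) (b k))" by (rule sum.swap)
  also have "\<dots> = (\<Sum>i\<in>I. t (\<phi> i))" by (rule sum.cong[OF refl], rule ab[symmetric], rule \<phi>)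
  finally show ?thesis .
qed

lemma FE_tensor_form_diff:
  assumes t: "t \<in> FE" and A: "A \<in> VN" "B \<in> VN" "B' \<in> VN"
  shows "t (tensor_form A (B - B')) = t (tensor_form A B) - t (tensor_form A B')"
proof -
  obtain n a b where ab: "\<And>i. i < (n::nat) ==> b i \<in> FS" "\<And>\<phi>. \<phi> \<in> bilinear_forms FS FS ==> t \<phi> = (\<Sum>i<n. \<phi> (a i) (b i))"
    using t by (rule FE_eval) ((assumption | rule that)+)?
  show ?thesis
    unfolding ab(2)[OF tensor_form_bilinear[OF A(1) vn_diff[OF A(2,3)]]] ab(2)[OF tensor_form_bilinear[OF A(1,2)]] ab(2)[OF tensor_form_bilinear[OF A(1,3)]]
    using ab(1) A by (simp add: tensor_form_def fs_pairing_diff algebra_simps flip: sum_subtractf)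
qed

definition completion_value :: "(('g::topological_group_add => complex) => ('g => complex) => complex) =>
    (nat => ('g => complex, 'g => complex) tensor) set => complex" where
  "completion_value \<phi> X = (SOME l. \<forall>x\<in>X. (\<lambda>n. x n \<phi>) \<longlonglongrightarrow> l)"

abbreviation "CE \<equiv> completion FE fnorm"

lemma CE_in: "X \<in> CE ==> x \<in> X ==> x n \<in> FE"
  by (rule fsem.cauchy_inD[OF fsem.completion_memD])

lemma CE_nonempty: "X \<in> CE ==> \<exists>x. x \<in> X"
  by (erule fsem.completionE) blast

lemma completion_value_eqI:
  assumes "X \<in> CE" "\<And>x. x \<in> X ==> (\<lambda>n. x n \<phi>) \<longlonglongrightarrow> l"
  shows "completion_value \<phi> X = l"
  unfolding completion_value_def using CE_nonempty[OF assms(1)] assms(2) by (intro some_equality) (auto intro: LIMSEQ_unique)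

lemma completion_value:
  assumes \<phi>: "contractive_form \<phi>" and X: "X \<in> CE"
  shows "x \<in> X ==> (\<lambda>n. x n \<phi>) \<longlonglongrightarrow> completion_value \<phi> X" and "cmod (completion_value \<phi> X) \<le> completion_norm fnorm X"
proof -
  obtain l where l: "\<And>x. x \<in> X ==> (\<lambda>n. x n \<phi>) \<longlonglongrightarrow> l" "cmod l \<le> completion_norm fnorm X"
    by (rule fsem.functional_limit[of "\<lambda>t. t \<phi>", OF _ contractive_form_fnorm[OF \<phi>] X]) (simp_all, (assumption | rule that)+)
  then show "x \<in> X ==> (\<lambda>n. x n \<phi>) \<longlonglongrightarrow> completion_value \<phi> X" "cmod (completion_value \<phi> X) \<le> completion_norm fnorm X"
    using completion_value_eqI[OF X, of \<phi> l] by simp_all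
qed

lemma completion_value_sum:
  assumes \<phi>: "\<And>i. i \<in> I ==> contractive_form (\<phi> i)" and X: "X \<in> CE"
  shows "completion_value (\<lambda>u v. \<Sum>i\<in>I. \<phi> i u v) X = (\<Sum>i\<in>I. completion_value (\<phi> i) X)"
proof (rule completion_value_eqI[OF X])
  fix x assume x: "x \<in> X"
  have "x n (\<lambda>u v. \<Sum>i\<in>I. \<phi> i u v) = (\<Sum>i\<in>I. x n (\<phi> i))" for n
    by (rule FE_sum_form[OF CE_in[OF X x]]) (use \<phi> in \<open>simp add: contractive_form_def\<close>)
  then show "(\<lambda>n. x n (\<lambda>u v. \<Sum>i\<in>I. \<phi> i u v)) \<longlonglongrightarrow> (\<Sum>i\<in>I. completion_value (\<phi> i) X)"
    by (simp only:) (intro tendsto_sum completion_value(1)[OF \<phi> X x])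
qed

lemma completion_value_tensor_diff:
  assumes A: "central_projection A" and B: "central_projection B" "central_projection B'" "central_projection (B - B')" and X: "X \<in> CE"
  shows "completion_value (tensor_form A (B - B')) X = completion_value (tensor_form A B) X - completion_value (tensor_form A B') X"
proof (rule completion_value_eqI[OF X])
  fix x assume x: "x \<in> X"
  show "(\<lambda>n. x n (tensor_form A (B - B'))) \<longlonglongrightarrow> completion_value (tensor_form A B) X - completion_value (tensor_form A B') X"
    unfolding FE_tensor_form_diff[OF CE_in[OF X x] central_projectionD(1)[OF A] central_projectionD(1)[OF B(1)] central_projectionD(1)[OF B(2)]]
    by (intro tendsto_diff completion_value(1)[OF _ X x] tensor_form_contractive A B)
qed

section \<open>Approximate diagonals at central idempotents\<close>

abbreviation "lmul a \<equiv> tensor_lift FS FS (\<lambda>b c. elem_tensor FS FS (\<lambda>s. a s * b s) c)"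
abbreviation "rmul a \<equiv> tensor_lift FS FS (\<lambda>b c. elem_tensor FS FS b (\<lambda>s. c s * a s))"

lemma ZE_EB: "p \<in> ZE ==> p \<in> EB"
  by (simp add: central_idempotents_def)

lemma ZE_in_vn: "p \<in> ZE ==> p \<in> VN"
  by (rule EB_in_vn[OF ZE_EB])

lemma mul_tensor_form:
  assumes t: "t \<in> FE" and a: "a \<in> FS" and p: "p \<in> ZE" and q: "q \<in> ZE"
  shows "lmul a t (tensor_form p q) = fs_pairing a p * t (tensor_form p q)"
    and "rmul a t (tensor_form p q) = fs_pairing a q * t (tensor_form p q)"
proof -
  obtain K where K: "cb_map K (\<lambda>u s. a s * u s)" "cb_map K (\<lambda>u s. u s * a s)"
    by (rule cb_map_mult[OF a]) ((assumption | rule that)+)?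
  obtain n f g where f: "\<And>i. i < (n::nat) ==> f i \<in> FS" "\<And>i. i < n ==> g i \<in> FS"
    and ev: "\<And>\<phi>. \<phi> \<in> bilinear_forms FS FS ==> t \<phi> = (\<Sum>i<n. \<phi> (f i) (g i))"
    using t by (rule FE_eval) ((assumption | rule that)+)?
  note bil = tensor_form_bilinear[OF ZE_in_vn[OF p] ZE_in_vn[OF q]]
  have "lmul a t (tensor_form p q) = (\<Sum>i<n. tensor_form p q (\<lambda>s. a s * f i s) (g i))"
    unfolding cb_tensor_eq[OF K(1) cb_map_id t] ev[OF cb_tensor_bilinear[OF K(1) cb_map_id]] elem_tensor_apply[OF bil] ..
  also have "\<dots> = (\<Sum>i<n. fs_pairing a p * tensor_form p q (f i) (g i))"
    using f by (intro sum.cong refl) (simp add: tensor_form_def EB_multiplicative[OF ZE_EB[OF p] a])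
  finally show "lmul a t (tensor_form p q) = fs_pairing a p * t (tensor_form p q)"
    by (simp add: ev[OF bil] sum_distrib_left)
  have "rmul a t (tensor_form p q) = (\<Sum>i<n. tensor_form p q (f i) (\<lambda>s. g i s * a s))"
    unfolding cb_tensor_eq[OF cb_map_id K(2) t] ev[OF cb_tensor_bilinear[OF cb_map_id K(2)]] elem_tensor_apply[OF bil] ..
  also have "\<dots> = (\<Sum>i<n. fs_pairing a q * tensor_form p q (f i) (g i))"
    using f by (intro sum.cong refl) (simp add: tensor_form_def EB_multiplicative[OF ZE_EB[OF q] _ a])
  finally show "rmul a t (tensor_form p q) = fs_pairing a q * t (tensor_form p q)"
    by (simp add: ev[OF bil] sum_distrib_left)
qed

text \<open>As \<open>p\<close> and \<open>q\<close> are multiplicative functionals, acting by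
  \<open>a\<close> on the left and on the right multiplies the value of \<open>p \<otimes>
  q\<close> by \<open>\<langle>a, p\<rangle>\<close> and \<open>\<langle>a, q\<rangle>\<close>.\<close>

lemma completion_value_commutator:
  assumes a: "a \<in> FS" and p: "p \<in> ZE" and q: "q \<in> ZE" and X: "X \<in> CE"
  defines "Y \<equiv> completion_diff FE fnorm (completion_map FE fnorm (lmul a) X) (completion_map FE fnorm (rmul a) X)"
  shows "cmod ((fs_pairing a p - fs_pairing a q) * completion_value (tensor_form p q) X) \<le> completion_norm fnorm Y"
proof -
  obtain K where K: "cb_map K (\<lambda>u s. a s * u s)" "cb_map K (\<lambda>u s. u s * a s)"
    by (rule cb_map_mult[OF a]) ((assumption | rule that)+)?
  note L = cb_tensor_completion[OF K(1) cb_map_id X] and R = cb_tensor_completion[OF cb_map_id K(2) X]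
  note c = tensor_form_contractive[OF ZE_central_projection[OF p] ZE_central_projection[OF q]]
  obtain x where x: "x \<in> X" using CE_nonempty[OF X] by blast
  have Y: "Y \<in> CE" "(\<lambda>n. lmul a (x n) - rmul a (x n)) \<in> Y"
    unfolding Y_def by (rule fsem.completion_diff_in(1)[OF L(1) R(1)], rule fsem.completion_diff_in(2)[OF L(1) R(1) L(2)[OF x] R(2)[OF x]])
  have "(\<lambda>n. (lmul a (x n) - rmul a (x n)) (tensor_form p q)) \<longlonglongrightarrow> completion_value (tensor_form p q) Y"
    by (rule completion_value(1)[OF c Y])
  moreover have "(lmul a (x n) - rmul a (x n)) (tensor_form p q) = (fs_pairing a p - fs_pairing a q) * x n (tensor_form p q)" for n
    using mul_tensor_form[OF CE_in[OF X x] a p q] by (simp add: algebra_simps)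
  ultimately have "(\<lambda>n. (fs_pairing a p - fs_pairing a q) * x n (tensor_form p q)) \<longlonglongrightarrow> completion_value (tensor_form p q) Y"
    by (simp only:)
  moreover have "(\<lambda>n. (fs_pairing a p - fs_pairing a q) * x n (tensor_form p q)) \<longlonglongrightarrow> (fs_pairing a p - fs_pairing a q) * completion_value (tensor_form p q) X"
    by (intro tendsto_mult_left completion_value(1)[OF c X x])
  ultimately have "(fs_pairing a p - fs_pairing a q) * completion_value (tensor_form p q) X = completion_value (tensor_form p q) Y"
    using LIMSEQ_unique by blast
  then show ?thesis using completion_value(2)[OF c Y(1)] by simp
qed

text \<open>On elementary tensors this is the multiplicativity of \<open>p\<close>; both sides are
  continuous.\<close>

lemma fs_pairing_cmult:
  assumes p: "p \<in> ZE" and X: "X \<in> CE"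
  shows "fs_pairing (cmult X) p = completion_value (tensor_form p p) X"
proof -
  note c = tensor_form_contractive[OF ZE_central_projection[OF p] ZE_central_projection[OF p]]
  obtain x where x: "x \<in> X" using CE_nonempty[OF X] by blast
  note xE = CE_in[OF X x] and vn = ZE_in_vn[OF p]
  have m: "fmult (x n) \<in> FS" for n by (rule fmult_pairing(1)[OF xE])
  note mX = cmult_limit(1)[OF X]
  have "fs_pairing (fmult (x n)) p = x n (tensor_form p p)" for n
  proof -
    obtain k f g where f: "\<And>i. i < (k::nat) ==> f i \<in> FS" "\<And>i. i < k ==> g i \<in> FS"
      and ev: "\<And>\<phi>. \<phi> \<in> bilinear_forms FS FS ==> x n \<phi> = (\<Sum>i<k. \<phi> (f i) (g i))"
      by (rule FE_eval[OF xE[of n]]) ((assumption | rule that)+)?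
    show ?thesis
      unfolding fmult_pairing(2)[OF xE vn] ev[OF product_form_bilinear[OF vn]] ev[OF tensor_form_bilinear[OF vn vn]]
      by (intro sum.cong refl) (use f in \<open>simp add: product_form_def tensor_form_def EB_multiplicative[OF ZE_EB[OF p]]\<close>)
  qed
  then have "(\<lambda>n. fs_pairing (fmult (x n)) p) \<longlonglongrightarrow> completion_value (tensor_form p p) X"
    using completion_value(1)[OF c X x] by simp
  moreover have "(\<lambda>n. fs_pairing (fmult (x n)) p - fs_pairing (cmult X) p) \<longlonglongrightarrow> 0"
  proof (rule Lim_null_comparison[OF _ cmult_limit(2)[OF X x]], intro always_eventually allI)
    fix n
    have d: "fmult (x n) - cmult X \<in> FS" by (rule complex_vector.subspace_diff[OF fs_subspace m mX])
    have e: "fmult (x n) = (fmult (x n) - cmult X) + cmult X" by (simp only: diff_add_cancel)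
    have "fs_pairing (fmult (x n)) p = fs_pairing (fmult (x n) - cmult X) p + fs_pairing (cmult X) p"
      by (subst e, rule fs_add(2)[OF d mX vn])
    moreover have "cmod (fs_pairing (fmult (x n) - cmult X) p) \<le> 1 * coeff_norm (fmult (x n) - cmult X)"
      by (rule fs_pairing_bound[OF d vn]) (use EB_contraction[OF ZE_EB[OF p]] in simp_all)
    ultimately show "norm (fs_pairing (fmult (x n)) p - fs_pairing (cmult X) p) \<le> coeff_norm (fmult (x n) - cmult X)" by simp
  qed
  then have "(\<lambda>n. fs_pairing (fmult (x n)) p) \<longlonglongrightarrow> fs_pairing (cmult X) p" by (simp add: LIM_zero_iff)
  ultimately show ?thesis using LIMSEQ_unique by blast
qed

text \<open>If \<open>t \<circ> r\<close> majorises \<open>s\<close>, then so does \<open>t\<close>.\<close>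

lemma central_separate:
  fixes s t :: "'g::topological_group_add univ_op"
  assumes s: "s \<in> ZE" and t: "t \<in> ZE" and r: "r \<in> ZE" and st: "s \<circ> t \<noteq> s"
  shows "s \<circ> (t \<circ> r) \<noteq> s"
proof
  assume e: "s \<circ> (t \<circ> r) = s"
  note c = central_projection_comm[OF ZE_central_projection[OF r] ZE_central_projection[OF t]]
  have "(s \<circ> t) x = s x" for x
  proof -
    have "s (t x) = s (t (r (t x)))" using fun_cong[OF e, of "t x"] by simp
    also have "\<dots> = s (t (r x))" by (simp add: c central_projectionD(3)[OF ZE_central_projection[OF t]])
    also have "\<dots> = s x" using fun_cong[OF e, of x] by simp
    finally show ?thesis by simp
  qed
  then show False using st by blast
qed

locale approximate_diagonal =
  fixes F :: "(nat => ('g::topological_group_add => complex, 'g => complex) tensor) set filter" and C :: real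
  assumes F_nontrivial: "F \<noteq> bot"
    and bounded: "\<forall>\<^sub>F d in F. d \<in> CE \<and> completion_norm fnorm d \<le> C"
    and commuting: "\<And>a. a \<in> FS ==> ((\<lambda>d. completion_norm fnorm
      (completion_diff FE fnorm (completion_map FE fnorm (lmul a) d) (completion_map FE fnorm (rmul a) d))) \<longlongrightarrow> 0) F"
    and unital: "\<And>a. a \<in> FS ==> ((\<lambda>d. os_norm FSA ((\<lambda>s. cmult d s * a s) - a)) \<longlongrightarrow> 0) F"
begin

lemma eventually_CE: "\<forall>\<^sub>F d in F. d \<in> CE"
  using bounded by eventually_elim simp

text \<open>Choose \<open>a\<close> that separates \<open>p\<close> from \<open>q\<close>.\<close>

lemma off_diagonal:
  assumes p: "p \<in> ZE" and q: "q \<in> ZE" and pq: "p \<noteq> q"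
  shows "((\<lambda>d. completion_value (tensor_form p q) d) \<longlongrightarrow> 0) F"
proof -
  obtain a where a: "a \<in> FS" "fs_pairing a p \<noteq> fs_pairing a q"
    by (rule fs_separates[OF ZE_in_vn[OF p] ZE_in_vn[OF q] pq]) ((assumption | rule that)+)?
  let ?k = "fs_pairing a p - fs_pairing a q"
  have "((\<lambda>d. ?k * completion_value (tensor_form p q) d) \<longlongrightarrow> 0) F"
    by (rule Lim_null_comparison[OF _ commuting[OF a(1)]])
      (use eventually_CE in eventually_elim, rule completion_value_commutator[OF a(1) p q])
  from tendsto_mult_left[OF this, of "inverse ?k"] show ?thesis using a(2) by (simp flip: mult.assoc)
qed

text \<open>Pair \<open>(m d) a - a\<close> with \<open>p\<close>, for some \<open>a\<close> that does not
  vanish at \<open>p\<close>.\<close>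

lemma diagonal:
  assumes p: "p \<in> ZE" and p0: "p \<noteq> (\<lambda>_. 0)"
  shows "((\<lambda>d. completion_value (tensor_form p p) d) \<longlongrightarrow> 1) F"
proof -
  note vn = ZE_in_vn[OF p]
  have "p - p \<in> VN" by (rule vn_diff[OF vn vn])
  moreover have "p - p = (\<lambda>_. 0)" by (simp add: fun_eq_iff)
  ultimately have z: "(\<lambda>_. 0) \<in> (VN :: ('g univ_op) set)" by simp
  obtain a where a: "a \<in> FS" "fs_pairing a p \<noteq> fs_pairing a (\<lambda>_. 0)"
    by (rule fs_separates[OF vn z p0]) ((assumption | rule that)+)?
  have "fs_pairing a (\<lambda>_. 0) = 0"
    using fs_pairing_diff[OF a(1) vn vn] \<open>p - p = (\<lambda>_. 0)\<close> by simp
  then have a0: "fs_pairing a p \<noteq> 0" using a(2) by simp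
  have "((\<lambda>d. (completion_value (tensor_form p p) d - 1) * fs_pairing a p) \<longlongrightarrow> 0) F"
  proof (rule Lim_null_comparison[OF _ unital[OF a(1)]])
    show "\<forall>\<^sub>F d in F. norm ((completion_value (tensor_form p p) d - 1) * fs_pairing a p) \<le> os_norm FSA ((\<lambda>s. cmult d s * a s) - a)"
      using eventually_CE
    proof eventually_elim
      fix d :: "(nat => ('g => complex, 'g => complex) tensor) set" assume d: "d \<in> CE"
      note mF = cmult_limit(1)[OF d]
      let ?u = "\<lambda>s. cmult d s * a s"
      have u: "?u \<in> FS" by (rule fs_mult[OF mF a(1)])
      have ua: "?u - a \<in> FS" by (rule complex_vector.subspace_diff[OF fs_subspace u a(1)])
      have "?u = (?u - a) + a" by (simp only: diff_add_cancel)
      then have "fs_pairing ?u p = fs_pairing (?u - a) p + fs_pairing a p" using fs_add(2)[OF ua a(1) vn] by (simp only:)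
      then have "(completion_value (tensor_form p p) d - 1) * fs_pairing a p = fs_pairing (?u - a) p"
        using EB_multiplicative[OF ZE_EB[OF p] mF a(1)] fs_pairing_cmult[OF p d] by (simp add: algebra_simps)
      moreover have "cmod (fs_pairing (?u - a) p) \<le> 1 * coeff_norm (?u - a)"
        by (rule fs_pairing_bound[OF ua vn]) (use EB_contraction[OF ZE_EB[OF p]] in simp_all)
      ultimately show "norm ((completion_value (tensor_form p p) d - 1) * fs_pairing a p) \<le> os_norm FSA (?u - a)"
        unfolding os_norm_FSA[OF ua] by simp
    qed
  qed
  from tendsto_mult_right[OF this, of "inverse (fs_pairing a p)"]
  have "((\<lambda>d. completion_value (tensor_form p p) d - 1) \<longlongrightarrow> 0) F" using a0 by (simp add: mult.assoc)
  then show ?thesis by (simp add: LIM_zero_iff)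
qed

lemma tensor_limit:
  assumes "s \<in> ZE" "s \<noteq> (\<lambda>_. 0)" "r \<in> ZE"
  shows "((\<lambda>d. completion_value (tensor_form s r) d) \<longlongrightarrow> (if r = s then 1 else 0)) F"
  using diagonal off_diagonal assms by auto

definition separates :: "('g univ_op) => ('g univ_op) set => ('g univ_op) => bool" where
  "separates s T B \<longleftrightarrow> central_projection B \<and> B \<circ> s = B \<and> (\<forall>t\<in>T. B \<circ> t = (\<lambda>_. 0)) \<and>
    (\<forall>r\<in>ZE. ((\<lambda>d. completion_value (tensor_form s (B \<circ> r)) d) \<longlongrightarrow> (if s \<circ> r = s then 1 else 0)) F)"

text \<open>The projection is \<open>s\<close> times the product of all \<open>1 - t\<close>. The limits
  along the products with further central idempotents \<open>r\<close> are carried along in order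
  that a new factor \<open>1 - t\<close> can be expanded: in the limit its second term contributes
  nothing, as no multiple of \<open>t\<close> majorises \<open>s\<close>.\<close>

lemma separating_projection:
  fixes T :: "('g univ_op) set"
  assumes s: "s \<in> ZE" and s0: "s \<noteq> (\<lambda>_. 0)" and T: "finite T" "T \<subseteq> ZE" "\<forall>t\<in>T. s \<circ> t \<noteq> s"
  shows "\<exists>B. separates s T B"
  using T(1) T(2,3)
proof (induction T rule: finite_induct)
  case empty
  have "\<forall>r\<in>ZE. ((\<lambda>d. completion_value (tensor_form s (s \<circ> r)) d) \<longlongrightarrow> (if s \<circ> r = s then 1 else 0)) F"
    using tensor_limit[OF s s0 ZE_comp[OF s]] by blast
  moreover have "s \<circ> s = s" using s by (simp add: central_idempotents_def)
  ultimately show ?case using ZE_central_projection[OF s] unfolding separates_def by (intro exI[of _ s]) simp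
next
  case (insert t T)
  from insert.IH insert.prems obtain B where B: "central_projection B" "B \<circ> s = B" "\<forall>t\<in>T. B \<circ> t = (\<lambda>_. 0)"
    "\<forall>r\<in>ZE. ((\<lambda>d. completion_value (tensor_form s (B \<circ> r)) d) \<longlongrightarrow> (if s \<circ> r = s then 1 else 0)) F" unfolding separates_def by auto
  have t: "t \<in> ZE" "s \<circ> t \<noteq> s" using insert.prems by blast+
  note tc = ZE_central_projection[OF t(1)] and sc = ZE_central_projection[OF s]
  let ?B = "B - (B \<circ> t)"
  note Bc = central_projection_diff[OF B(1) tc]
  have comm: "B (t x) = t (B x)" for x by (rule central_projection_comm[OF B(1) tc])
  have "?B \<circ> s = ?B"
    using fun_cong[OF B(2)] central_projection_comm[OF tc sc] by (intro ext) simp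
  moreover have "?B \<circ> u = (\<lambda>_. 0)" if "u \<in> insert t T" for u
  proof (cases "u = t")
    case True
    then show ?thesis using central_projectionD(3)[OF tc] by (intro ext) simp
  next
    case False
    then have u: "u \<in> T" using that by simp
    then have uc: "central_projection u" using insert.prems by (intro ZE_central_projection) auto
    have "B (u x) = 0" for x using fun_cong[OF bspec[OF B(3) u], of x] by simp
    then show ?thesis using central_projection_comm[OF tc uc] by (intro ext) simp
  qed
  moreover have "((\<lambda>d. completion_value (tensor_form s (?B \<circ> r)) d) \<longlongrightarrow> (if s \<circ> r = s then 1 else 0)) F" if r: "r \<in> ZE" for r
  proof -
    have e: "?B \<circ> r = (B \<circ> r) - (B \<circ> (t \<circ> r))" by (rule ext) simp
    have c: "central_projection (B \<circ> r)" "central_projection (B \<circ> (t \<circ> r))" "central_projection ((B \<circ> r) - (B \<circ> (t \<circ> r)))"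
      unfolding e[symmetric] by (intro central_projection_comp B(1) Bc tc ZE_central_projection[OF r])+
    have "((\<lambda>d. completion_value (tensor_form s (B \<circ> r)) d - completion_value (tensor_form s (B \<circ> (t \<circ> r))) d)
      \<longlongrightarrow> (if s \<circ> r = s then 1 else 0) - (if s \<circ> (t \<circ> r) = s then 1 else 0)) F"
      by (intro tendsto_diff bspec[OF B(4)] r ZE_comp t(1))
    then have "((\<lambda>d. completion_value (tensor_form s (B \<circ> r)) d - completion_value (tensor_form s (B \<circ> (t \<circ> r))) d)
      \<longlongrightarrow> (if s \<circ> r = s then 1 else 0)) F" using central_separate[OF s t(1) r t(2)] by simp
    moreover have "\<forall>\<^sub>F d in F. completion_value (tensor_form s (B \<circ> r)) d - completion_value (tensor_form s (B \<circ> (t \<circ> r))) d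
      = completion_value (tensor_form s (?B \<circ> r)) d"
      using eventually_CE by eventually_elim (simp only: e completion_value_tensor_diff[OF sc c])
    ultimately show ?thesis by (rule Lim_transform_eventually)
  qed
  ultimately show ?case unfolding separates_def using Bc by (intro exI[of _ ?B]) simp
qed

text \<open>For distinct \<open>s\<close> and \<open>t\<close> at least one of them does not majorise the
  other, so one of the two projections \<open>e s\<close>, \<open>e t\<close> kills the other.\<close>

lemma card_le:
  fixes S :: "('g univ_op) set"
  assumes S: "finite S" "S \<subseteq> ZE - {\<lambda>_. 0}"
  shows "real (card S) \<le> C"
proof -
  have "\<exists>B. separates s {t \<in> S. s \<circ> t \<noteq> s} B" if "s \<in> S" for s
    by (rule separating_projection) (use S that in auto)
  then have "\<forall>s\<in>S. \<exists>B. separates s {t \<in> S. s \<circ> t \<noteq> s} B" by blast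
  from bchoice[OF this] obtain e where e': "\<forall>s\<in>S. separates s {t \<in> S. s \<circ> t \<noteq> s} (e s)" by (rule exE)
  note e = bspec[OF e', unfolded separates_def]
  have ec: "central_projection (e s)" and es: "e s \<circ> s = e s" if "s \<in> S" for s using e[OF that] by blast+
  have e0: "e s \<circ> t = (\<lambda>_. 0)" if "s \<in> S" "t \<in> S" "s \<circ> t \<noteq> s" for s t using e[OF that(1)] that by blast
  have lim: "((\<lambda>d. completion_value (tensor_form s (e s)) d) \<longlongrightarrow> 1) F" if "s \<in> S" for s
  proof -
    have sZ: "s \<in> ZE" using S that by blast
    then have "s \<circ> s = s" by (simp add: central_idempotents_def)
    with e[OF that] sZ have "((\<lambda>d. completion_value (tensor_form s (e s \<circ> s)) d) \<longlongrightarrow> 1) F" by fastforce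
    then show ?thesis unfolding es[OF that] .
  qed
  have sc: "central_projection s" if "s \<in> S" for s by (rule ZE_central_projection) (use S that in blast)
  have orth: "e s (e t x) = 0" if st: "s \<in> S" "t \<in> S" "s \<noteq> t" for s t x
  proof (cases "s \<circ> t = s")
    case False
    have "e s (e t x) = e s (e t (t x))" using fun_cong[OF es[OF st(2)], of x] by simp
    also have "\<dots> = e s (t (e t x))" by (simp only: central_projection_comm[OF ec[OF st(2)] sc[OF st(2)]])
    also have "\<dots> = 0" using fun_cong[OF e0[OF st(1,2) False], of "e t x"] by simp
    finally show ?thesis .
  next
    case True
    have "t \<circ> s = s" using True central_projection_comm[OF sc[OF st(1)] sc[OF st(2)]] by (simp add: fun_eq_iff)
    then have ne: "t \<circ> s \<noteq> t" using st(3) by simp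
    have "e s (e t x) = e t (e s x)" by (rule central_projection_comm[OF ec ec]) (fact st)+
    also have "\<dots> = e t (e s (s x))" using fun_cong[OF es[OF st(1)], of x] by simp
    also have "\<dots> = e t (s (e s x))" by (simp only: central_projection_comm[OF ec[OF st(1)] sc[OF st(1)]])
    also have "\<dots> = 0" using fun_cong[OF e0[OF st(2,1) ne], of "e s x"] by simp
    finally show ?thesis .
  qed
  let ?\<phi> = "\<lambda>u v. \<Sum>s\<in>S. tensor_form s (e s) u v"
  have c: "contractive_form ?\<phi>"
    by (rule orthogonal_tensors_contractive[OF S(1) sc ec orth])
  have "((\<lambda>d. \<Sum>s\<in>S. completion_value (tensor_form s (e s)) d) \<longlongrightarrow> (\<Sum>s\<in>S. 1)) F" by (intro tendsto_sum lim)
  then have "((\<lambda>d. \<Sum>s\<in>S. completion_value (tensor_form s (e s)) d) \<longlongrightarrow> of_nat (card S)) F" by simp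
  from tendsto_norm[OF this]
  have "((\<lambda>d. cmod (\<Sum>s\<in>S. completion_value (tensor_form s (e s)) d)) \<longlongrightarrow> real (card S)) F" by simp
  moreover have "\<forall>\<^sub>F d in F. cmod (\<Sum>s\<in>S. completion_value (tensor_form s (e s)) d) \<le> C"
    using bounded
  proof eventually_elim
    fix d :: "(nat => ('g => complex, 'g => complex) tensor) set" assume d: "d \<in> CE \<and> completion_norm fnorm d \<le> C"
    have "completion_value ?\<phi> d = (\<Sum>s\<in>S. completion_value (tensor_form s (e s)) d)"
      by (rule completion_value_sum[OF tensor_form_contractive[OF sc ec]]) (use d in auto)
    then show "cmod (\<Sum>s\<in>S. completion_value (tensor_form s (e s)) d) \<le> C"
      using completion_value(2)[OF c, of d] d by simp
  qed
  ultimately show ?thesis by (rule tendsto_upperbound) (rule F_nontrivial)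
qed

lemma finite_ZE: "finite (ZE :: ('g univ_op) set)"
proof -
  have "finite (ZE - {\<lambda>_. 0} :: ('g univ_op) set) \<and> card (ZE - {\<lambda>_. 0} :: ('g univ_op) set) \<le> nat \<lfloor>C\<rfloor>"
    by (rule finite_if_finite_subsets_card_bdd) (use card_le in \<open>simp add: le_nat_floor\<close>)
  then show ?thesis by simp
qed

end

theorem theorem1p5:
  assumes "locally_compact_space (euclidean :: 'g::{topological_group_add, t2_space} topology)"
    and "operator_amenable (fourier_stieltjes_algebra :: ('g \<Rightarrow> complex) op_algebra)"
  shows "finite (central_idempotents :: ('g univ_vector \<Rightarrow> 'g univ_vector) set)"
proof -
  obtain F :: "(nat => ('g => complex, 'g => complex) tensor) set filter" and C where FC: "F \<noteq> bot \<and>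
     (\<forall>\<^sub>F d in F. d \<in> CE \<and> completion_norm fnorm d \<le> C) \<and>
     (\<forall>a\<in>FS. ((\<lambda>d. completion_norm fnorm (completion_diff FE fnorm (completion_map FE fnorm (lmul a) d) (completion_map FE fnorm (rmul a) d))) \<longlongrightarrow> 0) F \<and>
        ((\<lambda>d. os_norm FSA ((\<lambda>s. cmult d s * a s) - a)) \<longlongrightarrow> 0) F \<and>
        ((\<lambda>d. os_norm FSA ((\<lambda>s. a s * cmult d s) - a)) \<longlongrightarrow> 0) F)"
    using assms(2) unfolding operator_amenable_def Let_def FSA_simps by (elim exE)
  interpret approximate_diagonal F C
    by unfold_locales (use FC in \<open>blast+\<close>)
  show ?thesis by (rule finite_ZE)
qed

end
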